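(* Let $(R,\mathfrak m)$ be a one-dimensional Noetherian Cohen-Macaulay local ring with $R/\mathfrak m$ infinite, having a canonical module $\omega_R$ that is a fractional ideal with $R\subseteq\omega_R\subseteq\overline R$. Let $I$ be an $\mathfrak m$-primary (proper) ideal of $R$ and let $a,b\in R$. If $R(I)_{a,b}$ is almost Gorenstein, then its Cohen-Macaulay type $t(R(I)_{a,b})$ is odd and $1\le t(R(I)_{a,b})\le 2t(R)+1$, where $t(R)$ is the Cohen-Macaulay type of $R$.
   Context: All rings are commutative with unity. For a Noetherian ring $R$, a nonzero proper ideal $I$ and $a,b\in R$, the Rees algebra is the subring $\bigoplus_{n\ge 0} I^n t^n$ of $R[t]$, and $R(I)_{a,b}$ denotes the quotient of $\bigoplus_{n\ge 0} I^n t^n$ by the ideal $\big((t^2+at+b)R[t]\big)\cap \bigoplus_{n\ge 0} I^n t^n$. As an $R$-module $R(I)_{a,b}\cong R\oplus I$; its elements are written uniquely as $r+it$ with $r\in R$, $i\in I$, with product $(r+it)(s+jt)=rs-bij+(rj+is-aij)t$. If $(R,\mathfrak m)$ is local, then $R(I)_{a,b}$ is local with maximal ideal $\{m+it \mid m\in\mathfrak m, i\in I\}$. $\overline R$ is the integral closure of $R$ in its total ring of fractions $Q(R)$. A one-dimensional Cohen-Macaulay local ring $(S,\mathfrak n)$ is almost Gorenstein if it has a canonical module that is isomorphic to a fractional ideal $\omega_S$ of $S$ with $S\subseteq\omega_S\subseteq(\mathfrak n:\mathfrak n)$, where $(\mathfrak n:\mathfrak n)=\{q\in Q(S)\mid q\mathfrak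 n\subseteq\mathfrak n\}$; its Cohen-Macaulay type is the length of $\operatorname{Ext}^1_S(S/\mathfrak n,S)$. *)

theory Defs
  imports "HOL-Algebra.Algebra" "HOL-Library.Extended_Nat"
begin

section \<open>Local rings, ideals and Krull dimension\<close>

definition local_ring :: "('a, 'b) ring_scheme \<Rightarrow> bool" where
  "local_ring R \<longleftrightarrow> cring R \<and> (\<exists>!M. maximalideal M R)"

text \<open>Only meaningful for local rings.\<close>
definition max_ideal :: "('a, 'b) ring_scheme \<Rightarrow> 'a set" where
  "max_ideal R = (THE M. maximalideal M R)"

definition krull_dim :: "('a, 'b) ring_scheme \<Rightarrow> enat" where
  "krull_dim R = Sup {enat n | n. \<exists>P :: nat \<Rightarrow> 'a set.
     (\<forall>i\<le>n. primeideal (P i) R) \<and> (\<forall>i<n. P i \<subset> P (Suc i))}"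

definition radical :: "('a, 'b) ring_scheme \<Rightarrow> 'a set \<Rightarrow> 'a set" where
  "radical R I = {x \<in> carrier R. \<exists>n::nat. n > 0 \<and> x [^]\<^bsub>R\<^esub> n \<in> I}"

definition primary_ideal :: "('a, 'b) ring_scheme \<Rightarrow> 'a set \<Rightarrow> bool" where
  "primary_ideal R I \<longleftrightarrow> ideal I R \<and> I \<noteq> carrier R \<and>
     (\<forall>x \<in> carrier R. \<forall>y \<in> carrier R. x \<otimes>\<^bsub>R\<^esub> y \<in> I \<longrightarrow> x \<in> I \<or> y \<in> radical R I)"

definition primary_to :: "('a, 'b) ring_scheme \<Rightarrow> 'a set \<Rightarrow> 'a set \<Rightarrow> bool" where
  "primary_to R P I \<longleftrightarrow> primary_ideal R I \<and> radical R I = P"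

primrec ideal_power :: "('a, 'b) ring_scheme \<Rightarrow> 'a set \<Rightarrow> nat \<Rightarrow> 'a set" where
  "ideal_power R I 0 = carrier R"
| "ideal_power R I (Suc n) = I \<cdot>\<^bsub>R\<^esub> ideal_power R I n"

definition nonzerodivisors :: "('a, 'b) ring_scheme \<Rightarrow> 'a set" where
  "nonzerodivisors R =
     {s \<in> carrier R. \<forall>r \<in> carrier R. s \<otimes>\<^bsub>R\<^esub> r = \<zero>\<^bsub>R\<^esub> \<longrightarrow> r = \<zero>\<^bsub>R\<^esub>}"


section \<open>Modules\<close>

text \<open>
  The record type of modules extends that of rings; the fields for multiplication and unit
  play no role for a module and are left unspecified below.
\<close>

definition ring_as_module :: "('a, 'b) ring_scheme \<Rightarrow> ('a, 'a) module" where
  "ring_as_module R = \<lparr>carrier = carrier R, monoid.mult = undefined, one = undefined,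
     ring.zero = ring.zero R, ring.add = ring.add R, smult = monoid.mult R\<rparr>"

definition quot_module ::
    "('a, 'b) ring_scheme \<Rightarrow> ('a, 'm, 'c) module_scheme \<Rightarrow> 'm set \<Rightarrow> ('a, 'm set) module" where
  "quot_module R M N = \<lparr>carrier = a_rcosets\<^bsub>M\<^esub> N, monoid.mult = undefined, one = undefined,
     ring.zero = N, ring.add = set_add M, smult = (\<lambda>r U. \<Union>x\<in>U. N +>\<^bsub>M\<^esub> (r \<odot>\<^bsub>M\<^esub> x))\<rparr>"

abbreviation cyclic_module :: "('a, 'b) ring_scheme \<Rightarrow> 'a set \<Rightarrow> ('a, 'a set) module" where
  "cyclic_module R J \<equiv> quot_module R (ring_as_module R) J"

text \<open>Vectors in \<open>R\<^sup>n\<close> are functions on \<open>{..<n}\<close>, extended by \<open>undefined\<close>.\<close>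
definition free_module :: "('a, 'b) ring_scheme \<Rightarrow> nat \<Rightarrow> ('a, nat \<Rightarrow> 'a) module" where
  "free_module R n = \<lparr>carrier = {..<n} \<rightarrow>\<^sub>E carrier R, monoid.mult = undefined, one = undefined,
     ring.zero = (\<lambda>i\<in>{..<n}. \<zero>\<^bsub>R\<^esub>), ring.add = (\<lambda>u v. \<lambda>i\<in>{..<n}. u i \<oplus>\<^bsub>R\<^esub> v i),
     smult = (\<lambda>r u. \<lambda>i\<in>{..<n}. r \<otimes>\<^bsub>R\<^esub> u i)\<rparr>"

definition module_hom ::
    "('a, 'b) ring_scheme \<Rightarrow> ('a, 'm, 'c) module_scheme \<Rightarrow> ('a, 'n, 'd) module_scheme
      \<Rightarrow> ('m \<Rightarrow> 'n) set" where
  "module_hom R M N = {f \<in> carrier M \<rightarrow>\<^sub>E carrier N.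
     (\<forall>x \<in> carrier M. \<forall>y \<in> carrier M. f (x \<oplus>\<^bsub>M\<^esub> y) = f x \<oplus>\<^bsub>N\<^esub> f y) \<and>
     (\<forall>r \<in> carrier R. \<forall>x \<in> carrier M. f (r \<odot>\<^bsub>M\<^esub> x) = r \<odot>\<^bsub>N\<^esub> f x)}"

definition hom_module ::
    "('a, 'b) ring_scheme \<Rightarrow> ('a, 'm, 'c) module_scheme \<Rightarrow> ('a, 'n, 'd) module_scheme
      \<Rightarrow> ('a, 'm \<Rightarrow> 'n) module" where
  "hom_module R M N = \<lparr>carrier = module_hom R M N, monoid.mult = undefined, one = undefined,
     ring.zero = (\<lambda>x\<in>carrier M. \<zero>\<^bsub>N\<^esub>), ring.add = (\<lambda>f g. \<lambda>x\<in>carrier M. f x \<oplus>\<^bsub>N\<^esub> g x),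
     smult = (\<lambda>r f. \<lambda>x\<in>carrier M. r \<odot>\<^bsub>N\<^esub> f x)\<rparr>"

definition module_span ::
    "('a, 'b) ring_scheme \<Rightarrow> ('a, 'm, 'c) module_scheme \<Rightarrow> 'm set \<Rightarrow> 'm set" where
  "module_span R M A = \<Inter>{N. submodule N R M \<and> A \<subseteq> N}"

definition fin_gen_module ::
    "('a, 'b) ring_scheme \<Rightarrow> ('a, 'm, 'c) module_scheme \<Rightarrow> bool" where
  "fin_gen_module R M \<longleftrightarrow> module R M \<and>
     (\<exists>A. finite A \<and> A \<subseteq> carrier M \<and> module_span R M A = carrier M)"

definition module_length ::
    "('a, 'b) ring_scheme \<Rightarrow> ('a, 'm, 'c) module_scheme \<Rightarrow> enat" where
  "module_length R M = Sup {enat n | n. \<exists>N :: nat \<Rightarrow> 'm set.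
     (\<forall>i\<le>n. submodule (N i) R M) \<and> (\<forall>i<n. N i \<subset> N (Suc i))}"


section \<open>Ext\<close>

text \<open>
  A resolution of \<open>M\<close> by free modules of finite rank:
  \<open>\<dots> \<rightarrow> F (Suc i) \<rightarrow> F i \<rightarrow> \<dots> \<rightarrow> F 0 \<rightarrow> M \<rightarrow> 0\<close> with \<open>F i\<close> free of rank \<open>rk i\<close>,
  \<open>d i : F (Suc i) \<rightarrow> F i\<close> and augmentation \<open>e : F 0 \<rightarrow> M\<close>.
\<close>
definition free_resolution ::
    "('a, 'b) ring_scheme \<Rightarrow> ('a, 'm, 'c) module_scheme \<Rightarrow> (nat \<Rightarrow> nat)
      \<Rightarrow> (nat \<Rightarrow> (nat \<Rightarrow> 'a) \<Rightarrow> (nat \<Rightarrow> 'a)) \<Rightarrow> ((nat \<Rightarrow> 'a) \<Rightarrow> 'm) \<Rightarrow> bool" where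
  "free_resolution R M rk d e \<longleftrightarrow>
     e \<in> module_hom R (free_module R (rk 0)) M \<and>
     e ` carrier (free_module R (rk 0)) = carrier M \<and>
     (\<forall>i. d i \<in> module_hom R (free_module R (rk (Suc i))) (free_module R (rk i))) \<and>
     d 0 ` carrier (free_module R (rk (Suc 0))) =
       {x \<in> carrier (free_module R (rk 0)). e x = \<zero>\<^bsub>M\<^esub>} \<and>
     (\<forall>i. d (Suc i) ` carrier (free_module R (rk (Suc (Suc i)))) =
       {x \<in> carrier (free_module R (rk (Suc i))). d i x = \<zero>\<^bsub>free_module R (rk i)\<^esub>})"

definition ext_cocycles ::
    "('a, 'b) ring_scheme \<Rightarrow> ('a, 'n, 'c) module_scheme \<Rightarrow> (nat \<Rightarrow> nat)
      \<Rightarrow> (nat \<Rightarrow> (nat \<Rightarrow> 'a) \<Rightarrow> (nat \<Rightarrow> 'a)) \<Rightarrow> nat \<Rightarrow> ((nat \<Rightarrow> 'a) \<Rightarrow> 'n) set" where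
  "ext_cocycles R N rk d i = {f \<in> module_hom R (free_module R (rk i)) N.
     \<forall>x \<in> carrier (free_module R (rk (Suc i))). f (d i x) = \<zero>\<^bsub>N\<^esub>}"

primrec ext_coboundaries ::
    "('a, 'b) ring_scheme \<Rightarrow> ('a, 'n, 'c) module_scheme \<Rightarrow> (nat \<Rightarrow> nat)
      \<Rightarrow> (nat \<Rightarrow> (nat \<Rightarrow> 'a) \<Rightarrow> (nat \<Rightarrow> 'a)) \<Rightarrow> nat \<Rightarrow> ((nat \<Rightarrow> 'a) \<Rightarrow> 'n) set" where
  "ext_coboundaries R N rk d 0 = {\<zero>\<^bsub>hom_module R (free_module R (rk 0)) N\<^esub>}"
| "ext_coboundaries R N rk d (Suc i) =
     (\<lambda>g. compose (carrier (free_module R (rk (Suc i)))) g (d i)) `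
       module_hom R (free_module R (rk i)) N"

text \<open>
  \<open>Ext\<^sup>i(M, N)\<close> as the cohomology of \<open>Hom(F, N)\<close>, where \<open>F\<close> is some resolution of \<open>M\<close> by free
  modules of finite rank.  Such a resolution exists if \<open>R\<close> is Noetherian and \<open>M\<close> is finitely
  generated, which is the only situation in which this is used; the choice of the resolution
  does not matter up to isomorphism.
\<close>
definition Ext_module ::
    "('a, 'b) ring_scheme \<Rightarrow> ('a, 'm, 'c) module_scheme \<Rightarrow> ('a, 'n, 'd) module_scheme \<Rightarrow> nat
      \<Rightarrow> ('a, ((nat \<Rightarrow> 'a) \<Rightarrow> 'n) set) module" where
  "Ext_module R M N i =
     (let (rk, d) = (SOME (rk, d). \<exists>e. free_resolution R M rk d e)
      in quot_module R
           ((hom_module R (free_module R (rk i)) N)\<lparr>carrier := ext_cocycles R N rk d i\<rparr>)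
           (ext_coboundaries R N rk d i))"


section \<open>Cohen-Macaulay rings, type and canonical modules\<close>

definition regular_sequence ::
    "('a, 'b) ring_scheme \<Rightarrow> ('a, 'm, 'c) module_scheme \<Rightarrow> 'a list \<Rightarrow> bool" where
  "regular_sequence R M xs \<longleftrightarrow> set xs \<subseteq> carrier R \<and>
     (let N = (\<lambda>i. module_span R M {r \<odot>\<^bsub>M\<^esub> x | r x. r \<in> set (take i xs) \<and> x \<in> carrier M})
      in (\<forall>i<length xs. \<forall>x \<in> carrier M. xs ! i \<odot>\<^bsub>M\<^esub> x \<in> N i \<longrightarrow> x \<in> N i) \<and>
         N (length xs) \<noteq> carrier M)"

definition depth ::
    "('a, 'b) ring_scheme \<Rightarrow> ('a, 'm, 'c) module_scheme \<Rightarrow> enat" where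
  "depth R M = Sup {enat (length xs) | xs. set xs \<subseteq> max_ideal R \<and> regular_sequence R M xs}"

definition cohen_macaulay_local :: "('a, 'b) ring_scheme \<Rightarrow> bool" where
  "cohen_macaulay_local R \<longleftrightarrow> local_ring R \<and> noetherian_ring R \<and>
     depth R (ring_as_module R) = krull_dim R"

text \<open>For one-dimensional Cohen-Macaulay local rings only.\<close>
definition cm_type :: "('a, 'b) ring_scheme \<Rightarrow> enat" where
  "cm_type R =
     module_length R (Ext_module R (cyclic_module R (max_ideal R)) (ring_as_module R) 1)"

text \<open>
  The injective dimension of \<open>C\<close> is at most \<open>n\<close> iff \<open>Ext\<^sup>i(_, C)\<close> vanishes for all \<open>i > n\<close>; by
  Baer's criterion (and dimension shifting) cyclic modules suffice as first arguments.
  This formulation avoids quantifying over modules of arbitrary type.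
\<close>
definition finite_injective_dim ::
    "('a, 'b) ring_scheme \<Rightarrow> ('a, 'm, 'c) module_scheme \<Rightarrow> bool" where
  "finite_injective_dim R C \<longleftrightarrow> (\<exists>n. \<forall>i>n. \<forall>J. ideal J R \<longrightarrow>
     carrier (Ext_module R (cyclic_module R J) C i) =
       {\<zero>\<^bsub>Ext_module R (cyclic_module R J) C i\<^esub>})"

text \<open>
  As in Bruns and Herzog, Definition 3.3.1: a maximal Cohen-Macaulay module of type 1 and of
  finite injective dimension.
\<close>
definition canonical_module ::
    "('a, 'b) ring_scheme \<Rightarrow> ('a, 'm, 'c) module_scheme \<Rightarrow> bool" where
  "canonical_module R C \<longleftrightarrow> cohen_macaulay_local R \<and> fin_gen_module R C \<and>
     (\<exists>d. krull_dim R = enat d \<and> depth R C = enat d \<and>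
        module_length R (Ext_module R (cyclic_module R (max_ideal R)) C d) = 1) \<and>
     finite_injective_dim R C"


section \<open>The total ring of fractions\<close>

definition fraction :: "('a, 'b) ring_scheme \<Rightarrow> 'a \<Rightarrow> 'a \<Rightarrow> ('a \<times> 'a) set" where
  "fraction R a s =
     {(b, t). b \<in> carrier R \<and> t \<in> nonzerodivisors R \<and> a \<otimes>\<^bsub>R\<^esub> t = b \<otimes>\<^bsub>R\<^esub> s}"

definition total_fractions :: "('a, 'b) ring_scheme \<Rightarrow> ('a \<times> 'a) set ring" where
  "total_fractions R =
     \<lparr>carrier = {fraction R a s | a s. a \<in> carrier R \<and> s \<in> nonzerodivisors R},
      monoid.mult = (\<lambda>U V. \<Union>(a, s)\<in>U. \<Union>(b, t)\<in>V. fraction R (a \<otimes>\<^bsub>R\<^esub> b) (s \<otimes>\<^bsub>R\<^esub> t)),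
      one = fraction R \<one>\<^bsub>R\<^esub> \<one>\<^bsub>R\<^esub>,
      ring.zero = fraction R \<zero>\<^bsub>R\<^esub> \<one>\<^bsub>R\<^esub>,
      ring.add = (\<lambda>U V. \<Union>(a, s)\<in>U. \<Union>(b, t)\<in>V.
        fraction R (a \<otimes>\<^bsub>R\<^esub> t \<oplus>\<^bsub>R\<^esub> b \<otimes>\<^bsub>R\<^esub> s) (s \<otimes>\<^bsub>R\<^esub> t))\<rparr>"

definition frac_embed :: "('a, 'b) ring_scheme \<Rightarrow> 'a \<Rightarrow> ('a \<times> 'a) set" where
  "frac_embed R r = fraction R r \<one>\<^bsub>R\<^esub>"

text \<open>\<open>F\<close> regarded as an \<open>R\<close>-module, for an \<open>R\<close>-submodule \<open>F\<close> of the total ring of fractions.\<close>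
definition frac_module ::
    "('a, 'b) ring_scheme \<Rightarrow> ('a \<times> 'a) set set \<Rightarrow> ('a, ('a \<times> 'a) set) module" where
  "frac_module R F = \<lparr>carrier = F, monoid.mult = undefined, one = undefined,
     ring.zero = ring.zero (total_fractions R), ring.add = ring.add (total_fractions R),
     smult = (\<lambda>r q. frac_embed R r \<otimes>\<^bsub>total_fractions R\<^esub> q)\<rparr>"

definition fractional_ideal :: "('a, 'b) ring_scheme \<Rightarrow> ('a \<times> 'a) set set \<Rightarrow> bool" where
  "fractional_ideal R F \<longleftrightarrow>
     submodule F R (frac_module R (carrier (total_fractions R))) \<and>
     (\<exists>s \<in> nonzerodivisors R. \<forall>q \<in> F.
        frac_embed R s \<otimes>\<^bsub>total_fractions R\<^esub> q \<in> frac_embed R ` carrier R)"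

definition integral_closure :: "('a, 'b) ring_scheme \<Rightarrow> ('a \<times> 'a) set set" where
  "integral_closure R = {q \<in> carrier (total_fractions R).
     \<exists>n c. n > 0 \<and> c \<in> {..<n} \<rightarrow> carrier R \<and>
       q [^]\<^bsub>total_fractions R\<^esub> n \<oplus>\<^bsub>total_fractions R\<^esub>
         (\<Oplus>\<^bsub>total_fractions R\<^esub>i\<in>{..<n::nat}.
            frac_embed R (c i) \<otimes>\<^bsub>total_fractions R\<^esub> q [^]\<^bsub>total_fractions R\<^esub> i)
       = \<zero>\<^bsub>total_fractions R\<^esub>}"

definition endo_colon :: "('a, 'b) ring_scheme \<Rightarrow> 'a set \<Rightarrow> ('a \<times> 'a) set set" where
  "endo_colon R J = {q \<in> carrier (total_fractions R).
     \<forall>x \<in> J. q \<otimes>\<^bsub>total_fractions R\<^esub> frac_embed R x \<in> frac_embed R ` J}"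


section \<open>Almost Gorenstein rings\<close>

text \<open>
  Being canonical is invariant under isomorphism, so a canonical module isomorphic to the
  fractional ideal \<open>\<omega>\<close> exists iff \<open>\<omega>\<close> itself is a canonical module.
\<close>
definition almost_gorenstein :: "('a, 'b) ring_scheme \<Rightarrow> bool" where
  "almost_gorenstein S \<longleftrightarrow> cohen_macaulay_local S \<and> krull_dim S = 1 \<and>
     (\<exists>\<omega>. fractional_ideal S \<omega> \<and> canonical_module S (frac_module S \<omega>) \<and>
        frac_embed S ` carrier S \<subseteq> \<omega> \<and> \<omega> \<subseteq> endo_colon S (max_ideal S))"


section \<open>The rings \<open>R(I)\<^sub>a\<^sub>,\<^sub>b\<close>\<close>

definition rees_algebra :: "('a, 'b) ring_scheme \<Rightarrow> 'a set \<Rightarrow> ('a, nat \<Rightarrow> 'a) up_ring" where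
  "rees_algebra R I =
     (UP R)\<lparr>carrier := {p \<in> carrier (UP R). \<forall>n. coeff (UP R) p n \<in> ideal_power R I n}\<rparr>"

definition rees_poly :: "('a, 'b) ring_scheme \<Rightarrow> 'a \<Rightarrow> 'a \<Rightarrow> (nat \<Rightarrow> 'a)" where
  "rees_poly R a b =
     monom (UP R) \<one>\<^bsub>R\<^esub> 2 \<oplus>\<^bsub>UP R\<^esub> monom (UP R) a 1 \<oplus>\<^bsub>UP R\<^esub> monom (UP R) b 0"

definition rees_quotient ::
    "('a, 'b) ring_scheme \<Rightarrow> 'a set \<Rightarrow> 'a \<Rightarrow> 'a \<Rightarrow> (nat \<Rightarrow> 'a) set ring" where
  "rees_quotient R I a b =
     rees_algebra R I Quot (PIdl\<^bsub>UP R\<^esub> (rees_poly R a b) \<inter> carrier (rees_algebra R I))"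

end

theory Submission
 imports Defs
begin

text \<open>
 Let Q be the total ring of fractions of R, let m be the maximal ideal of R, and write \<omega> for the
 canonical ideal. Evaluation at t identifies \<open>S = R(I)\<^sub>a\<^sub>,\<^sub>b\<close> with the subring
 R \<times> I of \<open>B = Q[t]/(t\<^sup>2 + at + b)\<close> (rees_quotient_iso). The total ring of fractions
 of S is B (total_quotient_\<Psi>), and the maximal ideal of S is \<open>n = m \<times> I\<close>
 (max_ideal_image). The whole argument can therefore be carried out with regular fractional ideals, called
 lattices below, their colon modules F : G, and lengths \<open>\<ell>(F/G)\<close>.

 The homological notions are translated as follows. For an ideal J that contains a nonzerodivisor,
 \<open>Ext\<^sup>1(R/J, C)\<close> is \<open>(C : J)/C\<close> (ext1_length), so the type of R is
 \<open>\<ell>((R : m)/R)\<close>, and a canonical ideal satisfies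
 \<open>\<ell>((\<omega> : m)/\<omega>) = 1\<close>. Moreover \<open>\<omega> : (\<omega> : F) = F\<close> for
 every lattice F (CC_reflexive), so that dualizing reverses inclusions and preserves lengths (dual_length).
 The proof of this duality needs \<open>Ext\<^sup>2(R/J, \<omega>) = 0\<close>, which follows from finite
 injective dimension by descending induction on the degree (ext_zero_of_finite_injective_dim).

 The lattice \<open>K\<^sub>0 = (\<omega> : I) \<times> \<omega>\<close> of B has type one, that is, no
 lattice lies strictly between \<open>K\<^sub>0\<close> and \<open>K\<^sub>0 : n\<close> (K0_colon_between);
 this forces every canonical ideal K of S to be \<open>u K\<^sub>0\<close> for a unit u of B
 (canonical_is_scaled). Assume that \<open>S \<subseteq> K \<subseteq> T = n : n\<close>. The ring T has only
 finitely many maximal ideals, none of them contains all \<open>u(x, 0)\<close> with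
 \<open>x \<in> \<omega> : I\<close>, and the residue field is infinite; hence \<open>u(w, 0)\<close> is a
 unit of T for some \<open>w \<in> \<omega> : I\<close> (avoid_T_maximal). It follows that
 \<open>n = u(w, 0) n = u (wm \<times> wI)\<close>, and therefore
 \<open>\<ell>(K/n) = \<ell>((\<omega> : I)/wm) + \<ell>(\<omega>/wI)\<close>. Duality gives
 \<open>\<ell>((\<omega> : I)/wR) = \<ell>(\<omega>/wI) = q\<close>, say, so the first summand is 1 + q and
 \<open>\<ell>(K/n) = 2q + 1\<close>. Finally \<open>K n \<subseteq> n\<close> yields
 \<open>S : n = K : n\<close>, whence
 \<open>\<ell>((S : n)/S) = \<ell>(K/(K : (K : n))) = \<ell>(K/n)\<close>: the type of S is the odd number
 \<open>2q + 1\<close>.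

 For the upper bound, \<open>K n \<subseteq> n\<close> becomes
 \<open>n K\<^sub>0 \<subseteq> wm \<times> wI\<close>, in particular \<open>m\<omega> \<subseteq> wI\<close>.
 Every p with \<open>p wI \<subseteq> \<omega>\<close> then satisfies
 \<open>pm \<subseteq> \<omega> : \<omega> = R\<close>, so by duality
 \<open>\<omega> : (R : m) \<subseteq> wI\<close>, and
 \<open>q = \<ell>(\<omega>/wI) \<le> \<ell>(\<omega>/(\<omega> : (R : m))) = \<ell>((R : m)/R)\<close>, the
 type of R. Both computations are carried out in type_of_almost_gorenstein.
\<close>

section \<open>Linear maps and projective modules\<close>

lemma (in abelian_group) add_minus_cancel:
 assumes "x \<in> carrier G" "y \<in> carrier G"
 shows "y \<oplus> (x \<ominus> y) = x" "(y \<oplus> x) \<ominus> y = x"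
proof -
 show "y \<oplus> (x \<ominus> y) = x" using assms a_lcomm[of y x "\<ominus> y"] by (simp add: minus_eq r_neg)
 show "(y \<oplus> x) \<ominus> y = x" using assms a_comm[of y x] by (simp add: minus_eq r_neg a_assoc)
qed

lemma (in abelian_group) minus_eq_zeroD:
 assumes "x \<in> carrier G" "y \<in> carrier G" "x \<ominus> y = \<zero>"
 shows "x = y"
 using add_minus_cancel(1)[OF assms(1,2)] assms by simp

definition linear_map ::
  "('a, 'b) ring_scheme \<Rightarrow> ('a, 'm, 'c) module_scheme \<Rightarrow> ('a, 'n, 'd) module_scheme
   \<Rightarrow> ('m \<Rightarrow> 'n) \<Rightarrow> bool" where
 "linear_map R M N f \<longleftrightarrow> f \<in> carrier M \<rightarrow> carrier N \<and>
   (\<forall>x \<in> carrier M. \<forall>y \<in> carrier M. f (x \<oplus>\<^bsub>M\<^esub> y) = f x \<oplus>\<^bsub>N\<^esub> f y) \<and>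
   (\<forall>r \<in> carrier R. \<forall>x \<in> carrier M. f (r \<odot>\<^bsub>M\<^esub> x) = r \<odot>\<^bsub>N\<^esub> f x)"

lemma linear_mapI:
 assumes "\<And>x. x \<in> carrier M \<Longrightarrow> f x \<in> carrier N"
  and "\<And>x y. x \<in> carrier M \<Longrightarrow> y \<in> carrier M \<Longrightarrow> f (x \<oplus>\<^bsub>M\<^esub> y) = f x \<oplus>\<^bsub>N\<^esub> f y"
  and "\<And>r x. r \<in> carrier R \<Longrightarrow> x \<in> carrier M \<Longrightarrow> f (r \<odot>\<^bsub>M\<^esub> x) = r \<odot>\<^bsub>N\<^esub> f x"
 shows "linear_map R M N f"
 using assms unfolding linear_map_def by auto

lemma linear_mapD:
 assumes "linear_map R M N f"
 shows "x \<in> carrier M \<Longrightarrow> f x \<in> carrier N"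
  and "x \<in> carrier M \<Longrightarrow> y \<in> carrier M \<Longrightarrow> f (x \<oplus>\<^bsub>M\<^esub> y) = f x \<oplus>\<^bsub>N\<^esub> f y"
  and "r \<in> carrier R \<Longrightarrow> x \<in> carrier M \<Longrightarrow> f (r \<odot>\<^bsub>M\<^esub> x) = r \<odot>\<^bsub>N\<^esub> f x"
 using assms unfolding linear_map_def by auto

lemma linear_map_zero:
 assumes "module R M" "module R N" "linear_map R M N f"
 shows "f \<zero>\<^bsub>M\<^esub> = \<zero>\<^bsub>N\<^esub>"
proof -
 interpret M: module R M by fact
 interpret N: module R N by fact
 have "f (\<zero>\<^bsub>R\<^esub> \<odot>\<^bsub>M\<^esub> \<zero>\<^bsub>M\<^esub>) = \<zero>\<^bsub>R\<^esub> \<odot>\<^bsub>N\<^esub> f \<zero>\<^bsub>M\<^esub>"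
  by (rule linear_mapD(3)[OF assms(3)]) auto
 then show ?thesis using linear_mapD(1)[OF assms(3), of "\<zero>\<^bsub>M\<^esub>"] by simp
qed

lemma linear_map_neg:
 assumes "module R M" "module R N" "linear_map R M N f" "x \<in> carrier M"
 shows "f (\<ominus>\<^bsub>M\<^esub> x) = \<ominus>\<^bsub>N\<^esub> f x"
proof -
 interpret M: module R M by fact
 interpret N: module R N by fact
 have "f ((\<ominus>\<^bsub>R\<^esub> \<one>\<^bsub>R\<^esub>) \<odot>\<^bsub>M\<^esub> x) = (\<ominus>\<^bsub>R\<^esub> \<one>\<^bsub>R\<^esub>) \<odot>\<^bsub>N\<^esub> f x"
  by (rule linear_mapD(3)[OF assms(3)]) (use assms in auto)
 then show ?thesis using linear_mapD(1)[OF assms(3,4)] assms(4)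
  by (simp add: M.smult_l_minus N.smult_l_minus)
qed

lemma linear_map_diff:
 assumes "module R M" "module R N" "linear_map R M N f" "x \<in> carrier M" "y \<in> carrier M"
 shows "f (x \<ominus>\<^bsub>M\<^esub> y) = f x \<ominus>\<^bsub>N\<^esub> f y"
proof -
 interpret M: module R M by fact
 interpret N: module R N by fact
 show ?thesis using assms
  by (simp add: M.minus_eq N.minus_eq linear_mapD(2)[OF assms(3)] linear_map_neg[OF assms(1,2,3)])
qed

lemma linear_map_finsum:
 assumes "module R M" "module R N" "linear_map R M N f" "finite A" "g \<in> A \<rightarrow> carrier M"
 shows "f (\<Oplus>\<^bsub>M\<^esub>k\<in>A. g k) = (\<Oplus>\<^bsub>N\<^esub>k\<in>A. f (g k))"
proof -
 interpret M: module R M by fact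
 interpret N: module R N by fact
 show ?thesis using assms(4,5)
 proof (induction A rule: finite_induct)
  case empty then show ?case by (simp add: linear_map_zero[OF assms(1,2,3)])
 next
  case (insert a A)
  have "(\<Oplus>\<^bsub>N\<^esub>k\<in>insert a A. f (g k)) = f (g a) \<oplus>\<^bsub>N\<^esub> (\<Oplus>\<^bsub>N\<^esub>k\<in>A. f (g k))"
   by (rule N.finsum_insert) (use insert linear_mapD(1)[OF assms(3)] in auto)
  then show ?case using insert by (simp add: linear_mapD(2)[OF assms(3)])
 qed
qed

lemma linear_map_compose:
 assumes "linear_map R M N f" "linear_map R N L g"
 shows "linear_map R M L (\<lambda>x. g (f x))"
 using assms unfolding linear_map_def by (auto simp: Pi_def)

lemma linear_map_add:
 assumes "module R M" "module R N" "linear_map R M N f" "linear_map R M N g"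
 shows "linear_map R M N (\<lambda>x. f x \<oplus>\<^bsub>N\<^esub> g x)"
proof -
 interpret M: module R M by fact
 interpret N: module R N by fact
 show ?thesis
  by (rule linear_mapI) (use linear_mapD[OF assms(3)] linear_mapD[OF assms(4)] in
    \<open>simp_all add: N.a_ac N.smult_r_distr\<close>)
qed

lemma linear_map_uminus:
 assumes "module R M" "module R N" "linear_map R M N f"
 shows "linear_map R M N (\<lambda>x. \<ominus>\<^bsub>N\<^esub> f x)"
proof -
 interpret M: module R M by fact
 interpret N: module R N by fact
 show ?thesis
  by (rule linear_mapI) (use linear_mapD[OF assms(3)] in
    \<open>simp_all add: N.minus_add N.smult_r_minus\<close>)
qed

lemma linear_map_minus:
 assumes "module R M" "module R N" "linear_map R M N f" "linear_map R M N g"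
 shows "linear_map R M N (\<lambda>x. f x \<ominus>\<^bsub>N\<^esub> g x)"
proof -
 interpret N: module R N by fact
 show ?thesis
  using linear_map_add[OF assms(1,2,3) linear_map_uminus[OF assms(1,2,4)]] by (simp add: N.minus_eq)
qed

lemma linear_map_id: "linear_map R M M (\<lambda>x. x)"
 by (rule linear_mapI) auto

lemma linear_map_zero_map: "module R M \<Longrightarrow> module R N \<Longrightarrow> linear_map R M N (\<lambda>x. \<zero>\<^bsub>N\<^esub>)"
 by (rule linear_mapI)
  (auto simp: module.smult_r_null abelian_groupE(2) module_def abelian_group.axioms(1)
   abelian_monoid.l_zero abelian_monoid.zero_closed)

lemma ring_as_module_module:
 assumes "cring R" shows "module R (ring_as_module R)"
proof -
 interpret cring R by fact
 show ?thesis
  by (rule moduleI, fact, rule abelian_groupI)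
    (auto simp: ring_as_module_def a_ac l_distr r_distr m_assoc intro: l_neg)
qed

lemma ring_as_module_simps [simp]:
 "carrier (ring_as_module R) = carrier R" "\<zero>\<^bsub>ring_as_module R\<^esub> = \<zero>\<^bsub>R\<^esub>"
 "x \<oplus>\<^bsub>ring_as_module R\<^esub> y = x \<oplus>\<^bsub>R\<^esub> y" "x \<odot>\<^bsub>ring_as_module R\<^esub> y = x \<otimes>\<^bsub>R\<^esub> y"
 by (simp_all add: ring_as_module_def)

lemma ring_as_module_minus:
 assumes "cring R" "y \<in> carrier R"
 shows "\<ominus>\<^bsub>ring_as_module R\<^esub> y = \<ominus>\<^bsub>R\<^esub> y" "x \<ominus>\<^bsub>ring_as_module R\<^esub> y = x \<ominus>\<^bsub>R\<^esub> y"
proof -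
 interpret cring R by fact
 interpret M: module R "ring_as_module R" using ring_as_module_module[OF assms(1)] .
 show a: "\<ominus>\<^bsub>ring_as_module R\<^esub> y = \<ominus>\<^bsub>R\<^esub> y"
  by (rule M.minus_equality) (use assms in \<open>auto simp: l_neg\<close>)
 show "x \<ominus>\<^bsub>ring_as_module R\<^esub> y = x \<ominus>\<^bsub>R\<^esub> y" 
  by (simp add: M.minus_eq minus_eq a)
qed

definition prod_module :: "('a, 'm) module \<Rightarrow> ('a, 'n) module \<Rightarrow> ('a, 'm \<times> 'n) module" where
 "prod_module M N = \<lparr>carrier = carrier M \<times> carrier N, monoid.mult = undefined, one = undefined,
   ring.zero = (\<zero>\<^bsub>M\<^esub>, \<zero>\<^bsub>N\<^esub>), ring.add = (\<lambda>(x, y) (x', y'). (x \<oplus>\<^bsub>M\<^esub> x', y \<oplus>\<^bsub>N\<^esub> y')),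
   smult = (\<lambda>r (x, y). (r \<odot>\<^bsub>M\<^esub> x, r \<odot>\<^bsub>N\<^esub> y))\<rparr>"

lemma prod_module_simps [simp]:
 "carrier (prod_module M N) = carrier M \<times> carrier N" "\<zero>\<^bsub>prod_module M N\<^esub> = (\<zero>\<^bsub>M\<^esub>, \<zero>\<^bsub>N\<^esub>)"
 "(x, y) \<oplus>\<^bsub>prod_module M N\<^esub> (x', y') = (x \<oplus>\<^bsub>M\<^esub> x', y \<oplus>\<^bsub>N\<^esub> y')"
 "r \<odot>\<^bsub>prod_module M N\<^esub> (x, y) = (r \<odot>\<^bsub>M\<^esub> x, r \<odot>\<^bsub>N\<^esub> y)"
 by (simp_all add: prod_module_def)

lemma prod_module_module:
 assumes "module R M" "module R N"
 shows "module R (prod_module M N)"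
proof -
 interpret M: module R M by fact
 interpret N: module R N by fact
 show ?thesis
 proof (rule moduleI, fact M.R.is_cring, rule abelian_groupI)
  fix p assume "p \<in> carrier (prod_module M N)"
  then show "\<exists>q\<in>carrier (prod_module M N). q \<oplus>\<^bsub>prod_module M N\<^esub> p = \<zero>\<^bsub>prod_module M N\<^esub>"
   by (cases p) (auto intro!: bexI[of _ "(\<ominus>\<^bsub>M\<^esub> fst p, \<ominus>\<^bsub>N\<^esub> snd p)"] simp: M.l_neg N.l_neg)
 qed (auto simp: M.a_ac N.a_ac M.smult_l_distr N.smult_l_distr M.smult_r_distr N.smult_r_distr
   M.smult_assoc1 N.smult_assoc1)
qed

lemma linear_map_fst: "linear_map R (prod_module M N) M fst"
 and linear_map_snd: "linear_map R (prod_module M N) N snd"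
 by (rule linear_mapI; auto)+

lemma linear_map_Pair:
 "linear_map R L M f \<Longrightarrow> linear_map R L N g \<Longrightarrow> linear_map R L (prod_module M N) (\<lambda>x. (f x, g x))"
 by (rule linear_mapI) (auto simp: linear_mapD)

lemma linear_map_fst': "linear_map R L (prod_module M N) f \<Longrightarrow> linear_map R L M (\<lambda>x. fst (f x))"
 and linear_map_snd': "linear_map R L (prod_module M N) f \<Longrightarrow> linear_map R L N (\<lambda>x. snd (f x))"
 using linear_map_compose[OF _ linear_map_fst] linear_map_compose[OF _ linear_map_snd] by blast+

lemma linear_map_case:
 assumes "module R M" "module R N" "module R L" "linear_map R M L f" "linear_map R N L g"
 shows "linear_map R (prod_module M N) L (\<lambda>z. f (fst z) \<oplus>\<^bsub>L\<^esub> g (snd z))"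
 by (rule linear_map_add[OF prod_module_module[OF assms(1,2)] assms(3)
    linear_map_compose[OF linear_map_fst assms(4)] linear_map_compose[OF linear_map_snd assms(5)]])

text \<open>
 Finitely generated projectivity in the form of the dual basis lemma. This form refers to M alone; the lifting
 property would quantify over modules of all types.
\<close>
definition fg_projective :: "('a, 'b) ring_scheme \<Rightarrow> ('a, 'm, 'c) module_scheme \<Rightarrow> bool" where
 "fg_projective R M \<longleftrightarrow> (\<exists>n (v :: nat \<Rightarrow> 'm) \<phi>.
   (\<forall>k<n. v k \<in> carrier M \<and> linear_map R M (ring_as_module R) (\<phi> k)) \<and>
   (\<forall>z\<in>carrier M. z = (\<Oplus>\<^bsub>M\<^esub>k\<in>{..<n}. \<phi> k z \<odot>\<^bsub>M\<^esub> v k)))"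

lemma linear_map_smult_const:
 assumes "module R M" "module R N" "linear_map R M (ring_as_module R) \<phi>" "c \<in> carrier N"
 shows "linear_map R M N (\<lambda>z. \<phi> z \<odot>\<^bsub>N\<^esub> c)"
proof -
 interpret N: module R N by fact
 show ?thesis
  by (rule linear_mapI) (use linear_mapD[OF assms(3)] assms(4) in
    \<open>simp_all add: N.smult_l_distr N.smult_assoc1\<close>)
qed

lemma linear_map_finsum_map:
 assumes "module R M" "module R N" "finite A" "\<And>k. k \<in> A \<Longrightarrow> linear_map R M N (f k)"
 shows "linear_map R M N (\<lambda>z. \<Oplus>\<^bsub>N\<^esub>k\<in>A. f k z)"
 using assms(3,4)
proof (induction A rule: finite_induct)
 case empty
 interpret N: module R N by fact
 show ?case using linear_map_zero_map[OF assms(1,2)] by simp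
next
 case (insert a A)
 interpret N: module R N by fact
 have eq: "(\<Oplus>\<^bsub>N\<^esub>k\<in>insert a A. f k z) = f a z \<oplus>\<^bsub>N\<^esub> (\<Oplus>\<^bsub>N\<^esub>k\<in>A. f k z)" if "z \<in> carrier M" for z
  by (rule N.finsum_insert) (use insert linear_mapD(1)[OF insert.prems] that in auto)
 have "linear_map R M N (\<lambda>z. f a z \<oplus>\<^bsub>N\<^esub> (\<Oplus>\<^bsub>N\<^esub>k\<in>A. f k z))"
  by (rule linear_map_add[OF assms(1,2)]) (use insert in auto)
 moreover have "x \<oplus>\<^bsub>M\<^esub> y \<in> carrier M" if "x \<in> carrier M" "y \<in> carrier M" for x y
  using that assms(1) by (simp add: module.axioms abelian_group.axioms abelian_monoid.a_closed)
 moreover have "r \<odot>\<^bsub>M\<^esub> x \<in> carrier M" if "x \<in> carrier M" "r \<in> carrier R" for x r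
  using that assms(1) by (simp add: module.smult_closed)
 ultimately show ?case unfolding linear_map_def using eq by (simp add: Pi_def)
qed

lemma projective_lift:
 assumes "module R M" "module R N" "module R L" "fg_projective R M"
  and f: "linear_map R M L f" and p: "linear_map R N L p"
  and im: "\<And>z. z \<in> carrier M \<Longrightarrow> f z \<in> p ` carrier N"
 obtains g where "linear_map R M N g" "\<And>z. z \<in> carrier M \<Longrightarrow> p (g z) = f z"
proof -
 interpret M: module R M by fact
 interpret N: module R N by fact
 interpret L: module R L by fact
 obtain n v \<phi> where v: "\<And>k. k < (n::nat) \<Longrightarrow> v k \<in> carrier M"
  and \<phi>: "\<And>k. k < n \<Longrightarrow> linear_map R M (ring_as_module R) (\<phi> k)"
  and sp: "\<And>z. z \<in> carrier M \<Longrightarrow> z = (\<Oplus>\<^bsub>M\<^esub>k\<in>{..<n}. \<phi> k z \<odot>\<^bsub>M\<^esub> v k)"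
  using assms(4) unfolding fg_projective_def by blast
 have "\<forall>k\<in>{..<n}. \<exists>c\<in>carrier N. p c = f (v k)" using im v by (metis imageE lessThan_iff)
 then obtain c where c: "\<And>k. k < n \<Longrightarrow> c k \<in> carrier N" "\<And>k. k < n \<Longrightarrow> p (c k) = f (v k)"
  by (metis lessThan_iff)
 have \<phi>c: "\<phi> k z \<in> carrier R" if "k < n" "z \<in> carrier M" for k z
  using linear_mapD(1)[OF \<phi>[OF that(1)] that(2)] by simp
 define g where "g = (\<lambda>z. \<Oplus>\<^bsub>N\<^esub>k\<in>{..<n}. \<phi> k z \<odot>\<^bsub>N\<^esub> c k)"
 have "linear_map R M N g" unfolding g_def
  by (rule linear_map_finsum_map[OF assms(1,2)])
    (use linear_map_smult_const[OF assms(1,2) \<phi>] c in auto)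
 moreover have "p (g z) = f z" if z: "z \<in> carrier M" for z
 proof -
  have "p (g z) = (\<Oplus>\<^bsub>L\<^esub>k\<in>{..<n}. p (\<phi> k z \<odot>\<^bsub>N\<^esub> c k))" unfolding g_def
   by (rule linear_map_finsum[OF assms(2,3) p]) (use \<phi>c z c in auto)
  also have "\<dots> = (\<Oplus>\<^bsub>L\<^esub>k\<in>{..<n}. f (\<phi> k z \<odot>\<^bsub>M\<^esub> v k))"
   by (rule L.finsum_cong')
     (use \<phi>c z c v linear_mapD[OF f] linear_mapD[OF p] in auto)
  also have "\<dots> = f (\<Oplus>\<^bsub>M\<^esub>k\<in>{..<n}. \<phi> k z \<odot>\<^bsub>M\<^esub> v k)"
   by (rule linear_map_finsum[OF assms(1,3) f, symmetric]) (use \<phi>c z v in auto)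
  also have "\<dots> = f z" using sp[OF z] by simp
  finally show ?thesis .
 qed
 ultimately show ?thesis using that by blast
qed

text \<open>
 Lifting along \<open>N \<rightarrow> L/W\<close>, obtained without cosets: lift along
 \<open>N \<times> W \<rightarrow> L\<close> and forget the second coordinate.
\<close>
lemma projective_lift_mod:
 fixes L :: "('a, 'l) module" and N :: "('a, 'n) module"
 assumes "module R M" "module R N" "module R L" "fg_projective R M" "submodule W R L"
  and f: "linear_map R M L f" and p: "linear_map R N L p"
  and im: "\<And>z. z \<in> carrier M \<Longrightarrow> \<exists>c\<in>carrier N. f z \<ominus>\<^bsub>L\<^esub> p c \<in> W"
 obtains g where "linear_map R M N g" "\<And>z. z \<in> carrier M \<Longrightarrow> f z \<ominus>\<^bsub>L\<^esub> p (g z) \<in> W"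
proof -
 interpret M: module R M by fact
 interpret N: module R N by fact
 interpret L: module R L by fact
 have W: "W \<subseteq> carrier L" using L.submoduleE(1)[OF assms(5)] .
 let ?W = "L\<lparr>carrier := W\<rparr>"
 have mW: "module R ?W" using submodule.submodule_is_module[OF assms(5,3)] .
 have li: "linear_map R ?W L (\<lambda>x. x)" using W by (intro linear_mapI) auto
 obtain g where g: "linear_map R M (prod_module N ?W) g"
  and gp: "\<And>z. z \<in> carrier M \<Longrightarrow> p (fst (g z)) \<oplus>\<^bsub>L\<^esub> snd (g z) = f z"
 proof (rule projective_lift[OF assms(1) prod_module_module[OF assms(2) mW] assms(3,4) f
    linear_map_case[OF assms(2) mW assms(3) p li]])
  fix z assume z: "z \<in> carrier M"
  then obtain c where c: "c \<in> carrier N" "f z \<ominus>\<^bsub>L\<^esub> p c \<in> W" using im by blast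
  have "f z = p c \<oplus>\<^bsub>L\<^esub> (f z \<ominus>\<^bsub>L\<^esub> p c)"
   using linear_mapD(1)[OF f z] linear_mapD(1)[OF p c(1)]
   by (simp add: L.add_minus_cancel)
  then show "f z \<in> (\<lambda>z. p (fst z) \<oplus>\<^bsub>L\<^esub> snd z) ` carrier (prod_module N ?W)"
   using c by (auto intro!: image_eqI[of _ _ "(c, f z \<ominus>\<^bsub>L\<^esub> p c)"])
 qed blast
 have "f z \<ominus>\<^bsub>L\<^esub> p (fst (g z)) \<in> W" if z: "z \<in> carrier M" for z
 proof -
  have "g z \<in> carrier N \<times> W" using linear_mapD(1)[OF g z] by simp
  then have w: "snd (g z) \<in> W" "snd (g z) \<in> carrier L" "p (fst (g z)) \<in> carrier L"
   using W linear_mapD(1)[OF p] by auto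
  have "f z \<ominus>\<^bsub>L\<^esub> p (fst (g z)) = snd (g z)"
   using w gp[OF z, symmetric] by (simp add: L.add_minus_cancel)
  then show ?thesis using w by simp
 qed
 with linear_map_fst'[OF g] show ?thesis using that by blast
qed

text \<open>
 A resolution of R/J by finitely generated projective modules. The augmentation \<epsilon> takes values in R
 instead of R/J, so that no quotient module has to be formed; its kernel modulo J is what matters.
\<close>
locale ideal_resolution = ideal J R + cring R for J and R (structure) +
 fixes P :: "nat \<Rightarrow> ('a, 'f) module" and d :: "nat \<Rightarrow> 'f \<Rightarrow> 'f" and \<epsilon> :: "'f \<Rightarrow> 'a"
 assumes module_P: "module R (P i)"
  and projective_P: "fg_projective R (P i)"
  and linear_d: "linear_map R (P (Suc i)) (P i) (d i)"
  and linear_e: "linear_map R (P 0) (ring_as_module R) \<epsilon>"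
  and onto_mod: "r \<in> carrier R \<Longrightarrow> \<exists>z\<in>carrier (P 0). r \<ominus> \<epsilon> z \<in> J"
  and exact_0: "d 0 ` carrier (P (Suc 0)) = {z \<in> carrier (P 0). \<epsilon> z \<in> J}"
  and exact_Suc: "d (Suc i) ` carrier (P (Suc (Suc i))) =
   {z \<in> carrier (P (Suc i)). d i z = \<zero>\<^bsub>P i\<^esub>}"
begin
lemma d_closed [simp]: "z \<in> carrier (P (Suc i)) \<Longrightarrow> d i z \<in> carrier (P i)"
 using linear_mapD(1)[OF linear_d] .
lemma e_closed [simp]: "z \<in> carrier (P 0) \<Longrightarrow> \<epsilon> z \<in> carrier R"
 using linear_mapD(1)[OF linear_e] by simp
lemma d_d [simp]: "z \<in> carrier (P (Suc (Suc i))) \<Longrightarrow> d i (d (Suc i) z) = \<zero>\<^bsub>P i\<^esub>"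
 using exact_Suc[of i] by blast
lemma e_d: "z \<in> carrier (P (Suc 0)) \<Longrightarrow> \<epsilon> (d 0 z) \<in> J"
 using exact_0 by blast
end

text \<open>
 Exactness of \<open>Hom(P, C)\<close> in degree i + 1. If P resolves R/J, this says that
 \<open>Ext\<^sup>i\<^sup>+\<^sup>1(R/J, C) = 0\<close>; the shift makes the neighbouring degrees i and i + 2
 available, as degree 0 never occurs.
\<close>
definition ext_vanishes ::
 "('a, 'b) ring_scheme \<Rightarrow> (nat \<Rightarrow> ('a, 'f) module) \<Rightarrow> (nat \<Rightarrow> 'f \<Rightarrow> 'f) \<Rightarrow> ('a, 'm) module \<Rightarrow> nat \<Rightarrow> bool" where
 "ext_vanishes R P d C i \<longleftrightarrow> (\<forall>f. linear_map R (P (Suc i)) C f \<and>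
   (\<forall>z\<in>carrier (P (Suc (Suc i))). f (d (Suc i) z) = \<zero>\<^bsub>C\<^esub>) \<longrightarrow>
   (\<exists>g. linear_map R (P i) C g \<and> (\<forall>z\<in>carrier (P (Suc i)). f z = g (d i z))))"

lemma ideal_submodule:
 assumes "ideal J R" "cring R" shows "submodule J R (ring_as_module R)"
proof -
 interpret ideal J R by fact
 interpret cring R by fact
 interpret M: module R "ring_as_module R" using ring_as_module_module[OF assms(2)] .
 show ?thesis
  by (rule M.submoduleI) (use a_subset in \<open>auto simp: I_l_closed ring_as_module_minus[OF assms(2)] subsetD\<close>)
qed

text \<open>
 Multiplication by y maps R/J to R/J' and lifts degree by degree: each component exists by projectivity, since
 the previous one sends boundaries to cycles and cycles of P' are boundaries. With y = 1 this is the
 comparison map.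
\<close>
lemma chain_map_exists:
 fixes P :: "nat \<Rightarrow> ('a, 'f) module" and P' :: "nat \<Rightarrow> ('a, 'g) module"
 assumes "ideal_resolution J R P d \<epsilon>" "ideal_resolution J' R P' d' \<epsilon>'"
  and y: "y \<in> carrier R" "\<And>j. j \<in> J \<Longrightarrow> y \<otimes>\<^bsub>R\<^esub> j \<in> J'"
 obtains \<alpha> where "\<And>i. linear_map R (P i) (P' i) (\<alpha> i)"
  "\<And>z. z \<in> carrier (P 0) \<Longrightarrow> y \<otimes>\<^bsub>R\<^esub> \<epsilon> z \<ominus>\<^bsub>R\<^esub> \<epsilon>' (\<alpha> 0 z) \<in> J'"
  "\<And>i z. z \<in> carrier (P (Suc i)) \<Longrightarrow> d' i (\<alpha> (Suc i) z) = \<alpha> i (d i z)"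
proof -
 interpret A: ideal_resolution J R P d \<epsilon> by fact
 interpret B: ideal_resolution J' R P' d' \<epsilon>' by fact
 interpret RM: module R "ring_as_module R" using ring_as_module_module[OF A.is_cring] .
 have ly: "linear_map R (P 0) (ring_as_module R) (\<lambda>z. y \<otimes>\<^bsub>R\<^esub> \<epsilon> z)"
  using y by (intro linear_mapI)
   (simp_all add: linear_mapD[OF A.linear_e] A.r_distr A.m_lcomm)
 obtain \<alpha>0 where a0: "linear_map R (P 0) (P' 0) \<alpha>0"
  and a0e: "\<And>z. z \<in> carrier (P 0) \<Longrightarrow> y \<otimes>\<^bsub>R\<^esub> \<epsilon> z \<ominus>\<^bsub>R\<^esub> \<epsilon>' (\<alpha>0 z) \<in> J'"
 proof (rule projective_lift_mod[OF A.module_P B.module_P RM.module_axioms A.projective_P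
    ideal_submodule[OF B.ideal_axioms A.is_cring] ly B.linear_e])
  show "\<exists>c\<in>carrier (P' 0). y \<otimes>\<^bsub>R\<^esub> \<epsilon> z \<ominus>\<^bsub>ring_as_module R\<^esub> \<epsilon>' c \<in> J'"
   if "z \<in> carrier (P 0)" for z
   using B.onto_mod[of "y \<otimes>\<^bsub>R\<^esub> \<epsilon> z"] that y by (auto simp: ring_as_module_minus[OF A.is_cring])
 next
  fix g assume g: "linear_map R (P 0) (P' 0) g"
   "\<And>z. z \<in> carrier (P 0) \<Longrightarrow> y \<otimes>\<^bsub>R\<^esub> \<epsilon> z \<ominus>\<^bsub>ring_as_module R\<^esub> \<epsilon>' (g z) \<in> J'"
  then show ?thesis
   using that[OF g(1)] y linear_mapD(1)[OF g(1)] by (simp add: ring_as_module_minus[OF A.is_cring])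
 qed
 \<comment> \<open>The linear maps are chosen one after the other; each must send boundaries to boundaries for the next one to exist.\<close>
 define good where "good = (\<lambda>i \<alpha>. linear_map R (P i) (P' i) \<alpha> \<and> (i = 0 \<longrightarrow> \<alpha> = \<alpha>0) \<and>
  (\<forall>z\<in>carrier (P (Suc i)). \<alpha> (d i z) \<in> d' i ` carrier (P' (Suc i))))"
 define link where "link = (\<lambda>i \<alpha> \<beta>. \<forall>z\<in>carrier (P (Suc i)). d' i (\<beta> z) = \<alpha> (d i z))"
 have "\<exists>\<alpha>. \<forall>i. good i (\<alpha> i) \<and> link i (\<alpha> i) (\<alpha> (Suc i))"
 proof (rule dependent_nat_choice)
  have "\<alpha>0 (d 0 z) \<in> d' 0 ` carrier (P' (Suc 0))" if z: "z \<in> carrier (P (Suc 0))" for z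
  proof -
   have "y \<otimes>\<^bsub>R\<^esub> \<epsilon> (d 0 z) \<in> J'" using y A.e_d z by auto
   moreover have "y \<otimes>\<^bsub>R\<^esub> \<epsilon> (d 0 z) \<ominus>\<^bsub>R\<^esub> \<epsilon>' (\<alpha>0 (d 0 z)) \<in> J'" using a0e z by simp
   moreover have "\<epsilon>' (\<alpha>0 (d 0 z)) = y \<otimes>\<^bsub>R\<^esub> \<epsilon> (d 0 z) \<ominus>\<^bsub>R\<^esub> (y \<otimes>\<^bsub>R\<^esub> \<epsilon> (d 0 z) \<ominus>\<^bsub>R\<^esub> \<epsilon>' (\<alpha>0 (d 0 z)))"
   proof -
    have "y \<otimes>\<^bsub>R\<^esub> \<epsilon> (d 0 z) \<in> carrier R" "\<epsilon>' (\<alpha>0 (d 0 z)) \<in> carrier R"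
     using y z linear_mapD(1)[OF a0] by simp_all
    then show ?thesis by algebra
   qed
   ultimately have "\<epsilon>' (\<alpha>0 (d 0 z)) \<in> J'"
    by (metis A.minus_eq B.a_closed B.a_inv_closed)
   then show ?thesis using B.exact_0 linear_mapD(1)[OF a0] z by simp
  qed
  then show "\<exists>x. good 0 x" using a0 unfolding good_def by blast
 next
  fix \<alpha> i assume g: "good i \<alpha>"
  have la: "linear_map R (P i) (P' i) \<alpha>" using g unfolding good_def by simp
  obtain \<beta> where b: "linear_map R (P (Suc i)) (P' (Suc i)) \<beta>"
   "\<And>z. z \<in> carrier (P (Suc i)) \<Longrightarrow> d' i (\<beta> z) = \<alpha> (d i z)"
   by (rule projective_lift[OF A.module_P B.module_P B.module_P A.projective_P
     linear_map_compose[OF A.linear_d la] B.linear_d])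
     (use g in \<open>auto simp: good_def\<close>)
  have "\<beta> (d (Suc i) z) \<in> d' (Suc i) ` carrier (P' (Suc (Suc i)))" if "z \<in> carrier (P (Suc (Suc i)))" for z
   using that b A.d_closed[OF that] linear_mapD(1)[OF b(1)] 
    linear_map_zero[OF A.module_P B.module_P la] unfolding B.exact_Suc by simp
  then show "\<exists>y. good (Suc i) y \<and> link i \<alpha> y" using b unfolding good_def link_def by blast
 qed
 then show ?thesis using that a0e unfolding good_def link_def by metis
qed

text \<open>
 A self-map of a resolution that lifts the identity of R/J is homotopic to the identity. Only the values of
 the homotopy identity on boundaries are recorded: they suffice to compare cocycles, and they make the
 induction self-contained.
\<close>
lemma chain_homotopy:
 assumes "ideal_resolution J R P d \<epsilon>" 
  and a: "\<And>i. linear_map R (P i) (P i) (\<alpha> i)"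
  and ae: "\<And>z. z \<in> carrier (P 0) \<Longrightarrow> \<epsilon> z \<ominus>\<^bsub>R\<^esub> \<epsilon> (\<alpha> 0 z) \<in> J"
  and ad: "\<And>i z. z \<in> carrier (P (Suc i)) \<Longrightarrow> d i (\<alpha> (Suc i) z) = \<alpha> i (d i z)"
 shows "\<exists>h. linear_map R (P i) (P (Suc i)) h \<and>
  (\<forall>z\<in>carrier (P (Suc i)). d i (h (d i z)) = d i z \<ominus>\<^bsub>P i\<^esub> \<alpha> i (d i z))"
proof -
 interpret A: ideal_resolution J R P d \<epsilon> by fact
 show ?thesis
 proof (induction i)
  case 0
  interpret P0: module R "P 0" using A.module_P .
  have l: "linear_map R (P 0) (P 0) (\<lambda>z. z \<ominus>\<^bsub>P 0\<^esub> \<alpha> 0 z)"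
   by (rule linear_map_minus[OF A.module_P A.module_P linear_map_id a])
  obtain h where "linear_map R (P 0) (P (Suc 0)) h" "\<And>z. z \<in> carrier (P 0) \<Longrightarrow> d 0 (h z) = z \<ominus>\<^bsub>P 0\<^esub> \<alpha> 0 z"
  proof (rule projective_lift[OF A.module_P A.module_P A.module_P A.projective_P l A.linear_d])
   fix z assume z: "z \<in> carrier (P 0)"
   have "\<epsilon> (z \<ominus>\<^bsub>P 0\<^esub> \<alpha> 0 z) = \<epsilon> z \<ominus>\<^bsub>R\<^esub> \<epsilon> (\<alpha> 0 z)"
    using linear_map_diff[OF A.module_P ring_as_module_module[OF A.is_cring] A.linear_e z, of "\<alpha> 0 z"]
     linear_mapD(1)[OF a z] z by (simp add: ring_as_module_minus[OF A.is_cring])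
   then show "z \<ominus>\<^bsub>P 0\<^esub> \<alpha> 0 z \<in> d 0 ` carrier (P (Suc 0))"
    unfolding A.exact_0 using ae z linear_mapD(1)[OF a z] by simp
  qed blast
  then show ?case using A.d_closed by blast
 next
  case (Suc i)
  interpret P0: module R "P i" using A.module_P .
  interpret P1: module R "P (Suc i)" using A.module_P .
  obtain h where h: "linear_map R (P i) (P (Suc i)) h"
   "\<And>z. z\<in>carrier (P (Suc i)) \<Longrightarrow> d i (h (d i z)) = d i z \<ominus>\<^bsub>P i\<^esub> \<alpha> i (d i z)"
   using Suc by blast
  have l: "linear_map R (P (Suc i)) (P (Suc i)) (\<lambda>z. (z \<ominus>\<^bsub>P (Suc i)\<^esub> \<alpha> (Suc i) z) \<ominus>\<^bsub>P (Suc i)\<^esub> h (d i z))"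
   by (intro linear_map_minus[OF A.module_P A.module_P] linear_map_id a
     linear_map_compose[OF A.linear_d] h)
  obtain h' where h': "linear_map R (P (Suc i)) (P (Suc (Suc i))) h'"
    "\<And>z. z \<in> carrier (P (Suc i)) \<Longrightarrow> d (Suc i) (h' z) = (z \<ominus>\<^bsub>P (Suc i)\<^esub> \<alpha> (Suc i) z) \<ominus>\<^bsub>P (Suc i)\<^esub> h (d i z)"
  proof (rule projective_lift[OF A.module_P A.module_P A.module_P A.projective_P l A.linear_d])
   fix z assume z: "z \<in> carrier (P (Suc i))"
   note c = z linear_mapD(1)[OF a z] linear_mapD(1)[OF h(1) A.d_closed[OF z]]
   have "d i ((z \<ominus>\<^bsub>P (Suc i)\<^esub> \<alpha> (Suc i) z) \<ominus>\<^bsub>P (Suc i)\<^esub> h (d i z)) =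
     (d i z \<ominus>\<^bsub>P i\<^esub> \<alpha> i (d i z)) \<ominus>\<^bsub>P i\<^esub> (d i z \<ominus>\<^bsub>P i\<^esub> \<alpha> i (d i z))"
    using c by (simp add: linear_map_diff[OF A.module_P A.module_P A.linear_d] ad h)
   also have "\<dots> = \<zero>\<^bsub>P i\<^esub>" using c linear_mapD(1)[OF a] by (simp add: P0.minus_eq P0.r_neg)
   finally show "(z \<ominus>\<^bsub>P (Suc i)\<^esub> \<alpha> (Suc i) z) \<ominus>\<^bsub>P (Suc i)\<^esub> h (d i z) \<in> d (Suc i) ` carrier (P (Suc (Suc i)))"
    unfolding A.exact_Suc using c by simp
  qed blast
  have "d (Suc i) (h' (d (Suc i) z)) = d (Suc i) z \<ominus>\<^bsub>P (Suc i)\<^esub> \<alpha> (Suc i) (d (Suc i) z)"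
   if z: "z \<in> carrier (P (Suc (Suc i)))" for z
   using h'(2)[OF A.d_closed[OF z]] z linear_map_zero[OF A.module_P A.module_P h(1)]
    linear_mapD(1)[OF a A.d_closed[OF z]] by (simp add: P1.minus_eq)
  with h' show ?case by blast
 qed
qed

text \<open>
 If \<alpha> and \<beta> are the comparison maps and h is a homotopy from \<beta>\<alpha> to the identity, a
 cocycle f differs from f\<beta>\<alpha> by the coboundary of fh, and f\<beta> is a coboundary by assumption.
\<close>
lemma ext_vanishes_independent:
 fixes P :: "nat \<Rightarrow> ('a, 'f) module" and P' :: "nat \<Rightarrow> ('a, 'g) module" and C :: "('a, 'm) module"
 assumes "ideal_resolution J R P d \<epsilon>" "ideal_resolution J R P' d' \<epsilon>'" and C: "module R C"
  and van: "ext_vanishes R P' d' C i"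
 shows "ext_vanishes R P d C i"
 unfolding ext_vanishes_def
proof (intro allI impI, elim conjE)
 interpret A: ideal_resolution J R P d \<epsilon> by fact
 interpret B: ideal_resolution J R P' d' \<epsilon>' by fact
 interpret C: module R C by fact
 fix f assume f: "linear_map R (P (Suc i)) C f" and fz: "\<forall>z\<in>carrier (P (Suc (Suc i))). f (d (Suc i) z) = \<zero>\<^bsub>C\<^esub>"
 have one: "\<And>j. j \<in> J \<Longrightarrow> \<one>\<^bsub>R\<^esub> \<otimes>\<^bsub>R\<^esub> j \<in> J" using A.a_subset by auto
 obtain \<alpha> where a: "\<And>i. linear_map R (P i) (P' i) (\<alpha> i)"
  "\<And>z. z \<in> carrier (P 0) \<Longrightarrow> \<one>\<^bsub>R\<^esub> \<otimes>\<^bsub>R\<^esub> \<epsilon> z \<ominus>\<^bsub>R\<^esub> \<epsilon>' (\<alpha> 0 z) \<in> J"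
  "\<And>i z. z \<in> carrier (P (Suc i)) \<Longrightarrow> d' i (\<alpha> (Suc i) z) = \<alpha> i (d i z)"
  using chain_map_exists[OF assms(1,2) A.one_closed one] by metis
 obtain \<beta> where b: "\<And>i. linear_map R (P' i) (P i) (\<beta> i)"
  "\<And>z. z \<in> carrier (P' 0) \<Longrightarrow> \<one>\<^bsub>R\<^esub> \<otimes>\<^bsub>R\<^esub> \<epsilon>' z \<ominus>\<^bsub>R\<^esub> \<epsilon> (\<beta> 0 z) \<in> J"
  "\<And>i z. z \<in> carrier (P' (Suc i)) \<Longrightarrow> d i (\<beta> (Suc i) z) = \<beta> i (d' i z)"
  using chain_map_exists[OF assms(2,1) A.one_closed one] by metis
 note ac = linear_mapD(1)[OF a(1)] and bc = linear_mapD(1)[OF b(1)]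
 have fb: "linear_map R (P' (Suc i)) C (\<lambda>z. f (\<beta> (Suc i) z))"
  by (rule linear_map_compose[OF b(1) f])
 have "f (\<beta> (Suc i) (d' (Suc i) z)) = \<zero>\<^bsub>C\<^esub>" if "z \<in> carrier (P' (Suc (Suc i)))" for z
  using b(3)[OF that] fz bc[OF that] by metis
 then obtain g where g: "linear_map R (P' i) C g" "\<And>z. z\<in>carrier (P' (Suc i)) \<Longrightarrow> f (\<beta> (Suc i) z) = g (d' i z)"
  using van fb unfolding ext_vanishes_def by blast
 have ba: "\<And>i. linear_map R (P i) (P i) (\<lambda>z. \<beta> i (\<alpha> i z))"
  using linear_map_compose[OF a(1) b(1)] .
 have bae: "\<epsilon> z \<ominus>\<^bsub>R\<^esub> \<epsilon> (\<beta> 0 (\<alpha> 0 z)) \<in> J" if z: "z \<in> carrier (P 0)" for z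
 proof -
  note cl = A.e_closed[OF z] B.e_closed[OF ac[OF z]] A.e_closed[OF bc[OF ac[OF z]]]
  have "\<epsilon> z \<ominus>\<^bsub>R\<^esub> \<epsilon> (\<beta> 0 (\<alpha> 0 z)) =
   (\<one>\<^bsub>R\<^esub> \<otimes>\<^bsub>R\<^esub> \<epsilon> z \<ominus>\<^bsub>R\<^esub> \<epsilon>' (\<alpha> 0 z)) \<oplus>\<^bsub>R\<^esub> (\<one>\<^bsub>R\<^esub> \<otimes>\<^bsub>R\<^esub> \<epsilon>' (\<alpha> 0 z) \<ominus>\<^bsub>R\<^esub> \<epsilon> (\<beta> 0 (\<alpha> 0 z)))"
   using cl by algebra
  then show ?thesis using a(2)[OF z] b(2)[OF ac[OF z]] by simp
 qed
 have bad: "d i (\<beta> (Suc i) (\<alpha> (Suc i) z)) = \<beta> i (\<alpha> i (d i z))" if "z \<in> carrier (P (Suc i))" for i z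
  using b(3)[OF ac[OF that]] a(3)[OF that] by simp
 obtain h where h: "linear_map R (P i) (P (Suc i)) h"
  "\<And>z. z\<in>carrier (P (Suc i)) \<Longrightarrow> d i (h (d i z)) = d i z \<ominus>\<^bsub>P i\<^esub> \<beta> i (\<alpha> i (d i z))"
  using chain_homotopy[where \<alpha> = "\<lambda>i z. \<beta> i (\<alpha> i z)" and i = i, OF assms(1) ba bae bad] by blast
 define g' where "g' = (\<lambda>z. g (\<alpha> i z) \<oplus>\<^bsub>C\<^esub> f (h z))"
 have "linear_map R (P i) C g'" unfolding g'_def
  by (intro linear_map_add[OF A.module_P C] linear_map_compose[OF a(1) g(1)] linear_map_compose[OF h(1) f])
 moreover have "f z = g' (d i z)" if z: "z \<in> carrier (P (Suc i))" for z
 proof -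
  interpret P1: module R "P (Suc i)" using A.module_P .
  interpret P0: module R "P i" using A.module_P .
  let ?u = "(z \<ominus>\<^bsub>P (Suc i)\<^esub> \<beta> (Suc i) (\<alpha> (Suc i) z)) \<ominus>\<^bsub>P (Suc i)\<^esub> h (d i z)"
  note c = z bc[OF ac[OF z]] linear_mapD(1)[OF h(1) A.d_closed[OF z]] 
  note fc = c[THEN linear_mapD(1)[OF f]]
  have cc: "d i z \<in> carrier (P i)" "\<beta> i (\<alpha> i (d i z)) \<in> carrier (P i)"
   using A.d_closed[OF z] ac bc by auto
  have "d i ?u = (d i z \<ominus>\<^bsub>P i\<^esub> \<beta> i (\<alpha> i (d i z))) \<ominus>\<^bsub>P i\<^esub> (d i z \<ominus>\<^bsub>P i\<^esub> \<beta> i (\<alpha> i (d i z)))"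
   using c by (simp add: linear_map_diff[OF A.module_P A.module_P A.linear_d] bad h)
  also have "\<dots> = \<zero>\<^bsub>P i\<^esub>" using cc by (simp add: P0.minus_eq P0.r_neg)
  finally have "?u \<in> d (Suc i) ` carrier (P (Suc (Suc i)))" unfolding A.exact_Suc using c by simp
  then have "f ?u = \<zero>\<^bsub>C\<^esub>" using fz by (elim imageE) simp
  then have "(f z \<ominus>\<^bsub>C\<^esub> f (\<beta> (Suc i) (\<alpha> (Suc i) z))) \<ominus>\<^bsub>C\<^esub> f (h (d i z)) = \<zero>\<^bsub>C\<^esub>"
   using c by (simp add: linear_map_diff[OF A.module_P C f])
  then have "f z = f (\<beta> (Suc i) (\<alpha> (Suc i) z)) \<oplus>\<^bsub>C\<^esub> f (h (d i z))"
   using fc C.minus_eq_zeroD[of "f z \<ominus>\<^bsub>C\<^esub> f (\<beta> (Suc i) (\<alpha> (Suc i) z))" "f (h (d i z))"]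
    C.add_minus_cancel(1)[of "f z" "f (\<beta> (Suc i) (\<alpha> (Suc i) z))"] by simp
  then show ?thesis unfolding g'_def using g(2)[OF ac[OF z]] a(3)[OF z] by simp
 qed
 ultimately show "\<exists>g. linear_map R (P i) C g \<and> (\<forall>z\<in>carrier (P (Suc i)). f z = g (d i z))" by blast
qed

section \<open>Free modules are projective\<close>

lemma fg_projective_zero:
 assumes "module R M" "carrier M = {\<zero>\<^bsub>M\<^esub>}"
 shows "fg_projective R M"
proof -
 interpret module R M by fact
 show ?thesis unfolding fg_projective_def
  using assms(2) by (intro exI[of _ 0]) auto
qed

lemma fg_projective_prod:
 fixes M :: "('a, 'm) module" and N :: "('a, 'n) module"
 assumes "module R M" "module R N" "fg_projective R M" "fg_projective R N"
 shows "fg_projective R (prod_module M N)"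
proof -
 interpret M: module R M by fact
 interpret N: module R N by fact
 let ?MN = "prod_module M N"
 have mMN: "module R ?MN" using prod_module_module[OF assms(1,2)] .
 interpret MN: module R ?MN using mMN .
 obtain n v \<phi> where v: "\<And>k. k < (n::nat) \<Longrightarrow> v k \<in> carrier M"
  and \<phi>: "\<And>k. k < n \<Longrightarrow> linear_map R M (ring_as_module R) (\<phi> k)"
  and sp: "\<And>z. z \<in> carrier M \<Longrightarrow> z = (\<Oplus>\<^bsub>M\<^esub>k\<in>{..<n}. \<phi> k z \<odot>\<^bsub>M\<^esub> v k)"
  using assms(3) unfolding fg_projective_def by blast
 obtain m w \<psi> where w: "\<And>k. k < (m::nat) \<Longrightarrow> w k \<in> carrier N"
  and \<psi>: "\<And>k. k < m \<Longrightarrow> linear_map R N (ring_as_module R) (\<psi> k)"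
  and sq: "\<And>z. z \<in> carrier N \<Longrightarrow> z = (\<Oplus>\<^bsub>N\<^esub>k\<in>{..<m}. \<psi> k z \<odot>\<^bsub>N\<^esub> w k)"
  using assms(4) unfolding fg_projective_def by blast
 have \<phi>c: "\<And>k z. k < n \<Longrightarrow> z \<in> carrier M \<Longrightarrow> \<phi> k z \<in> carrier R"
  and \<psi>c: "\<And>k z. k < m \<Longrightarrow> z \<in> carrier N \<Longrightarrow> \<psi> k z \<in> carrier R"
  using linear_mapD(1)[OF \<phi>] linear_mapD(1)[OF \<psi>] by auto
 define u where "u = (\<lambda>k. if k < n then (v k, \<zero>\<^bsub>N\<^esub>) else (\<zero>\<^bsub>M\<^esub>, w (k - n)))"
 define \<chi> where "\<chi> = (\<lambda>k (z :: 'm \<times> 'n). if k < n then \<phi> k (fst z) else \<psi> (k - n) (snd z))"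
 have inl: "linear_map R M ?MN (\<lambda>x. (x, \<zero>\<^bsub>N\<^esub>))"
  by (rule linear_map_Pair[OF linear_map_id linear_map_zero_map[OF assms(1,2)]])
 have inr: "linear_map R N ?MN (\<lambda>x. (\<zero>\<^bsub>M\<^esub>, x))"
  by (rule linear_map_Pair[OF linear_map_zero_map[OF assms(2,1)] linear_map_id])
 have u: "u k \<in> carrier ?MN" if "k < n + m" for k using v w that by (auto simp: u_def)
 have \<chi>: "linear_map R ?MN (ring_as_module R) (\<chi> k)" if "k < n + m" for k
  unfolding \<chi>_def using linear_map_compose[OF linear_map_fst \<phi>] linear_map_compose[OF linear_map_snd \<psi>[of "k - n"]] that
  by (cases "k < n") (simp_all add: less_diff_conv2)
 have "z = (\<Oplus>\<^bsub>?MN\<^esub>k\<in>{..<n + m}. \<chi> k z \<odot>\<^bsub>?MN\<^esub> u k)" if z: "z \<in> carrier ?MN" for z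
 proof -
  obtain x y where xy: "z = (x, y)" "x \<in> carrier M" "y \<in> carrier N" using z by auto
  have cl: "\<chi> k z \<odot>\<^bsub>?MN\<^esub> u k \<in> carrier ?MN" if "k < n + m" for k
   using linear_mapD(1)[OF \<chi>[OF that] z] u[OF that] by (simp del: prod_module_simps)
  have 1: "(x, \<zero>\<^bsub>N\<^esub>) = (\<Oplus>\<^bsub>?MN\<^esub>k\<in>{..<n}. \<chi> k z \<odot>\<^bsub>?MN\<^esub> u k)"
  proof -
   have "(x, \<zero>\<^bsub>N\<^esub>) = (\<Oplus>\<^bsub>?MN\<^esub>k\<in>{..<n}. (\<phi> k x \<odot>\<^bsub>M\<^esub> v k, \<zero>\<^bsub>N\<^esub>))"
    by (subst sp[OF xy(2)], rule linear_map_finsum[OF assms(1) mMN inl]) (use v \<phi>c xy in auto)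
   also have "\<dots> = (\<Oplus>\<^bsub>?MN\<^esub>k\<in>{..<n}. \<chi> k z \<odot>\<^bsub>?MN\<^esub> u k)"
    by (rule MN.finsum_cong') (use v \<phi>c xy in \<open>auto simp: \<chi>_def u_def\<close>)
   finally show ?thesis .
  qed
  have 2: "(\<zero>\<^bsub>M\<^esub>, y) = (\<Oplus>\<^bsub>?MN\<^esub>k\<in>(\<lambda>k. n + k) ` {..<m}. \<chi> k z \<odot>\<^bsub>?MN\<^esub> u k)"
  proof -
   have "(\<zero>\<^bsub>M\<^esub>, y) = (\<Oplus>\<^bsub>?MN\<^esub>k\<in>{..<m}. (\<zero>\<^bsub>M\<^esub>, \<psi> k y \<odot>\<^bsub>N\<^esub> w k))"
    by (subst sq[OF xy(3)], rule linear_map_finsum[OF assms(2) mMN inr]) (use w \<psi>c xy in auto)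
   also have "\<dots> = (\<Oplus>\<^bsub>?MN\<^esub>k\<in>{..<m}. \<chi> (n + k) z \<odot>\<^bsub>?MN\<^esub> u (n + k))"
    by (rule MN.finsum_cong') (use w \<psi>c xy in \<open>auto simp: \<chi>_def u_def\<close>)
   also have "\<dots> = (\<Oplus>\<^bsub>?MN\<^esub>k\<in>(\<lambda>k. n + k) ` {..<m}. \<chi> k z \<odot>\<^bsub>?MN\<^esub> u k)"
    by (rule MN.finsum_reindex[symmetric]) (use cl in auto)
   finally show ?thesis .
  qed
  have "{..<n + m} = {..<n} \<union> (\<lambda>k. n + k) ` {..<m}"
   by (auto simp: image_iff) (metis add.commute add_less_cancel_left le_Suc_ex linorder_not_less lessThan_iff)
  then have "(\<Oplus>\<^bsub>?MN\<^esub>k\<in>{..<n + m}. \<chi> k z \<odot>\<^bsub>?MN\<^esub> u k) = (x, \<zero>\<^bsub>N\<^esub>) \<oplus>\<^bsub>?MN\<^esub> (\<zero>\<^bsub>M\<^esub>, y)"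
   unfolding 1 2 using cl by (auto intro!: MN.finsum_Un_disjoint)
  then show ?thesis using xy by simp
 qed
 then show ?thesis unfolding fg_projective_def using u \<chi> by blast
qed

lemma free_module_simps [simp]:
 "carrier (free_module R n) = {..<n} \<rightarrow>\<^sub>E carrier R"
 "\<zero>\<^bsub>free_module R n\<^esub> = (\<lambda>i\<in>{..<n}. \<zero>\<^bsub>R\<^esub>)"
 "u \<oplus>\<^bsub>free_module R n\<^esub> v = (\<lambda>i\<in>{..<n}. u i \<oplus>\<^bsub>R\<^esub> v i)"
 "r \<odot>\<^bsub>free_module R n\<^esub> u = (\<lambda>i\<in>{..<n}. r \<otimes>\<^bsub>R\<^esub> u i)"
 by (simp_all add: free_module_def)

text \<open>
 The common reason why free modules and Hom modules, both consisting of functions with values in a module, are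
 modules.
\<close>
lemma pointwise_module:
 fixes H :: "('a, 'i \<Rightarrow> 'n) module"
 assumes N: "module R N" and sub: "carrier H \<subseteq> Y \<rightarrow>\<^sub>E carrier N"
  and ops: "\<And>f g. f \<oplus>\<^bsub>H\<^esub> g = (\<lambda>x\<in>Y. f x \<oplus>\<^bsub>N\<^esub> g x)" "\<And>r f. r \<odot>\<^bsub>H\<^esub> f = (\<lambda>x\<in>Y. r \<odot>\<^bsub>N\<^esub> f x)"
   "\<zero>\<^bsub>H\<^esub> = (\<lambda>x\<in>Y. \<zero>\<^bsub>N\<^esub>)"
  and cl: "\<And>f g. f \<in> carrier H \<Longrightarrow> g \<in> carrier H \<Longrightarrow> f \<oplus>\<^bsub>H\<^esub> g \<in> carrier H"
   "\<And>r f. r \<in> carrier R \<Longrightarrow> f \<in> carrier H \<Longrightarrow> r \<odot>\<^bsub>H\<^esub> f \<in> carrier H" "\<zero>\<^bsub>H\<^esub> \<in> carrier H"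
 shows "module R H"
proof -
 interpret N: module R N by fact
 have v: "f x \<in> carrier N" if "f \<in> carrier H" "x \<in> Y" for f x
  using that sub by blast
 have eqI: "f = g" if "f \<in> carrier H" "g \<in> carrier H" "\<And>x. x \<in> Y \<Longrightarrow> f x = g x" for f g
  by (rule PiE_ext[OF subsetD[OF sub that(1)] subsetD[OF sub that(2)] that(3)])
 have val: "(f \<oplus>\<^bsub>H\<^esub> g) x = f x \<oplus>\<^bsub>N\<^esub> g x" "(r \<odot>\<^bsub>H\<^esub> f) x = r \<odot>\<^bsub>N\<^esub> f x" "\<zero>\<^bsub>H\<^esub> x = \<zero>\<^bsub>N\<^esub>" if "x \<in> Y" for f g r x
  using that by (simp_all add: ops)
 show ?thesis
 proof (rule moduleI[OF N.R.is_cring abelian_groupI])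
  fix f assume f: "f \<in> carrier H"
  have "(\<ominus>\<^bsub>R\<^esub> \<one>\<^bsub>R\<^esub>) \<odot>\<^bsub>H\<^esub> f \<oplus>\<^bsub>H\<^esub> f = \<zero>\<^bsub>H\<^esub>"
   by (rule eqI) (use f v in \<open>auto simp: val N.smult_l_minus N.l_neg intro!: cl\<close>)
  then show "\<exists>g\<in>carrier H. g \<oplus>\<^bsub>H\<^esub> f = \<zero>\<^bsub>H\<^esub>" using cl(2)[OF _ f, of "\<ominus>\<^bsub>R\<^esub> \<one>\<^bsub>R\<^esub>"] by auto
 qed (auto intro!: eqI cl simp: val v N.a_ac N.smult_l_distr N.smult_r_distr N.smult_assoc1)
qed

lemma free_module_module:
 assumes "cring R" shows "module R (free_module R n)"
proof -
 interpret cring R by fact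
 show ?thesis
  by (rule pointwise_module[OF ring_as_module_module[OF assms], where Y = "{..<n}"]) (auto simp: PiE_iff)
qed

lemma free_module_coord:
 "i < n \<Longrightarrow> linear_map R (free_module R n) (ring_as_module R) (\<lambda>z. z i)"
 by (rule linear_mapI) auto

lemma fg_projective_free_module:
 assumes "cring R" shows "fg_projective R (free_module R n)"
proof -
 interpret cring R by fact
 interpret F: module R "free_module R n" using free_module_module[OF assms] .
 interpret RM: module R "ring_as_module R" using ring_as_module_module[OF assms] .
 define v where "v = (\<lambda>k. \<lambda>i\<in>{..<n}. if i = k then \<one>\<^bsub>R\<^esub> else \<zero>\<^bsub>R\<^esub>)"
 have v: "v k \<in> carrier (free_module R n)" for k by (auto simp: v_def)
 have "z = (\<Oplus>\<^bsub>free_module R n\<^esub>k\<in>{..<n}. z k \<odot>\<^bsub>free_module R n\<^esub> v k)" (is "z = ?s")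
  if z: "z \<in> carrier (free_module R n)" for z
 proof (rule PiE_ext[of _ "{..<n}" "\<lambda>_. carrier R"])
  have zc: "\<And>k. k < n \<Longrightarrow> z k \<in> carrier R" using z by auto
  have cl: "(\<lambda>k. z k \<odot>\<^bsub>free_module R n\<^esub> v k) \<in> {..<n} \<rightarrow> carrier (free_module R n)"
   using zc v by (blast intro: F.smult_closed)
  show "z \<in> {..<n} \<rightarrow>\<^sub>E carrier R" using z by simp
  show "?s \<in> {..<n} \<rightarrow>\<^sub>E carrier R" using F.finsum_closed[OF cl] by simp
  fix i assume i: "i \<in> {..<n}"
  then have i': "i < n" by simp
  have "?s i = (\<Oplus>\<^bsub>ring_as_module R\<^esub>k\<in>{..<n}. (z k \<odot>\<^bsub>free_module R n\<^esub> v k) i)"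
   by (rule linear_map_finsum[OF F.module_axioms RM.module_axioms free_module_coord[OF i'] _ cl]) simp
  also have "\<dots> = (\<Oplus>\<^bsub>ring_as_module R\<^esub>k\<in>{..<n}. if i = k then z k else \<zero>\<^bsub>ring_as_module R\<^esub>)"
   by (rule RM.finsum_cong') (use i zc in \<open>auto simp: v_def\<close>)
  also have "\<dots> = z i" by (rule RM.finsum_singleton) (use i zc in auto)
  finally show "z i = ?s i" by simp
 qed
 then show ?thesis unfolding fg_projective_def using v free_module_coord
  by (intro exI[of _ n] exI[of _ v] exI[of _ "\<lambda>k z. z k"]) blast
qed

lemma fg_projective_ring:
 fixes R (structure)
 assumes "cring R" shows "fg_projective R (ring_as_module R)"
proof -
 interpret cring R by fact
 interpret RM: module R "ring_as_module R" using ring_as_module_module[OF assms] .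
 have "{..<Suc 0} = {0}" by auto
 then have "z = (\<Oplus>\<^bsub>ring_as_module R\<^esub>k\<in>{..<Suc 0}. z \<odot>\<^bsub>ring_as_module R\<^esub> \<one>)" if "z \<in> carrier R" for z
  using that by simp
 then show ?thesis unfolding fg_projective_def
  by (intro exI[of _ "Suc 0"] exI[of _ "\<lambda>_. \<one>"] exI[of _ "\<lambda>k z. z"]) (use linear_map_id in auto)
qed

section \<open>The mapping cone of a multiplication map\<close>

text \<open>
 \<open>F i \<oplus> G (i - 1)\<close>, with the zero module in place of \<open>G (-1)\<close> as a submodule
 of G 0, so that all degrees have the same type.
\<close>
definition cone_module ::
 "(nat \<Rightarrow> ('a, 'f) module) \<Rightarrow> (nat \<Rightarrow> ('a, 'g) module) \<Rightarrow> nat \<Rightarrow> ('a, 'f \<times> 'g) module" where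
 "cone_module F G i = prod_module (F i)
   (case i of 0 \<Rightarrow> (G 0)\<lparr>carrier := {\<zero>\<^bsub>G 0\<^esub>}\<rparr> | Suc j \<Rightarrow> G j)"

definition cone_diff ::
 "(nat \<Rightarrow> ('a, 'f) module) \<Rightarrow> (nat \<Rightarrow> ('a, 'g) module) \<Rightarrow> (nat \<Rightarrow> 'f \<Rightarrow> 'f) \<Rightarrow> (nat \<Rightarrow> 'g \<Rightarrow> 'g)
  \<Rightarrow> (nat \<Rightarrow> 'g \<Rightarrow> 'f) \<Rightarrow> nat \<Rightarrow> 'f \<times> 'g \<Rightarrow> 'f \<times> 'g" where
 "cone_diff F G dF dG \<phi> i z = (dF i (fst z) \<oplus>\<^bsub>F i\<^esub> \<phi> i (snd z),
   case i of 0 \<Rightarrow> \<zero>\<^bsub>G 0\<^esub> | Suc j \<Rightarrow> \<ominus>\<^bsub>G j\<^esub> dG j (snd z))"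

lemma ext_vanishesD:
 assumes "ext_vanishes R P d C i" "linear_map R (P (Suc i)) C f"
  "\<And>z. z \<in> carrier (P (Suc (Suc i))) \<Longrightarrow> f (d (Suc i) z) = \<zero>\<^bsub>C\<^esub>"
 shows "\<exists>g. linear_map R (P i) C g \<and> (\<forall>z\<in>carrier (P (Suc i)). f z = g (d i z))"
 using assms unfolding ext_vanishes_def by blast

lemma ideal_add_closed: "ideal J R \<Longrightarrow> x \<in> J \<Longrightarrow> y \<in> J \<Longrightarrow> x \<oplus>\<^bsub>R\<^esub> y \<in> J"
 by (rule additive_subgroup.a_closed[OF ideal.axioms(1)])

lemma ideal_minus_closed:
 assumes "ideal J R" "x \<in> J" "y \<in> J" shows "x \<ominus>\<^bsub>R\<^esub> y \<in> J"
proof -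
 interpret ideal J R by fact
 have "\<ominus>\<^bsub>R\<^esub> y \<in> J" using group.subgroupE(3)[OF add.is_group a_subgroup assms(3)] by (simp add: a_inv_def)
 then show ?thesis unfolding minus_eq by (rule ideal_add_closed[OF assms(1,2)])
qed

lemma ideal_minus_cancel:
 assumes "ideal J R" "x \<in> carrier R" "y \<in> carrier R" "x \<ominus>\<^bsub>R\<^esub> y \<in> J"
 shows "x \<in> J \<longleftrightarrow> y \<in> J"
proof -
 interpret ideal J R by fact
 interpret abelian_group R by (rule is_abelian_group)
 have "x \<ominus>\<^bsub>R\<^esub> (x \<ominus>\<^bsub>R\<^esub> y) = y" "y \<oplus>\<^bsub>R\<^esub> (x \<ominus>\<^bsub>R\<^esub> y) = x"
  using assms(2,3) add_minus_cancel[of x y] by (simp_all add: minus_eq minus_add a_assoc[symmetric] r_neg)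
 then show ?thesis using ideal_add_closed[OF assms(1) _ assms(4)] ideal_minus_closed[OF assms(1) _ assms(4)] by metis
qed

lemma zero_module:
 assumes "module R M" shows "module R (M\<lparr>carrier := {\<zero>\<^bsub>M\<^esub>}\<rparr>)"
proof -
 interpret module R M by fact
 show ?thesis
  by (rule submodule.submodule_is_module[OF submoduleI]) (use assms in auto)
qed

lemma fg_projective_zero_module: "module R M \<Longrightarrow> fg_projective R (M\<lparr>carrier := {\<zero>\<^bsub>M\<^esub>}\<rparr>)"
 by (rule fg_projective_zero[OF zero_module]) auto

text \<open>
 Resolutions F of R/J and G of R/K with \<open>K = J : y\<close>, and a lift \<phi> of the injection
 \<open>R/K \<rightarrow> R/J\<close> given by multiplication by y.
\<close>
locale cone = F: ideal_resolution J R F dF eF + G: ideal_resolution K R G dG eG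
 for J and R :: "('a, 'b) ring_scheme" (structure)
 and F :: "nat \<Rightarrow> ('a, 'f) module" and dF eF and K and G :: "nat \<Rightarrow> ('a, 'g) module" and dG eG +
 fixes y :: 'a and \<phi> :: "nat \<Rightarrow> 'g \<Rightarrow> 'f"
 assumes y: "y \<in> carrier R"
  and K: "K = {r \<in> carrier R. y \<otimes> r \<in> J}"
  and linear_phi: "linear_map R (G i) (F i) (\<phi> i)"
  and phi_e: "z \<in> carrier (G 0) \<Longrightarrow> y \<otimes> eG z \<ominus> eF (\<phi> 0 z) \<in> J"
  and phi_d: "z \<in> carrier (G (Suc i)) \<Longrightarrow> dF i (\<phi> (Suc i) z) = \<phi> i (dG i z)"
begin

abbreviation "P \<equiv> cone_module F G"
abbreviation "\<delta> \<equiv> cone_diff F G dF dG \<phi>"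

lemma mem_K: "r \<in> carrier R \<Longrightarrow> r \<in> K \<longleftrightarrow> y \<otimes> r \<in> J"
 using K by blast

lemma phi_closed [simp]: "z \<in> carrier (G i) \<Longrightarrow> \<phi> i z \<in> carrier (F i)"
 using linear_mapD(1)[OF linear_phi] .

lemma F_group: "abelian_group (F i)" and G_group: "abelian_group (G i)"
 using F.module_P[of i] G.module_P[of i] by (simp_all add: module.axioms)

lemma cone_carrier_Suc [simp]: "carrier (P (Suc i)) = carrier (F (Suc i)) \<times> carrier (G i)"
 and cone_carrier_0 [simp]: "carrier (P 0) = carrier (F 0) \<times> {\<zero>\<^bsub>G 0\<^esub>}"
 and cone_zero_Suc: "\<zero>\<^bsub>P (Suc i)\<^esub> = (\<zero>\<^bsub>F (Suc i)\<^esub>, \<zero>\<^bsub>G i\<^esub>)"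
 and cone_zero_0: "\<zero>\<^bsub>P 0\<^esub> = (\<zero>\<^bsub>F 0\<^esub>, \<zero>\<^bsub>G 0\<^esub>)"
 by (simp_all add: cone_module_def)

lemma cone_module_module: "module R (P i)"
 unfolding cone_module_def
 by (intro prod_module_module F.module_P) (auto split: nat.split intro: G.module_P zero_module)

lemma cone_diff_linear:
 "linear_map R (P (Suc i)) (P i) (\<delta> i)"
proof -
 have 1: "linear_map R (P (Suc i)) (F i) (\<lambda>z. dF i (fst z) \<oplus>\<^bsub>F i\<^esub> \<phi> i (snd z))"
  unfolding cone_module_def
  using linear_map_case[OF F.module_P G.module_P F.module_P F.linear_d linear_phi] by simp
 show ?thesis
 proof (cases i)
  case 0
  have "linear_map R (P (Suc i)) ((G 0)\<lparr>carrier := {\<zero>\<^bsub>G 0\<^esub>}\<rparr>) (\<lambda>z. \<zero>\<^bsub>G 0\<^esub>)"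
   using linear_map_zero_map[OF cone_module_module zero_module[OF G.module_P]] by simp
  from linear_map_Pair[OF 1 this] show ?thesis
   unfolding cone_module_def[of _ _ i] cone_diff_def[abs_def] by (simp add: 0)
 next
  case (Suc j)
  have "linear_map R (P (Suc i)) (G j) (\<lambda>z. \<ominus>\<^bsub>G j\<^esub> dG j (snd z))"
   unfolding cone_module_def
   using linear_map_uminus[OF prod_module_module[OF F.module_P G.module_P] G.module_P
     linear_map_compose[OF linear_map_snd G.linear_d]] by (simp add: Suc)
  from linear_map_Pair[OF 1 this] show ?thesis
   unfolding cone_module_def[of _ _ i] cone_diff_def[abs_def] by (simp add: Suc)
 qed
qed

lemma cone_e_phi: assumes "g \<in> carrier (G 0)" shows "eF (\<phi> 0 g) \<in> J \<longleftrightarrow> eG g \<in> K"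
proof -
 have c: "eF (\<phi> 0 g) \<in> carrier R" "y \<otimes> eG g \<in> carrier R" using assms y by auto
 show ?thesis using ideal_minus_cancel[OF F.ideal_axioms c(2,1) phi_e[OF assms]] assms mem_K[of "eG g"] by simp
qed

lemma linear_phi_uminus: "z \<in> carrier (G i) \<Longrightarrow> \<phi> i (\<ominus>\<^bsub>G i\<^esub> z) = \<ominus>\<^bsub>F i\<^esub> \<phi> i z"
 using linear_map_neg[OF G.module_P F.module_P linear_phi] .

text \<open>
 Exactness of F, in a form that treats degree 0 and the positive degrees alike.
\<close>
lemma cone_exact_step:
 assumes f: "f \<in> carrier (F i)" and g: "g' \<in> carrier (G i)"
  and ker: "i = 0 \<Longrightarrow> eF (f \<ominus>\<^bsub>F 0\<^esub> \<phi> 0 g') \<in> J"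
    "\<And>j. i = Suc j \<Longrightarrow> dF j (f \<ominus>\<^bsub>F i\<^esub> \<phi> i g') = \<zero>\<^bsub>F j\<^esub>"
 shows "\<exists>f'\<in>carrier (F (Suc i)). f = dF i f' \<oplus>\<^bsub>F i\<^esub> \<phi> i g'"
proof -
 interpret Fi: abelian_group "F i" by (rule F_group)
 have c: "f \<ominus>\<^bsub>F i\<^esub> \<phi> i g' \<in> carrier (F i)" using f g by simp
 have "f \<ominus>\<^bsub>F i\<^esub> \<phi> i g' \<in> dF i ` carrier (F (Suc i))"
 proof (cases i)
  case 0 then show ?thesis using ker(1) c F.exact_0 by simp
 next
  case (Suc j) then show ?thesis using ker(2) c F.exact_Suc by simp
 qed
 then obtain f' where "f' \<in> carrier (F (Suc i))" "f \<ominus>\<^bsub>F i\<^esub> \<phi> i g' = dF i f'" by (rule imageE) auto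
 moreover have "f = \<phi> i g' \<oplus>\<^bsub>F i\<^esub> (f \<ominus>\<^bsub>F i\<^esub> \<phi> i g')" using f g by (simp add: Fi.add_minus_cancel)
 ultimately show ?thesis using g by (metis F.d_closed Fi.a_comm phi_closed)
qed

text \<open>
 The sequence
 \<open>0 \<rightarrow> R/(J : y) \<rightarrow> R/J \<rightarrow> R/(J + yR) \<rightarrow> 0\<close> is exact,
 so the mapping cone of \<phi> resolves the third term.
\<close>
lemma cone_resolution:
 assumes "ideal J' R" and J': "J' = {j \<oplus> y \<otimes> r | j r. j \<in> J \<and> r \<in> carrier R}"
 shows "ideal_resolution J' R P \<delta> (\<lambda>z. eF (fst z))"
proof -
 interpret J': ideal J' R by fact
 interpret RM: module R "ring_as_module R" using ring_as_module_module[OF F.is_cring] .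
 have JJ: "J \<subseteq> J'"
 proof
  fix j assume j: "j \<in> J"
  then have "j = j \<oplus> y \<otimes> \<zero>" using y F.a_subset by auto
  then show "j \<in> J'" unfolding J' using j by blast
 qed
 have yJ: "y \<otimes> r \<in> J'" if "r \<in> carrier R" for r
 proof -
  have "y \<otimes> r = \<zero> \<oplus> y \<otimes> r" using that y by simp
  then show ?thesis unfolding J' using that additive_subgroup.zero_closed[OF F.additive_subgroup_axioms] by blast
 qed
 note ediff = linear_map_diff[OF F.module_P RM.module_axioms F.linear_e, unfolded ring_as_module_simps]
 note eadd = linear_mapD(2)[OF F.linear_e, unfolded ring_as_module_simps]
 show ?thesis
 proof (intro ideal_resolution.intro ideal_resolution_axioms.intro)
  show "ideal J' R" "cring R" by (fact, rule F.is_cring)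
  fix i
  show "module R (P i)" by (rule cone_module_module)
  show "fg_projective R (P i)" unfolding cone_module_def
   by (intro fg_projective_prod F.module_P F.projective_P)
     (auto split: nat.split intro: G.module_P G.projective_P zero_module fg_projective_zero_module)
  show "linear_map R (P (Suc i)) (P i) (\<delta> i)"
   by (rule cone_diff_linear)
  show "linear_map R (P 0) (ring_as_module R) (\<lambda>z. eF (fst z))"
   unfolding cone_module_def by (rule linear_map_compose[OF linear_map_fst F.linear_e])
  show "\<exists>z\<in>carrier (P 0). r \<ominus> eF (fst z) \<in> J'" if "r \<in> carrier R" for r
   using F.onto_mod[OF that] JJ by auto
  show "\<delta> 0 ` carrier (P (Suc 0)) =
   {z \<in> carrier (P 0). eF (fst z) \<in> J'}" (is "?L = ?R")
  proof (intro equalityI subsetI)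
   interpret F0: abelian_group "F 0" by (rule F_group)
   fix z assume "z \<in> ?L"
   then obtain f g where fg: "f \<in> carrier (F (Suc 0))" "g \<in> carrier (G 0)"
    "z = (dF 0 f \<oplus>\<^bsub>F 0\<^esub> \<phi> 0 g, \<zero>\<^bsub>G 0\<^esub>)" by (auto simp: cone_diff_def)
   have "eF (\<phi> 0 g) \<in> J'"
    using ideal_minus_cancel[OF assms(1) _ _ subsetD[OF JJ phi_e[OF fg(2)]]] yJ[of "eG g"] y fg(2) by simp
   then show "z \<in> ?R" using fg F.e_d[OF fg(1)] JJ by (auto simp: eadd)
  next
   interpret F0: abelian_group "F 0" by (rule F_group)
   fix z assume "z \<in> ?R"
   then obtain f j r where f: "z = (f, \<zero>\<^bsub>G 0\<^esub>)" "f \<in> carrier (F 0)" "eF f = j \<oplus> y \<otimes> r" "j \<in> J" "r \<in> carrier R"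
    unfolding J' by auto
   obtain g where g: "g \<in> carrier (G 0)" "r \<ominus> eG g \<in> K" using G.onto_mod[OF f(5)] by blast
   have "eF (f \<ominus>\<^bsub>F 0\<^esub> \<phi> 0 g) = (j \<oplus> y \<otimes> (r \<ominus> eG g)) \<oplus> (y \<otimes> eG g \<ominus> eF (\<phi> 0 g))"
   proof -
    have c: "j \<in> carrier R" "eG g \<in> carrier R" "eF (\<phi> 0 g) \<in> carrier R" "r \<in> carrier R" "y \<in> carrier R"
     using f g y F.a_subset by auto
    have "eF (f \<ominus>\<^bsub>F 0\<^esub> \<phi> 0 g) = (j \<oplus> y \<otimes> r) \<ominus> eF (\<phi> 0 g)"
     using f g by (simp add: ediff ring_as_module_minus[OF F.is_cring])
    also have "\<dots> = (j \<oplus> y \<otimes> (r \<ominus> eG g)) \<oplus> (y \<otimes> eG g \<ominus> eF (\<phi> 0 g))" using c by algebra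
    finally show ?thesis .
   qed
   moreover have "y \<otimes> (r \<ominus> eG g) \<in> J" using g(2) K by blast
   ultimately have "eF (f \<ominus>\<^bsub>F 0\<^esub> \<phi> 0 g) \<in> J"
    using f(4) phi_e[OF g(1)] ideal_add_closed[OF F.ideal_axioms] by simp
   then obtain f' where "f'\<in>carrier (F (Suc 0))" "f = dF 0 f' \<oplus>\<^bsub>F 0\<^esub> \<phi> 0 g"
    using cone_exact_step[OF f(2) g(1)] by auto
   then show "z \<in> ?L" using f g by (auto simp: cone_diff_def intro!: image_eqI[of _ _ "(f', g)"])
  qed
  show "\<delta> (Suc i) ` carrier (P (Suc (Suc i))) =
   {z \<in> carrier (P (Suc i)). \<delta> i z = \<zero>\<^bsub>P i\<^esub>}" (is "?L = ?R")
  proof (intro equalityI subsetI)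
   interpret Fi: abelian_group "F i" by (rule F_group)
   interpret Fi': abelian_group "F (Suc i)" by (rule F_group)
   interpret Gi: abelian_group "G i" by (rule G_group)
   fix z assume "z \<in> ?L"
   then obtain f g where fg: "f \<in> carrier (F (Suc (Suc i)))" "g \<in> carrier (G (Suc i))"
    "z = (dF (Suc i) f \<oplus>\<^bsub>F (Suc i)\<^esub> \<phi> (Suc i) g, \<ominus>\<^bsub>G i\<^esub> dG i g)" by (auto simp: cone_diff_def)
   have z: "z \<in> carrier (P (Suc i))" using fg by auto
   have 1: "dF i (fst z) \<oplus>\<^bsub>F i\<^esub> \<phi> i (snd z) = \<zero>\<^bsub>F i\<^esub>"
    using fg by (simp add: linear_mapD(2)[OF F.linear_d] phi_d linear_phi_uminus Fi.r_neg)
   have "\<delta> i z = \<zero>\<^bsub>P i\<^esub>"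
   proof (cases i)
    case 0 then show ?thesis using 1 by (simp add: cone_diff_def cone_zero_0)
   next
    case (Suc j)
    interpret Gj: abelian_group "G j" by (rule G_group)
    have "dG j (\<ominus>\<^bsub>G i\<^esub> dG i g) = \<zero>\<^bsub>G j\<^esub>" using fg(2) G.d_d[of g j] Suc
     by (simp add: linear_map_neg[OF G.module_P G.module_P G.linear_d])
    then show ?thesis using 1 fg(3) Suc by (simp add: cone_diff_def cone_zero_Suc)
   qed
   then show "z \<in> ?R" using z by simp
  next
   interpret Fi: abelian_group "F i" by (rule F_group)
   interpret Fi': abelian_group "F (Suc i)" by (rule F_group)
   interpret Gi: abelian_group "G i" by (rule G_group)
   fix z assume "z \<in> ?R"
   then obtain f g where fg: "z = (f, g)" "f \<in> carrier (F (Suc i))" "g \<in> carrier (G i)"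
    "\<delta> i (f, g) = \<zero>\<^bsub>P i\<^esub>" by auto
   have 1: "dF i f \<oplus>\<^bsub>F i\<^esub> \<phi> i g = \<zero>\<^bsub>F i\<^esub>"
    using fg(4) by (cases i) (simp_all add: cone_diff_def cone_zero_0 cone_zero_Suc)
   then have df: "dF i f = \<ominus>\<^bsub>F i\<^esub> \<phi> i g" using fg by (simp add: Fi.minus_equality)
   have "\<ominus>\<^bsub>G i\<^esub> g \<in> dG i ` carrier (G (Suc i))"
   proof (cases i)
    case 0
    have "eF (\<phi> 0 (\<ominus>\<^bsub>G 0\<^esub> g)) \<in> J" using F.e_d[of f] fg df 0 linear_phi_uminus[of g 0] by simp
    then have "eG (\<ominus>\<^bsub>G 0\<^esub> g) \<in> K" using cone_e_phi[of "\<ominus>\<^bsub>G 0\<^esub> g"] fg 0 Gi.a_inv_closed by simp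
    then show ?thesis using G.exact_0 fg 0 Gi.a_inv_closed by simp
   next
    case (Suc j)
    interpret Gj: abelian_group "G j" by (rule G_group)
    have "\<ominus>\<^bsub>G j\<^esub> dG j g = \<zero>\<^bsub>G j\<^esub>" using fg(4) Suc by (simp add: cone_diff_def cone_zero_Suc)
    then have "dG j (\<ominus>\<^bsub>G i\<^esub> g) = \<zero>\<^bsub>G j\<^esub>" using fg(3) Suc
     by (simp add: linear_map_neg[OF G.module_P G.module_P G.linear_d])
    then show ?thesis using G.exact_Suc fg Suc Gi.a_inv_closed by simp
   qed
   then obtain g' where g': "g' \<in> carrier (G (Suc i))" "\<ominus>\<^bsub>G i\<^esub> g = dG i g'" by (rule imageE) auto
   have g: "g = \<ominus>\<^bsub>G i\<^esub> dG i g'" using g'(2) fg(3) by (metis Gi.minus_minus)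
   have "dF i (f \<ominus>\<^bsub>F (Suc i)\<^esub> \<phi> (Suc i) g') = \<zero>\<^bsub>F i\<^esub>"
    using fg g' df phi_closed[OF fg(3)]
    by (simp add: linear_map_diff[OF F.module_P F.module_P F.linear_d] phi_d Fi.minus_eq Fi.l_neg
      flip: g'(2) add: linear_phi_uminus)
   then obtain f' where "f' \<in> carrier (F (Suc (Suc i)))" "f = dF (Suc i) f' \<oplus>\<^bsub>F (Suc i)\<^esub> \<phi> (Suc i) g'"
    using cone_exact_step[OF fg(2) g'(1)] by auto
   then show "z \<in> ?L" using fg g g' by (auto simp: cone_diff_def intro!: image_eqI[of _ _ "(f', g')"])
  qed
 qed
qed

text \<open>
 Two steps of the long exact sequence of Ext for this short exact sequence, here and in the next lemma, proved
 on cocycles: vanishing for R/J, and for \<open>R/(J + yR)\<close> one degree higher, gives vanishing for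
 \<open>R/(J : y)\<close>.
\<close>
lemma ext_vanishes_kernel:
 fixes C :: "('a, 'm) module"
 assumes C: "module R C" and vF: "ext_vanishes R F dF C i"
  and vP: "ext_vanishes R P \<delta> C (Suc i)"
 shows "ext_vanishes R G dG C i"
 unfolding ext_vanishes_def
proof (intro allI impI, elim conjE)
 interpret C: module R C by fact
 interpret Fi: abelian_group "F (Suc i)" by (rule F_group)
 interpret Fi2: abelian_group "F (Suc (Suc i))" by (rule F_group)
 interpret Gi: abelian_group "G i" by (rule G_group)
 interpret Gi': abelian_group "G (Suc i)" by (rule G_group)
 fix g assume g: "linear_map R (G (Suc i)) C g" and gz: "\<forall>z\<in>carrier (G (Suc (Suc i))). g (dG (Suc i) z) = \<zero>\<^bsub>C\<^esub>"
 have "linear_map R (P (Suc (Suc i))) C (\<lambda>z. g (snd z))"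
  unfolding cone_module_def using linear_map_compose[OF linear_map_snd g] by simp
 moreover have "g (snd (\<delta> (Suc (Suc i)) z)) = \<zero>\<^bsub>C\<^esub>"
  if "z \<in> carrier (P (Suc (Suc (Suc i))))" for z
  using that gz by (auto simp: cone_diff_def linear_map_neg[OF G.module_P C g])
 ultimately obtain h where h: "linear_map R (P (Suc i)) C h"
  "\<And>z. z \<in> carrier (P (Suc (Suc i))) \<Longrightarrow> g (snd z) = h (\<delta> (Suc i) z)"
  using ext_vanishesD[OF vP, of "\<lambda>z. g (snd z)"] by blast
 have inl: "linear_map R (F (Suc i)) (P (Suc i)) (\<lambda>x. (x, \<zero>\<^bsub>G i\<^esub>))"
  unfolding cone_module_def using linear_map_Pair[OF linear_map_id linear_map_zero_map[OF F.module_P G.module_P]] by simp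
 have inr: "linear_map R (G i) (P (Suc i)) (\<lambda>x. (\<zero>\<^bsub>F (Suc i)\<^esub>, x))"
  unfolding cone_module_def using linear_map_Pair[OF linear_map_zero_map[OF G.module_P F.module_P] linear_map_id] by simp
 note h1 = linear_map_compose[OF inl h(1)] and h2 = linear_map_compose[OF inr h(1)]
 have hsplit: "h (a, b) = h (a, \<zero>\<^bsub>G i\<^esub>) \<oplus>\<^bsub>C\<^esub> h (\<zero>\<^bsub>F (Suc i)\<^esub>, b)"
  if "a \<in> carrier (F (Suc i))" "b \<in> carrier (G i)" for a b
  using linear_mapD(2)[OF h(1), of "(a, \<zero>\<^bsub>G i\<^esub>)" "(\<zero>\<^bsub>F (Suc i)\<^esub>, b)"] that
  by (simp add: cone_module_def)
 have "h (dF (Suc i) x, \<zero>\<^bsub>G i\<^esub>) = \<zero>\<^bsub>C\<^esub>" if x: "x \<in> carrier (F (Suc (Suc i)))" for x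
  using h(2)[of "(x, \<zero>\<^bsub>G (Suc i)\<^esub>)"] x linear_map_zero[OF G.module_P C g]
   linear_map_zero[OF G.module_P F.module_P linear_phi, of "Suc i"]
   linear_map_zero[OF G.module_P G.module_P G.linear_d, of i] Gi.minus_equality[of "\<zero>\<^bsub>G i\<^esub>" "\<zero>\<^bsub>G i\<^esub>"]
  by (simp add: cone_diff_def)
 then obtain h1' where h1': "linear_map R (F i) C h1'"
  "\<And>z. z \<in> carrier (F (Suc i)) \<Longrightarrow> h (z, \<zero>\<^bsub>G i\<^esub>) = h1' (dF i z)"
  using ext_vanishesD[OF vF h1] by blast
 have "linear_map R (G i) C (\<lambda>z. h1' (\<phi> i z) \<ominus>\<^bsub>C\<^esub> h (\<zero>\<^bsub>F (Suc i)\<^esub>, z))"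
  by (rule linear_map_minus[OF G.module_P C linear_map_compose[OF linear_phi h1'(1)] h2])
 moreover have "g z = h1' (\<phi> i (dG i z)) \<ominus>\<^bsub>C\<^esub> h (\<zero>\<^bsub>F (Suc i)\<^esub>, dG i z)" if z: "z \<in> carrier (G (Suc i))" for z
 proof -
  have d0: "dF (Suc i) \<zero>\<^bsub>F (Suc (Suc i))\<^esub> = \<zero>\<^bsub>F (Suc i)\<^esub>"
   using linear_map_zero[OF F.module_P F.module_P F.linear_d] .
  have "g z = h (\<phi> (Suc i) z, \<ominus>\<^bsub>G i\<^esub> dG i z)"
   using h(2)[of "(\<zero>\<^bsub>F (Suc (Suc i))\<^esub>, z)"] z by (simp add: cone_diff_def d0)
  also have "\<dots> = h (\<phi> (Suc i) z, \<zero>\<^bsub>G i\<^esub>) \<oplus>\<^bsub>C\<^esub> h (\<zero>\<^bsub>F (Suc i)\<^esub>, \<ominus>\<^bsub>G i\<^esub> dG i z)"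
   by (rule hsplit) (use z Gi.a_inv_closed in auto)
  also have "\<dots> = h1' (\<phi> i (dG i z)) \<ominus>\<^bsub>C\<^esub> h (\<zero>\<^bsub>F (Suc i)\<^esub>, dG i z)"
   using z h1'(2)[of "\<phi> (Suc i) z"] linear_map_neg[OF G.module_P C h2, of "dG i z"]
   by (simp add: phi_d C.minus_eq)
  finally show ?thesis .
 qed
 ultimately show "\<exists>ga. linear_map R (G i) C ga \<and> (\<forall>z\<in>carrier (G (Suc i)). g z = ga (dG i z))" by blast
qed

text \<open>
 A cocycle f on F restricts along \<phi> to the coboundary of some g on G; then \<open>(f, g)\<close> is a
 cocycle on the cone, and a cochain bounding it restricts to one bounding f.
\<close>
lemma ext_vanishes_middle:
 fixes C :: "('a, 'm) module"
 assumes C: "module R C" and vG: "ext_vanishes R G dG C (Suc i)"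
  and vP: "ext_vanishes R P \<delta> C (Suc i)"
 shows "ext_vanishes R F dF C (Suc i)"
 unfolding ext_vanishes_def
proof (intro allI impI, elim conjE)
 interpret C: module R C by fact
 interpret Fi: abelian_group "F (Suc i)" by (rule F_group)
 interpret Fi2: abelian_group "F (Suc (Suc i))" by (rule F_group)
 interpret Gi: abelian_group "G i" by (rule G_group)
 interpret Gi': abelian_group "G (Suc i)" by (rule G_group)
 fix f assume f: "linear_map R (F (Suc (Suc i))) C f" and fz: "\<forall>z\<in>carrier (F (Suc (Suc (Suc i)))). f (dF (Suc (Suc i)) z) = \<zero>\<^bsub>C\<^esub>"
 have "f (\<phi> (Suc (Suc i)) (dG (Suc (Suc i)) z)) = \<zero>\<^bsub>C\<^esub>" if "z \<in> carrier (G (Suc (Suc (Suc i))))" for z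
  using phi_d[OF that] fz phi_closed[OF that] by metis
 then obtain g where g: "linear_map R (G (Suc i)) C g"
  "\<And>z. z \<in> carrier (G (Suc (Suc i))) \<Longrightarrow> f (\<phi> (Suc (Suc i)) z) = g (dG (Suc i) z)"
  using ext_vanishesD[OF vG linear_map_compose[OF linear_phi f]] by blast
 have "linear_map R (P (Suc (Suc i))) C (\<lambda>z. f (fst z) \<oplus>\<^bsub>C\<^esub> g (snd z))"
  unfolding cone_module_def using linear_map_case[OF F.module_P G.module_P C f g(1)] by simp
 moreover have "f (fst (\<delta> (Suc (Suc i)) z)) \<oplus>\<^bsub>C\<^esub> g (snd (\<delta> (Suc (Suc i)) z)) = \<zero>\<^bsub>C\<^esub>"
  if "z \<in> carrier (P (Suc (Suc (Suc i))))" for z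
 proof -
  obtain a b where ab: "z = (a, b)" "a \<in> carrier (F (Suc (Suc (Suc i))))" "b \<in> carrier (G (Suc (Suc i)))"
   using \<open>z \<in> _\<close> by auto
  show ?thesis using ab fz linear_mapD(1)[OF f] linear_mapD(1)[OF g(1)] g(2)
   by (simp add: cone_diff_def linear_mapD(2)[OF f] linear_map_neg[OF G.module_P C g(1)] C.r_neg)
 qed
 ultimately obtain h where h: "linear_map R (P (Suc i)) C h"
  "\<And>z. z \<in> carrier (P (Suc (Suc i))) \<Longrightarrow>
    f (fst z) \<oplus>\<^bsub>C\<^esub> g (snd z) = h (\<delta> (Suc i) z)"
  using ext_vanishesD[OF vP, of "\<lambda>z. f (fst z) \<oplus>\<^bsub>C\<^esub> g (snd z)"] by blast
 have inl: "linear_map R (F (Suc i)) (P (Suc i)) (\<lambda>x. (x, \<zero>\<^bsub>G i\<^esub>))"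
  unfolding cone_module_def using linear_map_Pair[OF linear_map_id linear_map_zero_map[OF F.module_P G.module_P]] by simp
 have "f z = h (dF (Suc i) z, \<zero>\<^bsub>G i\<^esub>)" if z: "z \<in> carrier (F (Suc (Suc i)))" for z
  using h(2)[of "(z, \<zero>\<^bsub>G (Suc i)\<^esub>)"] z linear_map_zero[OF G.module_P C g(1)] linear_mapD(1)[OF f z]
   linear_map_zero[OF G.module_P F.module_P linear_phi, of "Suc i"]
   linear_map_zero[OF G.module_P G.module_P G.linear_d, of i] Gi.minus_equality[of "\<zero>\<^bsub>G i\<^esub>" "\<zero>\<^bsub>G i\<^esub>"]
  by (simp add: cone_diff_def)
 then show "\<exists>g. linear_map R (F (Suc i)) C g \<and> (\<forall>z\<in>carrier (F (Suc (Suc i))). f z = g (dF (Suc i) z))"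
  using linear_map_compose[OF inl h(1)] by blast
qed

end

section \<open>Quotient modules and free resolutions over Noetherian rings\<close>

lemma submodule_abelian_subgroup:
 assumes "module R M" "submodule N R M" shows "abelian_subgroup N M"
proof -
 interpret M: module R M by fact
 show ?thesis
  by (rule abelian_subgroupI3[OF _ M.abelian_group_axioms])
    (use assms(2) in \<open>simp add: additive_subgroup_def submodule_def\<close>)
qed

lemma a_rcos_eq_iff:
 assumes "abelian_subgroup N M" "x \<in> carrier M" "y \<in> carrier M"
 shows "N +>\<^bsub>M\<^esub> x = N +>\<^bsub>M\<^esub> y \<longleftrightarrow> x \<ominus>\<^bsub>M\<^esub> y \<in> N"
proof -
 interpret abelian_subgroup N M by fact
 have "N +>\<^bsub>M\<^esub> x = N +>\<^bsub>M\<^esub> y \<longleftrightarrow> x \<in> N +>\<^bsub>M\<^esub> y"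
  using a_repr_independence[OF _ assms(3) a_subgroup, of x] a_rcos_self[OF assms(2)] assms(2) by metis
 also have "\<dots> \<longleftrightarrow> x \<ominus>\<^bsub>M\<^esub> y \<in> N"
  using a_rcos_module[OF assms(3,2)] by (simp add: a_minus_def)
 finally show ?thesis .
qed

lemma quot_module_simps:
 "carrier (quot_module R M N) = a_rcosets\<^bsub>M\<^esub> N" "\<zero>\<^bsub>quot_module R M N\<^esub> = N"
 "U \<oplus>\<^bsub>quot_module R M N\<^esub> V = U <+>\<^bsub>M\<^esub> V"
 "r \<odot>\<^bsub>quot_module R M N\<^esub> U = (\<Union>x\<in>U. N +>\<^bsub>M\<^esub> (r \<odot>\<^bsub>M\<^esub> x))"
 by (simp_all add: quot_module_def)

lemma quot_module_smult_coset:
 assumes "module R M" "submodule N R M" "r \<in> carrier R" "x \<in> carrier M"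
 shows "r \<odot>\<^bsub>quot_module R M N\<^esub> (N +>\<^bsub>M\<^esub> x) = N +>\<^bsub>M\<^esub> (r \<odot>\<^bsub>M\<^esub> x)"
proof -
 interpret M: module R M by fact
 interpret N: abelian_subgroup N M using submodule_abelian_subgroup[OF assms(1,2)] .
 interpret sN: submodule N R M by fact
 have "N +>\<^bsub>M\<^esub> (r \<odot>\<^bsub>M\<^esub> z) = N +>\<^bsub>M\<^esub> (r \<odot>\<^bsub>M\<^esub> x)" if "z \<in> N +>\<^bsub>M\<^esub> x" for z
 proof -
  have z: "z \<in> carrier M" using that assms(4) M.a_r_coset_subset_G[OF N.a_subset assms(4)] by blast
  have "z \<ominus>\<^bsub>M\<^esub> x \<in> N" using N.a_rcos_module[OF assms(4) z] that by (simp add: a_minus_def)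
  then have "r \<odot>\<^bsub>M\<^esub> (z \<ominus>\<^bsub>M\<^esub> x) \<in> N" using assms(3) by simp
  then show ?thesis using a_rcos_eq_iff[OF N.abelian_subgroup_axioms] z assms(3,4)
   by (simp add: M.minus_eq M.smult_r_distr M.smult_r_minus)
 qed
 moreover have "x \<in> N +>\<^bsub>M\<^esub> x" using N.a_rcos_self assms(4) by simp
 ultimately show ?thesis unfolding quot_module_simps by blast
qed

lemma quot_module_module:
 assumes "module R M" "submodule N R M"
 shows "module R (quot_module R M N)" and "linear_map R M (quot_module R M N) (\<lambda>x. N +>\<^bsub>M\<^esub> x)"
proof -
 interpret M: module R M by fact
 interpret N: abelian_subgroup N M using submodule_abelian_subgroup[OF assms] .
 interpret sN: submodule N R M by fact
 let ?Q = "quot_module R M N"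
 have carE: "P" if "U \<in> carrier ?Q" "\<And>x. x \<in> carrier M \<Longrightarrow> U = N +>\<^bsub>M\<^esub> x \<Longrightarrow> P" for U P
  using that by (auto simp: quot_module_simps A_RCOSETS_def')
 have add: "(N +>\<^bsub>M\<^esub> x) \<oplus>\<^bsub>?Q\<^esub> (N +>\<^bsub>M\<^esub> y) = N +>\<^bsub>M\<^esub> (x \<oplus>\<^bsub>M\<^esub> y)"
  if "x \<in> carrier M" "y \<in> carrier M" for x y
  using N.a_rcos_sum[OF that] by (simp add: quot_module_simps)
 have mem: "N +>\<^bsub>M\<^esub> x \<in> carrier ?Q" if "x \<in> carrier M" for x
  using M.a_rcosetsI[OF N.a_subset that] by (simp add: quot_module_simps)
 note sm = quot_module_smult_coset[OF assms]
 have zero: "\<zero>\<^bsub>?Q\<^esub> = N +>\<^bsub>M\<^esub> \<zero>\<^bsub>M\<^esub>" using M.a_coset_add_zero[OF N.a_subset] by (simp add: quot_module_simps)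
 show "module R ?Q"
 proof (rule moduleI, rule M.R.is_cring, rule abelian_groupI)
  show "\<exists>y\<in>carrier ?Q. y \<oplus>\<^bsub>?Q\<^esub> U = \<zero>\<^bsub>?Q\<^esub>" if asm: "U \<in> carrier ?Q" for U
  proof -
   obtain x where x: "x \<in> carrier M" "U = N +>\<^bsub>M\<^esub> x" by (rule carE[OF asm])
   have "(N +>\<^bsub>M\<^esub> (\<ominus>\<^bsub>M\<^esub> x)) \<oplus>\<^bsub>?Q\<^esub> U = N +>\<^bsub>M\<^esub> (\<ominus>\<^bsub>M\<^esub> x \<oplus>\<^bsub>M\<^esub> x)"
    unfolding x(2) by (rule add) (use x in auto)
   also have "\<dots> = \<zero>\<^bsub>?Q\<^esub>" unfolding zero M.l_neg[OF x(1)] ..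
   finally show ?thesis using mem[of "\<ominus>\<^bsub>M\<^esub> x"] x by blast
  qed
  show "\<zero>\<^bsub>?Q\<^esub> \<in> carrier ?Q" by (simp add: zero mem del: M.a_coset_add_zero)
  show "\<zero>\<^bsub>?Q\<^esub> \<oplus>\<^bsub>?Q\<^esub> U = U" if asm: "U \<in> carrier ?Q" for U
   by (rule carE[OF asm]) (simp add: add zero del: M.a_coset_add_zero)
 qed (auto elim!: carE simp: add sm mem M.a_ac M.smult_l_distr M.smult_r_distr M.smult_assoc1)
 show "linear_map R M ?Q (\<lambda>x. N +>\<^bsub>M\<^esub> x)"
  by (rule linear_mapI) (simp_all add: add sm mem)
qed

lemma linear_map_image_submodule:
 assumes "module R M" "module R N" "linear_map R M N f" "submodule H R M"
 shows "submodule (f ` H) R N"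
proof -
 interpret M: module R M by fact
 interpret N: module R N by fact
 interpret H: submodule H R M by fact
 have Hc: "\<And>x. x \<in> H \<Longrightarrow> x \<in> carrier M" using M.submoduleE(1)[OF assms(4)] by blast
 note E = M.submoduleE[OF assms(4)]
 show ?thesis
 proof (rule N.submoduleI)
  show "f ` H \<subseteq> carrier N" using Hc linear_mapD(1)[OF assms(3)] by auto
  show "\<zero>\<^bsub>N\<^esub> \<in> f ` H" using linear_map_zero[OF assms(1,2,3)] H.one_closed by (metis image_eqI monoid.simps(2))
  show "\<ominus>\<^bsub>N\<^esub> a \<in> f ` H" if a: "a \<in> f ` H" for a
  proof -
   obtain x where "x \<in> H" "a = f x" using a by (rule imageE) auto
   then show ?thesis using linear_map_neg[OF assms(1,2,3) Hc] E(3) by (intro image_eqI[of _ _ "\<ominus>\<^bsub>M\<^esub> x"]) auto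
  qed
  show "a \<oplus>\<^bsub>N\<^esub> b \<in> f ` H" if a: "a \<in> f ` H" and b: "b \<in> f ` H" for a b
  proof -
   obtain x where "x \<in> H" "a = f x" using a by (rule imageE) auto
   moreover obtain y where "y \<in> H" "b = f y" using b by (rule imageE) auto
   ultimately show ?thesis using linear_mapD(2)[OF assms(3) Hc Hc] E(5) by (intro image_eqI[of _ _ "x \<oplus>\<^bsub>M\<^esub> y"]) auto
  qed
  show "r \<odot>\<^bsub>N\<^esub> b \<in> f ` H" if r: "r \<in> carrier R" and b: "b \<in> f ` H" for r b
  proof -
   obtain y where "y \<in> H" "b = f y" using b by (rule imageE) auto
   then show ?thesis using linear_mapD(3)[OF assms(3) r Hc] E(4)[OF r] by (intro image_eqI[of _ _ "r \<odot>\<^bsub>M\<^esub> y"]) auto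
  qed
 qed
qed

lemma linear_map_kernel_submodule:
 assumes "module R M" "module R N" "linear_map R M N f" "submodule H R N"
 shows "submodule {x \<in> carrier M. f x \<in> H} R M"
proof -
 interpret M: module R M by fact
 interpret N: module R N by fact
 note E = N.submoduleE[OF assms(4)]
 have z: "\<zero>\<^bsub>N\<^esub> \<in> H" using submodule.axioms(1)[OF assms(4)] subgroup.one_closed by fastforce
 show ?thesis
  by (rule M.submoduleI)
    (use z E linear_map_zero[OF assms(1-3)] linear_map_neg[OF assms(1-3)] linear_mapD[OF assms(3)] in auto)
qed

lemma zero_submodule: "module R M \<Longrightarrow> submodule {\<zero>\<^bsub>M\<^esub>} R M"
proof -
 assume "module R M"
 then interpret M: module R M .
 show ?thesis by (rule M.submoduleI) auto
qed

lemma submodule_ring_ideal: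
 assumes "cring R" "submodule J R (ring_as_module R)" shows "ideal J R"
proof -
 interpret cring R by fact
 interpret M: module R "ring_as_module R" using ring_as_module_module[OF assms(1)] .
 note E = M.submoduleE[OF assms(2)]
 have neg: "\<ominus>\<^bsub>R\<^esub> x \<in> J" if "x \<in> J" for x
  using E(3)[OF that] ring_as_module_minus(1)[OF assms(1)] E(1) that by auto
 show ?thesis
 proof (rule idealI, rule ring_axioms)
  show "subgroup J (add_monoid R)"
   by (rule add.subgroupI) (use E(1,2,5) neg in \<open>auto simp flip: a_inv_def\<close>)
  show l: "x \<otimes>\<^bsub>R\<^esub> a \<in> J" if "a \<in> J" "x \<in> carrier R" for a x
   using E(4)[OF that(2)] that by simp
  show "a \<otimes>\<^bsub>R\<^esub> x \<in> J" if "a \<in> J" "x \<in> carrier R" for a x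
   using l[OF that] m_comm[of a x] E(1) that by auto
 qed
qed

definition fg_submodule :: "('a, 'b) ring_scheme \<Rightarrow> ('a, 'm, 'c) module_scheme \<Rightarrow> 'm set \<Rightarrow> bool" where
 "fg_submodule R M Z \<longleftrightarrow> (\<exists>A. finite A \<and> A \<subseteq> Z \<and> (\<forall>N. submodule N R M \<longrightarrow> A \<subseteq> N \<longrightarrow> Z \<subseteq> N))"

lemma fg_submoduleE:
 assumes "fg_submodule R M Z"
 obtains A where "finite A" "A \<subseteq> Z" "\<And>N. submodule N R M \<Longrightarrow> A \<subseteq> N \<Longrightarrow> Z \<subseteq> N"
 using assms unfolding fg_submodule_def by (elim exE conjE) simp

lemma fg_submoduleI:
 assumes "finite A" "A \<subseteq> Z" "\<And>N. submodule N R M \<Longrightarrow> A \<subseteq> N \<Longrightarrow> Z \<subseteq> N"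
 shows "fg_submodule R M Z"
 using assms unfolding fg_submodule_def by (intro exI[of _ A]) simp

text \<open>
 Induction on the number of coordinates that may be nonzero: generators of the ideal of values of the last of
 them are lifted to Z and joined to generators of the submodule on which this coordinate vanishes.
\<close>
lemma free_module_noetherian:
 assumes "noetherian_ring R" "cring R" and Z: "submodule Z R (free_module R n)"
 shows "fg_submodule R (free_module R n) Z"
proof -
 interpret noetherian_ring R by fact
 let ?F = "free_module R n"
 interpret F: module R ?F using free_module_module[OF assms(2)] .
 interpret RM: module R "ring_as_module R" using ring_as_module_module[OF assms(2)] .
 have "fg_submodule R ?F Z"
  if "submodule Z R ?F" "\<And>z i. z \<in> Z \<Longrightarrow> j \<le> i \<Longrightarrow> i < n \<Longrightarrow> z i = \<zero>\<^bsub>R\<^esub>" for j Z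
  using that
 proof (induction j arbitrary: Z)
  case 0
  have "z = \<zero>\<^bsub>?F\<^esub>" if z: "z \<in> Z" for z
   by (rule PiE_ext[of _ "{..<n}" "\<lambda>_. carrier R"]) (use F.submoduleE(1)[OF 0(1)] z 0(2) in auto)
  moreover have "\<zero>\<^bsub>?F\<^esub> \<in> N" if "submodule N R ?F" for N
   using submodule.axioms(1)[OF that] subgroup.one_closed by fastforce
  ultimately show ?case by (intro fg_submoduleI[of "{}"]) auto
 next
  case (Suc j)
  note Zc = F.submoduleE(1)[OF Suc(2)]
  show ?case
  proof (cases "j < n")
   case False
   then show ?thesis using Suc by (intro Suc.IH) auto
  next
   case True
   note lc = free_module_coord[OF True, of R]
   have coordI: "ideal ((\<lambda>z. z j) ` N) R" if "submodule N R ?F" for N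
    by (rule submodule_ring_ideal[OF assms(2)
       linear_map_image_submodule[OF F.module_axioms RM.module_axioms lc that]])
   define Z0 where "Z0 = Z \<inter> {z \<in> carrier ?F. z j \<in> {\<zero>\<^bsub>R\<^esub>}}"
   have k: "submodule {z \<in> carrier ?F. z j \<in> {\<zero>\<^bsub>R\<^esub>}} R ?F"
    using linear_map_kernel_submodule[OF F.module_axioms RM.module_axioms lc zero_submodule[OF RM.module_axioms]] by simp
   have inter: "submodule (H \<inter> H') R ?F" if "submodule H R ?F" "submodule H' R ?F" for H H'
    by (rule F.submoduleI) 
     (use F.submoduleE[OF that(1)] F.submoduleE[OF that(2)] subgroup.one_closed[OF submodule.axioms(1)[OF that(1)]]
      subgroup.one_closed[OF submodule.axioms(1)[OF that(2)]] in auto)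
   have Z0: "submodule Z0 R ?F" unfolding Z0_def by (rule inter[OF Suc(2) k])
   have "z i = \<zero>\<^bsub>R\<^esub>" if "z \<in> Z0" "j \<le> i" "i < n" for z i
    using that Suc(3)[of z i] unfolding Z0_def by (cases "i = j") auto
   then obtain A0 where A0: "finite A0" "A0 \<subseteq> Z0" "\<And>N. submodule N R ?F \<Longrightarrow> A0 \<subseteq> N \<Longrightarrow> Z0 \<subseteq> N"
    using fg_submoduleE[OF Suc.IH[OF Z0]] by metis
   obtain D where D: "finite D" "D \<subseteq> carrier R" "(\<lambda>z. z j) ` Z = Idl\<^bsub>R\<^esub> D"
    using finetely_gen[OF coordI[OF Suc(2)]] by blast
   have "D \<subseteq> (\<lambda>z. z j) ` Z" using D genideal_self by auto
   then obtain B where B: "finite B" "B \<subseteq> Z" "D = (\<lambda>z. z j) ` B"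
    using finite_subset_image[OF D(1)] by metis
   have "Z \<subseteq> N" if N: "submodule N R ?F" "A0 \<union> B \<subseteq> N" for N
   proof
    fix z assume z: "z \<in> Z"
    have "D \<subseteq> (\<lambda>z. z j) ` (N \<inter> Z)" using B N by auto
    then have "(\<lambda>z. z j) ` Z \<subseteq> (\<lambda>z. z j) ` (N \<inter> Z)"
     using genideal_minimal[OF coordI[OF inter[OF N(1) Suc(2)]]] D(3) by simp
    then obtain w where w: "w \<in> N" "w \<in> Z" "w j = z j" using z by (smt (verit) IntD1 IntD2 image_iff subset_iff)
    have c: "z \<in> carrier ?F" "w \<in> carrier ?F" using z w Zc by auto
    have "z \<ominus>\<^bsub>?F\<^esub> w \<in> Z" using F.submoduleE(3,5)[OF Suc(2)] z w(2) by (simp add: F.minus_eq)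
    moreover have "(z \<ominus>\<^bsub>?F\<^esub> w) j = \<zero>\<^bsub>R\<^esub>"
    proof -
     have zj: "z j \<in> carrier R" using c(1) True by auto
     have "(z \<ominus>\<^bsub>?F\<^esub> w) j = z j \<ominus>\<^bsub>ring_as_module R\<^esub> w j"
      by (rule linear_map_diff[OF F.module_axioms RM.module_axioms lc c])
     also have "\<dots> = \<zero>\<^bsub>R\<^esub>" unfolding w(3) ring_as_module_minus(2)[OF assms(2) zj]
      using zj by (simp add: minus_eq r_neg)
     finally show ?thesis .
    qed
    moreover have "z \<ominus>\<^bsub>?F\<^esub> w \<in> carrier ?F" using c by (rule F.minus_closed)
    ultimately have "z \<ominus>\<^bsub>?F\<^esub> w \<in> N" using A0(3)[OF N(1)] N(2) unfolding Z0_def by auto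
    then have "w \<oplus>\<^bsub>?F\<^esub> (z \<ominus>\<^bsub>?F\<^esub> w) \<in> N" using F.submoduleE(5)[OF N(1)] w by blast
    then show "z \<in> N" by (simp only: F.add_minus_cancel(1)[OF c])
   qed
   then show ?thesis using A0 B by (intro fg_submoduleI[of "A0 \<union> B"]) (auto simp: Z0_def)
  qed
 qed
 then show ?thesis using Z by (metis leD)
qed

lemma module_surjection:
 fixes M :: "('a, 'm) module"
 assumes "module R M" "finite A" "A \<subseteq> carrier M" and gen: "\<And>N. submodule N R M \<Longrightarrow> A \<subseteq> N \<Longrightarrow> carrier M \<subseteq> N"
 obtains m g where "linear_map R (free_module R m) M g" "g ` carrier (free_module R m) = carrier M"
proof -
 interpret M: module R M by fact
 obtain v and m :: nat where v: "A = v ` {..<m}"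
  using assms(2) by (metis finite_imp_nat_seg_image_inj_on lessThan_def)
 let ?F = "free_module R m"
 interpret F: module R ?F using free_module_module[OF M.is_cring] .
 define g where "g = (\<lambda>c. \<Oplus>\<^bsub>M\<^esub>k\<in>{..<m}. c k \<odot>\<^bsub>M\<^esub> v k)"
 have vc: "v k \<in> carrier M" if "k < m" for k using v assms(3) that by auto
 have g: "linear_map R ?F M g" unfolding g_def
  by (rule linear_map_finsum_map[OF F.module_axioms assms(1)])
    (auto intro: linear_map_smult_const[OF F.module_axioms assms(1) free_module_coord] vc)
 have "A \<subseteq> g ` carrier ?F"
 proof
  fix a assume "a \<in> A"
  then obtain i where i: "i < m" "a = v i" using v by auto
  define c where "c = (\<lambda>k\<in>{..<m}. if i = k then \<one>\<^bsub>R\<^esub> else \<zero>\<^bsub>R\<^esub>)"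
  have "g c = (\<Oplus>\<^bsub>M\<^esub>k\<in>{..<m}. if i = k then v k else \<zero>\<^bsub>M\<^esub>)" unfolding g_def
   by (rule M.finsum_cong') (use vc in \<open>auto simp: c_def\<close>)
  also have "\<dots> = v i" by (rule M.finsum_singleton) (use i vc in auto)
  finally show "a \<in> g ` carrier ?F" using i by (intro image_eqI[of _ _ c]) (auto simp: c_def)
 qed
 then have "carrier M \<subseteq> g ` carrier ?F"
  by (rule gen[OF linear_map_image_submodule[OF F.module_axioms assms(1) g F.carrier_is_submodule]])
 then have "g ` carrier ?F = carrier M" using linear_mapD(1)[OF g] by auto
 with g show ?thesis using that by blast
qed

lemma submodule_surjection:
 assumes "noetherian_ring R" "cring R" and Z: "submodule Z R (free_module R n)"
 obtains m g where "linear_map R (free_module R m) (free_module R n) g" "g ` carrier (free_module R m) = Z"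
proof -
 let ?F = "free_module R n"
 let ?Z = "?F\<lparr>carrier := Z\<rparr>"
 interpret F: module R ?F using free_module_module[OF assms(2)] .
 obtain A where A: "finite A" "A \<subseteq> Z" "\<And>N. submodule N R ?F \<Longrightarrow> A \<subseteq> N \<Longrightarrow> Z \<subseteq> N"
  using free_module_noetherian[OF assms] by (rule fg_submoduleE) auto
 have mZ: "module R ?Z" using submodule.submodule_is_module[OF Z F.module_axioms] .
 interpret Z: module R ?Z by (fact mZ)
 have Zc: "Z \<subseteq> carrier ?F" using F.submoduleE(1)[OF Z] .
 have sub: "submodule N R ?F" if "submodule N R ?Z" for N
 proof (rule F.module_incl_imp_submodule)
  show "N \<subseteq> carrier ?F" using Z.submoduleE(1)[OF that] Zc by auto
  show "module R (?F\<lparr>carrier := N\<rparr>)" using submodule.submodule_is_module[OF that mZ] by simp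
 qed
 obtain m g where g: "linear_map R (free_module R m) ?Z g" "g ` carrier (free_module R m) = carrier ?Z"
  by (rule module_surjection[OF mZ A(1)]) (use A sub in auto)
 have "linear_map R (free_module R m) ?F g" using g(1) Zc unfolding linear_map_def by auto
 then show ?thesis using g(2) that by simp
qed

lemma module_hom_iff: "f \<in> module_hom R M N \<longleftrightarrow> linear_map R M N f \<and> f \<in> extensional (carrier M)"
 by (auto simp: module_hom_def linear_map_def PiE_def)

lemma linear_map_restrict:
 assumes "module R M" "linear_map R M N f" shows "restrict f (carrier M) \<in> module_hom R M N"
proof -
 interpret module R M by fact
 show ?thesis using assms(2) unfolding module_hom_def linear_map_def by auto
qed

lemma free_resolution_exists:
 assumes "noetherian_ring R" "cring R" "ideal J R"
 obtains rk d e where "free_resolution R (cyclic_module R J) rk d e"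
proof -
 interpret cring R by fact
 let ?F = "\<lambda>n. free_module R n"
 let ?C = "cyclic_module R J"
 note RM = ring_as_module_module[OF assms(2)]
 note mF = free_module_module[OF assms(2)]
 have sJ: "submodule J R (ring_as_module R)" using ideal_submodule[OF assms(3,2)] .
 have mC: "module R ?C" and lq: "linear_map R (ring_as_module R) ?C (\<lambda>x. J +>\<^bsub>ring_as_module R\<^esub> x)"
  using quot_module_module[OF RM sJ] by auto
 define e where "e = restrict (\<lambda>z. J +>\<^bsub>ring_as_module R\<^esub> (z 0)) (carrier (?F 1))"
 have le: "linear_map R (?F 1) ?C (\<lambda>z. J +>\<^bsub>ring_as_module R\<^esub> (z 0))"
  by (rule linear_map_compose[OF free_module_coord lq]) simp
 have e: "e \<in> module_hom R (?F 1) ?C" unfolding e_def by (rule linear_map_restrict[OF mF le])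
 have le': "linear_map R (?F 1) ?C e" using e by (simp add: module_hom_iff)
 have e_onto: "e ` carrier (?F 1) = carrier ?C"
 proof
  show "e ` carrier (?F 1) \<subseteq> carrier ?C" using linear_mapD(1)[OF le'] by blast
  show "carrier ?C \<subseteq> e ` carrier (?F 1)"
  proof
   fix U assume "U \<in> carrier ?C"
   then obtain r where "r \<in> carrier R" "U = J +>\<^bsub>ring_as_module R\<^esub> r"
    by (auto simp: quot_module_simps A_RCOSETS_def')
   then show "U \<in> e ` carrier (?F 1)" by (intro image_eqI[of _ _ "\<lambda>i\<in>{..<1}. r"]) (auto simp: e_def)
  qed
 qed
 define good where "good = (\<lambda>i (n, m, d). d \<in> module_hom R (?F m) (?F n) \<and>
   (i = (0::nat) \<longrightarrow> n = 1 \<and> d ` carrier (?F m) = {x \<in> carrier (?F 1). e x = \<zero>\<^bsub>?C\<^esub>}))"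
 define link where "link = (\<lambda>(i::nat) (n, m, d) (n', m', d'). n' = m \<and> d' ` carrier (?F m') = {x \<in> carrier (?F m). d x = \<zero>\<^bsub>?F n\<^esub>})"
 have ker: "\<exists>m' d'. d' \<in> module_hom R (?F m') (?F m) \<and> d' ` carrier (?F m') = {x \<in> carrier (?F m). f x = \<zero>\<^bsub>N\<^esub>}"
  if N: "module R N" and f: "linear_map R (?F m) N f" for m f and N :: "('a, 'n) module"
 proof -
  have "submodule {x \<in> carrier (?F m). f x = \<zero>\<^bsub>N\<^esub>} R (?F m)"
   using linear_map_kernel_submodule[OF mF N f zero_submodule[OF N]] by simp
  then obtain m' g where g: "linear_map R (?F m') (?F m) g" "g ` carrier (?F m') = {x \<in> carrier (?F m). f x = \<zero>\<^bsub>N\<^esub>}"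
   by (rule submodule_surjection[OF assms(1,2)])
  then show ?thesis
   using linear_map_restrict[OF mF g(1)] by (intro exI[of _ m'] exI[of _ "restrict g (carrier (?F m'))"]) simp
 qed
 have "\<exists>x. \<forall>i. good i (x i) \<and> link i (x i) (x (Suc i))"
 proof (rule dependent_nat_choice)
  show "\<exists>x. good 0 x" using ker[OF mC le'] unfolding good_def by auto
 next
  fix x i assume g: "good i x"
  obtain n m d where x: "x = (n, m, d)" by (cases x)
  have "linear_map R (?F m) (?F n) d" using g unfolding good_def x by (simp add: module_hom_iff)
  from ker[OF mF this] obtain m' d' where "d' \<in> module_hom R (?F m') (?F m)"
   "d' ` carrier (?F m') = {x \<in> carrier (?F m). d x = \<zero>\<^bsub>?F n\<^esub>}" by blast
  then show "\<exists>y. good (Suc i) y \<and> link i x y" unfolding good_def link_def x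
   by (intro exI[of _ "(m, m', d')"]) auto
 qed
 then obtain x where x: "\<And>i. good i (x i)" "\<And>i. link i (x i) (x (Suc i))" by blast
 define rk where "rk = (\<lambda>i. fst (x i))"
 define d where "d = (\<lambda>i. snd (snd (x i)))"
 have xi: "x i = (rk i, rk (Suc i), d i)" for i
  using x(2)[of i] unfolding link_def rk_def d_def by (cases "x i"; cases "x (Suc i)") auto
 have "free_resolution R ?C rk d e"
  unfolding free_resolution_def
  using x(1)[of 0] x(1) x(2) e e_onto unfolding good_def link_def xi by auto
 then show ?thesis using that by blast
qed

section \<open>Vanishing of Ext for modules of finite injective dimension\<close>

text \<open>
 The augmentation to R/J lifts to R, as free modules are projective.
\<close>
lemma ideal_resolution_of_free_resolution:
 assumes "cring R" "ideal J R" and res: "free_resolution R (cyclic_module R J) rk d e"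
 obtains \<epsilon> where "ideal_resolution J R (\<lambda>i. free_module R (rk i)) d \<epsilon>"
  "\<And>z. z \<in> carrier (free_module R (rk 0)) \<Longrightarrow> e z = J +>\<^bsub>ring_as_module R\<^esub> \<epsilon> z"
proof -
 interpret cring R by fact
 interpret J: ideal J R by fact
 let ?F = "\<lambda>i. free_module R (rk i)"
 let ?C = "cyclic_module R J"
 let ?RM = "ring_as_module R"
 note RM = ring_as_module_module[OF assms(1)]
 note mF = free_module_module[OF assms(1)]
 have sJ: "submodule J R ?RM" using ideal_submodule[OF assms(2,1)] .
 have mC: "module R ?C" and lq: "linear_map R ?RM ?C (\<lambda>x. J +>\<^bsub>?RM\<^esub> x)"
  using quot_module_module[OF RM sJ] by auto
 note aJ = submodule_abelian_subgroup[OF RM sJ]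
 interpret aJ: abelian_subgroup J ?RM by (fact aJ)
 have e: "linear_map R (?F 0) ?C e" and e_onto: "e ` carrier (?F 0) = carrier ?C"
  and d: "\<And>i. linear_map R (?F (Suc i)) (?F i) (d i)"
  and ex0: "d 0 ` carrier (?F (Suc 0)) = {x \<in> carrier (?F 0). e x = \<zero>\<^bsub>?C\<^esub>}"
  and exS: "\<And>i. d (Suc i) ` carrier (?F (Suc (Suc i))) = {x \<in> carrier (?F (Suc i)). d i x = \<zero>\<^bsub>?F i\<^esub>}"
  using res unfolding free_resolution_def module_hom_iff by auto
 obtain \<epsilon> where \<epsilon>: "linear_map R (?F 0) ?RM \<epsilon>"
  and e\<epsilon>: "\<And>z. z \<in> carrier (?F 0) \<Longrightarrow> J +>\<^bsub>?RM\<^esub> \<epsilon> z = e z"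
 proof (rule projective_lift[OF mF RM mC fg_projective_free_module[OF assms(1)] e lq])
  show "e z \<in> (\<lambda>x. J +>\<^bsub>?RM\<^esub> x) ` carrier ?RM" if "z \<in> carrier (?F 0)" for z
   using linear_mapD(1)[OF e that] by (auto simp: quot_module_simps A_RCOSETS_def')
 qed blast
 have \<epsilon>c: "\<epsilon> z \<in> carrier R" if "z \<in> carrier (?F 0)" for z using linear_mapD(1)[OF \<epsilon> that] by simp
 have zero: "J +>\<^bsub>?RM\<^esub> x = J \<longleftrightarrow> x \<in> J" if "x \<in> carrier R" for x
 proof -
  have "J +>\<^bsub>?RM\<^esub> \<zero>\<^bsub>R\<^esub> = J" using aJ.a_rcos_const[of "\<zero>\<^bsub>R\<^esub>"] J.zero_closed by simp
  then have "J +>\<^bsub>?RM\<^esub> x = J \<longleftrightarrow> J +>\<^bsub>?RM\<^esub> x = J +>\<^bsub>?RM\<^esub> \<zero>\<^bsub>R\<^esub>" by simp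
  also have "\<dots> \<longleftrightarrow> x \<ominus>\<^bsub>?RM\<^esub> \<zero>\<^bsub>R\<^esub> \<in> J" by (rule a_rcos_eq_iff[OF aJ]) (use that in auto)
  also have "x \<ominus>\<^bsub>?RM\<^esub> \<zero>\<^bsub>R\<^esub> = x" using that by (simp add: ring_as_module_minus[OF assms(1)] minus_eq)
  finally show ?thesis .
 qed
 have "ideal_resolution J R ?F d \<epsilon>"
 proof (intro ideal_resolution.intro ideal_resolution_axioms.intro)
  show "ideal J R" "cring R" by fact+
  show "\<exists>z\<in>carrier (?F 0). r \<ominus>\<^bsub>R\<^esub> \<epsilon> z \<in> J" if r: "r \<in> carrier R" for r
  proof -
   have "J +>\<^bsub>?RM\<^esub> r \<in> e ` carrier (?F 0)" unfolding e_onto using linear_mapD(1)[OF lq] r by simp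
   then obtain z where z: "z \<in> carrier (?F 0)" "J +>\<^bsub>?RM\<^esub> r = J +>\<^bsub>?RM\<^esub> \<epsilon> z" using e\<epsilon> by auto
   then have "r \<ominus>\<^bsub>?RM\<^esub> \<epsilon> z \<in> J" using a_rcos_eq_iff[OF aJ, of r "\<epsilon> z"] r \<epsilon>c by simp
   then show ?thesis using z \<epsilon>c[OF z(1)] by (auto simp: ring_as_module_minus[OF assms(1)])
  qed
  show "d 0 ` carrier (?F (Suc 0)) = {z \<in> carrier (?F 0). \<epsilon> z \<in> J}"
   unfolding ex0 using zero[OF \<epsilon>c] e\<epsilon> by (auto simp: quot_module_simps simp del: free_module_simps)
 qed (use mF fg_projective_free_module[OF assms(1)] d \<epsilon> exS in \<open>auto simp del: free_module_simps\<close>)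
 then show ?thesis using that e\<epsilon> by simp
qed

text \<open>
 Gives a handle on the resolution picked by the choice operator in the definition of Ext. It does not depend
 on C or on the degree.
\<close>
lemma Ext_module_eq:
 assumes "noetherian_ring R" "cring R" "ideal J R"
 obtains rk d \<epsilon> where "ideal_resolution J R (\<lambda>i. free_module R (rk i)) d \<epsilon>"
  "\<And>i. d i \<in> module_hom R (free_module R (rk (Suc i))) (free_module R (rk i))"
  "\<And>C i. Ext_module R (cyclic_module R J) C i = quot_module R
      ((hom_module R (free_module R (rk i)) C)\<lparr>carrier := ext_cocycles R C rk d i\<rparr>)
      (ext_coboundaries R C rk d i)"
proof -
 let ?P = "\<lambda>(rk, d). \<exists>e. free_resolution R (cyclic_module R J) rk d e"
 obtain rk0 d0 e0 where "free_resolution R (cyclic_module R J) rk0 d0 e0"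
  by (rule free_resolution_exists[OF assms])
 then have "?P (rk0, d0)" by auto
 then have P: "?P (SOME x. ?P x)" by (rule someI)
 obtain rk d where rkd: "(SOME x. ?P x) = (rk, d)" by (cases "SOME x. ?P x")
 then obtain e where e: "free_resolution R (cyclic_module R J) rk d e" using P by auto
 obtain \<epsilon> where \<epsilon>: "ideal_resolution J R (\<lambda>i. free_module R (rk i)) d \<epsilon>"
  by (rule ideal_resolution_of_free_resolution[OF assms(2,3) e])
 moreover have "Ext_module R (cyclic_module R J) C i = quot_module R
      ((hom_module R (free_module R (rk i)) C)\<lparr>carrier := ext_cocycles R C rk d i\<rparr>)
      (ext_coboundaries R C rk d i)" for C i
  unfolding Ext_module_def using rkd by simp
 moreover have "d i \<in> module_hom R (free_module R (rk (Suc i))) (free_module R (rk i))" for i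
  using e unfolding free_resolution_def by simp
 ultimately show ?thesis using that by blast
qed

text \<open>
 \<open>Ext\<^sup>i\<^sup>+\<^sup>1(R/J, C) = 0\<close>, witnessed by one resolution. By independence of the
 resolution it may be checked, and used, on any other.
\<close>
definition ext_zero :: "('a, 'b) ring_scheme \<Rightarrow> 'a set \<Rightarrow> ('a, 'm) module \<Rightarrow> nat \<Rightarrow> bool" where
 "ext_zero R J C i \<longleftrightarrow> (\<exists>(P :: nat \<Rightarrow> ('a, nat \<Rightarrow> 'a) module) d \<epsilon>.
   ideal_resolution J R P d \<epsilon> \<and> ext_vanishes R P d C i)"

lemma ext_zero_of_Ext_module:
 fixes C :: "('a, 'm) module"
 assumes "noetherian_ring R" "cring R" "ideal J R" and C: "module R C"
  and E: "carrier (Ext_module R (cyclic_module R J) C (Suc i)) = {\<zero>\<^bsub>Ext_module R (cyclic_module R J) C (Suc i)\<^esub>}"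
 shows "ext_zero R J C i"
proof -
 interpret C: module R C by fact
 obtain rk d \<epsilon> where res: "ideal_resolution J R (\<lambda>i. free_module R (rk i)) d \<epsilon>"
  and d: "\<And>i. d i \<in> module_hom R (free_module R (rk (Suc i))) (free_module R (rk i))"
  and Ext: "\<And>(C :: ('a, 'm) module) i. Ext_module R (cyclic_module R J) C i = quot_module R
      ((hom_module R (free_module R (rk i)) C)\<lparr>carrier := ext_cocycles R C rk d i\<rparr>)
      (ext_coboundaries R C rk d i)"
  by (rule Ext_module_eq[OF assms(1-3)]) blast
 let ?F = "\<lambda>i. free_module R (rk i)"
 note mF = free_module_module[OF assms(2)]
 have dl: "linear_map R (?F (Suc i)) (?F i) (d i)" for i using d by (simp add: module_hom_iff)
 let ?H = "(hom_module R (?F (Suc i)) C)\<lparr>carrier := ext_cocycles R C rk d (Suc i)\<rparr>"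
 let ?B = "ext_coboundaries R C rk d (Suc i)"
 have "ext_vanishes R ?F d C i" unfolding ext_vanishes_def
 proof (intro allI impI, elim conjE)
  fix f assume f: "linear_map R (?F (Suc i)) C f"
   and fz: "\<forall>z\<in>carrier (?F (Suc (Suc i))). f (d (Suc i) z) = \<zero>\<^bsub>C\<^esub>"
  define f' where "f' = restrict f (carrier (?F (Suc i)))"
  have dc: "d j z \<in> carrier (?F j)" if "z \<in> carrier (?F (Suc j))" for j z using linear_mapD(1)[OF dl that] .
  have hf: "f' \<in> module_hom R (?F (Suc i)) C" unfolding f'_def by (rule linear_map_restrict[OF mF f])
  then have f': "f' \<in> ext_cocycles R C rk d (Suc i)"
   unfolding ext_cocycles_def using fz dc by (simp add: f'_def del: free_module_simps)
  define z where "z = restrict (\<lambda>_. \<zero>\<^bsub>C\<^esub>) (carrier (?F i))"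
  have "z \<in> module_hom R (?F i) C" unfolding z_def
   by (rule linear_map_restrict[OF mF linear_map_zero_map[OF mF C]])
  moreover define z' where "z' = compose (carrier (?F (Suc i))) z (d i)"
  ultimately have z': "z' \<in> ?B" by auto
  have "z' \<oplus>\<^bsub>?H\<^esub> f' = f'"
  proof (rule ext)
   fix x show "(z' \<oplus>\<^bsub>?H\<^esub> f') x = f' x"
    using dc linear_mapD(1)[OF f] by (auto simp: hom_module_def z'_def compose_def z_def f'_def simp del: free_module_simps)
  qed
  then have "f' \<in> ?B +>\<^bsub>?H\<^esub> f'" using z' unfolding a_r_coset_def' by force
  moreover have "?B +>\<^bsub>?H\<^esub> f' \<in> carrier (Ext_module R (cyclic_module R J) C (Suc i))"
   unfolding Ext quot_module_simps A_RCOSETS_def' using f' by auto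
  ultimately have "f' \<in> ?B" unfolding E unfolding Ext quot_module_simps by auto
  then obtain g where g: "g \<in> module_hom R (?F i) C" "f' = compose (carrier (?F (Suc i))) g (d i)" by auto
  have "f z = g (d i z)" if "z \<in> carrier (?F (Suc i))" for z
   using fun_cong[OF g(2), of z] that by (simp add: f'_def compose_def del: free_module_simps)
  then show "\<exists>g. linear_map R (?F i) C g \<and> (\<forall>z\<in>carrier (?F (Suc i)). f z = g (d i z))"
   using g(1) by (auto simp: module_hom_iff simp del: free_module_simps)
 qed
 then show ?thesis using res unfolding ext_zero_def by blast
qed

lemma ext_zeroD:
 fixes C :: "('a, 'm) module" and P :: "nat \<Rightarrow> ('a, 'f) module"
 assumes "ext_zero R J C i" "module R C" "ideal_resolution J R P d \<epsilon>"
 shows "ext_vanishes R P d C i"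
 using assms ext_vanishes_independent unfolding ext_zero_def by blast

lemma ext_zeroI:
 fixes C :: "('a, 'm) module" and P :: "nat \<Rightarrow> ('a, 'f) module"
 assumes "noetherian_ring R" "module R C" "ideal_resolution J R P d \<epsilon>" "ext_vanishes R P d C i"
 shows "ext_zero R J C i"
proof -
 interpret ideal_resolution J R P d \<epsilon> by fact
 obtain rk d' \<epsilon>' where "ideal_resolution J R (\<lambda>i. free_module R (rk i)) d' \<epsilon>'"
  by (rule Ext_module_eq[OF assms(1) is_cring ideal_axioms]) blast
 with ext_vanishes_independent[OF this assms(3,2,4)] show ?thesis unfolding ext_zero_def by blast
qed

lemma ext_zero_carrier:
 fixes C :: "('a, 'm) module"
 assumes "noetherian_ring R" "cring R" "module R C"
 shows "ext_zero R (carrier R) C i"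
proof -
 interpret cring R by fact
 interpret RM: module R "ring_as_module R" using ring_as_module_module[OF assms(2)] .
 define Z where "Z = (ring_as_module R)\<lparr>carrier := {\<zero>\<^bsub>ring_as_module R\<^esub>}\<rparr>"
 have Z: "module R Z" "fg_projective R Z" "carrier Z = {\<zero>\<^bsub>R\<^esub>}" "\<zero>\<^bsub>Z\<^esub> = \<zero>\<^bsub>R\<^esub>"
  unfolding Z_def using zero_module[OF RM.module_axioms] fg_projective_zero_module[OF RM.module_axioms] by auto
 have res: "ideal_resolution (carrier R) R (\<lambda>_. Z) (\<lambda>_ z. \<zero>\<^bsub>Z\<^esub>) (\<lambda>z. \<zero>\<^bsub>ring_as_module R\<^esub>)"
 proof (intro ideal_resolution.intro ideal_resolution_axioms.intro)
  show "ideal (carrier R) R" "cring R" by (rule oneideal, fact)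
  show "module R Z" "fg_projective R Z" by (fact Z)+
  show "linear_map R Z Z (\<lambda>z. \<zero>\<^bsub>Z\<^esub>)" by (rule linear_map_zero_map[OF Z(1) Z(1)])
  show "linear_map R Z (ring_as_module R) (\<lambda>z. \<zero>\<^bsub>ring_as_module R\<^esub>)"
   by (rule linear_map_zero_map[OF Z(1) RM.module_axioms])
 qed (auto simp: Z)
 have "ext_vanishes R (\<lambda>_. Z) (\<lambda>_ z. \<zero>\<^bsub>Z\<^esub>) C i"
  unfolding ext_vanishes_def
 proof (intro allI impI exI conjI ballI)
  show "linear_map R Z C (\<lambda>z. \<zero>\<^bsub>C\<^esub>)" by (rule linear_map_zero_map[OF Z(1) assms(3)])
  fix f z assume "linear_map R Z C f \<and> (\<forall>z\<in>carrier Z. f \<zero>\<^bsub>Z\<^esub> = \<zero>\<^bsub>C\<^esub>)" "z \<in> carrier Z"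
  then show "f z = \<zero>\<^bsub>C\<^esub>" by (simp add: Z)
 qed
 with ext_zeroI[OF assms(1,3) res] show ?thesis .
qed

text \<open>
 The principal ideal of a nonzerodivisor has the resolution \<open>0 \<rightarrow> R \<rightarrow> R\<close>
 of length one.
\<close>
lemma ext_zero_principal:
 fixes C :: "('a, 'm) module"
 assumes "noetherian_ring R" "cring R" "module R C" and x: "x \<in> nonzerodivisors R"
 shows "ext_zero R (PIdl\<^bsub>R\<^esub> x) C (Suc i)"
proof -
 interpret cring R by fact
 interpret RM: module R "ring_as_module R" using ring_as_module_module[OF assms(2)] .
 have xc: "x \<in> carrier R" and xr: "\<And>r. r \<in> carrier R \<Longrightarrow> x \<otimes>\<^bsub>R\<^esub> r = \<zero>\<^bsub>R\<^esub> \<Longrightarrow> r = \<zero>\<^bsub>R\<^esub>"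
  using x unfolding nonzerodivisors_def by auto
 define Z where "Z = (ring_as_module R)\<lparr>carrier := {\<zero>\<^bsub>ring_as_module R\<^esub>}\<rparr>"
 have Z: "module R Z" "fg_projective R Z" "carrier Z = {\<zero>\<^bsub>R\<^esub>}" "\<zero>\<^bsub>Z\<^esub> = \<zero>\<^bsub>R\<^esub>"
  unfolding Z_def using zero_module[OF RM.module_axioms] fg_projective_zero_module[OF RM.module_axioms] by auto
 define P where "P = (\<lambda>i::nat. if i \<le> 1 then ring_as_module R else Z)"
 define d where "d = (\<lambda>i::nat. if i = 0 then (\<lambda>z. x \<otimes>\<^bsub>R\<^esub> z) else (\<lambda>z. \<zero>\<^bsub>R\<^esub>))"
 have lx: "linear_map R (ring_as_module R) (ring_as_module R) (\<lambda>z. x \<otimes>\<^bsub>R\<^esub> z)"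
  by (rule linear_mapI) (use xc in \<open>auto simp: r_distr m_lcomm\<close>)
 have l0: "linear_map R Z (P j) (\<lambda>z. \<zero>\<^bsub>R\<^esub>)" for j
  using linear_map_zero_map[OF Z(1) Z(1)] linear_map_zero_map[OF Z(1) RM.module_axioms] Z(4) unfolding P_def by simp
 have "ideal_resolution (PIdl\<^bsub>R\<^esub> x) R P d (\<lambda>z. z)"
 proof (intro ideal_resolution.intro ideal_resolution_axioms.intro)
  show "ideal (PIdl\<^bsub>R\<^esub> x) R" "cring R" using cgenideal_ideal[OF xc] assms(2) by auto
  fix i
  show "module R (P i)" "fg_projective R (P i)" unfolding P_def
   using Z RM.module_axioms fg_projective_ring[OF assms(2)] by auto
  show "linear_map R (P (Suc i)) (P i) (d i)"
   using lx l0[of i] unfolding d_def by (cases "i = 0") (auto simp: P_def)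
  show "linear_map R (P 0) (ring_as_module R) (\<lambda>z. z)" using linear_map_id by (simp add: P_def)
  show "\<exists>z\<in>carrier (P 0). r \<ominus>\<^bsub>R\<^esub> z \<in> PIdl\<^bsub>R\<^esub> x" if "r \<in> carrier R" for r
   using that additive_subgroup.zero_closed[OF ideal.axioms(1)[OF cgenideal_ideal[OF xc]]]
   by (intro bexI[of _ r]) (auto simp: P_def minus_eq r_neg)
  show "d 0 ` carrier (P (Suc 0)) = {z \<in> carrier (P 0). z \<in> PIdl\<^bsub>R\<^esub> x}"
   using xc by (auto simp: P_def d_def cgenideal_def m_comm)
  show "d (Suc i) ` carrier (P (Suc (Suc i))) = {z \<in> carrier (P (Suc i)). d i z = \<zero>\<^bsub>P i\<^esub>}"
   using xr xc by (cases "i = 0") (auto simp: P_def d_def Z)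
 qed
 moreover have "ext_vanishes R P d C (Suc i)" unfolding ext_vanishes_def
 proof (intro allI impI, elim conjE)
  fix f assume f: "linear_map R (P (Suc (Suc i))) C f"
  have P2: "P (Suc (Suc i)) = Z" by (simp add: P_def)
  have Pm: "module R (P (Suc i))" using Z RM.module_axioms by (simp add: P_def)
  have "f z = \<zero>\<^bsub>C\<^esub>" if "z \<in> carrier (P (Suc (Suc i)))" for z
   using that linear_map_zero[OF Z(1) assms(3) f[unfolded P2]] unfolding P2 by (simp add: Z)
  then show "\<exists>g. linear_map R (P (Suc i)) C g \<and> (\<forall>z\<in>carrier (P (Suc (Suc i))). f z = g (d (Suc i) z))"
   using linear_map_zero_map[OF Pm assms(3)] by blast
 qed
 ultimately show ?thesis using ext_zeroI[OF assms(1,3)] by blast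
qed

lemma (in noetherian_ring) exists_maximal_ideal_in:
 assumes "Fam \<noteq> {}" "\<And>J. J \<in> Fam \<Longrightarrow> ideal J R"
 obtains J where "J \<in> Fam" "\<And>J'. J' \<in> Fam \<Longrightarrow> J \<subseteq> J' \<Longrightarrow> J' = J"
proof -
 have "\<exists>M\<in>Fam. \<forall>Y\<in>Fam. M \<subseteq> Y \<longrightarrow> Y = M"
 proof (rule subset_Zorn_nonempty[OF assms(1)])
  fix Ch assume "Ch \<noteq> {}" and c: "subset.chain Fam Ch"
  then have "subset.chain {I. ideal I R} Ch" using assms(2) unfolding subset.chain_def by auto
  then have "\<Union>Ch \<in> Ch" by (rule ideal_chain_is_trivial[OF \<open>Ch \<noteq> {}\<close>])
  then show "\<Union>Ch \<in> Fam" using c unfolding subset.chain_def by auto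
 qed
 then show ?thesis using that by (elim bexE) simp
qed

lemma ideal_add_element:
 assumes "cring R" "ideal J R" "y \<in> carrier R"
 defines "J' \<equiv> {j \<oplus>\<^bsub>R\<^esub> y \<otimes>\<^bsub>R\<^esub> r | j r. j \<in> J \<and> r \<in> carrier R}"
 shows "ideal J' R" "J \<subseteq> J'" "y \<in> J'"
proof -
 interpret cring R by fact
 interpret J: ideal J R by fact
 have Jc: "j \<in> carrier R" if "j \<in> J" for j using that J.a_subset by auto
 have z: "\<zero>\<^bsub>R\<^esub> \<in> J" by (rule J.zero_closed)
 show "J \<subseteq> J'"
 proof
  fix j assume j: "j \<in> J"
  then have "j = j \<oplus>\<^bsub>R\<^esub> y \<otimes>\<^bsub>R\<^esub> \<zero>\<^bsub>R\<^esub>" using assms(3) Jc by auto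
  then show "j \<in> J'" unfolding J'_def using j by blast
 qed
 show "y \<in> J'"
 proof -
  have "y = \<zero>\<^bsub>R\<^esub> \<oplus>\<^bsub>R\<^esub> y \<otimes>\<^bsub>R\<^esub> \<one>\<^bsub>R\<^esub>" using assms(3) by simp
  then show ?thesis unfolding J'_def using z by blast
 qed
 have l: "x \<otimes>\<^bsub>R\<^esub> a \<in> J'" if "a \<in> J'" "x \<in> carrier R" for a x
 proof -
  obtain j r where jr: "a = j \<oplus>\<^bsub>R\<^esub> y \<otimes>\<^bsub>R\<^esub> r" "j \<in> J" "r \<in> carrier R" using \<open>a \<in> J'\<close> unfolding J'_def by blast
  have "x \<otimes>\<^bsub>R\<^esub> a = x \<otimes>\<^bsub>R\<^esub> j \<oplus>\<^bsub>R\<^esub> y \<otimes>\<^bsub>R\<^esub> (x \<otimes>\<^bsub>R\<^esub> r)"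
   using jr Jc that(2) assms(3) by (simp add: r_distr m_lcomm)
  then show ?thesis unfolding J'_def using J.I_l_closed[OF jr(2) that(2)] that(2) jr(3) by blast
 qed
 have J'c: "a \<in> carrier R" if "a \<in> J'" for a using that Jc assms(3) unfolding J'_def by auto
 show "ideal J' R"
 proof (rule idealI[OF ring_axioms])
  show "subgroup J' (add_monoid R)"
  proof (rule add.subgroupI)
   show "J' \<subseteq> carrier R" using J'c by auto
   show "J' \<noteq> {}" using \<open>y \<in> J'\<close> by auto
   show "\<ominus>\<^bsub>R\<^esub> a \<in> J'" if "a \<in> J'" for a
    using l[OF that, of "\<ominus>\<^bsub>R\<^esub> \<one>\<^bsub>R\<^esub>"] J'c[OF that] by (simp add: l_minus)
   show "a \<oplus>\<^bsub>R\<^esub> b \<in> J'" if "a \<in> J'" "b \<in> J'" for a b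
   proof -
    obtain j r where jr: "a = j \<oplus>\<^bsub>R\<^esub> y \<otimes>\<^bsub>R\<^esub> r" "j \<in> J" "r \<in> carrier R" using \<open>a \<in> J'\<close> unfolding J'_def by blast
    obtain k s where ks: "b = k \<oplus>\<^bsub>R\<^esub> y \<otimes>\<^bsub>R\<^esub> s" "k \<in> J" "s \<in> carrier R" using \<open>b \<in> J'\<close> unfolding J'_def by blast
    have "a \<oplus>\<^bsub>R\<^esub> b = (j \<oplus>\<^bsub>R\<^esub> k) \<oplus>\<^bsub>R\<^esub> y \<otimes>\<^bsub>R\<^esub> (r \<oplus>\<^bsub>R\<^esub> s)"
     using jr ks Jc assms(3) by (simp add: r_distr a_ac)
    then show ?thesis unfolding J'_def using ideal_add_closed[OF assms(2) jr(2) ks(2)] jr(3) ks(3) by blast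
   qed
  qed
  show "x \<otimes>\<^bsub>R\<^esub> a \<in> J'" if "a \<in> J'" "x \<in> carrier R" for a x by (rule l[OF that])
  show "a \<otimes>\<^bsub>R\<^esub> x \<in> J'" if "a \<in> J'" "x \<in> carrier R" for a x
   using l[OF that] m_comm[OF J'c[OF that(1)] that(2)] by simp
 qed
qed

lemma cone_of_ext_zero:
 fixes C :: "('a, 'm) module"
 assumes N: "noetherian_ring R" and C: "module R C" and J: "ideal J R" and y: "y \<in> carrier R"
  and J': "J' = {j \<oplus>\<^bsub>R\<^esub> y \<otimes>\<^bsub>R\<^esub> r | j r. j \<in> J \<and> r \<in> carrier R}"
  and K: "ideal K R" "K = {r \<in> carrier R. y \<otimes>\<^bsub>R\<^esub> r \<in> J}"
  and v: "ext_zero R J' C (Suc i)"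
 shows "ext_zero R J C i \<Longrightarrow> ext_zero R K C i"
  and "ext_zero R K C (Suc i) \<Longrightarrow> ext_zero R J C (Suc i)"
proof -
 interpret CC: module R C by fact
 note cR = CC.is_cring
 have J'i: "ideal J' R" unfolding J' by (rule ideal_add_element(1)[OF cR J y])
 obtain rF dF eF where F: "ideal_resolution J R (\<lambda>i. free_module R (rF i)) dF eF"
  by (rule Ext_module_eq[OF N cR J]) blast
 obtain rG dG eG where G: "ideal_resolution K R (\<lambda>i. free_module R (rG i)) dG eG"
  by (rule Ext_module_eq[OF N cR K(1)]) blast
 have yK: "y \<otimes>\<^bsub>R\<^esub> r \<in> J" if "r \<in> K" for r using that K(2) by blast
 obtain \<phi> where \<phi>: "\<And>i. linear_map R (free_module R (rG i)) (free_module R (rF i)) (\<phi> i)"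
  "\<And>z. z \<in> carrier (free_module R (rG 0)) \<Longrightarrow> y \<otimes>\<^bsub>R\<^esub> eG z \<ominus>\<^bsub>R\<^esub> eF (\<phi> 0 z) \<in> J"
  "\<And>i z. z \<in> carrier (free_module R (rG (Suc i))) \<Longrightarrow> dF i (\<phi> (Suc i) z) = \<phi> i (dG i z)"
  by (rule chain_map_exists[OF G F y yK]) blast+
 interpret cone J R "\<lambda>i. free_module R (rF i)" dF eF K "\<lambda>i. free_module R (rG i)" dG eG y \<phi>
  by (intro cone.intro F G cone_axioms.intro y K(2) \<phi>)
 note vP = ext_zeroD[OF v C cone_resolution[OF J'i J']]
 show "ext_zero R K C i" if "ext_zero R J C i"
  by (rule ext_zeroI[OF N C G ext_vanishes_kernel[OF C ext_zeroD[OF that C F] vP]])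
 show "ext_zero R J C (Suc i)" if "ext_zero R K C (Suc i)"
  by (rule ext_zeroI[OF N C F ext_vanishes_middle[OF C ext_zeroD[OF that C G] vP]])
qed

text \<open>
 Vanishing of \<open>Ext\<^sup>i\<^sup>+\<^sup>3\<close> on all regular ideals gives vanishing of
 \<open>Ext\<^sup>i\<^sup>+\<^sup>2\<close>. For M itself, write \<open>M = (x) : y\<close>; the principal
 ideal (x) has no higher Ext, and \<open>(x) + yR\<close> is covered by the assumption one degree up. For the
 others take a maximal counterexample K and write \<open>K : y = M\<close>; then R/K is an extension of
 \<open>R/(K + yR)\<close>, which is not a counterexample, by R/M.
\<close>
lemma ext_zero_descend:
 fixes C :: "('a, 'm) module"
 assumes N: "noetherian_ring R" and C: "module R C"
  and M: "ideal M R" "M \<noteq> carrier R" and x: "x \<in> nonzerodivisors R" "PIdl\<^bsub>R\<^esub> x \<noteq> carrier R"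
  and socle: "\<And>J. ideal J R \<Longrightarrow> J \<inter> nonzerodivisors R \<noteq> {} \<Longrightarrow> J \<noteq> carrier R \<Longrightarrow>
   \<exists>y\<in>carrier R. {r \<in> carrier R. y \<otimes>\<^bsub>R\<^esub> r \<in> J} = M"
  and "\<And>J. ideal J R \<Longrightarrow> J \<inter> nonzerodivisors R \<noteq> {} \<Longrightarrow> ext_zero R J C (Suc (Suc i))"
  and J: "ideal J R" "J \<inter> nonzerodivisors R \<noteq> {}"
 shows "ext_zero R J C (Suc i)"
proof (rule ccontr)
 assume "\<not> ext_zero R J C (Suc i)"
 interpret CC: module R C by fact
 note cR = CC.is_cring
 interpret noetherian_ring R by fact
 let ?bad = "{J. ideal J R \<and> J \<inter> nonzerodivisors R \<noteq> {} \<and> \<not> ext_zero R J C (Suc i)}"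
 have xc: "x \<in> carrier R" using x(1) by (simp add: nonzerodivisors_def)
 have Mzero: "ext_zero R M C (Suc i)"
 proof -
  have xI: "x \<in> PIdl\<^bsub>R\<^esub> x" by (rule CC.R.cgenideal_self[OF xc])
  have I: "ideal (PIdl\<^bsub>R\<^esub> x) R" by (rule CC.R.cgenideal_ideal[OF xc])
  obtain y where y: "y \<in> carrier R" "{r \<in> carrier R. y \<otimes>\<^bsub>R\<^esub> r \<in> PIdl\<^bsub>R\<^esub> x} = M"
   using socle[OF I _ x(2)] x(1) xI by auto
  let ?J' = "{j \<oplus>\<^bsub>R\<^esub> y \<otimes>\<^bsub>R\<^esub> r | j r. j \<in> PIdl\<^bsub>R\<^esub> x \<and> r \<in> carrier R}"
  note J' = ideal_add_element[OF cR I y(1)]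
  have "ext_zero R ?J' C (Suc (Suc i))" by (rule assms(8)[OF J'(1)]) (use J'(2) xI x(1) in auto)
  from cone_of_ext_zero(1)[OF N C I y(1) refl M(1) y(2)[symmetric] this ext_zero_principal[OF N cR C x(1)]]
  show ?thesis .
 qed
 have "?bad \<noteq> {}" using J \<open>\<not> ext_zero R J C (Suc i)\<close> by auto
 then obtain K where K: "K \<in> ?bad" "\<And>K'. K' \<in> ?bad \<Longrightarrow> K \<subseteq> K' \<Longrightarrow> K' = K"
  by (rule exists_maximal_ideal_in) auto
 then have KI: "ideal K R" "K \<inter> nonzerodivisors R \<noteq> {}" "\<not> ext_zero R K C (Suc i)" by auto
 have "K \<noteq> carrier R" using KI(3) ext_zero_carrier[OF N cR C] by auto
 then obtain y where y: "y \<in> carrier R" "{r \<in> carrier R. y \<otimes>\<^bsub>R\<^esub> r \<in> K} = M"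
  using socle[OF KI(1,2)] by auto
 let ?J' = "{j \<oplus>\<^bsub>R\<^esub> y \<otimes>\<^bsub>R\<^esub> r | j r. j \<in> K \<and> r \<in> carrier R}"
 note J' = ideal_add_element[OF cR KI(1) y(1)]
 have "y \<notin> K"
 proof
  assume "y \<in> K"
  then have "y \<otimes>\<^bsub>R\<^esub> r \<in> K" if "r \<in> carrier R" for r using ideal.I_r_closed[OF KI(1)] that by blast
  then have "M = carrier R" using y(2) by auto
  then show False using M(2) by simp
 qed
 then have "?J' \<noteq> K" using J'(3) by auto
 then have "?J' \<notin> ?bad" using K(2)[OF _ J'(2)] by blast
 then have "ext_zero R ?J' C (Suc i)" using J'(1,2) KI(2) by blast
 from cone_of_ext_zero(2)[OF N C KI(1) y(1) refl M(1) y(2)[symmetric] this Mzero] KI(3) show False by simp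
qed

lemma ext_zero_of_finite_injective_dim:
 fixes C :: "('a, 'm) module"
 assumes N: "noetherian_ring R" and C: "module R C"
  and M: "ideal M R" "M \<noteq> carrier R" and x: "x \<in> nonzerodivisors R" "PIdl\<^bsub>R\<^esub> x \<noteq> carrier R"
  and socle: "\<And>J. ideal J R \<Longrightarrow> J \<inter> nonzerodivisors R \<noteq> {} \<Longrightarrow> J \<noteq> carrier R \<Longrightarrow>
   \<exists>y\<in>carrier R. {r \<in> carrier R. y \<otimes>\<^bsub>R\<^esub> r \<in> J} = M"
  and inj: "finite_injective_dim R C"
  and J: "ideal J R" "J \<inter> nonzerodivisors R \<noteq> {}"
 shows "ext_zero R J C 1"
proof -
 have cR: "cring R" using C by (rule module.axioms)
 obtain n where n': "\<forall>i>n. \<forall>J. ideal J R \<longrightarrow>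
   carrier (Ext_module R (cyclic_module R J) C i) = {\<zero>\<^bsub>Ext_module R (cyclic_module R J) C i\<^esub>}"
  using inj unfolding finite_injective_dim_def by (rule exE)
 have n: "carrier (Ext_module R (cyclic_module R J) C i) = {\<zero>\<^bsub>Ext_module R (cyclic_module R J) C i\<^esub>}"
  if "i > n" "ideal J R" for i J
  using n' that by simp
 have "ext_zero R J C (Suc i)" if "ideal J R" "J \<inter> nonzerodivisors R \<noteq> {}" "k + i \<ge> n" for k i J
  using that
 proof (induction k arbitrary: i J)
  case 0
  show ?case by (rule ext_zero_of_Ext_module[OF N cR 0(1) C n[OF _ 0(1)]]) (use 0(3) in auto)
 next
  case (Suc k)
  show ?case by (rule ext_zero_descend[OF N C M x socle Suc.IH Suc.prems(1,2)]) (use Suc.prems(3) in auto)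
 qed
 from this[OF J, of n 0] show ?thesis by simp
qed

section \<open>Submodules of a total ring of fractions\<close>

definition stable_subgroup :: "('q, 'd) ring_scheme \<Rightarrow> 'q set \<Rightarrow> 'q set \<Rightarrow> bool" where
 "stable_subgroup Q A H \<longleftrightarrow> H \<subseteq> carrier Q \<and> \<zero>\<^bsub>Q\<^esub> \<in> H \<and>
   (\<forall>x\<in>H. \<forall>y\<in>H. x \<oplus>\<^bsub>Q\<^esub> y \<in> H) \<and> (\<forall>a\<in>A. \<forall>x\<in>H. a \<otimes>\<^bsub>Q\<^esub> x \<in> H)"

lemma stableI:
 assumes "H \<subseteq> carrier Q" "\<zero>\<^bsub>Q\<^esub> \<in> H" "\<And>x y. x \<in> H \<Longrightarrow> y \<in> H \<Longrightarrow> x \<oplus>\<^bsub>Q\<^esub> y \<in> H"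
  "\<And>a x. a \<in> A \<Longrightarrow> x \<in> H \<Longrightarrow> a \<otimes>\<^bsub>Q\<^esub> x \<in> H"
 shows "stable_subgroup Q A H"
 using assms unfolding stable_subgroup_def by blast

lemma stableD:
 assumes "stable_subgroup Q A H"
 shows "x \<in> H \<Longrightarrow> x \<in> carrier Q" "\<zero>\<^bsub>Q\<^esub> \<in> H" "x \<in> H \<Longrightarrow> y \<in> H \<Longrightarrow> x \<oplus>\<^bsub>Q\<^esub> y \<in> H"
  "a \<in> A \<Longrightarrow> x \<in> H \<Longrightarrow> a \<otimes>\<^bsub>Q\<^esub> x \<in> H"
 using assms unfolding stable_subgroup_def by blast+

definition colon :: "('q, 'd) ring_scheme \<Rightarrow> 'q set \<Rightarrow> 'q set \<Rightarrow> 'q set" where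
 "colon Q F G = {q \<in> carrier Q. \<forall>g\<in>G. q \<otimes>\<^bsub>Q\<^esub> g \<in> F}"

text \<open>
 Chains are counted as in the definition of module length, so that the two lengths can be compared by carrying
 over chains.
\<close>
definition quotient_length :: "('q, 'd) ring_scheme \<Rightarrow> 'q set \<Rightarrow> 'q set \<Rightarrow> 'q set \<Rightarrow> enat" where
 "quotient_length Q A F G = Sup {enat n | n. \<exists>N :: nat \<Rightarrow> 'q set.
   (\<forall>i\<le>n. stable_subgroup Q A (N i) \<and> G \<subseteq> N i \<and> N i \<subseteq> F) \<and> (\<forall>i<n. N i \<subset> N (Suc i))}"

text \<open>
 A total ring of fractions up to isomorphism. The explicit construction by classes of fractions is one
 instance; the quadratic extension of Q is another, for the Rees quotient.
\<close>
locale total_quotient = R: cring R + Q: cring Q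
 for R :: "('a, 'b) ring_scheme" and Q :: "('q, 'd) ring_scheme" (structure) +
 fixes \<iota> :: "'a \<Rightarrow> 'q"
 assumes iota_hom: "\<iota> \<in> ring_hom R Q" and iota_inj: "inj_on \<iota> (carrier R)"
  and iota_units: "s \<in> nonzerodivisors R \<Longrightarrow> \<iota> s \<in> Units Q"
  and fractions: "q \<in> carrier Q \<Longrightarrow> \<exists>r\<in>carrier R. \<exists>s\<in>nonzerodivisors R. \<iota> s \<otimes> q = \<iota> r"
begin

lemma iota_simps [simp]:
 "r \<in> carrier R \<Longrightarrow> \<iota> r \<in> carrier Q"
 "r \<in> carrier R \<Longrightarrow> s \<in> carrier R \<Longrightarrow> \<iota> (r \<oplus>\<^bsub>R\<^esub> s) = \<iota> r \<oplus> \<iota> s"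
 "r \<in> carrier R \<Longrightarrow> s \<in> carrier R \<Longrightarrow> \<iota> (r \<otimes>\<^bsub>R\<^esub> s) = \<iota> r \<otimes> \<iota> s"
 "\<iota> \<one>\<^bsub>R\<^esub> = \<one>"
 using iota_hom by (auto simp: ring_hom_def)

sublocale hom: ring_hom_cring R Q \<iota>
 by (intro ring_hom_cring.intro R.is_cring Q.is_cring ring_hom_cring_axioms.intro iota_hom)

abbreviation "A \<equiv> \<iota> ` carrier R"

lemma nzd_closed: "s \<in> nonzerodivisors R \<Longrightarrow> s \<in> carrier R"
 by (simp add: nonzerodivisors_def)

lemma stable_minus:
 assumes "stable_subgroup Q A H" "x \<in> H" shows "\<ominus> x \<in> H"
proof -
 have "\<iota> (\<ominus>\<^bsub>R\<^esub> \<one>\<^bsub>R\<^esub>) \<otimes> x \<in> H" by (rule stableD(4)[OF assms(1) imageI assms(2)]) simp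
 then show ?thesis using stableD(1)[OF assms] by (simp add: Q.l_minus)
qed

lemma stable_diff:
 assumes "stable_subgroup Q A H" "x \<in> H" "y \<in> H" shows "x \<ominus> y \<in> H"
 unfolding Q.minus_eq using stableD(3)[OF assms(1,2) stable_minus[OF assms(1,3)]] .

text \<open>
 \<Theta> induces an isomorphism of H/N with L/C0; chains of submodules are carried over in both directions,
 which avoids naming the isomorphism.
\<close>
lemma module_length_quot:
 fixes H :: "('a, 'm) module"
 assumes H: "module R H"
  and L: "stable_subgroup Q A L" and C0: "stable_subgroup Q A C0" "C0 \<subseteq> L"
  and \<Theta>: "\<And>f. f \<in> carrier H \<Longrightarrow> \<Theta> f \<in> L"
   "\<And>f g. f \<in> carrier H \<Longrightarrow> g \<in> carrier H \<Longrightarrow> \<Theta> (f \<oplus>\<^bsub>H\<^esub> g) = \<Theta> f \<oplus> \<Theta> g"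
   "\<And>r f. r \<in> carrier R \<Longrightarrow> f \<in> carrier H \<Longrightarrow> \<Theta> (r \<odot>\<^bsub>H\<^esub> f) = \<iota> r \<otimes> \<Theta> f"
  and onto: "\<And>q. q \<in> L \<Longrightarrow> \<exists>f\<in>carrier H. q \<ominus> \<Theta> f \<in> C0"
 defines "N \<equiv> {f \<in> carrier H. \<Theta> f \<in> C0}"
 shows "module_length R (quot_module R H N) = quotient_length Q A L C0"
proof -
 interpret H: module R H by fact
 have LQ: "q \<in> carrier Q" if "q \<in> L" for q using stableD(1)[OF L that] .
 have \<Theta>neg: "\<Theta> (\<ominus>\<^bsub>H\<^esub> f) = \<ominus> \<Theta> f" if "f \<in> carrier H" for f
  using \<Theta>(3)[of "\<ominus>\<^bsub>R\<^esub> \<one>\<^bsub>R\<^esub>" f] that LQ[OF \<Theta>(1)] by (simp add: H.smult_l_minus Q.l_minus)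
 have \<Theta>zero: "\<Theta> \<zero>\<^bsub>H\<^esub> = \<zero>" using \<Theta>(3)[of "\<zero>\<^bsub>R\<^esub>" "\<zero>\<^bsub>H\<^esub>"] LQ[OF \<Theta>(1)[OF H.zero_closed]] by simp
 have preimage: "submodule {f \<in> carrier H. \<Theta> f \<in> V} R H" if "stable_subgroup Q A V" for V
  by (rule H.submoduleI) (use stable_minus[OF that] stableD[OF that] \<Theta> \<Theta>neg \<Theta>zero in auto)
 have N: "submodule N R H" unfolding N_def by (rule preimage[OF C0(1)])
 let ?M = "quot_module R H N"
 have mM: "module R ?M" and lq: "linear_map R H ?M (\<lambda>x. N +>\<^bsub>H\<^esub> x)" by (rule quot_module_module[OF H N])+
 interpret M: module R ?M by (rule mM)
 note aN = submodule_abelian_subgroup[OF H N]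
 have coset_eq: "N +>\<^bsub>H\<^esub> f = N +>\<^bsub>H\<^esub> g \<longleftrightarrow> \<Theta> f \<ominus> \<Theta> g \<in> C0" if fg: "f \<in> carrier H" "g \<in> carrier H" for f g
 proof -
  have "f \<ominus>\<^bsub>H\<^esub> g \<in> N \<longleftrightarrow> \<Theta> (f \<ominus>\<^bsub>H\<^esub> g) \<in> C0" using fg by (simp add: N_def)
  also have "\<Theta> (f \<ominus>\<^bsub>H\<^esub> g) = \<Theta> f \<ominus> \<Theta> g" using fg by (simp add: H.minus_eq Q.minus_eq \<Theta>(2) \<Theta>neg)
  finally show ?thesis using a_rcos_eq_iff[OF aN fg] by simp
 qed
 have M_car: "\<exists>f\<in>carrier H. U = N +>\<^bsub>H\<^esub> f" if "U \<in> carrier ?M" for U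
  using that by (auto simp: quot_module_simps A_RCOSETS_def')
 define down where "down = (\<lambda>U. {q \<in> L. \<exists>f\<in>carrier H. N +>\<^bsub>H\<^esub> f \<in> U \<and> q \<ominus> \<Theta> f \<in> C0})"
 define up where "up = (\<lambda>V. (\<lambda>f. N +>\<^bsub>H\<^esub> f) ` {f \<in> carrier H. \<Theta> f \<in> V})"
 note add_q = linear_mapD(2)[OF lq, symmetric] and smult_q = linear_mapD(3)[OF lq, symmetric]
 have Uz: "\<zero>\<^bsub>?M\<^esub> \<in> U" if "submodule U R ?M" for U
  using subgroup.one_closed[OF submodule.axioms(1)[OF that]] by simp
 have down_stable: "stable_subgroup Q A (down U) \<and> C0 \<subseteq> down U \<and> down U \<subseteq> L" if U: "submodule U R ?M" for U
 proof (intro conjI)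
  note E = M.submoduleE[OF U]
  have z: "N +>\<^bsub>H\<^esub> \<zero>\<^bsub>H\<^esub> \<in> U" using Uz[OF U] linear_map_zero[OF H mM lq] by simp
  show C0d: "C0 \<subseteq> down U"
  proof
   fix q assume q: "q \<in> C0"
   have "q \<ominus> \<Theta> \<zero>\<^bsub>H\<^esub> \<in> C0" using q stableD(1)[OF C0(1) q] \<Theta>zero by (simp add: Q.minus_eq)
   then show "q \<in> down U" unfolding down_def using q C0(2) z H.zero_closed by blast
  qed
  show "down U \<subseteq> L" unfolding down_def by blast
  show "stable_subgroup Q A (down U)"
  proof (rule stableI)
   show "down U \<subseteq> carrier Q" using LQ unfolding down_def by blast
   show "\<zero> \<in> down U" using C0d stableD(2)[OF C0(1)] by blast
  next
   fix p q assume "p \<in> down U" "q \<in> down U"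
   then obtain f g where f: "f \<in> carrier H" "N +>\<^bsub>H\<^esub> f \<in> U" "p \<ominus> \<Theta> f \<in> C0" "p \<in> L"
    and g: "g \<in> carrier H" "N +>\<^bsub>H\<^esub> g \<in> U" "q \<ominus> \<Theta> g \<in> C0" "q \<in> L" unfolding down_def by blast
   have "(p \<oplus> q) \<ominus> \<Theta> (f \<oplus>\<^bsub>H\<^esub> g) = (p \<ominus> \<Theta> f) \<oplus> (q \<ominus> \<Theta> g)"
    unfolding \<Theta>(2)[OF f(1) g(1)] using LQ[OF f(4)] LQ[OF g(4)] LQ[OF \<Theta>(1)[OF f(1)]] LQ[OF \<Theta>(1)[OF g(1)]] by algebra
   moreover have "N +>\<^bsub>H\<^esub> (f \<oplus>\<^bsub>H\<^esub> g) \<in> U" using E(5)[OF f(2) g(2)] add_q[OF f(1) g(1)] by simp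
   ultimately show "p \<oplus> q \<in> down U" unfolding down_def
    using stableD(3)[OF C0(1) f(3) g(3)] stableD(3)[OF L f(4) g(4)] f(1) g(1) by auto
  next
   fix a q assume "a \<in> A" "q \<in> down U"
   then obtain r f where r: "r \<in> carrier R" "a = \<iota> r"
    and f: "f \<in> carrier H" "N +>\<^bsub>H\<^esub> f \<in> U" "q \<ominus> \<Theta> f \<in> C0" "q \<in> L" unfolding down_def by blast
   have "a \<otimes> q \<ominus> \<Theta> (r \<odot>\<^bsub>H\<^esub> f) = a \<otimes> (q \<ominus> \<Theta> f)"
    unfolding \<Theta>(3)[OF r(1) f(1)] r(2) using iota_simps(1)[OF r(1)] LQ[OF f(4)] LQ[OF \<Theta>(1)[OF f(1)]] by algebra
   moreover have "N +>\<^bsub>H\<^esub> (r \<odot>\<^bsub>H\<^esub> f) \<in> U" using E(4)[OF r(1) f(2)] smult_q[OF r(1) f(1)] by simp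
   ultimately show "a \<otimes> q \<in> down U" unfolding down_def
    using stableD(4)[OF C0(1) \<open>a \<in> A\<close> f(3)] stableD(4)[OF L \<open>a \<in> A\<close> f(4)] r(1) f(1) by auto
  qed
 qed
 have down_strict: "down U \<subset> down U'" if U: "submodule U R ?M" "submodule U' R ?M" "U \<subset> U'" for U U'
 proof -
  have "down U \<subseteq> down U'" using U(3) unfolding down_def by blast
  moreover obtain W where W: "W \<in> U'" "W \<notin> U" using U(3) by blast
  obtain f where f: "f \<in> carrier H" "W = N +>\<^bsub>H\<^esub> f" using M_car W(1) M.submoduleE(1)[OF U(2)] by blast
  have "\<Theta> f \<ominus> \<Theta> f = \<zero>" using LQ[OF \<Theta>(1)[OF f(1)]] by (simp add: Q.minus_eq Q.r_neg)
  then have "\<Theta> f \<in> down U'" unfolding down_def using f W(1) \<Theta>(1)[OF f(1)] stableD(2)[OF C0(1)] by auto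
  moreover have "\<Theta> f \<notin> down U"
  proof
   assume "\<Theta> f \<in> down U"
   then obtain g where g: "g \<in> carrier H" "N +>\<^bsub>H\<^esub> g \<in> U" "\<Theta> f \<ominus> \<Theta> g \<in> C0" unfolding down_def by blast
   then have "N +>\<^bsub>H\<^esub> f = N +>\<^bsub>H\<^esub> g" using coset_eq[OF f(1) g(1)] by simp
   then show False using W(2) f(2) g(2) by simp
  qed
  ultimately show ?thesis by blast
 qed
 have up_sub: "submodule (up V) R ?M" if V: "stable_subgroup Q A V" for V
  unfolding up_def
  by (rule linear_map_image_submodule[OF H mM lq preimage[OF V]])
 have up_strict: "up V \<subset> up V'" if V: "stable_subgroup Q A V" "C0 \<subseteq> V" "stable_subgroup Q A V'" "V' \<subseteq> L" "V \<subset> V'" for V V'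
 proof -
  have "up V \<subseteq> up V'" using V(5) unfolding up_def by blast
  moreover obtain q where q: "q \<in> V'" "q \<notin> V" using V(5) by blast
  obtain f where f: "f \<in> carrier H" "q \<ominus> \<Theta> f \<in> C0" using onto q(1) V(4) by blast
  have qf: "q \<in> carrier Q" "\<Theta> f \<in> carrier Q" using LQ q(1) V(4) \<Theta>(1)[OF f(1)] by blast+
  have "q \<ominus> (q \<ominus> \<Theta> f) = \<Theta> f" using qf by algebra
  then have "\<Theta> f \<in> V'" using stable_diff[OF V(3) q(1), of "q \<ominus> \<Theta> f"] f(2) V(2,5) by auto
  then have "N +>\<^bsub>H\<^esub> f \<in> up V'" unfolding up_def using f(1) by blast
  moreover have "N +>\<^bsub>H\<^esub> f \<notin> up V"
  proof
   assume "N +>\<^bsub>H\<^esub> f \<in> up V"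
   then obtain g where g: "g \<in> carrier H" "\<Theta> g \<in> V" "N +>\<^bsub>H\<^esub> f = N +>\<^bsub>H\<^esub> g" unfolding up_def by blast
   have gq: "\<Theta> g \<in> carrier Q" using LQ[OF \<Theta>(1)[OF g(1)]] .
   have 1: "\<Theta> f \<ominus> \<Theta> g \<in> V" using coset_eq[OF f(1) g(1)] g(3) V(2) by blast
   have 2: "q \<ominus> \<Theta> f \<in> V" using f(2) V(2) by blast
   have "(q \<ominus> \<Theta> f) \<oplus> ((\<Theta> f \<ominus> \<Theta> g) \<oplus> \<Theta> g) = q" using qf gq by algebra
   then have "q \<in> V" using stableD(3)[OF V(1) 2 stableD(3)[OF V(1) 1 g(2)]] by simp
   then show False using q(2) by simp
  qed
  ultimately show ?thesis by blast
 qed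
 have "(\<exists>S :: nat \<Rightarrow> 'm set set. (\<forall>i\<le>n. submodule (S i) R ?M) \<and> (\<forall>i<n. S i \<subset> S (Suc i))) \<longleftrightarrow>
   (\<exists>S :: nat \<Rightarrow> 'q set. (\<forall>i\<le>n. stable_subgroup Q A (S i) \<and> C0 \<subseteq> S i \<and> S i \<subseteq> L) \<and> (\<forall>i<n. S i \<subset> S (Suc i)))" (is "?l \<longleftrightarrow> ?r") for n
 proof
  assume ?l
  then obtain S where S: "\<And>i. i \<le> n \<Longrightarrow> submodule (S i) R ?M" "\<And>i. i < n \<Longrightarrow> S i \<subset> S (Suc i)" by blast
  show ?r by (intro exI[of _ "\<lambda>i. down (S i)"]) (use S down_stable down_strict in auto)
 next
  assume ?r
  then obtain S where S: "\<And>i. i \<le> n \<Longrightarrow> stable_subgroup Q A (S i)" "\<And>i. i \<le> n \<Longrightarrow> C0 \<subseteq> S i" "\<And>i. i \<le> n \<Longrightarrow> S i \<subseteq> L"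
    "\<And>i. i < n \<Longrightarrow> S i \<subset> S (Suc i)" by blast
  show ?l by (intro exI[of _ "\<lambda>i. up (S i)"]) (use S up_sub up_strict in auto)
 qed
 then show ?thesis unfolding module_length_def quotient_length_def by simp
qed

end

text \<open>
 Covers R itself as well as a fractional ideal in any model of the total ring of fractions.
\<close>
locale embedded_module = total_quotient R Q \<iota> + C: module R C
 for R :: "('a, 'b) ring_scheme" and Q :: "('q, 'd) ring_scheme" (structure) and \<iota> and C :: "('a, 'm) module" +
 fixes j :: "'m \<Rightarrow> 'q"
 assumes j_closed [simp]: "c \<in> carrier C \<Longrightarrow> j c \<in> carrier Q"
  and j_add: "c \<in> carrier C \<Longrightarrow> c' \<in> carrier C \<Longrightarrow> j (c \<oplus>\<^bsub>C\<^esub> c') = j c \<oplus> j c'"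
  and j_smult: "r \<in> carrier R \<Longrightarrow> c \<in> carrier C \<Longrightarrow> j (r \<odot>\<^bsub>C\<^esub> c) = \<iota> r \<otimes> j c"
  and j_inj: "inj_on j (carrier C)"
begin

abbreviation "CC \<equiv> j ` carrier C"

lemma j_zero: "j \<zero>\<^bsub>C\<^esub> = \<zero>"
 using j_smult[of "\<zero>\<^bsub>R\<^esub>" "\<zero>\<^bsub>C\<^esub>"] by simp

lemma j_neg: "c \<in> carrier C \<Longrightarrow> j (\<ominus>\<^bsub>C\<^esub> c) = \<ominus> j c"
 using j_smult[of "\<ominus>\<^bsub>R\<^esub> \<one>\<^bsub>R\<^esub>" c] by (simp add: C.smult_l_minus Q.l_minus)

lemma CC_stable: "stable_subgroup Q A CC"
proof (rule stableI)
 show "\<zero> \<in> CC" using j_zero by (metis C.zero_closed image_eqI)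
 show "x \<oplus> y \<in> CC" if "x \<in> CC" "y \<in> CC" for x y
  using that by (auto simp flip: j_add)
 show "a \<otimes> x \<in> CC" if "a \<in> A" "x \<in> CC" for a x
  using that by (auto simp flip: j_smult)
qed auto

lemma preimage_linear:
 assumes M: "module R M" and f: "\<And>z. z \<in> carrier M \<Longrightarrow> f z \<in> CC"
  "\<And>z w. z \<in> carrier M \<Longrightarrow> w \<in> carrier M \<Longrightarrow> f (z \<oplus>\<^bsub>M\<^esub> w) = f z \<oplus> f w"
  "\<And>r z. r \<in> carrier R \<Longrightarrow> z \<in> carrier M \<Longrightarrow> f (r \<odot>\<^bsub>M\<^esub> z) = \<iota> r \<otimes> f z"
 obtains g where "linear_map R M C g" "\<And>z. z \<in> carrier M \<Longrightarrow> j (g z) = f z"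
proof -
 interpret M: module R M by fact
 define g where "g = (\<lambda>z. inv_into (carrier C) j (f z))"
 have g: "g z \<in> carrier C" "j (g z) = f z" if "z \<in> carrier M" for z
  using inv_into_into[OF f(1)[OF that]] f_inv_into_f[OF f(1)[OF that]] unfolding g_def by auto
 have "linear_map R M C g"
 proof (rule linear_mapI)
  show "g (z \<oplus>\<^bsub>M\<^esub> w) = g z \<oplus>\<^bsub>C\<^esub> g w" if "z \<in> carrier M" "w \<in> carrier M" for z w
   by (rule inj_onD[OF j_inj]) (use that g f j_add in auto)
  show "g (r \<odot>\<^bsub>M\<^esub> z) = r \<odot>\<^bsub>C\<^esub> g z" if "r \<in> carrier R" "z \<in> carrier M" for r z
   by (rule inj_onD[OF j_inj]) (use that g f j_smult in auto)
 qed (rule g)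
 then show ?thesis using g that by blast
qed
end

section \<open>The first Ext group as a colon quotient\<close>

lemma hom_module_simps:
 "carrier (hom_module R M N) = module_hom R M N"
 "\<zero>\<^bsub>hom_module R M N\<^esub> = (\<lambda>x\<in>carrier M. \<zero>\<^bsub>N\<^esub>)"
 "f \<oplus>\<^bsub>hom_module R M N\<^esub> g = (\<lambda>x\<in>carrier M. f x \<oplus>\<^bsub>N\<^esub> g x)"
 "r \<odot>\<^bsub>hom_module R M N\<^esub> f = (\<lambda>x\<in>carrier M. r \<odot>\<^bsub>N\<^esub> f x)"
 by (simp_all add: hom_module_def)

lemma hom_module_module:
 assumes "module R M" "module R N"
 shows "module R (hom_module R M N)"
proof (rule pointwise_module[OF assms(2)])
 interpret M: module R M by fact
 interpret N: module R N by fact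
 have lin: "linear_map R M N f" if "f \<in> carrier (hom_module R M N)" for f
  using that by (simp add: hom_module_simps module_hom_iff)
 have mem: "restrict f (carrier M) \<in> carrier (hom_module R M N)" if "linear_map R M N f" for f
  using linear_map_restrict[OF assms(1) that] by (simp add: hom_module_simps)
 show "carrier (hom_module R M N) \<subseteq> carrier M \<rightarrow>\<^sub>E carrier N"
  by (auto simp: hom_module_simps module_hom_def)
 show "\<zero>\<^bsub>hom_module R M N\<^esub> \<in> carrier (hom_module R M N)"
  unfolding hom_module_simps(2) by (rule mem[OF linear_map_zero_map[OF assms]])
 fix f assume f: "f \<in> carrier (hom_module R M N)"
 show "r \<odot>\<^bsub>hom_module R M N\<^esub> f \<in> carrier (hom_module R M N)" if "r \<in> carrier R" for r
  unfolding hom_module_simps(4) by (rule mem, rule linear_mapI) (use that linear_mapD[OF lin[OF f]] in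
    \<open>auto simp: N.smult_r_distr simp flip: N.smult_assoc1 simp: M.R.m_comm\<close>)
 show "f \<oplus>\<^bsub>hom_module R M N\<^esub> g \<in> carrier (hom_module R M N)" if "g \<in> carrier (hom_module R M N)" for g
  unfolding hom_module_simps(3) by (rule mem[OF linear_map_add[OF assms lin[OF f] lin[OF that]]])
qed (simp_all add: hom_module_simps)

lemma ext_cocycles_submodule:
 assumes "module R (free_module R (rk i))" "module R C"
  and d: "\<And>z. z \<in> carrier (free_module R (rk (Suc i))) \<Longrightarrow> d i z \<in> carrier (free_module R (rk i))"
 shows "submodule (ext_cocycles R C rk d i) R (hom_module R (free_module R (rk i)) C)"
proof -
 let ?F = "free_module R (rk i)"
 interpret C: module R C by fact
 interpret H: module R "hom_module R ?F C" by (rule hom_module_module[OF assms(1,2)])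
 have neg: "(\<ominus>\<^bsub>hom_module R ?F C\<^esub> f) z = \<ominus>\<^bsub>C\<^esub> f z" if "f \<in> module_hom R ?F C" "z \<in> carrier ?F" for f z
 proof -
  have f: "f \<in> carrier (hom_module R ?F C)" using that by (simp add: hom_module_simps)
  have "\<ominus>\<^bsub>hom_module R ?F C\<^esub> f = (\<ominus>\<^bsub>R\<^esub> \<one>\<^bsub>R\<^esub>) \<odot>\<^bsub>hom_module R ?F C\<^esub> f"
   using H.smult_l_minus[OF _ f, of "\<one>\<^bsub>R\<^esub>"] H.smult_one[OF f] by simp
  then have "(\<ominus>\<^bsub>hom_module R ?F C\<^esub> f) z = (\<ominus>\<^bsub>R\<^esub> \<one>\<^bsub>R\<^esub>) \<odot>\<^bsub>C\<^esub> f z" using that(2) by (simp add: hom_module_simps)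
  also have "\<dots> = \<ominus>\<^bsub>C\<^esub> f z" using that linear_mapD(1)[of R ?F C f z] by (simp add: C.smult_l_minus module_hom_iff del: free_module_simps)
  finally show ?thesis .
 qed
 show ?thesis
 proof (rule H.submoduleI)
  show "ext_cocycles R C rk d i \<subseteq> carrier (hom_module R ?F C)"
   by (auto simp: ext_cocycles_def hom_module_simps)
  show "\<zero>\<^bsub>hom_module R ?F C\<^esub> \<in> ext_cocycles R C rk d i"
   using H.zero_closed d unfolding ext_cocycles_def by (simp add: hom_module_simps del: free_module_simps)
  show "\<ominus>\<^bsub>hom_module R ?F C\<^esub> f \<in> ext_cocycles R C rk d i" if "f \<in> ext_cocycles R C rk d i" for f
  proof -
   have f: "f \<in> module_hom R ?F C" "\<And>x. x \<in> carrier (free_module R (rk (Suc i))) \<Longrightarrow> f (d i x) = \<zero>\<^bsub>C\<^esub>"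
    using that by (auto simp: ext_cocycles_def)
   have "\<ominus>\<^bsub>hom_module R ?F C\<^esub> f \<in> module_hom R ?F C" using H.a_inv_closed[of f] f(1) by (simp add: hom_module_simps)
   then show ?thesis unfolding ext_cocycles_def using f neg[OF f(1) d] by (simp del: free_module_simps)
  qed
  show "f \<oplus>\<^bsub>hom_module R ?F C\<^esub> g \<in> ext_cocycles R C rk d i"
   if "f \<in> ext_cocycles R C rk d i" "g \<in> ext_cocycles R C rk d i" for f g
   using that H.a_closed[of f g] d unfolding ext_cocycles_def by (simp add: hom_module_simps del: free_module_simps)
  show "r \<odot>\<^bsub>hom_module R ?F C\<^esub> f \<in> ext_cocycles R C rk d i"
   if "r \<in> carrier R" "f \<in> ext_cocycles R C rk d i" for r f
   using that H.smult_closed[of r f] d unfolding ext_cocycles_def by (simp add: hom_module_simps del: free_module_simps)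
 qed
qed

text \<open>
 A cocycle vanishes on cycles, so its value at p depends only on d 0 p. Consequently values at elements with
 proportional boundaries are proportional.
\<close>
lemma (in total_quotient) cocycle_values:
 assumes res: "ideal_resolution J R P d \<epsilon>"
  and \<theta>: "\<And>p. p \<in> carrier (P (Suc 0)) \<Longrightarrow> \<theta> p \<in> carrier Q"
   "\<And>p q. p \<in> carrier (P (Suc 0)) \<Longrightarrow> q \<in> carrier (P (Suc 0)) \<Longrightarrow> \<theta> (p \<oplus>\<^bsub>P (Suc 0)\<^esub> q) = \<theta> p \<oplus> \<theta> q"
   "\<And>r p. r \<in> carrier R \<Longrightarrow> p \<in> carrier (P (Suc 0)) \<Longrightarrow> \<theta> (r \<odot>\<^bsub>P (Suc 0)\<^esub> p) = \<iota> r \<otimes> \<theta> p"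
   "\<And>z. z \<in> carrier (P (Suc (Suc 0))) \<Longrightarrow> \<theta> (d (Suc 0) z) = \<zero>"
  and p: "p \<in> carrier (P (Suc 0))" and q: "q \<in> carrier (P (Suc 0))"
 shows "d 0 p = d 0 q \<Longrightarrow> \<theta> p = \<theta> q"
  and "u \<in> carrier (P 0) \<Longrightarrow> r \<in> carrier R \<Longrightarrow> s \<in> carrier R \<Longrightarrow> d 0 p = r \<odot>\<^bsub>P 0\<^esub> u \<Longrightarrow> d 0 q = s \<odot>\<^bsub>P 0\<^esub> u \<Longrightarrow>
   \<iota> s \<otimes> \<theta> p = \<iota> r \<otimes> \<theta> q"
proof -
 interpret P: ideal_resolution J R P d \<epsilon> by (rule res)
 interpret P0: module R "P 0" by (rule P.module_P)
 interpret P1: module R "P (Suc 0)" by (rule P.module_P)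
 have val: "\<theta> p = \<theta> q" if p: "p \<in> carrier (P (Suc 0))" and q: "q \<in> carrier (P (Suc 0))" and eq: "d 0 p = d 0 q" for p q
 proof -
  have "d 0 (p \<ominus>\<^bsub>P (Suc 0)\<^esub> q) = \<zero>\<^bsub>P 0\<^esub>"
   using p q P.d_closed[OF q] eq by (simp add: linear_map_diff[OF P.module_P P.module_P P.linear_d] P0.minus_eq P0.r_neg)
  then have "p \<ominus>\<^bsub>P (Suc 0)\<^esub> q \<in> d (Suc 0) ` carrier (P (Suc (Suc 0)))" unfolding P.exact_Suc using p q by simp
  then have "\<theta> (p \<ominus>\<^bsub>P (Suc 0)\<^esub> q) = \<zero>" using \<theta>(4) by (elim imageE) simp
  moreover have "p \<ominus>\<^bsub>P (Suc 0)\<^esub> q = p \<oplus>\<^bsub>P (Suc 0)\<^esub> (\<ominus>\<^bsub>R\<^esub> \<one>\<^bsub>R\<^esub>) \<odot>\<^bsub>P (Suc 0)\<^esub> q"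
   using q by (simp add: P1.minus_eq P1.smult_l_minus)
  ultimately have "\<theta> p \<ominus> \<theta> q = \<zero>" using p q \<theta>(1-3) by (simp add: Q.l_minus Q.minus_eq)
  then show ?thesis by (rule Q.minus_eq_zeroD[OF \<theta>(1)[OF p] \<theta>(1)[OF q]])
 qed
 show "d 0 p = d 0 q \<Longrightarrow> \<theta> p = \<theta> q" by (rule val[OF p q])
 assume u: "u \<in> carrier (P 0)" "r \<in> carrier R" "s \<in> carrier R" "d 0 p = r \<odot>\<^bsub>P 0\<^esub> u" "d 0 q = s \<odot>\<^bsub>P 0\<^esub> u"
 have "\<theta> (s \<odot>\<^bsub>P (Suc 0)\<^esub> p) = \<theta> (r \<odot>\<^bsub>P (Suc 0)\<^esub> q)"
  by (rule val) (use p q u in \<open>simp_all add: linear_mapD(3)[OF P.linear_d] R.m_comm flip: P0.smult_assoc1\<close>)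
 then show "\<iota> s \<otimes> \<theta> p = \<iota> r \<otimes> \<theta> q" using p q u \<theta>(3) by simp
qed

context embedded_module
begin

lemma colon_stable:
 assumes "stable_subgroup Q A F" "G \<subseteq> carrier Q" shows "stable_subgroup Q A (colon Q F G)"
proof (rule stableI)
 show "colon Q F G \<subseteq> carrier Q" by (auto simp: colon_def)
 show "\<zero> \<in> colon Q F G" using assms stableD(2)[OF assms(1)] by (auto simp: colon_def)
 show "x \<oplus> y \<in> colon Q F G" if "x \<in> colon Q F G" "y \<in> colon Q F G" for x y
  using that assms stableD(3)[OF assms(1)] by (auto simp: colon_def Q.l_distr subset_iff)
 show "a \<otimes> x \<in> colon Q F G" if "a \<in> A" "x \<in> colon Q F G" for a x
  using that assms stableD(4)[OF assms(1)] by (auto simp: colon_def Q.m_assoc subset_iff)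
qed

text \<open>
 Up to coboundaries, a cocycle f in degree one is a homomorphism from J to C, and since J contains a
 nonzerodivisor x, such a homomorphism is multiplication by an element of C : J. Concretely, fix u with
 \<open>\<epsilon> u \<equiv> 1\<close> modulo J and p with \<open>d 0 p = xu\<close>; the element is
 \<open>f p / x\<close>. Coboundaries correspond to elements of C.
\<close>
lemma ext1_length:
 assumes "noetherian_ring R" "ideal J R" and x: "x \<in> J" "x \<in> nonzerodivisors R"
 shows "module_length R (Ext_module R (cyclic_module R J) C 1) =
  quotient_length Q A (colon Q CC (\<iota> ` J)) CC"
proof -
 obtain rk d \<epsilon> where res: "ideal_resolution J R (\<lambda>i. free_module R (rk i)) d \<epsilon>"
  and d: "\<And>i. d i \<in> module_hom R (free_module R (rk (Suc i))) (free_module R (rk i))"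
  and Ext: "\<And>(C :: ('a, 'm) module) i. Ext_module R (cyclic_module R J) C i = quot_module R
      ((hom_module R (free_module R (rk i)) C)\<lparr>carrier := ext_cocycles R C rk d i\<rparr>)
      (ext_coboundaries R C rk d i)"
  by (rule Ext_module_eq[OF assms(1) R.is_cring assms(2)]) blast
 define P where "P = (\<lambda>i. free_module R (rk i))"
 interpret P: ideal_resolution J R P d \<epsilon> using res unfolding P_def .
 note ecar = P.e_closed
 have eadd: "\<epsilon> (z \<oplus>\<^bsub>P 0\<^esub> w) = \<epsilon> z \<oplus>\<^bsub>R\<^esub> \<epsilon> w" "\<epsilon> (r \<odot>\<^bsub>P 0\<^esub> z) = r \<otimes>\<^bsub>R\<^esub> \<epsilon> z"
  if "z \<in> carrier (P 0)" "w \<in> carrier (P 0)" "r \<in> carrier R" for z w r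
  using linear_mapD(2,3)[OF P.linear_e] that by simp_all
 interpret P0: module R "P 0" by (rule P.module_P)
 interpret P1: module R "P (Suc 0)" by (rule P.module_P)
 have xR: "x \<in> carrier R" using x(2) nzd_closed by simp
 have xU: "\<iota> x \<in> Units Q" by (rule iota_units[OF x(2)])
 define xi where "xi = inv (\<iota> x)"
 have xi: "xi \<in> carrier Q" "xi \<otimes> \<iota> x = \<one>" unfolding xi_def using xU by auto
 have xi_cancel: "xi \<otimes> (\<iota> x \<otimes> q) = q" if "q \<in> carrier Q" for q
  using xi that xR by (simp flip: Q.m_assoc)
 \<comment> \<open>u represents 1 in R/J; \<open>\<epsilon> u = 1\<close> cannot be expected for a general J.\<close>
 obtain u where u: "u \<in> carrier (P 0)" "\<one>\<^bsub>R\<^esub> \<ominus>\<^bsub>R\<^esub> \<epsilon> u \<in> J" using P.onto_mod[of "\<one>\<^bsub>R\<^esub>"] by auto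
 have J_lift: "\<exists>p\<in>carrier (P (Suc 0)). d 0 p = z" if "z \<in> carrier (P 0)" "\<epsilon> z \<in> J" for z
  using P.exact_0 that by (metis (mono_tags, lifting) imageE mem_Collect_eq)
 have JR: "r \<in> carrier R" if "r \<in> J" for r using that P.a_subset by blast
 have smult_lift: "\<exists>p\<in>carrier (P (Suc 0)). d 0 p = r \<odot>\<^bsub>P 0\<^esub> z" if "z \<in> carrier (P 0)" "r \<in> J" for r z
  by (rule J_lift) (use that JR eadd P.I_r_closed in auto)
 obtain p where p: "p \<in> carrier (P (Suc 0))" "d 0 p = x \<odot>\<^bsub>P 0\<^esub> u" using smult_lift[OF u(1) x(1)] by blast
 let ?H = "(hom_module R (P 1) C)\<lparr>carrier := ext_cocycles R C rk d 1\<rparr>"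
 let ?N = "ext_coboundaries R C rk d 1"
 let ?L = "colon Q CC (\<iota> ` J)"
 have sub: "submodule (ext_cocycles R C rk d 1) R (hom_module R (P 1) C)"
  unfolding P_def by (rule ext_cocycles_submodule)
   (use P.module_P C.module_axioms P.d_closed in \<open>auto simp: P_def simp del: free_module_simps\<close>)
 have mH: "module R ?H"
  by (rule submodule.submodule_is_module[OF sub hom_module_module[OF P.module_P C.module_axioms]])
 have Hlin: "linear_map R (P (Suc 0)) C f" and Hco: "\<And>z. z \<in> carrier (P (Suc (Suc 0))) \<Longrightarrow> f (d (Suc 0) z) = \<zero>\<^bsub>C\<^esub>"
  if "f \<in> carrier ?H" for f
  using that by (auto simp: ext_cocycles_def module_hom_iff P_def simp del: free_module_simps)
 have fc: "f z \<in> carrier C" if "f \<in> carrier ?H" "z \<in> carrier (P (Suc 0))" for f z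
  using linear_mapD(1)[OF Hlin[OF that(1)] that(2)] .
 have fr: "j (f (r \<odot>\<^bsub>P (Suc 0)\<^esub> z)) = \<iota> r \<otimes> j (f z)" if "f \<in> carrier ?H" "z \<in> carrier (P (Suc 0))" "r \<in> carrier R" for f z r
  using linear_mapD(3)[OF Hlin[OF that(1)] that(3,2)] j_smult[OF that(3) fc[OF that(1,2)]] by simp
 have fa: "j (f (z \<oplus>\<^bsub>P (Suc 0)\<^esub> w)) = j (f z) \<oplus> j (f w)"
  if "f \<in> carrier ?H" "z \<in> carrier (P (Suc 0))" "w \<in> carrier (P (Suc 0))" for f z w
  using linear_mapD(2)[OF Hlin[OF that(1)] that(2,3)] fc[OF that(1)] that(2,3) by (simp add: j_add)
 have f0: "j (f (d (Suc 0) z)) = \<zero>" if "f \<in> carrier ?H" "z \<in> carrier (P (Suc (Suc 0)))" for f z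
  using Hco[OF that] j_zero by simp
 have cocycle_eq: "j (f z) = j (f w)"
  if "f \<in> carrier ?H" "z \<in> carrier (P (Suc 0))" "w \<in> carrier (P (Suc 0))" "d 0 z = d 0 w" for f z w
  by (rule cocycle_values(1)[OF P.ideal_resolution_axioms, where \<theta> = "\<lambda>z. j (f z)"])
   (use that fc fa fr f0 in simp_all)
 have dr: "d 0 (r \<odot>\<^bsub>P (Suc 0)\<^esub> z) = r \<odot>\<^bsub>P 0\<^esub> d 0 z" if "z \<in> carrier (P (Suc 0))" "r \<in> carrier R" for r z
  using linear_mapD(3)[OF P.linear_d that(2,1)] .
 define \<Theta> where "\<Theta> = (\<lambda>f. xi \<otimes> j (f p))"
 have L: "stable_subgroup Q A ?L" by (rule colon_stable[OF CC_stable]) (use JR in auto)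
 have CL: "CC \<subseteq> ?L"
  using stableD(4)[OF CC_stable] JR by (auto simp: colon_def Q.m_comm)
 have \<Theta>L: "\<Theta> f \<in> ?L" if f: "f \<in> carrier ?H" for f
  unfolding colon_def
 proof (intro CollectI conjI ballI)
  show "\<Theta> f \<in> carrier Q" unfolding \<Theta>_def using xi fc[OF f p(1)] by simp
  fix g assume "g \<in> \<iota> ` J"
  then obtain r where r: "r \<in> J" "g = \<iota> r" by blast
  obtain pr where pr: "pr \<in> carrier (P (Suc 0))" "d 0 pr = r \<odot>\<^bsub>P 0\<^esub> u" using smult_lift[OF u(1) r(1)] by blast
  have "\<iota> r \<otimes> j (f p) = \<iota> x \<otimes> j (f pr)"
   by (rule cocycle_values(2)[OF P.ideal_resolution_axioms, where \<theta> = "\<lambda>z. j (f z)"])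
    (use f p pr u(1) xR JR[OF r(1)] fc fa fr f0 in simp_all)
  moreover have "\<Theta> f \<otimes> \<iota> r = xi \<otimes> (\<iota> r \<otimes> j (f p))"
   unfolding \<Theta>_def using xi fc[OF f p(1)] JR[OF r(1)] by (simp add: Q.m_ac)
  ultimately have "\<Theta> f \<otimes> \<iota> r = j (f pr)" using xi_cancel fc[OF f pr(1)] by simp
  then show "\<Theta> f \<otimes> g \<in> CC" using r fc[OF f pr(1)] by simp
 qed
 have \<Theta>add: "\<Theta> (f \<oplus>\<^bsub>?H\<^esub> g) = \<Theta> f \<oplus> \<Theta> g" if "f \<in> carrier ?H" "g \<in> carrier ?H" for f g
  using p(1) xi fc[OF that(1) p(1)] fc[OF that(2) p(1)] by (simp add: \<Theta>_def hom_module_simps j_add Q.r_distr)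
 have \<Theta>smult: "\<Theta> (r \<odot>\<^bsub>?H\<^esub> f) = \<iota> r \<otimes> \<Theta> f" if "r \<in> carrier R" "f \<in> carrier ?H" for r f
  using p(1) xi fc[OF that(2) p(1)] that(1) by (simp add: \<Theta>_def hom_module_simps j_smult Q.m_lcomm)
 have onto: "\<exists>f\<in>carrier ?H. q \<ominus> \<Theta> f \<in> CC" if q: "q \<in> ?L" for q
 proof -
  have qc: "q \<in> carrier Q" and qJ: "\<And>r. r \<in> J \<Longrightarrow> \<iota> r \<otimes> q \<in> CC" using q JR by (auto simp: colon_def Q.m_comm)
  obtain f where f: "linear_map R (P (Suc 0)) C f" "\<And>z. z \<in> carrier (P (Suc 0)) \<Longrightarrow> j (f z) = \<iota> (\<epsilon> (d 0 z)) \<otimes> q"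
  proof (rule preimage_linear[OF P.module_P])
   fix z w r assume z: "z \<in> carrier (P (Suc 0))"
   show "\<iota> (\<epsilon> (d 0 z)) \<otimes> q \<in> CC" by (rule qJ[OF P.e_d[OF z]])
   show "\<iota> (\<epsilon> (d 0 (z \<oplus>\<^bsub>P (Suc 0)\<^esub> w))) \<otimes> q = \<iota> (\<epsilon> (d 0 z)) \<otimes> q \<oplus> \<iota> (\<epsilon> (d 0 w)) \<otimes> q"
    if "w \<in> carrier (P (Suc 0))"
    using z that qc by (simp add: linear_mapD(2)[OF P.linear_d] eadd(1)[OF _ _ R.zero_closed] Q.l_distr)
   show "\<iota> (\<epsilon> (d 0 (r \<odot>\<^bsub>P (Suc 0)\<^esub> z))) \<otimes> q = \<iota> r \<otimes> (\<iota> (\<epsilon> (d 0 z)) \<otimes> q)"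
    if "r \<in> carrier R"
    using z that qc by (simp add: dr eadd(2)[OF _ P0.zero_closed] Q.m_assoc)
  qed blast
  define f' where "f' = restrict f (carrier (P 1))"
  have "f (d (Suc 0) z) = \<zero>\<^bsub>C\<^esub>" if z: "z \<in> carrier (P (Suc (Suc 0)))" for z
  proof (rule inj_onD[OF j_inj])
   have "\<epsilon> \<zero>\<^bsub>P 0\<^esub> = \<zero>\<^bsub>R\<^esub>" using linear_map_zero[OF P.module_P ring_as_module_module[OF R.is_cring] P.linear_e] by simp
   then show "j (f (d (Suc 0) z)) = j \<zero>\<^bsub>C\<^esub>" using f(2)[of "d (Suc 0) z"] z qc by (simp add: j_zero)
  qed (use z linear_mapD(1)[OF f(1)] in auto)
  then have f'H: "f' \<in> carrier ?H"
   using linear_map_restrict[OF P.module_P f(1)] P.d_closed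
   by (simp add: f'_def ext_cocycles_def P_def del: free_module_simps)
  have "\<Theta> f' = xi \<otimes> (\<iota> (x \<otimes>\<^bsub>R\<^esub> \<epsilon> u) \<otimes> q)"
   unfolding \<Theta>_def f'_def using p f(2)[OF p(1)] eadd(2)[OF u(1) u(1) xR] by simp
  also have "\<dots> = \<iota> (\<epsilon> u) \<otimes> q"
   using xi_cancel[of "\<iota> (\<epsilon> u) \<otimes> q"] u(1) qc xR by (simp add: Q.m_assoc)
  finally have "q \<ominus> \<Theta> f' = \<iota> (\<one>\<^bsub>R\<^esub> \<ominus>\<^bsub>R\<^esub> \<epsilon> u) \<otimes> q"
   using u(1) qc by (simp add: R.minus_eq Q.minus_eq Q.l_distr Q.l_minus)
  then show ?thesis using qJ[OF u(2)] f'H by metis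
 qed
 have N: "?N = {f \<in> carrier ?H. \<Theta> f \<in> CC}"
 proof (intro equalityI subsetI)
  fix f assume "f \<in> ?N"
  then obtain g where g: "g \<in> module_hom R (P 0) C" "f = compose (carrier (P (Suc 0))) g (d 0)"
   by (auto simp: P_def)
  have gl: "linear_map R (P 0) C g" using g(1) by (simp add: module_hom_iff)
  have fv: "f z = g (d 0 z)" if "z \<in> carrier (P (Suc 0))" for z using that g(2) by (simp add: compose_def)
  have "f \<in> module_hom R (P 1) C" using linear_map_restrict[OF P.module_P linear_map_compose[OF P.linear_d gl]]
   unfolding g(2) compose_def by simp
  moreover have "f (d (Suc 0) z) = \<zero>\<^bsub>C\<^esub>" if "z \<in> carrier (P (Suc (Suc 0)))" for z
   using that fv linear_map_zero[OF P.module_P C.module_axioms gl] by simp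
  ultimately have fH: "f \<in> carrier ?H" by (simp add: ext_cocycles_def P_def del: free_module_simps)
  have "\<Theta> f = xi \<otimes> (\<iota> x \<otimes> j (g u))" unfolding \<Theta>_def
   using fv[OF p(1)] p(2) linear_mapD(3)[OF gl xR u(1)] j_smult[OF xR linear_mapD(1)[OF gl u(1)]] by simp
  then have "\<Theta> f = j (g u)" using xi_cancel linear_mapD(1)[OF gl u(1)] by simp
  then show "f \<in> {f \<in> carrier ?H. \<Theta> f \<in> CC}" using fH linear_mapD(1)[OF gl u(1)] by simp
 next
  fix f assume "f \<in> {f \<in> carrier ?H. \<Theta> f \<in> CC}"
  then have f: "f \<in> carrier ?H" "\<Theta> f \<in> CC" by auto
  \<comment> \<open>If \<open>f p / x\<close> lies in C, then \<open>z \<mapsto> f(xz) / x\<close> is a cochain with values in C, and f is its coboundary; here f(xz) stands for the value of f at any element with boundary xz.\<close>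
  define pre where "pre = (\<lambda>z. SOME p. p \<in> carrier (P (Suc 0)) \<and> d 0 p = x \<odot>\<^bsub>P 0\<^esub> z)"
  have pre: "pre z \<in> carrier (P (Suc 0))" "d 0 (pre z) = x \<odot>\<^bsub>P 0\<^esub> z" if "z \<in> carrier (P 0)" for z
   using someI_ex[of "\<lambda>p. p \<in> carrier (P (Suc 0)) \<and> d 0 p = x \<odot>\<^bsub>P 0\<^esub> z"] smult_lift[OF that x(1)]
   unfolding pre_def by blast+
  have jval: "xi \<otimes> j (f w) = xi \<otimes> j (f (pre z))"
   if "z \<in> carrier (P 0)" "w \<in> carrier (P (Suc 0))" "d 0 w = x \<odot>\<^bsub>P 0\<^esub> z" for z w
   using cocycle_eq[OF f(1) that(2) pre(1)[OF that(1)]] pre(2)[OF that(1)] that(3) by simp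
  obtain g where g: "linear_map R (P 0) C g" "\<And>z. z \<in> carrier (P 0) \<Longrightarrow> j (g z) = xi \<otimes> j (f (pre z))"
  proof (rule preimage_linear[OF P.module_P])
   fix z w r assume z: "z \<in> carrier (P 0)"
   \<comment> \<open>z is split as a multiple of u and an element of the kernel of the augmentation.\<close>
   let ?y = "z \<ominus>\<^bsub>P 0\<^esub> \<epsilon> z \<odot>\<^bsub>P 0\<^esub> u"
   have ez: "\<epsilon> z \<in> carrier R" using z by simp
   have "\<epsilon> ?y = \<epsilon> z \<otimes>\<^bsub>R\<^esub> (\<one>\<^bsub>R\<^esub> \<ominus>\<^bsub>R\<^esub> \<epsilon> u)"
   proof -
    have "\<epsilon> ?y = \<epsilon> z \<ominus>\<^bsub>ring_as_module R\<^esub> \<epsilon> (\<epsilon> z \<odot>\<^bsub>P 0\<^esub> u)"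
     by (rule linear_map_diff[OF P.module_P ring_as_module_module[OF R.is_cring] P.linear_e]) (use z u in auto)
    also have "\<dots> = \<epsilon> z \<ominus>\<^bsub>R\<^esub> \<epsilon> z \<otimes>\<^bsub>R\<^esub> \<epsilon> u"
     using z u by (simp add: ring_as_module_minus[OF R.is_cring] eadd(2)[OF u(1) u(1)])
    also have "\<dots> = \<epsilon> z \<otimes>\<^bsub>R\<^esub> (\<one>\<^bsub>R\<^esub> \<ominus>\<^bsub>R\<^esub> \<epsilon> u)" using ez ecar[OF u(1)] by algebra
    finally show ?thesis .
   qed
   then obtain p' where p': "p' \<in> carrier (P (Suc 0))" "d 0 p' = ?y"
    using J_lift[of ?y] z u P.I_l_closed[OF u(2) ez] by auto
   let ?w = "\<epsilon> z \<odot>\<^bsub>P (Suc 0)\<^esub> p \<oplus>\<^bsub>P (Suc 0)\<^esub> x \<odot>\<^bsub>P (Suc 0)\<^esub> p'"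
   have w: "?w \<in> carrier (P (Suc 0))" using p(1) p' xR ez by simp
   have "d 0 ?w = \<epsilon> z \<odot>\<^bsub>P 0\<^esub> (x \<odot>\<^bsub>P 0\<^esub> u) \<oplus>\<^bsub>P 0\<^esub> x \<odot>\<^bsub>P 0\<^esub> ?y"
    using p p' xR ez by (simp add: linear_mapD(2)[OF P.linear_d] dr)
   also have "\<epsilon> z \<odot>\<^bsub>P 0\<^esub> (x \<odot>\<^bsub>P 0\<^esub> u) = x \<odot>\<^bsub>P 0\<^esub> (\<epsilon> z \<odot>\<^bsub>P 0\<^esub> u)"
    using ez xR u(1) by (simp add: R.m_comm flip: P0.smult_assoc1)
   also have "x \<odot>\<^bsub>P 0\<^esub> (\<epsilon> z \<odot>\<^bsub>P 0\<^esub> u) \<oplus>\<^bsub>P 0\<^esub> x \<odot>\<^bsub>P 0\<^esub> ?y = x \<odot>\<^bsub>P 0\<^esub> (\<epsilon> z \<odot>\<^bsub>P 0\<^esub> u \<oplus>\<^bsub>P 0\<^esub> ?y)"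
    by (rule P0.smult_r_distr[symmetric]) (use ez xR u(1) z in auto)
   also have "\<epsilon> z \<odot>\<^bsub>P 0\<^esub> u \<oplus>\<^bsub>P 0\<^esub> ?y = z" by (rule P0.add_minus_cancel) (use ez u(1) z in auto)
   finally have dw: "d 0 ?w = x \<odot>\<^bsub>P 0\<^esub> z" .
   have "xi \<otimes> j (f (pre z)) = xi \<otimes> j (f ?w)" using jval[OF z w dw] by simp
   also have "\<dots> = xi \<otimes> (\<iota> (\<epsilon> z) \<otimes> j (f p) \<oplus> \<iota> x \<otimes> j (f p'))"
    using p(1) p'(1) ez xR fc[OF f(1)] by (simp add: fa[OF f(1)] fr[OF f(1)])
   also have "\<dots> = \<iota> (\<epsilon> z) \<otimes> \<Theta> f \<oplus> j (f p')"
    unfolding \<Theta>_def using ez xR fc[OF f(1) p(1)] fc[OF f(1) p'(1)] xi(1) xi_cancel[of "j (f p')"]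
    by (simp add: Q.r_distr Q.m_lcomm)
   also have "\<dots> \<in> CC"
    by (intro stableD(3)[OF CC_stable] stableD(4)[OF CC_stable] imageI ez f(2) fc[OF f(1) p'(1)])
   finally show "xi \<otimes> j (f (pre z)) \<in> CC" .
   have prez: "j (f (pre z)) \<in> carrier Q" using pre(1)[OF z] fc[OF f(1)] by simp
   show "xi \<otimes> j (f (pre (z \<oplus>\<^bsub>P 0\<^esub> w))) = xi \<otimes> j (f (pre z)) \<oplus> xi \<otimes> j (f (pre w))"
    if w: "w \<in> carrier (P 0)"
   proof -
    have 1: "d 0 (pre z \<oplus>\<^bsub>P (Suc 0)\<^esub> pre w) = x \<odot>\<^bsub>P 0\<^esub> (z \<oplus>\<^bsub>P 0\<^esub> w)"
     using pre[OF z] pre[OF w] xR z w by (simp add: linear_mapD(2)[OF P.linear_d] P0.smult_r_distr)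
    have "xi \<otimes> j (f (pre (z \<oplus>\<^bsub>P 0\<^esub> w))) = xi \<otimes> j (f (pre z \<oplus>\<^bsub>P (Suc 0)\<^esub> pre w))"
     using jval[OF _ _ 1] pre(1)[OF z] pre(1)[OF w] z w by simp
    then show ?thesis using xi(1) fc[OF f(1) pre(1)[OF z]] fc[OF f(1) pre(1)[OF w]] pre(1)[OF z] pre(1)[OF w]
     by (simp add: fa[OF f(1)] Q.r_distr)
   qed
   show "xi \<otimes> j (f (pre (r \<odot>\<^bsub>P 0\<^esub> z))) = \<iota> r \<otimes> (xi \<otimes> j (f (pre z)))"
    if r: "r \<in> carrier R"
   proof -
    have 1: "d 0 (r \<odot>\<^bsub>P (Suc 0)\<^esub> pre z) = x \<odot>\<^bsub>P 0\<^esub> (r \<odot>\<^bsub>P 0\<^esub> z)"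
     using pre[OF z] xR z r by (simp add: dr R.m_comm flip: P0.smult_assoc1)
    have "xi \<otimes> j (f (pre (r \<odot>\<^bsub>P 0\<^esub> z))) = xi \<otimes> j (f (r \<odot>\<^bsub>P (Suc 0)\<^esub> pre z))"
     using jval[OF _ _ 1] pre(1)[OF z] z r by simp
    also have "\<dots> = \<iota> r \<otimes> (xi \<otimes> j (f (pre z)))"
     unfolding fr[OF f(1) pre(1)[OF z] r] using xi(1) prez r by (simp add: Q.m_lcomm)
    finally show ?thesis .
   qed
  qed blast
  have "f z = g (d 0 z)" if z: "z \<in> carrier (P (Suc 0))" for z
  proof (rule inj_onD[OF j_inj])
   have 1: "d 0 (x \<odot>\<^bsub>P (Suc 0)\<^esub> z) = x \<odot>\<^bsub>P 0\<^esub> d 0 z" by (rule dr[OF z xR])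
   have "j (g (d 0 z)) = xi \<otimes> j (f (x \<odot>\<^bsub>P (Suc 0)\<^esub> z))"
    using g(2)[of "d 0 z"] jval[OF _ _ 1] z xR by simp
   also have "\<dots> = j (f z)" unfolding fr[OF f(1) z xR] using xi_cancel fc[OF f(1) z] by simp
   finally show "j (f z) = j (g (d 0 z))" by simp
  qed (use z fc[OF f(1)] linear_mapD(1)[OF g(1)] in auto)
  moreover have "f \<in> extensional (carrier (P (Suc 0)))" using f(1) by (simp add: ext_cocycles_def module_hom_iff P_def del: free_module_simps)
  ultimately have "f = compose (carrier (P (Suc 0))) (restrict g (carrier (P 0))) (d 0)"
   by (intro extensionalityI[of _ "carrier (P (Suc 0))"]) (auto simp: compose_def)
  then show "f \<in> ?N" using linear_map_restrict[OF P.module_P g(1)] by (auto simp: P_def simp del: free_module_simps)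
 qed
 have "module_length R (quot_module R ?H ?N) = quotient_length Q A ?L CC"
  unfolding N by (rule module_length_quot[OF mH L CC_stable CL \<Theta>L \<Theta>add \<Theta>smult onto])
 then show ?thesis unfolding Ext P_def by simp
qed

end

section \<open>Strictness of duality\<close>

context embedded_module
begin

text \<open>
 Let \<open>J = J0 + yR\<close> with \<open>J0 : y = M\<close>. If \<open>C : J0 \<subseteq> C : y\<close>,
 then \<open>C : M \<subseteq> C\<close>: an element c of C : M gives a homomorphism
 \<open>g + ry \<mapsto> rc\<close> from J to Q/C. The obstruction to lifting it to a homomorphism from J to Q
 lies in \<open>Ext\<^sup>1(J, C) = Ext\<^sup>2(R/J, C) = 0\<close>. The lift is multiplication by some \<tau>
 with \<open>\<tau> J0 \<subseteq> C\<close>, hence \<open>\<tau> y \<in> C\<close>, while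
 \<open>\<tau> y \<equiv> c\<close> modulo C.
\<close>
lemma colon_strict:
 assumes ez: "ext_zero R J C 1" and J: "ideal J R" and J0: "ideal J0 R" "J0 \<subseteq> J"
  and J_eq: "J = {g \<oplus>\<^bsub>R\<^esub> y \<otimes>\<^bsub>R\<^esub> r | g r. g \<in> J0 \<and> r \<in> carrier R}"
  and y: "y \<in> J" and M: "M = {r \<in> carrier R. y \<otimes>\<^bsub>R\<^esub> r \<in> J0}"
  and x: "x \<in> J" "x \<in> nonzerodivisors R"
  and jac: "\<And>r. r \<in> J \<Longrightarrow> \<one>\<^bsub>R\<^esub> \<ominus>\<^bsub>R\<^esub> r \<in> Units R"
  and c: "c \<in> carrier Q" "\<And>r. r \<in> M \<Longrightarrow> \<iota> r \<otimes> c \<in> CC"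
  and same: "\<And>q. q \<in> carrier Q \<Longrightarrow> (\<And>g. g \<in> J0 \<Longrightarrow> q \<otimes> \<iota> g \<in> CC) \<Longrightarrow> q \<otimes> \<iota> y \<in> CC"
 shows "c \<in> CC"
proof -
 obtain P :: "nat \<Rightarrow> ('a, nat \<Rightarrow> 'a) module" and d \<epsilon>
  where res: "ideal_resolution J R P d \<epsilon>" and van: "ext_vanishes R P d C 1"
  using ez unfolding ext_zero_def by blast
 interpret P: ideal_resolution J R P d \<epsilon> by (rule res)
 interpret P0: module R "P 0" by (rule P.module_P)
 interpret P1: module R "P (Suc 0)" by (rule P.module_P)
 let ?RM = "ring_as_module R"
 let ?J0 = "?RM\<lparr>carrier := J0\<rparr>"
 note RM = ring_as_module_module[OF R.is_cring]
 have mJ0: "module R ?J0" by (rule submodule.submodule_is_module[OF ideal_submodule[OF J0(1) R.is_cring] RM])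
 have JR: "r \<in> carrier R" if "r \<in> J" for r using that P.a_subset by blast
 have J0R: "r \<in> carrier R" if "r \<in> J0" for r using that J0(2) JR by blast
 have xR: "x \<in> carrier R" and yR: "y \<in> carrier R" using x(1) y JR by auto
 have eadd: "\<epsilon> (r \<odot>\<^bsub>P 0\<^esub> z) = r \<otimes>\<^bsub>R\<^esub> \<epsilon> z" if "z \<in> carrier (P 0)" "r \<in> carrier R" for z r
  using linear_mapD(3)[OF P.linear_e] that by simp
 have dr: "d 0 (r \<odot>\<^bsub>P (Suc 0)\<^esub> z) = r \<odot>\<^bsub>P 0\<^esub> d 0 z" if "z \<in> carrier (P (Suc 0))" "r \<in> carrier R" for r z
  using linear_mapD(3)[OF P.linear_d that(2,1)] .
 obtain u where u: "u \<in> carrier (P 0)" "\<epsilon> u = \<one>\<^bsub>R\<^esub>"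
 proof -
  obtain z where z: "z \<in> carrier (P 0)" "\<one>\<^bsub>R\<^esub> \<ominus>\<^bsub>R\<^esub> \<epsilon> z \<in> J" using P.onto_mod[of "\<one>\<^bsub>R\<^esub>"] by auto
  have "\<one>\<^bsub>R\<^esub> \<ominus>\<^bsub>R\<^esub> (\<one>\<^bsub>R\<^esub> \<ominus>\<^bsub>R\<^esub> \<epsilon> z) = \<epsilon> z" using P.e_closed[OF z(1)] by algebra
  then have U: "\<epsilon> z \<in> Units R" using jac[OF z(2)] by simp
  show ?thesis by (rule that[of "inv\<^bsub>R\<^esub> (\<epsilon> z) \<odot>\<^bsub>P 0\<^esub> z"]) (use U z eadd in auto)
 qed
 \<comment> \<open>a linear choice of the decomposition \<open>g + ry\<close> of elements of J\<close>
 obtain \<beta> where b: "linear_map R (P (Suc 0)) (prod_module ?J0 ?RM) \<beta>"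
  and b_eq: "\<And>p. p \<in> carrier (P (Suc 0)) \<Longrightarrow> fst (\<beta> p) \<oplus>\<^bsub>R\<^esub> y \<otimes>\<^bsub>R\<^esub> snd (\<beta> p) = \<epsilon> (d 0 p)"
 proof (rule projective_lift[OF P.module_P prod_module_module[OF mJ0 RM] RM P.projective_P
    linear_map_compose[OF P.linear_d P.linear_e]])
  have 1: "linear_map R ?J0 ?RM (\<lambda>x. x)" by (rule linear_mapI) (use J0R in auto)
  have 2: "linear_map R ?RM ?RM (\<lambda>r. y \<otimes>\<^bsub>R\<^esub> r)"
   by (rule linear_mapI) (use yR in \<open>auto simp: R.r_distr R.m_lcomm\<close>)
  show "linear_map R (prod_module ?J0 ?RM) ?RM (\<lambda>z. fst z \<oplus>\<^bsub>R\<^esub> y \<otimes>\<^bsub>R\<^esub> snd z)"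
   using linear_map_case[OF mJ0 RM RM 1 2] by simp
  show "\<epsilon> (d 0 z) \<in> (\<lambda>z. fst z \<oplus>\<^bsub>R\<^esub> y \<otimes>\<^bsub>R\<^esub> snd z) ` carrier (prod_module ?J0 ?RM)"
   if "z \<in> carrier (P (Suc 0))" for z
   using P.e_d[OF that] unfolding J_eq by (force simp: image_iff)
 qed blast
 define \<beta>1 where "\<beta>1 = (\<lambda>p. fst (\<beta> p))"
 define \<beta>2 where "\<beta>2 = (\<lambda>p. snd (\<beta> p))"
 have b2: "linear_map R (P (Suc 0)) ?RM \<beta>2" unfolding \<beta>2_def by (rule linear_map_snd'[OF b])
 have b1c: "\<beta>1 p \<in> J0" "\<beta>2 p \<in> carrier R" if "p \<in> carrier (P (Suc 0))" for p
  using linear_mapD(1)[OF b that] by (auto simp: \<beta>1_def \<beta>2_def)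
 have beq: "\<beta>1 p \<oplus>\<^bsub>R\<^esub> y \<otimes>\<^bsub>R\<^esub> \<beta>2 p = \<epsilon> (d 0 p)" if "p \<in> carrier (P (Suc 0))" for p
  using b_eq[OF that] by (simp add: \<beta>1_def \<beta>2_def)
 have b2M: "\<beta>2 p \<in> M" if p: "p \<in> carrier (P (Suc 0))" "\<epsilon> (d 0 p) \<in> J0" for p
 proof -
  have "y \<otimes>\<^bsub>R\<^esub> \<beta>2 p = \<epsilon> (d 0 p) \<ominus>\<^bsub>R\<^esub> \<beta>1 p"
  proof -
   have cl: "y \<otimes>\<^bsub>R\<^esub> \<beta>2 p \<in> carrier R" "\<beta>1 p \<in> carrier R" using b1c[OF p(1)] J0R yR by auto
   show ?thesis unfolding beq[OF p(1), symmetric] using cl by algebra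
  qed
  also have "\<dots> \<in> J0" by (rule ideal_minus_closed[OF J0(1) p(2) b1c(1)[OF p(1)]])
  finally show ?thesis unfolding M using b1c(2)[OF p(1)] by simp
 qed
 obtain f where f: "linear_map R (P (Suc (Suc 0))) C f"
  "\<And>z. z \<in> carrier (P (Suc (Suc 0))) \<Longrightarrow> j (f z) = \<iota> (\<beta>2 (d (Suc 0) z)) \<otimes> c"
 proof (rule preimage_linear[OF P.module_P])
  fix z w r assume z: "z \<in> carrier (P (Suc (Suc 0)))"
  note dz = P.d_closed[OF z]
  have "\<epsilon> (d 0 (d (Suc 0) z)) \<in> J0"
   using z linear_map_zero[OF P.module_P RM P.linear_e] additive_subgroup.zero_closed[OF ideal.axioms(1)[OF J0(1)]] by simp
  then show "\<iota> (\<beta>2 (d (Suc 0) z)) \<otimes> c \<in> CC" by (rule c(2)[OF b2M[OF dz]])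
  show "\<iota> (\<beta>2 (d (Suc 0) (z \<oplus>\<^bsub>P (Suc (Suc 0))\<^esub> w))) \<otimes> c =
   \<iota> (\<beta>2 (d (Suc 0) z)) \<otimes> c \<oplus> \<iota> (\<beta>2 (d (Suc 0) w)) \<otimes> c" if w: "w \<in> carrier (P (Suc (Suc 0)))"
   using z w b1c(2)[OF dz] b1c(2)[OF P.d_closed[OF w]] c(1)
   by (simp add: linear_mapD(2)[OF P.linear_d] linear_mapD(2)[OF b2] Q.l_distr)
  show "\<iota> (\<beta>2 (d (Suc 0) (r \<odot>\<^bsub>P (Suc (Suc 0))\<^esub> z))) \<otimes> c = \<iota> r \<otimes> (\<iota> (\<beta>2 (d (Suc 0) z)) \<otimes> c)"
   if "r \<in> carrier R"
   using z that b1c(2)[OF dz] c(1)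
   by (simp add: linear_mapD(3)[OF P.linear_d] linear_mapD(3)[OF b2] Q.m_assoc)
 qed blast
 have "f (d (Suc (Suc 0)) z) = \<zero>\<^bsub>C\<^esub>" if z: "z \<in> carrier (P (Suc (Suc (Suc 0))))" for z
 proof (rule inj_onD[OF j_inj])
  have "\<beta>2 \<zero>\<^bsub>P (Suc 0)\<^esub> = \<zero>\<^bsub>R\<^esub>" using linear_map_zero[OF P.module_P RM b2] by simp
  then show "j (f (d (Suc (Suc 0)) z)) = j \<zero>\<^bsub>C\<^esub>" using f(2)[OF P.d_closed[OF z]] z c(1) by (simp add: j_zero)
 qed (use z linear_mapD(1)[OF f(1)] in auto)
 \<comment> \<open>This is where the second Ext group vanishes.\<close>
 then obtain \<gamma> where g: "linear_map R (P (Suc 0)) C \<gamma>"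
  "\<And>z. z \<in> carrier (P (Suc (Suc 0))) \<Longrightarrow> f z = \<gamma> (d (Suc 0) z)"
  using ext_vanishesD[OF van, of f] f(1) by auto
 have gc: "\<gamma> p \<in> carrier C" if "p \<in> carrier (P (Suc 0))" for p using linear_mapD(1)[OF g(1) that] .
 \<comment> \<open>\<open>\<beta>2 \<cdot> c\<close> corrected by a cochain with values in C becomes a cocycle with values in Q, that is, multiplication by an element \<tau>.\<close>
 define \<theta> where "\<theta> = (\<lambda>p. \<iota> (\<beta>2 p) \<otimes> c \<ominus> j (\<gamma> p))"
 have tc: "\<theta> p \<in> carrier Q" if "p \<in> carrier (P (Suc 0))" for p
  unfolding \<theta>_def using b1c(2)[OF that] gc[OF that] c(1) by simp
 have tadd: "\<theta> (p \<oplus>\<^bsub>P (Suc 0)\<^esub> q) = \<theta> p \<oplus> \<theta> q" if pq: "p \<in> carrier (P (Suc 0))" "q \<in> carrier (P (Suc 0))" for p q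
 proof -
  have cl: "\<iota> (\<beta>2 p) \<in> carrier Q" "\<iota> (\<beta>2 q) \<in> carrier Q" "j (\<gamma> p) \<in> carrier Q" "j (\<gamma> q) \<in> carrier Q"
   using pq b1c(2) gc by auto
  have "\<theta> (p \<oplus>\<^bsub>P (Suc 0)\<^esub> q) = (\<iota> (\<beta>2 p) \<oplus> \<iota> (\<beta>2 q)) \<otimes> c \<ominus> (j (\<gamma> p) \<oplus> j (\<gamma> q))"
   unfolding \<theta>_def using pq b1c(2) gc by (simp add: linear_mapD(2)[OF b2] linear_mapD(2)[OF g(1)] j_add)
  also have "\<dots> = \<theta> p \<oplus> \<theta> q" unfolding \<theta>_def using cl c(1) by algebra
  finally show ?thesis .
 qed
 have tsmult: "\<theta> (r \<odot>\<^bsub>P (Suc 0)\<^esub> p) = \<iota> r \<otimes> \<theta> p" if "r \<in> carrier R" "p \<in> carrier (P (Suc 0))" for r p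
 proof -
  have "\<theta> (r \<odot>\<^bsub>P (Suc 0)\<^esub> p) = \<iota> (r \<otimes>\<^bsub>R\<^esub> \<beta>2 p) \<otimes> c \<ominus> \<iota> r \<otimes> j (\<gamma> p)"
   unfolding \<theta>_def using linear_mapD(3)[OF b2 that] linear_mapD(3)[OF g(1) that] that gc
   by (simp add: j_smult)
  also have "\<dots> = \<iota> r \<otimes> \<theta> p" unfolding \<theta>_def iota_simps(3)[OF that(1) b1c(2)[OF that(2)]]
  proof -
   have cl: "\<iota> (\<beta>2 p) \<in> carrier Q" "\<iota> r \<in> carrier Q" "j (\<gamma> p) \<in> carrier Q"
    using that b1c(2) gc by auto
   show "\<iota> r \<otimes> \<iota> (\<beta>2 p) \<otimes> c \<ominus> \<iota> r \<otimes> j (\<gamma> p) = \<iota> r \<otimes> (\<iota> (\<beta>2 p) \<otimes> c \<ominus> j (\<gamma> p))"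
    using cl c(1) by algebra
  qed
  finally show ?thesis .
 qed
 have t0: "\<theta> (d (Suc 0) z) = \<zero>" if z: "z \<in> carrier (P (Suc (Suc 0)))" for z
  unfolding \<theta>_def g(2)[OF z, symmetric] f(2)[OF z]
  using b1c(2)[OF P.d_closed[OF z]] c(1) by (simp add: Q.minus_eq Q.r_neg)
 have lift: "\<exists>p\<in>carrier (P (Suc 0)). d 0 p = r \<odot>\<^bsub>P 0\<^esub> u" if "r \<in> J" for r
 proof -
  have "r \<odot>\<^bsub>P 0\<^esub> u \<in> d 0 ` carrier (P (Suc 0))"
   unfolding P.exact_0 using that u JR[OF that] by (simp add: eadd)
  then show ?thesis by (elim imageE) auto
 qed
 obtain px where px: "px \<in> carrier (P (Suc 0))" "d 0 px = x \<odot>\<^bsub>P 0\<^esub> u" using lift[OF x(1)] by blast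
 have xU: "\<iota> x \<in> Units Q" by (rule iota_units[OF x(2)])
 define \<tau> where "\<tau> = inv (\<iota> x) \<otimes> \<theta> px"
 have \<tau>: "\<tau> \<in> carrier Q" unfolding \<tau>_def using xU tc[OF px(1)] by simp
 have x\<tau>: "\<iota> x \<otimes> \<tau> = \<theta> px" unfolding \<tau>_def using xU tc[OF px(1)] xR by (simp flip: Q.m_assoc)
 have \<tau>r: "\<tau> \<otimes> \<iota> r = \<theta> p" if r: "r \<in> J" and p: "p \<in> carrier (P (Suc 0))" "d 0 p = r \<odot>\<^bsub>P 0\<^esub> u" for r p
 proof -
  have rR: "r \<in> carrier R" by (rule JR[OF r])
  have "\<iota> x \<otimes> \<theta> p = \<iota> r \<otimes> (\<iota> x \<otimes> \<tau>)"
   unfolding x\<tau> by (rule cocycle_values(2)[OF res tc tadd tsmult t0 p(1) px(1) u(1) rR xR p(2) px(2)])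
  then have "\<iota> x \<otimes> \<theta> p = \<iota> x \<otimes> (\<tau> \<otimes> \<iota> r)" using rR xR \<tau> by (simp add: Q.m_ac)
  then show ?thesis using xU tc[OF p(1)] \<tau> rR by (simp add: Q.Units_l_cancel)
 qed
 have "\<tau> \<otimes> \<iota> g \<in> CC" if g0: "g \<in> J0" for g
 proof -
  have gJ: "g \<in> J" using g0 J0(2) by blast
  obtain p where p: "p \<in> carrier (P (Suc 0))" "d 0 p = g \<odot>\<^bsub>P 0\<^esub> u" using lift[OF gJ] by blast
  have "\<epsilon> (d 0 p) = g" unfolding p(2) using u JR[OF gJ] by (simp add: eadd)
  then have "\<beta>2 p \<in> M" using b2M[OF p(1)] g0 by simp
  then have "\<theta> p \<in> CC" unfolding \<theta>_def using c(2) gc[OF p(1)] by (intro stable_diff[OF CC_stable]) auto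
  then show ?thesis using \<tau>r[OF gJ p] by simp
 qed
 then have \<tau>y: "\<tau> \<otimes> \<iota> y \<in> CC" by (rule same[OF \<tau>])
 obtain p where p: "p \<in> carrier (P (Suc 0))" "d 0 p = y \<odot>\<^bsub>P 0\<^esub> u" using lift[OF y] by blast
 have ep: "\<epsilon> (d 0 p) = y" unfolding p(2) using u yR by (simp add: eadd)
 have "y \<otimes>\<^bsub>R\<^esub> (\<one>\<^bsub>R\<^esub> \<ominus>\<^bsub>R\<^esub> \<beta>2 p) = \<beta>1 p"
 proof -
  have cl: "\<beta>1 p \<in> carrier R" "\<beta>2 p \<in> carrier R" using b1c[OF p(1)] J0R by auto
  have "y \<otimes>\<^bsub>R\<^esub> (\<one>\<^bsub>R\<^esub> \<ominus>\<^bsub>R\<^esub> \<beta>2 p) = y \<ominus>\<^bsub>R\<^esub> y \<otimes>\<^bsub>R\<^esub> \<beta>2 p" using cl yR by algebra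
  also have "\<dots> = (\<beta>1 p \<oplus>\<^bsub>R\<^esub> y \<otimes>\<^bsub>R\<^esub> \<beta>2 p) \<ominus>\<^bsub>R\<^esub> y \<otimes>\<^bsub>R\<^esub> \<beta>2 p" using beq[OF p(1)] ep by simp
  also have "\<dots> = \<beta>1 p" using cl yR by algebra
  finally show ?thesis .
 qed
 then have "\<one>\<^bsub>R\<^esub> \<ominus>\<^bsub>R\<^esub> \<beta>2 p \<in> M" unfolding M using b1c[OF p(1)] by simp
 then have 1: "\<iota> (\<one>\<^bsub>R\<^esub> \<ominus>\<^bsub>R\<^esub> \<beta>2 p) \<otimes> c \<in> CC" by (rule c(2))
 have 2: "\<theta> p \<in> CC" using \<tau>y \<tau>r[OF y p] by simp
 have 3: "j (\<gamma> p) \<in> CC" using gc[OF p(1)] by simp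
 have cl: "\<iota> (\<beta>2 p) \<in> carrier Q" "j (\<gamma> p) \<in> carrier Q" using b1c[OF p(1)] gc[OF p(1)] by auto
 have "c = \<iota> (\<one>\<^bsub>R\<^esub> \<ominus>\<^bsub>R\<^esub> \<beta>2 p) \<otimes> c \<oplus> (\<theta> p \<oplus> j (\<gamma> p))"
 proof -
  have "\<iota> (\<one>\<^bsub>R\<^esub> \<ominus>\<^bsub>R\<^esub> \<beta>2 p) = \<one> \<ominus> \<iota> (\<beta>2 p)" using b1c[OF p(1)] by (simp add: R.minus_eq Q.minus_eq)
  then show ?thesis unfolding \<theta>_def using cl c(1) by algebra
 qed
 also have "\<dots> \<in> CC" by (intro stableD(3)[OF CC_stable] 1 2 3)
 finally show ?thesis .
qed
end

section \<open>One-dimensional Cohen-Macaulay local rings\<close>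

definition colon_ideal :: "('a, 'b) ring_scheme \<Rightarrow> 'a set \<Rightarrow> 'a \<Rightarrow> 'a set" where
 "colon_ideal R J y = {r \<in> carrier R. y \<otimes>\<^bsub>R\<^esub> r \<in> J}"

lemma colon_ideal_ideal:
 assumes "cring R" "ideal J R" "y \<in> carrier R"
 shows "ideal (colon_ideal R J y) R"
proof -
 interpret cring R by fact
 have l: "linear_map R (ring_as_module R) (ring_as_module R) (\<lambda>r. y \<otimes>\<^bsub>R\<^esub> r)"
  by (rule linear_mapI) (use assms(3) in \<open>auto simp: r_distr m_lcomm\<close>)
 note RM = ring_as_module_module[OF assms(1)]
 have "submodule (colon_ideal R J y) R (ring_as_module R)"
  using linear_map_kernel_submodule[OF RM RM l ideal_submodule[OF assms(2,1)]]
  by (simp add: colon_ideal_def)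
 then show ?thesis by (rule submodule_ring_ideal[OF assms(1)])
qed

text \<open>
 An ideal maximal among those disjoint from S is prime.
\<close>
lemma exists_prime_disjoint:
 fixes R (structure)
 assumes "noetherian_ring R" "cring R"
  and S: "S \<subseteq> carrier R" "\<one> \<in> S" "\<zero> \<notin> S" "\<And>s t. s \<in> S \<Longrightarrow> t \<in> S \<Longrightarrow> s \<otimes> t \<in> S"
 obtains P where "primeideal P R" "P \<inter> S = {}"
proof -
 interpret noetherian_ring R by fact
 interpret cring R by fact
 let ?F = "{J. ideal J R \<and> J \<inter> S = {}}"
 have "{\<zero>} \<in> ?F" using zeroideal S(3) by auto
 then have "?F \<noteq> {}" by auto
 then obtain P where P: "P \<in> ?F" "\<And>J. J \<in> ?F \<Longrightarrow> P \<subseteq> J \<Longrightarrow> J = P"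
  by (rule exists_maximal_ideal_in) auto
 then have PI: "ideal P R" and PS: "P \<inter> S = {}" by auto
 interpret P: ideal P R by (rule PI)
 have meets: "\<exists>j r. j \<in> P \<and> r \<in> carrier R \<and> j \<oplus> a \<otimes> r \<in> S" if a: "a \<in> carrier R" "a \<notin> P" for a
 proof -
  let ?J = "{j \<oplus> a \<otimes> r | j r. j \<in> P \<and> r \<in> carrier R}"
  note J = ideal_add_element[OF assms(2) PI a(1)]
  have "?J \<noteq> P" using J(3) a(2) by auto
  then have "?J \<notin> ?F" using P(2)[OF _ J(2)] by blast
  then have "?J \<inter> S \<noteq> {}" using J(1) by simp
  then show ?thesis by auto
 qed
 have "primeideal P R"
 proof (rule primeidealI[OF PI is_cring])
  show "carrier R \<noteq> P" using PS S(1,2) by auto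
  fix a b assume ab: "a \<in> carrier R" "b \<in> carrier R" "a \<otimes> b \<in> P"
  show "a \<in> P \<or> b \<in> P"
  proof (rule ccontr)
   assume "\<not> (a \<in> P \<or> b \<in> P)"
   then obtain j r k s where jr: "j \<in> P" "r \<in> carrier R" "j \<oplus> a \<otimes> r \<in> S"
    and ks: "k \<in> P" "s \<in> carrier R" "k \<oplus> b \<otimes> s \<in> S" using meets ab by meson
   have jk: "j \<in> carrier R" "k \<in> carrier R" using jr(1) ks(1) P.a_subset by auto
   have eq: "(j \<oplus> a \<otimes> r) \<otimes> (k \<oplus> b \<otimes> s) = (k \<oplus> b \<otimes> s) \<otimes> j \<oplus> ((a \<otimes> r) \<otimes> k \<oplus> (r \<otimes> s) \<otimes> (a \<otimes> b))"
    using jk jr(2) ks(2) ab by algebra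
   have "(j \<oplus> a \<otimes> r) \<otimes> (k \<oplus> b \<otimes> s) \<in> P" unfolding eq
    by (intro ideal_add_closed[OF PI] P.I_l_closed jr ks ab m_closed add.m_closed jk)
   moreover have "(j \<oplus> a \<otimes> r) \<otimes> (k \<oplus> b \<otimes> s) \<in> S" by (rule S(4)[OF jr(3) ks(3)])
   ultimately show False using PS by blast
  qed
 qed
 then show ?thesis using that PS by blast
qed

text \<open>
 A prime that contains a nonzerodivisor x is not minimal: the products \<open>x\<^sup>n s\<close> with
 s \<notin> P form a multiplicative set without 0, and a prime avoiding it lies in P and omits x.
\<close>
lemma nonunit_power_prime:
 fixes R (structure)
 assumes "noetherian_ring R" "cring R" "primeideal P R" "x \<in> nonzerodivisors R" "x \<in> P"
 obtains P' where "primeideal P' R" "P' \<subset> P"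
proof -
 interpret cring R by fact
 interpret P: primeideal P R by fact
 have xc: "x \<in> carrier R" and xr: "\<And>r. r \<in> carrier R \<Longrightarrow> x \<otimes> r = \<zero> \<Longrightarrow> r = \<zero>"
  using assms(4) by (auto simp: nonzerodivisors_def)
 let ?S = "{x [^] (n::nat) \<otimes> s | n s. s \<in> carrier R - P}"
 have one: "\<one> \<in> carrier R - P" using P.I_notcarr P.one_imp_carrier by auto
 have xn: "r = \<zero>" if "r \<in> carrier R" "x [^] (n::nat) \<otimes> r = \<zero>" for n r
  using that
 proof (induction n)
  case (Suc n)
  have "x \<otimes> (x [^] n \<otimes> r) = x [^] Suc n \<otimes> r" using xc Suc.prems(1) by (simp add: m_ac)
  then have "x [^] n \<otimes> r = \<zero>" using xr[of "x [^] n \<otimes> r"] Suc.prems xc by simp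
  then show ?case using Suc by simp
 qed simp
 obtain P' where P': "primeideal P' R" "P' \<inter> ?S = {}"
 proof (rule exists_prime_disjoint[OF assms(1,2)])
  show "?S \<subseteq> carrier R" using xc by auto
  have "\<one> = x [^] (0::nat) \<otimes> \<one>" by simp
  then show "\<one> \<in> ?S" using one by blast
  show "\<zero> \<notin> ?S"
  proof
   assume "\<zero> \<in> ?S"
   then obtain n :: nat and s where ns: "\<zero> = x [^] n \<otimes> s" "s \<in> carrier R" "s \<notin> P" by blast
   then have "s = \<zero>" using xn[of s n] by simp
   then show False using ns(3) by simp
  qed
  fix a b assume "a \<in> ?S" "b \<in> ?S"
  then obtain n m s t where "a = x [^] (n::nat) \<otimes> s" "s \<in> carrier R - P" "b = x [^] (m::nat) \<otimes> t" "t \<in> carrier R - P"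
   by blast
  moreover then have "a \<otimes> b = x [^] (n + m) \<otimes> (s \<otimes> t)" using xc by (simp add: nat_pow_mult[symmetric] m_ac)
  moreover have "s \<otimes> t \<in> carrier R - P" using calculation P.I_prime by auto
  ultimately show "a \<otimes> b \<in> ?S" by blast
 qed
 interpret P': primeideal P' R by (rule P'(1))
 have "P' \<subseteq> P"
 proof
  fix s assume s: "s \<in> P'"
  show "s \<in> P"
  proof (rule ccontr)
   assume "s \<notin> P"
   moreover have "s = x [^] (0::nat) \<otimes> s" using s P'.a_subset by auto
   ultimately have "s \<in> ?S" using s P'.a_subset by blast
   then show False using P'(2) s by blast
  qed
 qed
 moreover have "x \<notin> P'"
 proof
  assume "x \<in> P'"
  moreover have "x = x [^] (1::nat) \<otimes> \<one>" using xc by simp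
  then have "x \<in> ?S" using one by blast
  ultimately show False using P'(2) by blast
 qed
 ultimately show ?thesis using that[OF P'(1)] assms(5) by blast
qed

locale one_dim_cm = cring R + noetherian_ring R for R :: "('a, 'b) ring_scheme" (structure) +
 assumes cm: "cohen_macaulay_local R" and dim: "krull_dim R = 1"
begin

abbreviation "M \<equiv> max_ideal R"

lemma M_maximal: "maximalideal M R" and M_unique: "maximalideal N R \<Longrightarrow> N = M"
proof -
 have "\<exists>!M. maximalideal M R" using cm unfolding cohen_macaulay_local_def local_ring_def by blast
 then show "maximalideal M R" "maximalideal N R \<Longrightarrow> N = M"
  unfolding max_ideal_def using theI'[of "\<lambda>M. maximalideal M R"] by (auto intro: the1_equality[symmetric])
qed

lemma M_ideal: "ideal M R" and M_proper: "M \<noteq> carrier R" and M_sub: "M \<subseteq> carrier R"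
 using M_maximal by (auto simp: maximalideal_def maximalideal_axioms_def dest: ideal.Icarr)

lemma proper_ideal_sub_M:
 assumes "ideal J R" "J \<noteq> carrier R" shows "J \<subseteq> M"
proof -
 let ?F = "{K. ideal K R \<and> K \<noteq> carrier R \<and> J \<subseteq> K}"
 have "?F \<noteq> {}" using assms by auto
 then obtain K where K: "K \<in> ?F" "\<And>K'. K' \<in> ?F \<Longrightarrow> K \<subseteq> K' \<Longrightarrow> K' = K"
  by (rule exists_maximal_ideal_in) auto
 have "maximalideal K R"
  by (rule maximalidealI) (use K in \<open>auto simp: subset_iff\<close>)
 then show ?thesis using M_unique K(1) by auto
qed

lemma not_M_unit: assumes "r \<in> carrier R" "r \<notin> M" shows "r \<in> Units R"
proof -
 have "PIdl r = carrier R"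
  using proper_ideal_sub_M[OF cgenideal_ideal[OF assms(1)]] cgenideal_self[OF assms(1)] assms(2) by blast
 then have "\<one> \<in> PIdl r" by simp
 then obtain s where "s \<in> carrier R" "\<one> = s \<otimes> r" unfolding cgenideal_def by auto
 then show ?thesis using assms(1) m_comm[of r s] unfolding Units_def by force
qed

lemma one_minus_unit: assumes "r \<in> M" shows "\<one> \<ominus> r \<in> Units R"
proof (rule not_M_unit)
 have r: "r \<in> carrier R" using assms M_sub by auto
 then show "\<one> \<ominus> r \<in> carrier R" by simp
 show "\<one> \<ominus> r \<notin> M"
 proof
  assume "\<one> \<ominus> r \<in> M"
  then have "(\<one> \<ominus> r) \<oplus> r \<in> M" by (rule ideal_add_closed[OF M_ideal _ assms])
  moreover have "(\<one> \<ominus> r) \<oplus> r = \<one>" using r by algebra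
  ultimately show False using ideal.one_imp_carrier[OF M_ideal] M_proper by simp
 qed
qed

lemma exists_regular: obtains x where "x \<in> M" "x \<in> nonzerodivisors R"
proof -
 let ?RM = "ring_as_module R"
 interpret RM: module R ?RM by (rule ring_as_module_module[OF is_cring])
 have "depth R ?RM = 1" using cm dim unfolding cohen_macaulay_local_def by simp
 then have "\<exists>xs. xs \<noteq> [] \<and> set xs \<subseteq> M \<and> regular_sequence R ?RM xs"
 proof (rule contrapos_pp)
  assume a: "\<nexists>xs. xs \<noteq> [] \<and> set xs \<subseteq> M \<and> regular_sequence R ?RM xs"
  have "depth R ?RM \<le> 0" unfolding depth_def
   by (rule Sup_least) (use a in \<open>auto simp: zero_enat_def\<close>)
  then show "depth R ?RM \<noteq> 1" by auto
 qed
 then obtain xs where xs: "xs \<noteq> []" "set xs \<subseteq> M" "regular_sequence R ?RM xs" by blast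
 have span: "module_span R ?RM {} \<subseteq> {\<zero>}" unfolding module_span_def
  using zero_submodule[OF RM.module_axioms] by auto
 have z: "\<zero> \<in> module_span R ?RM {}" unfolding module_span_def
  using subgroup.one_closed[OF submodule.axioms(1)] by fastforce
 have reg: "x \<in> module_span R ?RM {}" if "x \<in> carrier R" "xs ! 0 \<otimes> x \<in> module_span R ?RM {}" for x
  using xs(1,3) that unfolding regular_sequence_def Let_def by auto
 have "xs ! 0 \<in> M" using xs(1,2) by auto
 moreover have "xs ! 0 \<in> nonzerodivisors R" unfolding nonzerodivisors_def
 proof (intro CollectI conjI ballI impI)
  show "xs ! 0 \<in> carrier R" using M_sub \<open>xs ! 0 \<in> M\<close> by blast
  show "r = \<zero>" if "r \<in> carrier R" "xs ! 0 \<otimes> r = \<zero>" for r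
   using reg[OF that(1)] that(2) z span by auto
 qed
 ultimately show ?thesis using that by blast
qed

lemma regular_prime: assumes P: "primeideal P R" and x: "x \<in> P" "x \<in> nonzerodivisors R" shows "P = M"
proof (rule ccontr)
 assume ne: "P \<noteq> M"
 interpret P: primeideal P R by fact
 have PM: "P \<subset> M" using proper_ideal_sub_M[OF P.is_ideal] P.I_notcarr ne by auto
 obtain P' where P': "primeideal P' R" "P' \<subset> P"
  by (rule nonunit_power_prime[OF noetherian_ring_axioms is_cring P x(2,1)])
 define c where "c = (\<lambda>i::nat. if i = 0 then P' else if i = 1 then P else M)"
 have "\<forall>i\<le>2. primeideal (c i) R" "\<forall>i<2. c i \<subset> c (Suc i)"
  using P P' PM maximalideal_prime[OF M_maximal] by (auto simp: c_def less_2_cases_iff)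
 then have "enat 2 \<le> krull_dim R" unfolding krull_dim_def by (intro Sup_upper) blast
 then show False using dim by (simp add: one_enat_def)
qed

text \<open>
 Among the ideals J : y with \<open>y \<in> J' - J\<close> a maximal one is prime, and it contains the
 nonzerodivisor x, so it is M.
\<close>
lemma exists_socle:
 assumes J: "ideal J R" "ideal J' R" "J \<subset> J'" and x: "x \<in> J" "x \<in> nonzerodivisors R"
 obtains y where "y \<in> J'" "y \<notin> J" "colon_ideal R J y = M"
proof -
 have J'c: "y \<in> carrier R" if "y \<in> J'" for y using ideal.Icarr[OF J(2) that] .
 let ?F = "colon_ideal R J ` (J' - J)"
 have "?F \<noteq> {}" using J(3) by auto
 then obtain K where K: "K \<in> ?F" "\<And>K'. K' \<in> ?F \<Longrightarrow> K \<subseteq> K' \<Longrightarrow> K' = K"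
  by (rule exists_maximal_ideal_in) (use colon_ideal_ideal[OF is_cring J(1)] J'c in auto)
 obtain y where y: "y \<in> J'" "y \<notin> J" "K = colon_ideal R J y" using K(1) by auto
 note yc = J'c[OF y(1)]
 have KI: "ideal K R" unfolding y(3) by (rule colon_ideal_ideal[OF is_cring J(1) yc])
 have "primeideal K R"
 proof (rule primeidealI[OF KI is_cring])
  have "\<one> \<notin> K" using y yc by (simp add: colon_ideal_def)
  then show "carrier R \<noteq> K" by auto
  fix r s assume rs: "r \<in> carrier R" "s \<in> carrier R" "r \<otimes> s \<in> K"
  show "r \<in> K \<or> s \<in> K"
  proof (rule disjCI)
   assume sK: "s \<notin> K"
   have ys: "y \<otimes> s \<in> J'" "y \<otimes> s \<notin> J"
    using ideal.I_r_closed[OF J(2) y(1) rs(2)] sK rs(2) unfolding y(3) colon_ideal_def by auto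
   have "K \<subseteq> colon_ideal R J (y \<otimes> s)"
   proof
    fix k assume k: "k \<in> K"
    then have kc: "k \<in> carrier R" "y \<otimes> k \<in> J" unfolding y(3) colon_ideal_def by auto
    have "(y \<otimes> s) \<otimes> k = s \<otimes> (y \<otimes> k)" using kc yc rs by (simp add: m_ac)
    then show "k \<in> colon_ideal R J (y \<otimes> s)" unfolding colon_ideal_def
     using kc ideal.I_l_closed[OF J(1) kc(2) rs(2)] by simp
   qed
   then have "colon_ideal R J (y \<otimes> s) = K" using K(2) ys by blast
   moreover have "r \<in> colon_ideal R J (y \<otimes> s)"
    using rs yc unfolding y(3) colon_ideal_def by (simp add: m_ac)
   ultimately show "r \<in> K" by simp
  qed
 qed
 moreover have "x \<in> K" unfolding y(3) colon_ideal_def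
  using ideal.I_l_closed[OF J(1) x(1) yc] x(2) by (simp add: nonzerodivisors_def)
 ultimately have "K = M" by (rule regular_prime[OF _ _ x(2)])
 then show ?thesis using that y by simp
qed

lemma exists_socle_carrier:
 assumes J: "ideal J R" "J \<inter> nonzerodivisors R \<noteq> {}" "J \<noteq> carrier R"
 shows "\<exists>y\<in>carrier R. {r \<in> carrier R. y \<otimes> r \<in> J} = M"
proof -
 obtain x where x: "x \<in> J" "x \<in> nonzerodivisors R" using J(2) by blast
 have "J \<subset> carrier R" using J(1,3) ideal.Icarr[OF J(1)] by blast
 then obtain y where "y \<in> carrier R" "colon_ideal R J y = M"
  by (rule exists_socle[OF J(1) oneideal _ x])
 then show ?thesis unfolding colon_ideal_def by blast
qed

lemma ext_zero_canonical:
 fixes C :: "('a, 'm) module"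
 assumes "module R C" "finite_injective_dim R C" "ideal J R" "J \<inter> nonzerodivisors R \<noteq> {}"
 shows "ext_zero R J C 1"
proof -
 obtain x where x: "x \<in> M" "x \<in> nonzerodivisors R" by (rule exists_regular)
 have xc: "x \<in> carrier R" using x(1) M_sub by auto
 have "PIdl x \<subseteq> M" unfolding cgenideal_def using ideal.I_l_closed[OF M_ideal x(1)] by auto
 then have "PIdl x \<noteq> carrier R" using M_proper M_sub by auto
 then show ?thesis
  by (rule ext_zero_of_finite_injective_dim[OF noetherian_ring_axioms assms(1) M_ideal M_proper x(2) _
    exists_socle_carrier assms(2-4)])
qed
end

lemma one_dim_cmI:
 assumes "cohen_macaulay_local R" "krull_dim R = 1" shows "one_dim_cm R"
 using assms by (intro one_dim_cm.intro one_dim_cm_axioms.intro)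
  (auto simp: cohen_macaulay_local_def local_ring_def)

section \<open>Duality with respect to a canonical ideal\<close>

text \<open>
 Regular fractional ideals: the unit u makes the module big, the unit s is a common denominator.
\<close>
definition is_lattice :: "('q, 'd) ring_scheme \<Rightarrow> 'q set \<Rightarrow> 'q set \<Rightarrow> bool" where
 "is_lattice Q A F \<longleftrightarrow> stable_subgroup Q A F \<and> (\<exists>u\<in>F. u \<in> Units Q) \<and>
   (\<exists>s\<in>Units Q. \<forall>f\<in>F. s \<otimes>\<^bsub>Q\<^esub> f \<in> A)"

definition reflexive_for :: "('q, 'd) ring_scheme \<Rightarrow> 'q set \<Rightarrow> 'q set \<Rightarrow> bool" where
 "reflexive_for Q A K \<longleftrightarrow> (\<forall>F. is_lattice Q A F \<longrightarrow> colon Q K (colon Q K F) = F)"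

lemma (in total_quotient) unit_nzd:
 assumes "r \<in> carrier R" "\<iota> r \<in> Units Q" shows "r \<in> nonzerodivisors R"
 unfolding nonzerodivisors_def
proof (intro CollectI conjI ballI impI)
 fix s assume s: "s \<in> carrier R" "r \<otimes>\<^bsub>R\<^esub> s = \<zero>\<^bsub>R\<^esub>"
 have "\<iota> r \<otimes> \<iota> s = \<iota> r \<otimes> \<zero>" using s assms by (simp flip: iota_simps(3))
 then have "\<iota> s = \<iota> \<zero>\<^bsub>R\<^esub>" using assms s by (simp add: Q.Units_l_cancel del: Q.r_null)
 then show "s = \<zero>\<^bsub>R\<^esub>" by (rule inj_onD[OF iota_inj]) (use s in auto)
qed (rule assms)

lemma (in total_quotient) preimage_ideal:
 assumes F: "stable_subgroup Q A F" and s: "s \<in> carrier Q"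
 shows "ideal {r \<in> carrier R. s \<otimes> \<iota> r \<in> F} R"
proof (rule submodule_ring_ideal[OF R.is_cring])
 interpret RM: module R "ring_as_module R" by (rule ring_as_module_module[OF R.is_cring])
 show "submodule {r \<in> carrier R. s \<otimes> \<iota> r \<in> F} R (ring_as_module R)"
 proof (rule RM.submoduleI)
  show "\<zero>\<^bsub>ring_as_module R\<^esub> \<in> {r \<in> carrier R. s \<otimes> \<iota> r \<in> F}"
   using s stableD(2)[OF F] by simp
  show "\<ominus>\<^bsub>ring_as_module R\<^esub> r \<in> {r \<in> carrier R. s \<otimes> \<iota> r \<in> F}"
   if "r \<in> {r \<in> carrier R. s \<otimes> \<iota> r \<in> F}" for r
   using that s stable_minus[OF F, of "s \<otimes> \<iota> r"] by (simp add: ring_as_module_minus[OF R.is_cring] Q.r_minus)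
  show "r \<oplus>\<^bsub>ring_as_module R\<^esub> r' \<in> {r \<in> carrier R. s \<otimes> \<iota> r \<in> F}"
   if "r \<in> {r \<in> carrier R. s \<otimes> \<iota> r \<in> F}" "r' \<in> {r \<in> carrier R. s \<otimes> \<iota> r \<in> F}" for r r'
   using that s stableD(3)[OF F, of "s \<otimes> \<iota> r" "s \<otimes> \<iota> r'"] by (simp add: Q.r_distr)
  show "a \<odot>\<^bsub>ring_as_module R\<^esub> r \<in> {r \<in> carrier R. s \<otimes> \<iota> r \<in> F}"
   if "a \<in> carrier R" "r \<in> {r \<in> carrier R. s \<otimes> \<iota> r \<in> F}" for a r
   using that s stableD(4)[OF F, of "\<iota> a" "s \<otimes> \<iota> r"] by (simp add: Q.m_lcomm)
 qed auto
qed

lemma quotient_length_one: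
 assumes len: "quotient_length Q A F G = 1"
  and FG: "stable_subgroup Q A F" "stable_subgroup Q A G" "G \<subseteq> F"
 shows "F \<noteq> G" and "stable_subgroup Q A Y \<Longrightarrow> G \<subseteq> Y \<Longrightarrow> Y \<subseteq> F \<Longrightarrow> Y = G \<or> Y = F"
proof -
 show "F \<noteq> G"
 proof
  assume "F = G"
  have "quotient_length Q A F G \<le> 0" unfolding quotient_length_def
  proof (rule Sup_least, clarify)
   fix n :: nat and N :: "nat \<Rightarrow> 'a set"
   assume N: "\<forall>i\<le>n. stable_subgroup Q A (N i) \<and> G \<subseteq> N i \<and> N i \<subseteq> F" "\<forall>i<n. N i \<subset> N (Suc i)"
   have "n = 0"
   proof (rule ccontr)
    assume "n \<noteq> 0"
    then have "N 0 = F" "N (Suc 0) = F" 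
     using N(1)[rule_format, of 0] N(1)[rule_format, of "Suc 0"] \<open>F = G\<close> by auto
    then show False using N(2) \<open>n \<noteq> 0\<close> by auto
   qed
   then show "enat n \<le> 0" by (simp add: zero_enat_def)
  qed
  then show False using len by simp
 qed
 show "Y = G \<or> Y = F" if Y: "stable_subgroup Q A Y" "G \<subseteq> Y" "Y \<subseteq> F"
 proof (rule ccontr)
  assume ne: "\<not> (Y = G \<or> Y = F)"
  define N where "N = (\<lambda>i::nat. if i = 0 then G else if i = 1 then Y else F)"
  have "(\<forall>i\<le>2. stable_subgroup Q A (N i) \<and> G \<subseteq> N i \<and> N i \<subseteq> F) \<and> (\<forall>i<2. N i \<subset> N (Suc i))"
   using FG Y ne by (auto simp: N_def less_2_cases_iff)
  then have "enat 2 \<le> quotient_length Q A F G" unfolding quotient_length_def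
   by (intro Sup_upper) blast
  then show False using len by (simp add: one_enat_def)
 qed
qed

locale canonical_embedding = one_dim_cm R + embedded_module R Q \<iota> C j
 for R :: "('a, 'b) ring_scheme" and Q :: "('q, 'd) ring_scheme" (structure) and \<iota>
  and C :: "('a, 'm) module" and j +
 assumes finite_inj: "finite_injective_dim R C"
  and type_one: "module_length R (Ext_module R (cyclic_module R M) C 1) = 1"
  and lattice_CC: "is_lattice Q A CC"
begin

lemma iota_M_sub: "\<iota> ` M \<subseteq> carrier Q" using M_sub by auto

lemma colon_M_length: "quotient_length Q A (colon Q CC (\<iota> ` M)) CC = 1"
proof -
 obtain x where "x \<in> M" "x \<in> nonzerodivisors R" by (rule exists_regular)
 then show ?thesis using ext1_length[OF noetherian_ring_axioms M_ideal] type_one by simp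
qed

lemma CC_sub_colon_M: "CC \<subseteq> colon Q CC (\<iota> ` M)"
proof -
 have "\<iota> r \<otimes> c \<in> CC" if "r \<in> M" "c \<in> CC" for r c
  using stableD(4)[OF CC_stable _ that(2)] that(1) M_sub by blast
 then show ?thesis unfolding colon_def using M_sub by (auto simp: Q.m_comm subset_iff)
qed

text \<open>
 Suppose that F is strictly contained in \<open>F' = C : (C : F)\<close>. A unit t of Q scales both into M,
 giving ideals \<open>J0 \<subset> J2\<close> of R, and there is \<open>y \<in> J2\<close> with
 \<open>J0 : y = M\<close>. As F and F' have the same colon into C, so have J0 and \<open>J0 + yR\<close>. By
 colon_strict this forces \<open>C : M \<subseteq> C\<close>, contrary to type one.
\<close>
lemma CC_reflexive: "reflexive_for Q A CC"
 unfolding reflexive_for_def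
proof (intro allI impI)
 fix F assume F: "is_lattice Q A F"
 let ?D = "colon Q CC F"
 let ?F = "colon Q CC ?D"
 have Fs: "stable_subgroup Q A F" using F by (simp add: is_lattice_def)
 have Fc: "f \<in> carrier Q" if "f \<in> F" for f using stableD(1)[OF Fs that] .
 obtain u where u: "u \<in> F" "u \<in> Units Q" using F unfolding is_lattice_def by blast
 obtain s where s: "s \<in> Units Q" "\<And>f. f \<in> F \<Longrightarrow> s \<otimes> f \<in> A" using F unfolding is_lattice_def by blast
 obtain c0 where c0: "c0 \<in> CC" "c0 \<in> Units Q" using lattice_CC unfolding is_lattice_def by blast
 obtain s' where s': "s' \<in> Units Q" "\<And>f. f \<in> CC \<Longrightarrow> s' \<otimes> f \<in> A" using lattice_CC unfolding is_lattice_def by blast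
 obtain x where x: "x \<in> M" "x \<in> nonzerodivisors R" by (rule exists_regular)
 have xc: "x \<in> carrier R" using x(1) M_sub by auto
 have FF: "F \<subseteq> ?F"
 proof
  fix f assume f: "f \<in> F"
  show "f \<in> ?F" unfolding colon_def using Fc[OF f] f by (auto simp: Q.m_comm)
 qed
 have FFs: "stable_subgroup Q A ?F" by (rule colon_stable[OF CC_stable]) (auto simp: colon_def)
 have v: "c0 \<otimes> s \<in> ?D"
  unfolding colon_def
 proof (intro CollectI conjI ballI)
  show "c0 \<otimes> s \<in> carrier Q" using c0(2) s(1) by (simp add: Q.Units_closed)
  fix f assume f: "f \<in> F"
  have "(s \<otimes> f) \<otimes> c0 \<in> CC" by (rule stableD(4)[OF CC_stable s(2)[OF f] c0(1)])
  then show "c0 \<otimes> s \<otimes> f \<in> CC" using c0(2) s(1) Fc[OF f] by (simp add: Q.m_ac Q.Units_closed)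
 qed
 \<comment> \<open>The double colon is multiplied into C by c0 s, then into A by s', and into the maximal ideal by x.\<close>
 define t where "t = \<iota> x \<otimes> (s' \<otimes> (c0 \<otimes> s))"
 have tU: "t \<in> Units Q" unfolding t_def using iota_units[OF x(2)] s' c0 s by simp
 have tc: "t \<in> carrier Q" using tU by (rule Q.Units_closed)
 define ti where "ti = inv t"
 have ti: "ti \<in> carrier Q" "ti \<otimes> t = \<one>" "t \<otimes> ti = \<one>"
  unfolding ti_def using tU by auto
 have tcancel: "ti \<otimes> (t \<otimes> q) = q" "t \<otimes> (ti \<otimes> q) = q" if "q \<in> carrier Q" for q
  using ti tc that by (simp_all flip: Q.m_assoc)
 have tM: "\<exists>r\<in>M. t \<otimes> h = \<iota> r" if h: "h \<in> ?F" for h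
 proof -
  have hc: "h \<in> carrier Q" using h by (simp add: colon_def)
  have "h \<otimes> (c0 \<otimes> s) \<in> CC" using h v by (simp add: colon_def)
  then obtain r where r: "r \<in> carrier R" "s' \<otimes> (h \<otimes> (c0 \<otimes> s)) = \<iota> r" using s'(2) by blast
  have "t \<otimes> h = \<iota> x \<otimes> (s' \<otimes> (h \<otimes> (c0 \<otimes> s)))"
   unfolding t_def using hc xc s'(1) c0(2) s(1) by (simp add: Q.m_ac Q.Units_closed)
  also have "\<dots> = \<iota> (x \<otimes>\<^bsub>R\<^esub> r)" using r xc by simp
  finally show ?thesis using ideal.I_r_closed[OF M_ideal x(1) r(1)] by blast
 qed
 show "?F = F"
 proof (rule ccontr)
  assume ne: "?F \<noteq> F"
  define J0 where "J0 = {r \<in> carrier R. ti \<otimes> \<iota> r \<in> F}"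
  define J2 where "J2 = {r \<in> carrier R. ti \<otimes> \<iota> r \<in> ?F}"
  have I0: "ideal J0 R" unfolding J0_def by (rule preimage_ideal[OF Fs ti(1)])
  have I2: "ideal J2 R" unfolding J2_def by (rule preimage_ideal[OF FFs ti(1)])
  have J2M: "J2 \<subseteq> M"
  proof
   fix r assume r: "r \<in> J2"
   then have rc: "r \<in> carrier R" by (simp add: J2_def)
   obtain r' where r': "r' \<in> M" "t \<otimes> (ti \<otimes> \<iota> r) = \<iota> r'" using tM r by (auto simp: J2_def)
   then have "\<iota> r = \<iota> r'" using tcancel(2) rc by simp
   then show "r \<in> M" using inj_onD[OF iota_inj, of r r'] rc r' M_sub by auto
  qed
  have "J0 \<subseteq> J2" unfolding J0_def J2_def using FF by auto
  moreover have "J0 \<noteq> J2"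
  proof -
   obtain h where h: "h \<in> ?F" "h \<notin> F" using ne FF by blast
   then obtain r where r: "r \<in> M" "t \<otimes> h = \<iota> r" using tM by blast
   have "ti \<otimes> \<iota> r = h" using tcancel(1)[of h] h(1) r(2) by (simp add: colon_def)
   then have "r \<in> J2" "r \<notin> J0" unfolding J0_def J2_def using h r(1) M_sub by auto
   then show ?thesis by blast
  qed
  ultimately have J02: "J0 \<subset> J2" by blast
  obtain x0 where x0: "x0 \<in> J0" "x0 \<in> nonzerodivisors R"
  proof -
   obtain r where r: "r \<in> M" "t \<otimes> u = \<iota> r" using tM FF u(1) by blast
   have rc: "r \<in> carrier R" using r(1) M_sub by auto
   have "\<iota> r \<in> Units Q" using r(2) tU u(2) by (metis Q.Units_m_closed)
   then have "r \<in> nonzerodivisors R" by (rule unit_nzd[OF rc])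
   moreover have "r \<in> J0" unfolding J0_def using rc u(1) tcancel(1)[OF Fc[OF u(1)]] by (simp flip: r(2))
   ultimately show ?thesis using that by blast
  qed
  obtain y where y: "y \<in> J2" "y \<notin> J0" "colon_ideal R J0 y = M"
   by (rule exists_socle[OF I0 I2 J02 x0])
  have yc: "y \<in> carrier R" using y(1) by (simp add: J2_def)
  let ?J = "{g \<oplus>\<^bsub>R\<^esub> y \<otimes>\<^bsub>R\<^esub> r | g r. g \<in> J0 \<and> r \<in> carrier R}"
  note J = ideal_add_element[OF is_cring I0 yc]
  have JM: "?J \<subseteq> M"
  proof
   fix z assume "z \<in> ?J"
   then obtain g r where z: "z = g \<oplus>\<^bsub>R\<^esub> y \<otimes>\<^bsub>R\<^esub> r" "g \<in> J0" "r \<in> carrier R" by blast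
   show "z \<in> M" unfolding z(1)
    by (intro ideal_add_closed[OF M_ideal] ideal.I_r_closed[OF M_ideal]) (use z y(1) J02 J2M in auto)
  qed
  have "?J \<inter> nonzerodivisors R \<noteq> {}" using J(2) x0 by blast
  then have ez: "ext_zero R ?J C 1" by (rule ext_zero_canonical[OF C.module_axioms finite_inj J(1)])
  have ne': "colon Q CC (\<iota> ` M) \<noteq> CC"
   by (rule quotient_length_one(1)[OF colon_M_length colon_stable[OF CC_stable iota_M_sub] CC_stable CC_sub_colon_M])
  then obtain c where c: "c \<in> colon Q CC (\<iota> ` M)" "c \<notin> CC" using CC_sub_colon_M by blast
  have cc: "c \<in> carrier Q" using c(1) by (simp add: colon_def)
  have "c \<in> CC"
  proof (rule colon_strict[OF ez J(1) I0 J(2) refl J(3) y(3)[symmetric, unfolded colon_ideal_def] subsetD[OF J(2) x0(1)] x0(2)])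
   show "\<one>\<^bsub>R\<^esub> \<ominus>\<^bsub>R\<^esub> r \<in> Units R" if "r \<in> ?J" for r by (rule one_minus_unit) (use that JM in blast)
   show "\<iota> r \<otimes> c \<in> CC" if "r \<in> M" for r
   proof -
    have "c \<otimes> \<iota> r \<in> CC" using c(1) that by (simp add: colon_def)
    then show ?thesis using that M_sub cc by (simp add: Q.m_comm subset_iff)
   qed
   fix q assume q: "q \<in> carrier Q" "\<And>g. g \<in> J0 \<Longrightarrow> q \<otimes> \<iota> g \<in> CC"
   have "q \<otimes> t \<in> ?D" unfolding colon_def
   proof (intro CollectI conjI ballI)
    show "q \<otimes> t \<in> carrier Q" using q tc by simp
    fix f assume f: "f \<in> F"
    then obtain r where r: "r \<in> M" "t \<otimes> f = \<iota> r" using tM FF by blast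
    have "r \<in> J0" unfolding J0_def using r(1) M_sub f tcancel(1)[OF Fc[OF f]] by (auto simp flip: r(2))
    then have "q \<otimes> (t \<otimes> f) \<in> CC" using q(2) r(2) by simp
    then show "q \<otimes> t \<otimes> f \<in> CC" using q(1) tc Fc[OF f] by (simp add: Q.m_assoc)
   qed
   moreover have "ti \<otimes> \<iota> y \<in> ?F" using y(1) by (simp add: J2_def)
   ultimately have "(ti \<otimes> \<iota> y) \<otimes> (q \<otimes> t) \<in> CC" by (simp add: colon_def)
   moreover have "(ti \<otimes> \<iota> y) \<otimes> (q \<otimes> t) = t \<otimes> (ti \<otimes> (q \<otimes> \<iota> y))"
    using ti(1) tc q(1) yc by (simp add: Q.m_ac)
   ultimately show "q \<otimes> \<iota> y \<in> CC" using tcancel(2) q(1) yc by simp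
  qed (rule cc)
  then show False using c(2) by simp
 qed
qed

end

section \<open>Length of intervals of submodules, lattices\<close>

definition simple_over :: "('q, 'd) ring_scheme \<Rightarrow> 'q set \<Rightarrow> 'q set \<Rightarrow> 'q set \<Rightarrow> bool" where
 "simple_over Q A F G \<longleftrightarrow> stable_subgroup Q A F \<and> G \<subset> F \<and>
   (\<forall>H. stable_subgroup Q A H \<longrightarrow> G \<subseteq> H \<longrightarrow> H \<subseteq> F \<longrightarrow> H = G \<or> H = F)"

inductive composition_series :: "('q, 'd) ring_scheme \<Rightarrow> 'q set \<Rightarrow> 'q set \<Rightarrow> 'q set \<Rightarrow> nat \<Rightarrow> bool"
 for Q A G where
 trivial: "stable_subgroup Q A G \<Longrightarrow> composition_series Q A G G 0"
| step: "composition_series Q A G F n \<Longrightarrow> simple_over Q A F' F \<Longrightarrow> composition_series Q A G F' (Suc n)"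

lemma composition_series_stable:
 "composition_series Q A G F n \<Longrightarrow> stable_subgroup Q A G \<and> stable_subgroup Q A F \<and> G \<subseteq> F"
 by (induction rule: composition_series.induct) (auto simp: simple_over_def)

lemma composition_series_trans:
 "composition_series Q A F F' m \<Longrightarrow> composition_series Q A G F n \<Longrightarrow> composition_series Q A G F' (n + m)"
 by (induction rule: composition_series.induct) (auto intro: composition_series.step)

lemma composition_series_ex_chain:
 assumes "composition_series Q A G F n"
 shows "\<exists>N :: nat \<Rightarrow> 'q set. (\<forall>i\<le>n. stable_subgroup Q A (N i) \<and> G \<subseteq> N i \<and> N i \<subseteq> F) \<and> N n = F \<and>
  (\<forall>i<n. N i \<subset> N (Suc i))"
 using assms
proof (induction rule: composition_series.induct)
 case trivial
 then show ?case by (intro exI[of _ "\<lambda>_. G"]) auto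
next
 case (step F n F')
 then obtain N where N: "\<forall>i\<le>n. stable_subgroup Q A (N i) \<and> G \<subseteq> N i \<and> N i \<subseteq> F" "N n = F"
  "\<forall>i<n. N i \<subset> N (Suc i)" by blast
 have F': "stable_subgroup Q A F'" "F \<subset> F'" using step(2) by (auto simp: simple_over_def)
 have GF: "G \<subseteq> F" using composition_series_stable[OF step(1)] by simp
 define N' where "N' = N(Suc n := F')"
 have "stable_subgroup Q A (N' i) \<and> G \<subseteq> N' i \<and> N' i \<subseteq> F'" if "i \<le> Suc n" for i
 proof (cases "i = Suc n")
  case False
  then have "i \<le> n" using that by simp
  then show ?thesis using N(1)[rule_format, of i] F' by (auto simp: N'_def)
 qed (use F' GF in \<open>auto simp: N'_def\<close>)
 moreover have "N' i \<subset> N' (Suc i)" if "i < Suc n" for i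
  using that N(2,3) F'(2) by (cases "i = n") (auto simp: N'_def)
 ultimately show ?case by (intro exI[of _ N']) (simp add: N'_def)
qed

context cring
begin

lemma stable_neg:
 assumes "stable_subgroup R A H" "\<ominus> \<one> \<in> A" "x \<in> H" shows "\<ominus> x \<in> H"
 using stableD(4)[OF assms(1,2,3)] stableD(1)[OF assms(1,3)] by (simp add: l_minus)

lemma stable_inter:
 "stable_subgroup R A F \<Longrightarrow> stable_subgroup R A G \<Longrightarrow> stable_subgroup R A (F \<inter> G)"
 unfolding stable_subgroup_def by blast

lemma stable_sum:
 assumes "stable_subgroup R A F" "stable_subgroup R A G" "A \<subseteq> carrier R"
 shows "stable_subgroup R A (F <+>\<^bsub>R\<^esub> G)" "F \<subseteq> F <+>\<^bsub>R\<^esub> G" "G \<subseteq> F <+>\<^bsub>R\<^esub> G"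
proof -
 note D = stableD[OF assms(1)] and E = stableD[OF assms(2)]
 show "F \<subseteq> F <+>\<^bsub>R\<^esub> G"
 proof
  fix x assume x: "x \<in> F"
  then have "x = x \<oplus> \<zero>" using D(1) by simp
  then show "x \<in> F <+>\<^bsub>R\<^esub> G" unfolding set_add_def' using x E(2) by blast
 qed
 show "G \<subseteq> F <+>\<^bsub>R\<^esub> G"
 proof
  fix x assume x: "x \<in> G"
  then have "x = \<zero> \<oplus> x" using E(1) by simp
  then show "x \<in> F <+>\<^bsub>R\<^esub> G" unfolding set_add_def' using x D(2) by blast
 qed
 show "stable_subgroup R A (F <+>\<^bsub>R\<^esub> G)"
 proof (rule stableI)
  show "F <+>\<^bsub>R\<^esub> G \<subseteq> carrier R" using D(1) E(1) unfolding set_add_def' by auto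
  show "\<zero> \<in> F <+>\<^bsub>R\<^esub> G" using \<open>F \<subseteq> F <+>\<^bsub>R\<^esub> G\<close> D(2) by blast
  fix x y assume "x \<in> F <+>\<^bsub>R\<^esub> G" "y \<in> F <+>\<^bsub>R\<^esub> G"
  then obtain f g f' g' where "x = f \<oplus> g" "y = f' \<oplus> g'" and fg: "f \<in> F" "g \<in> G" "f' \<in> F" "g' \<in> G"
   unfolding set_add_def' by blast
  moreover have "(f \<oplus> g) \<oplus> (f' \<oplus> g') = (f \<oplus> f') \<oplus> (g \<oplus> g')" using fg D(1) E(1) by (simp add: a_ac)
  ultimately have "x \<oplus> y = (f \<oplus> f') \<oplus> (g \<oplus> g')" by simp
  then show "x \<oplus> y \<in> F <+>\<^bsub>R\<^esub> G" unfolding set_add_def' using D(3)[OF fg(1,3)] E(3)[OF fg(2,4)] by blast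
 next
  fix a x assume a: "a \<in> A" and "x \<in> F <+>\<^bsub>R\<^esub> G"
  then obtain f g where "x = f \<oplus> g" and fg: "f \<in> F" "g \<in> G" unfolding set_add_def' by blast
  moreover have "a \<otimes> (f \<oplus> g) = a \<otimes> f \<oplus> a \<otimes> g" using fg a assms(3) D(1) E(1) by (simp add: r_distr subset_iff)
  ultimately show "a \<otimes> x \<in> F <+>\<^bsub>R\<^esub> G" unfolding set_add_def' using D(4)[OF a] E(4)[OF a] by blast
 qed
qed

lemma modular_strict:
 assumes st: "stable_subgroup R A F" "stable_subgroup R A H" "stable_subgroup R A H'" and A: "\<ominus> \<one> \<in> A"
  and HH: "H \<subset> H'" and sum: "H' \<subseteq> H <+>\<^bsub>R\<^esub> F"
 shows "H \<inter> F \<subset> H' \<inter> F"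
proof -
 obtain x where x: "x \<in> H'" "x \<notin> H" using HH by blast
 then obtain h f where hf: "x = h \<oplus> f" "h \<in> H" "f \<in> F" using sum unfolding set_add_def' by blast
 have c: "h \<in> carrier R" "f \<in> carrier R" using hf stableD(1)[OF st(2)] stableD(1)[OF st(1)] by auto
 have "x \<oplus> \<ominus> h \<in> H'"
  by (rule stableD(3)[OF st(3) x(1)], rule stable_neg[OF st(3) A]) (use hf HH in blast)
 moreover have "x \<oplus> \<ominus> h = f" using c unfolding hf(1) by algebra
 moreover have "f \<notin> H"
  using x(2) stableD(3)[OF st(2) hf(2)] hf(1) by blast
 ultimately show ?thesis using hf(3) HH by blast
qed

text \<open>
 The inequality in the Jordan-Hoelder theorem. Intersecting a chain in F' with the last proper term F loses at
 most one step: above the first N i not contained in F one has \<open>N i + F = F'\<close>, so by the modular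
 law the intersections still increase strictly.
\<close>
lemma composition_series_bounds_chains:
 assumes "composition_series R A G F n" and A: "A \<subseteq> carrier R" "\<ominus> \<one> \<in> A"
  and N: "\<And>i. i \<le> k \<Longrightarrow> stable_subgroup R A (N i)" "\<And>i. i \<le> k \<Longrightarrow> G \<subseteq> N i" "\<And>i. i \<le> k \<Longrightarrow> N i \<subseteq> F"
   "\<And>i. i < k \<Longrightarrow> N i \<subset> N (Suc i)"
 shows "k \<le> n"
 using assms(1) N
proof (induction arbitrary: N k rule: composition_series.induct)
 case trivial
 show ?case
 proof (rule ccontr)
  assume "\<not> k \<le> 0"
  then have "N 0 = G" "N (Suc 0) = G" using trivial(3)[of 0] trivial(4)[of 0] trivial(3)[of "Suc 0"] trivial(4)[of "Suc 0"] by auto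
  then show False using trivial(5)[of 0] \<open>\<not> k \<le> 0\<close> by auto
 qed
next
 case (step F n F')
 have Fs: "stable_subgroup R A F" and GF: "G \<subseteq> F" using composition_series_stable[OF step(1)] by auto
 have sim: "H = F \<or> H = F'" if "stable_subgroup R A H" "F \<subseteq> H" "H \<subseteq> F'" for H
  using step(2) that unfolding simple_over_def by blast
 have F's: "stable_subgroup R A F'" "F \<subseteq> F'" using step(2) unfolding simple_over_def by auto
 show ?case
 proof (cases "\<forall>i\<le>k. N i \<subseteq> F")
  case True
  then show ?thesis using step.IH[of k N] step.prems by fastforce
 next
  case False
  \<comment> \<open>the first term outside F\<close>
  define i0 where "i0 = (LEAST i. \<not> N i \<subseteq> F)"
  obtain i where i: "i \<le> k" "\<not> N i \<subseteq> F" using False by blast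
  have i0: "\<not> N i0 \<subseteq> F" unfolding i0_def by (rule LeastI[of "\<lambda>i. \<not> N i \<subseteq> F", OF i(2)])
  have i0k: "i0 \<le> k" using Least_le[of "\<lambda>i. \<not> N i \<subseteq> F", OF i(2)] i(1) unfolding i0_def by simp
  have below: "N i \<subseteq> F" if "i < i0" for i using not_less_Least[OF that[unfolded i0_def]] by simp
  have mono: "N a \<subseteq> N b" if "a \<le> b" "b \<le> k" for a b
   using that
  proof (induction b)
   case (Suc b)
   show ?case
   proof (cases "a = Suc b")
    case False
    then have "N a \<subseteq> N b" using Suc by simp
    then show ?thesis using step.prems(4)[of b] Suc.prems by auto
   qed simp
  qed simp
  have full: "F' \<subseteq> N i <+>\<^bsub>R\<^esub> F" if "i0 \<le> i" "i \<le> k" for i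
  proof -
   have st: "stable_subgroup R A (N i)" using step.prems(1) that by simp
   note S = stable_sum[OF st Fs A(1)]
   have "N i <+>\<^bsub>R\<^esub> F \<subseteq> F'"
    using step.prems(3)[OF that(2)] F's stableD(3)[OF F's(1)] unfolding set_add_def' by blast
   then have "N i <+>\<^bsub>R\<^esub> F = F \<or> N i <+>\<^bsub>R\<^esub> F = F'" using sim[OF S(1) S(3)] by simp
   moreover have "N i <+>\<^bsub>R\<^esub> F \<noteq> F" using S(2) mono[OF that] i0 by blast
   ultimately show ?thesis by blast
  qed
  have strict: "N i \<inter> F \<subset> N (Suc i) \<inter> F" if "i0 \<le> i" "i < k" for i
   by (rule modular_strict[OF Fs _ _ A(2) step.prems(4)[OF that(2)]])
     (use step.prems(1) step.prems(3)[of "Suc i"] full[of i] that in auto)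
  show ?thesis
  proof (cases k)
   case (Suc k')
   have "k' \<le> n"
   \<comment> \<open>The term N i0 is dropped and later terms are cut down to F.\<close>
   proof (rule step.IH[of k' "\<lambda>i. if i < i0 then N i else N (Suc i) \<inter> F"])
    fix i assume ik: "i \<le> k'"
    then have "stable_subgroup R A (N i)" "stable_subgroup R A (N (Suc i))" "G \<subseteq> N i" "G \<subseteq> N (Suc i)"
     using step.prems(1,2) Suc by auto
    then show "stable_subgroup R A (if i < i0 then N i else N (Suc i) \<inter> F)"
     "G \<subseteq> (if i < i0 then N i else N (Suc i) \<inter> F)"
     "(if i < i0 then N i else N (Suc i) \<inter> F) \<subseteq> F"
     using stable_inter[OF _ Fs] GF below by auto
   next
    fix i assume ik: "i < k'"
    consider "Suc i < i0" | "Suc i = i0" | "i0 \<le> i" by linarith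
    then show "(if i < i0 then N i else N (Suc i) \<inter> F) \<subset> (if Suc i < i0 then N (Suc i) else N (Suc (Suc i)) \<inter> F)"
    proof cases
     case 1
     then show ?thesis using step.prems(4)[of i] ik Suc by simp
    next
     case 2
     have "N i \<subseteq> N i0 \<inter> F" using mono[of i i0] below[of i] 2 ik Suc by auto
     also have "\<dots> \<subset> N (Suc i0) \<inter> F" using strict[of i0] 2 ik Suc by simp
     finally show ?thesis using 2 by simp
    next
     case 3
     then show ?thesis using strict[of "Suc i"] ik Suc by simp
    qed
   qed
   then show ?thesis using Suc by simp
  qed simp
 qed
qed

lemma composition_series_length:
 assumes "composition_series R A G F n" and A: "A \<subseteq> carrier R" "\<ominus> \<one> \<in> A"
 shows "quotient_length R A F G = enat n"
 unfolding quotient_length_def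
proof (rule antisym)
 show "Sup {enat n |n. \<exists>N. (\<forall>i\<le>n. stable_subgroup R A (N i) \<and> G \<subseteq> N i \<and> N i \<subseteq> F) \<and> (\<forall>i<n. N i \<subset> N (Suc i))} \<le> enat n"
 proof (rule Sup_least, clarify)
  fix k and N :: "nat \<Rightarrow> 'a set"
  assume "\<forall>i\<le>k. stable_subgroup R A (N i) \<and> G \<subseteq> N i \<and> N i \<subseteq> F" "\<forall>i<k. N i \<subset> N (Suc i)"
  then show "enat k \<le> enat n"
   using composition_series_bounds_chains[OF assms, of k N] by simp
 qed
 show "enat n \<le> Sup {enat n |n. \<exists>N. (\<forall>i\<le>n. stable_subgroup R A (N i) \<and> G \<subseteq> N i \<and> N i \<subseteq> F) \<and> (\<forall>i<n. N i \<subset> N (Suc i))}"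
  by (rule Sup_upper) (use composition_series_ex_chain[OF assms(1)] in blast)
qed
end

lemma quotient_length_le:
 assumes "\<And>H. stable_subgroup Q A H \<Longrightarrow> G \<subseteq> H \<Longrightarrow> H \<subseteq> F \<Longrightarrow>
   stable_subgroup Q' A' (\<phi> H) \<and> G' \<subseteq> \<phi> H \<and> \<phi> H \<subseteq> F'"
  and "\<And>H H'. stable_subgroup Q A H \<Longrightarrow> G \<subseteq> H \<Longrightarrow> stable_subgroup Q A H' \<Longrightarrow> H' \<subseteq> F \<Longrightarrow> H \<subset> H' \<Longrightarrow> \<phi> H \<subset> \<phi> H'"
 shows "quotient_length Q A F G \<le> quotient_length Q' A' F' G'"
 unfolding quotient_length_def
proof (rule Sup_subset_mono, clarify)
 fix n and N :: "nat \<Rightarrow> 'a set"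
 assume N: "\<forall>i\<le>n. stable_subgroup Q A (N i) \<and> G \<subseteq> N i \<and> N i \<subseteq> F" "\<forall>i<n. N i \<subset> N (Suc i)"
 show "\<exists>m. enat n = enat m \<and> (\<exists>N. (\<forall>i\<le>m. stable_subgroup Q' A' (N i) \<and> G' \<subseteq> N i \<and> N i \<subseteq> F') \<and> (\<forall>i<m. N i \<subset> N (Suc i)))"
  by (intro exI[of _ n] conjI refl exI[of _ "\<lambda>i. \<phi> (N i)"]) (use N assms in auto)
qed

lemma quotient_length_le_dual:
 assumes "\<And>H. stable_subgroup Q A H \<Longrightarrow> G \<subseteq> H \<Longrightarrow> H \<subseteq> F \<Longrightarrow>
   stable_subgroup Q' A' (\<phi> H) \<and> G' \<subseteq> \<phi> H \<and> \<phi> H \<subseteq> F'"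
  and "\<And>H H'. stable_subgroup Q A H \<Longrightarrow> G \<subseteq> H \<Longrightarrow> stable_subgroup Q A H' \<Longrightarrow> H' \<subseteq> F \<Longrightarrow> H \<subset> H' \<Longrightarrow> \<phi> H' \<subset> \<phi> H"
 shows "quotient_length Q A F G \<le> quotient_length Q' A' F' G'"
 unfolding quotient_length_def
proof (rule Sup_subset_mono, clarify)
 fix n and N :: "nat \<Rightarrow> 'a set"
 assume N: "\<forall>i\<le>n. stable_subgroup Q A (N i) \<and> G \<subseteq> N i \<and> N i \<subseteq> F" "\<forall>i<n. N i \<subset> N (Suc i)"
 have "\<phi> (N (n - i)) \<subset> \<phi> (N (n - Suc i))" if "i < n" for i
 proof (rule assms(2))
  have "Suc (n - Suc i) = n - i" using that by simp
  then show "N (n - Suc i) \<subset> N (n - i)" using N(2)[rule_format, of "n - Suc i"] that by simp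
 qed (use N(1) in auto)
 then show "\<exists>m. enat n = enat m \<and> (\<exists>N. (\<forall>i\<le>m. stable_subgroup Q' A' (N i) \<and> G' \<subseteq> N i \<and> N i \<subseteq> F') \<and> (\<forall>i<m. N i \<subset> N (Suc i)))"
  by (intro exI[of _ n] conjI refl exI[of _ "\<lambda>i. \<phi> (N (n - i))"]) (use N assms(1) in auto)
qed

text \<open>
 What is used of a local Noetherian order A in Q with regular maximal ideal m. Both R in Q and the Rees
 quotient in its quadratic extension are instances.
\<close>
locale lattice_ring = cring Q for Q :: "('q, 'd) ring_scheme" (structure) +
 fixes A m :: "'q set"
 assumes A_stable: "stable_subgroup Q A A" and A_one: "\<one> \<in> A" and A_neg: "\<ominus> \<one> \<in> A"
  and m_stable: "stable_subgroup Q A m" and m_sub: "m \<subseteq> A" and one_not_m: "\<one> \<notin> m"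
  and not_m_inverse: "\<And>a. a \<in> A \<Longrightarrow> a \<notin> m \<Longrightarrow> \<exists>b\<in>A. b \<otimes> a = \<one>"
  and m_regular: "\<exists>x\<in>m. x \<in> Units Q"
  and acc_A: "\<And>Fam. Fam \<noteq> {} \<Longrightarrow> (\<And>H. H \<in> Fam \<Longrightarrow> stable_subgroup Q A H \<and> H \<subseteq> A) \<Longrightarrow>
   \<exists>H\<in>Fam. \<forall>H'\<in>Fam. H \<subseteq> H' \<longrightarrow> H' = H"
begin

lemma A_closed: "a \<in> A \<Longrightarrow> a \<in> carrier Q" and m_closed': "a \<in> m \<Longrightarrow> a \<in> carrier Q"
 using stableD(1)[OF A_stable] m_sub by auto

lemma A_carrier: "A \<subseteq> carrier Q" using A_closed by auto

abbreviation "submod \<equiv> stable_subgroup Q A"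
abbreviation "latt \<equiv> is_lattice Q A"

lemma stable_neg': "submod H \<Longrightarrow> x \<in> H \<Longrightarrow> \<ominus> x \<in> H"
 using stable_neg A_neg by blast

lemma stable_diff': "submod H \<Longrightarrow> x \<in> H \<Longrightarrow> y \<in> H \<Longrightarrow> x \<ominus> y \<in> H"
 unfolding minus_eq using stableD(3) stable_neg' by metis

lemma lattice_stable: "latt F \<Longrightarrow> submod F" by (simp add: is_lattice_def)

lemma lattice_closed: "latt F \<Longrightarrow> f \<in> F \<Longrightarrow> f \<in> carrier Q"
 using stableD(1)[OF lattice_stable] .

lemma lattice_between:
 assumes "latt F" "latt G" "submod H" "G \<subseteq> H" "H \<subseteq> F" shows "latt H"
 using assms unfolding is_lattice_def by blast

lemma lattice_A: "latt A"
 unfolding is_lattice_def using A_stable A_one A_closed by (auto intro!: bexI[of _ \<one>])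

lemma lattice_m: "latt m"
 unfolding is_lattice_def using m_stable m_regular m_closed' m_sub by (auto intro!: bexI[of _ \<one>])

lemma stable_scale: assumes "submod H" "s \<in> carrier Q" shows "submod ((\<lambda>h. s \<otimes> h) ` H)"
proof (rule stableI)
 note D = stableD[OF assms(1)]
 show "(\<lambda>h. s \<otimes> h) ` H \<subseteq> carrier Q" using D(1) assms(2) by auto
 show "\<zero> \<in> (\<lambda>h. s \<otimes> h) ` H" using D(2) assms(2) by (intro image_eqI[of _ _ \<zero>]) auto
 show "x \<oplus> y \<in> (\<lambda>h. s \<otimes> h) ` H" if "x \<in> (\<lambda>h. s \<otimes> h) ` H" "y \<in> (\<lambda>h. s \<otimes> h) ` H" for x y
  using that D(1,3) assms(2) by (auto simp flip: r_distr)
 show "a \<otimes> x \<in> (\<lambda>h. s \<otimes> h) ` H" if a: "a \<in> A" and x: "x \<in> (\<lambda>h. s \<otimes> h) ` H" for a x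
 proof -
  obtain h where "h \<in> H" "x = s \<otimes> h" using x by blast
  then show ?thesis using D(1) D(4)[OF a] A_closed[OF a] assms(2)
   by (intro image_eqI[of _ _ "a \<otimes> h"]) (auto simp: m_lcomm)
 qed
qed

lemma scale_inverse:
 assumes "s \<in> Units Q" "H \<subseteq> carrier Q"
 shows "(\<lambda>h. inv s \<otimes> h) ` ((\<lambda>h. s \<otimes> h) ` H) = H" "(\<lambda>h. s \<otimes> h) ` ((\<lambda>h. inv s \<otimes> h) ` H) = H"
proof -
 have "inv s \<otimes> (s \<otimes> h) = h" "s \<otimes> (inv s \<otimes> h) = h" if "h \<in> H" for h
  using that assms by (auto simp: subset_iff Units_closed simp flip: m_assoc)
 then show "(\<lambda>h. inv s \<otimes> h) ` ((\<lambda>h. s \<otimes> h) ` H) = H" "(\<lambda>h. s \<otimes> h) ` ((\<lambda>h. inv s \<otimes> h) ` H) = H"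
  by (force simp: image_image)+
qed

lemma lattice_scale: assumes "latt F" "s \<in> Units Q" shows "latt ((\<lambda>h. s \<otimes> h) ` F)"
proof -
 obtain u t where u: "u \<in> F" "u \<in> Units Q" and t: "t \<in> Units Q" "\<And>f. f \<in> F \<Longrightarrow> t \<otimes> f \<in> A"
  using assms(1) unfolding is_lattice_def by blast
 have "t \<otimes> inv s \<otimes> (s \<otimes> f) = t \<otimes> f" if "f \<in> F" for f
 proof -
  have "t \<otimes> inv s \<otimes> (s \<otimes> f) = t \<otimes> (inv s \<otimes> s \<otimes> f)"
   using lattice_closed[OF assms(1) that] assms(2) t(1) by (simp add: m_assoc Units_closed del: Units_l_inv)
  then show ?thesis using lattice_closed[OF assms(1) that] assms(2) by simp
 qed
 then have "\<forall>f\<in>(\<lambda>h. s \<otimes> h) ` F. (t \<otimes> inv s) \<otimes> f \<in> A" using t(2) by auto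
 moreover have "s \<otimes> u \<in> (\<lambda>h. s \<otimes> h) ` F" "s \<otimes> u \<in> Units Q" using u assms(2) by auto
 ultimately show ?thesis unfolding is_lattice_def
  using stable_scale[OF lattice_stable[OF assms(1)] Units_closed[OF assms(2)]] assms(2) t(1)
  by (metis Units_inv_Units Units_m_closed)
qed

lemma stable_colon: assumes "submod F" "G \<subseteq> carrier Q" shows "submod (colon Q F G)"
proof (rule stableI)
 note D = stableD[OF assms(1)]
 show "colon Q F G \<subseteq> carrier Q" by (auto simp: colon_def)
 show "\<zero> \<in> colon Q F G" using assms D(2) by (auto simp: colon_def)
 show "x \<oplus> y \<in> colon Q F G" if "x \<in> colon Q F G" "y \<in> colon Q F G" for x y
  using that assms D(3) by (auto simp: colon_def l_distr subset_iff)
 show "a \<otimes> x \<in> colon Q F G" if "a \<in> A" "x \<in> colon Q F G" for a x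
  using that assms D(4) A_closed by (auto simp: colon_def m_assoc subset_iff)
qed

lemma lattice_colon: assumes F: "latt F" and G: "latt G" shows "latt (colon Q F G)"
proof -
 obtain u t where u: "u \<in> F" "u \<in> Units Q" and t: "t \<in> Units Q" "\<And>f. f \<in> F \<Longrightarrow> t \<otimes> f \<in> A"
  using F unfolding is_lattice_def by blast
 obtain v s where v: "v \<in> G" "v \<in> Units Q" and s: "s \<in> Units Q" "\<And>f. f \<in> G \<Longrightarrow> s \<otimes> f \<in> A"
  using G unfolding is_lattice_def by blast
 have Gc: "G \<subseteq> carrier Q" using lattice_closed[OF G] by auto
 have "u \<otimes> s \<in> colon Q F G" unfolding colon_def
 proof (intro CollectI conjI ballI)
  show "u \<otimes> s \<in> carrier Q" using u s by (simp add: Units_closed)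
  fix g assume g: "g \<in> G"
  have "(s \<otimes> g) \<otimes> u \<in> F" by (rule stableD(4)[OF lattice_stable[OF F] s(2)[OF g] u(1)])
  then show "u \<otimes> s \<otimes> g \<in> F" using u(2) s(1) g Gc by (auto simp: m_ac Units_closed subset_iff)
 qed
 moreover have "(t \<otimes> v) \<otimes> q \<in> A" if q: "q \<in> colon Q F G" for q
 proof -
  have "t \<otimes> (q \<otimes> v) \<in> A" using q v(1) t(2) by (simp add: colon_def)
  then show ?thesis using q t(1) v(2) by (auto simp: colon_def m_ac Units_closed)
 qed
 ultimately show ?thesis unfolding is_lattice_def
  using stable_colon[OF lattice_stable[OF F] Gc] u s t v by (meson Units_m_closed)
qed

lemma acc_lattice:
 assumes F: "latt F" and "Fam \<noteq> {}" "\<And>H. H \<in> Fam \<Longrightarrow> submod H \<and> H \<subseteq> F"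
 obtains H where "H \<in> Fam" "\<And>H'. H' \<in> Fam \<Longrightarrow> H \<subseteq> H' \<Longrightarrow> H' = H"
proof -
 obtain s where s: "s \<in> Units Q" "\<And>f. f \<in> F \<Longrightarrow> s \<otimes> f \<in> A" using F unfolding is_lattice_def by blast
 let ?s = "\<lambda>H. (\<lambda>h. s \<otimes> h) ` H"
 have "submod K \<and> K \<subseteq> A" if "K \<in> ?s ` Fam" for K
 proof -
  obtain H where H: "H \<in> Fam" "K = ?s H" using \<open>K \<in> ?s ` Fam\<close> by (rule imageE) auto
  have "K \<subseteq> A" unfolding H(2) using assms(3)[OF H(1)] s(2) by auto
  then show ?thesis unfolding H(2) using stable_scale[of H s] assms(3)[OF H(1)] s(1) by (simp add: Units_closed)
 qed
 then obtain K where K: "K \<in> ?s ` Fam" "\<forall>K'\<in>?s ` Fam. K \<subseteq> K' \<longrightarrow> K' = K"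
  using acc_A[of "?s ` Fam"] assms(2) by auto
 obtain H where H1: "H \<in> Fam" "K = ?s H" using K(1) by (rule imageE) auto
 have H: "H \<in> Fam" "\<And>H'. H' \<in> Fam \<Longrightarrow> ?s H \<subseteq> ?s H' \<Longrightarrow> ?s H' = ?s H"
  using H1 K(2) by simp_all
 have "H' = H" if "H' \<in> Fam" "H \<subseteq> H'" for H'
 proof -
  have "?s H' = ?s H" using H(2)[OF that(1)] that(2) by blast
  moreover have "H \<subseteq> carrier Q" "H' \<subseteq> carrier Q" using assms(3)[OF H(1)] assms(3)[OF that(1)] lattice_closed[OF F] by auto
  ultimately show ?thesis using scale_inverse(1)[OF s(1)] by metis
 qed
 then show ?thesis using H(1) that by simp
qed

definition adjoin :: "'q set \<Rightarrow> 'q \<Rightarrow> 'q set" where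
 "adjoin H y = {h \<oplus> a \<otimes> y | h a. h \<in> H \<and> a \<in> A}"

lemma stable_adjoin:
 assumes "submod H" "y \<in> carrier Q"
 shows "submod (adjoin H y)" "H \<subseteq> adjoin H y" "y \<in> adjoin H y"
  and "submod N \<Longrightarrow> H \<subseteq> N \<Longrightarrow> y \<in> N \<Longrightarrow> adjoin H y \<subseteq> N"
proof -
 note D = stableD[OF assms(1)] and DA = stableD[OF A_stable]
 show "H \<subseteq> adjoin H y"
 proof
  fix h assume "h \<in> H"
  then have "h = h \<oplus> \<zero> \<otimes> y" using D(1) assms(2) by simp
  then show "h \<in> adjoin H y" unfolding adjoin_def using \<open>h \<in> H\<close> DA(2) by blast
 qed
 have "y = \<zero> \<oplus> \<one> \<otimes> y" using assms(2) by simp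
 then show "y \<in> adjoin H y" unfolding adjoin_def using D(2) A_one by blast
 show "submod (adjoin H y)"
 proof (rule stableI)
  show "adjoin H y \<subseteq> carrier Q" using D(1) A_closed assms(2) unfolding adjoin_def by auto
  show "\<zero> \<in> adjoin H y" using \<open>H \<subseteq> adjoin H y\<close> D(2) by blast
  fix z w assume "z \<in> adjoin H y" "w \<in> adjoin H y"
  then obtain h a k b where zw: "z = h \<oplus> a \<otimes> y" "w = k \<oplus> b \<otimes> y" "h \<in> H" "a \<in> A" "k \<in> H" "b \<in> A"
   unfolding adjoin_def by blast
  have "z \<oplus> w = (h \<oplus> k) \<oplus> (a \<oplus> b) \<otimes> y" using zw D(1) A_closed assms(2) by (simp add: l_distr a_ac)
  then show "z \<oplus> w \<in> adjoin H y" unfolding adjoin_def using D(3)[OF zw(3,5)] DA(3)[OF zw(4,6)] by blast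
 next
  fix c z assume c: "c \<in> A" and "z \<in> adjoin H y"
  then obtain h a where z: "z = h \<oplus> a \<otimes> y" "h \<in> H" "a \<in> A" unfolding adjoin_def by blast
  have "c \<otimes> z = c \<otimes> h \<oplus> (c \<otimes> a) \<otimes> y" using z c D(1) A_closed assms(2) by (simp add: r_distr m_assoc)
  then show "c \<otimes> z \<in> adjoin H y" unfolding adjoin_def using D(4)[OF c z(2)] DA(4)[OF c z(3)] by blast
 qed
 show "adjoin H y \<subseteq> N" if "submod N" "H \<subseteq> N" "y \<in> N"
  unfolding adjoin_def using that stableD(3,4)[OF that(1)] by blast
qed

lemma simple_adjoin:
 assumes H: "submod H" and y: "y \<in> carrier Q" "y \<notin> H" and m: "\<And>a. a \<in> m \<Longrightarrow> a \<otimes> y \<in> H"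
 shows "simple_over Q A (adjoin H y) H"
 unfolding simple_over_def
proof (intro conjI allI impI)
 note S = stable_adjoin[OF H y(1)]
 show "submod (adjoin H y)" "H \<subset> adjoin H y" using S y(2) by auto
 fix N assume N: "submod N" "H \<subseteq> N" "N \<subseteq> adjoin H y"
 show "N = H \<or> N = adjoin H y"
 proof (rule disjCI)
  assume "N \<noteq> adjoin H y"
  have "z \<in> H" if z: "z \<in> N" for z
  proof -
   obtain h a where ha: "z = h \<oplus> a \<otimes> y" "h \<in> H" "a \<in> A" using N(3) z unfolding adjoin_def by blast
   have c: "h \<in> carrier Q" "a \<in> carrier Q" using ha A_closed stableD(1)[OF H] by auto
   have "a \<in> m"
   proof (rule ccontr)
    assume "a \<notin> m"
    then obtain b where b: "b \<in> A" "b \<otimes> a = \<one>" using not_m_inverse ha(3) by blast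
    have "b \<otimes> (z \<ominus> h) \<in> N"
     by (rule stableD(4)[OF N(1) b(1)], rule stable_diff'[OF N(1) z]) (use N(2) ha(2) in blast)
    moreover have "b \<otimes> (z \<ominus> h) = (b \<otimes> a) \<otimes> y" unfolding ha(1) using c y(1) A_closed[OF b(1)] by algebra
    ultimately have "y \<in> N" using b(2) y(1) by simp
    then show False using S(4)[OF N(1,2)] N(3) \<open>N \<noteq> adjoin H y\<close> by blast
   qed
   then show "z \<in> H" unfolding ha(1) using m stableD(3)[OF H ha(2)] by blast
  qed
  then show "N = H" using N(2) by blast
 qed
qed

lemma composition_series_exists:
 assumes F: "latt F" and G: "submod G" "G \<subseteq> F" and m: "\<And>a f. a \<in> m \<Longrightarrow> f \<in> F \<Longrightarrow> a \<otimes> f \<in> G"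
 shows "\<exists>n. composition_series Q A G F n"
proof -
 let ?Fam = "{H. submod H \<and> H \<subseteq> F \<and> (\<exists>n. composition_series Q A G H n)}"
 have "G \<in> ?Fam" using G composition_series.trivial by blast
 then have ne: "?Fam \<noteq> {}" by blast
 obtain H where H: "H \<in> ?Fam" "\<And>H'. H' \<in> ?Fam \<Longrightarrow> H \<subseteq> H' \<Longrightarrow> H' = H"
  by (rule acc_lattice[OF F ne]) auto
 obtain n where n: "composition_series Q A G H n" using H(1) by blast
 have GH: "G \<subseteq> H" using composition_series_stable[OF n] by simp
 have "F \<subseteq> H"
 proof
  fix y assume y: "y \<in> F"
  show "y \<in> H"
  proof (rule ccontr)
   assume yH: "y \<notin> H"
   note yc = lattice_closed[OF F y]
   have Hs: "submod H" using H(1) by simp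
   note S = stable_adjoin[OF Hs yc]
   have "simple_over Q A (adjoin H y) H" by (rule simple_adjoin[OF Hs yc yH]) (use m y GH in blast)
   then have "composition_series Q A G (adjoin H y) (Suc n)" by (rule composition_series.step[OF n])
   moreover have "adjoin H y \<subseteq> F" by (rule S(4)[OF lattice_stable[OF F]]) (use H(1) y in auto)
   ultimately have "adjoin H y = H" using H(2)[OF _ S(2)] S(1) by blast
   then show False using S(3) yH by simp
  qed
 qed
 then have "F = H" using H(1) by blast
 then show ?thesis using n by blast
qed

text \<open>
 The hypothesis says that \<open>H + m L = L\<close>, phrased by all submodules that contain H and the
 products, so that the module m L need not be constructed. Finite generation of L enters as the ascending
 chain condition: a maximal proper submodule containing H contains m L.
\<close>
lemma nakayama:
 assumes L: "latt L" and H: "submod H" "H \<subseteq> L"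
  and gen: "\<And>N. submod N \<Longrightarrow> H \<subseteq> N \<Longrightarrow> (\<And>a l. a \<in> m \<Longrightarrow> l \<in> L \<Longrightarrow> a \<otimes> l \<in> N) \<Longrightarrow> L \<subseteq> N"
 shows "H = L"
proof (rule ccontr)
 assume "H \<noteq> L"
 let ?Fam = "{N. submod N \<and> H \<subseteq> N \<and> N \<subset> L}"
 have "H \<in> ?Fam" using H \<open>H \<noteq> L\<close> by blast
 then have ne: "?Fam \<noteq> {}" by blast
 obtain N where N: "N \<in> ?Fam" "\<And>N'. N' \<in> ?Fam \<Longrightarrow> N \<subseteq> N' \<Longrightarrow> N' = N"
  by (rule acc_lattice[OF L ne]) auto
 have Ns: "submod N" using N(1) by simp
 have "a \<otimes> l \<in> N" if a: "a \<in> m" and l: "l \<in> L" for a l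
 proof (rule ccontr)
  assume n: "a \<otimes> l \<notin> N"
  have aA: "a \<in> A" using a m_sub by auto
  note c = A_closed[OF aA] lattice_closed[OF L l]
  have alc: "a \<otimes> l \<in> carrier Q" using c by simp
  have alL: "a \<otimes> l \<in> L" by (rule stableD(4)[OF lattice_stable[OF L] aA l])
  note S = stable_adjoin[OF Ns alc]
  have "adjoin N (a \<otimes> l) \<subseteq> L" by (rule S(4)[OF lattice_stable[OF L] _ alL]) (use N(1) in auto)
  moreover have "adjoin N (a \<otimes> l) \<noteq> N" using S(3) n by auto
  ultimately have "adjoin N (a \<otimes> l) = L" using N(2)[of "adjoin N (a \<otimes> l)"] S(1,2) N(1) by blast
  then obtain h b where hb: "l = h \<oplus> b \<otimes> (a \<otimes> l)" "h \<in> N" "b \<in> A" using l unfolding adjoin_def by blast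
  have hc: "h \<in> carrier Q" "b \<in> carrier Q" using hb A_closed stableD(1)[OF Ns] by auto
  have ba: "b \<otimes> a \<in> m" by (rule stableD(4)[OF m_stable hb(3) a])
  have "\<one> \<ominus> b \<otimes> a \<notin> m"
  proof
   assume "\<one> \<ominus> b \<otimes> a \<in> m"
   then have "(\<one> \<ominus> b \<otimes> a) \<oplus> b \<otimes> a \<in> m" using ba stableD(3)[OF m_stable] by blast
   moreover have "(\<one> \<ominus> b \<otimes> a) \<oplus> b \<otimes> a = \<one>" using hc c by algebra
   ultimately show False using one_not_m by simp
  qed
  moreover have "\<one> \<ominus> b \<otimes> a \<in> A" using stable_diff'[OF A_stable A_one] ba m_sub by blast
  ultimately obtain e where e: "e \<in> A" "e \<otimes> (\<one> \<ominus> b \<otimes> a) = \<one>" using not_m_inverse by blast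
  have "(\<one> \<ominus> b \<otimes> a) \<otimes> l = l \<ominus> b \<otimes> (a \<otimes> l)" using hc c by algebra
  also have "\<dots> = (h \<oplus> b \<otimes> (a \<otimes> l)) \<ominus> b \<otimes> (a \<otimes> l)" using hb(1) by simp
  also have "\<dots> = h" using hc c by algebra
  finally have eq: "(\<one> \<ominus> b \<otimes> a) \<otimes> l = h" .
  have "l = (e \<otimes> (\<one> \<ominus> b \<otimes> a)) \<otimes> l" using e(2) c by simp
  also have "\<dots> = e \<otimes> ((\<one> \<ominus> b \<otimes> a) \<otimes> l)" using A_closed[OF e(1)] hc c by (simp add: m_assoc)
  also have "\<dots> = e \<otimes> h" by (simp only: eq)
  finally have "l \<in> N" using stableD(4)[OF Ns e(1) hb(2)] by simp
  then have "a \<otimes> l \<in> N" by (rule stableD(4)[OF Ns aA])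
  then show False using n by simp
 qed
 then have "L \<subseteq> N" using gen[OF Ns] N(1) by blast
 then show False using N(1) by blast
qed

lemma colon_antimono: "G \<subseteq> F \<Longrightarrow> colon Q K F \<subseteq> colon Q K G"
 by (auto simp: colon_def)

lemma dual_length_le:
 assumes K: "latt K" "reflexive_for Q A K" and F: "latt F" and G: "latt G"
 shows "quotient_length Q A F G \<le> quotient_length Q A (colon Q K G) (colon Q K F)"
proof (rule quotient_length_le_dual)
 have dd: "colon Q K (colon Q K H) = H" if "submod H" "G \<subseteq> H" "H \<subseteq> F" for H
  using K(2) lattice_between[OF F G that] unfolding reflexive_for_def by blast
 have Hc: "H \<subseteq> carrier Q" if "H \<subseteq> F" for H using that lattice_closed[OF F] by auto
 fix H assume H: "submod H" "G \<subseteq> H"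
 show "submod (colon Q K H) \<and> colon Q K F \<subseteq> colon Q K H \<and> colon Q K H \<subseteq> colon Q K G" if "H \<subseteq> F"
  using stable_colon[OF lattice_stable[OF K(1)] Hc[OF that]] colon_antimono that H(2) by blast
 fix H' assume H': "submod H'" "H' \<subseteq> F" "H \<subset> H'"
 have "colon Q K H' \<subseteq> colon Q K H" using colon_antimono H'(3) by blast
 moreover have "colon Q K H' \<noteq> colon Q K H"
  using dd[OF H(1,2)] dd[OF H'(1) _ H'(2)] H'(2,3) H(2) by auto
 ultimately show "colon Q K H' \<subset> colon Q K H" by blast
qed

lemma dual_length:
 assumes K: "latt K" "reflexive_for Q A K" and F: "latt F" and G: "latt G"
 shows "quotient_length Q A F G = quotient_length Q A (colon Q K G) (colon Q K F)"
proof (rule antisym[OF dual_length_le[OF assms]])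
 have "colon Q K (colon Q K F) = F" "colon Q K (colon Q K G) = G" using K(2) F G unfolding reflexive_for_def by auto
 then show "quotient_length Q A (colon Q K G) (colon Q K F) \<le> quotient_length Q A F G"
  using dual_length_le[OF K lattice_colon[OF K(1) G] lattice_colon[OF K(1) F]] by simp
qed

lemma scale_length_le:
 assumes F: "latt F" and s: "s \<in> Units Q"
 shows "quotient_length Q A F G \<le> quotient_length Q A ((\<lambda>h. s \<otimes> h) ` F) ((\<lambda>h. s \<otimes> h) ` G)"
proof (rule quotient_length_le)
 fix H assume H: "submod H" "G \<subseteq> H"
 show "submod ((\<lambda>h. s \<otimes> h) ` H) \<and> (\<lambda>h. s \<otimes> h) ` G \<subseteq> (\<lambda>h. s \<otimes> h) ` H \<and> (\<lambda>h. s \<otimes> h) ` H \<subseteq> (\<lambda>h. s \<otimes> h) ` F"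
  if "H \<subseteq> F" using stable_scale[OF H(1) Units_closed[OF s]] H(2) that by blast
 fix H' assume H': "submod H'" "H' \<subseteq> F" "H \<subset> H'"
 have "H \<subseteq> carrier Q" "H' \<subseteq> carrier Q" using lattice_closed[OF F] H' by auto
 then have "(\<lambda>h. s \<otimes> h) ` H \<noteq> (\<lambda>h. s \<otimes> h) ` H'" using scale_inverse(1)[OF s] H'(3) by (metis psubset_eq)
 then show "(\<lambda>h. s \<otimes> h) ` H \<subset> (\<lambda>h. s \<otimes> h) ` H'" using H'(3) by blast
qed

lemma scale_length:
 assumes F: "latt F" and s: "s \<in> Units Q" and G: "G \<subseteq> carrier Q"
 shows "quotient_length Q A ((\<lambda>h. s \<otimes> h) ` F) ((\<lambda>h. s \<otimes> h) ` G) = quotient_length Q A F G"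
proof (rule antisym)
 have Fc: "F \<subseteq> carrier Q" using lattice_closed[OF F] by auto
 show "quotient_length Q A ((\<lambda>h. s \<otimes> h) ` F) ((\<lambda>h. s \<otimes> h) ` G) \<le> quotient_length Q A F G"
  using scale_length_le[OF lattice_scale[OF F s] Units_inv_Units[OF s], of "(\<lambda>h. s \<otimes> h) ` G"]
  unfolding scale_inverse(1)[OF s Fc] scale_inverse(1)[OF s G] .
qed (rule scale_length_le[OF F s])

end

section \<open>The standard canonical lattice of a quadratic extension\<close>

text \<open>
 \<open>Q[t]/(t\<^sup>2 + at + b)\<close>, with \<open>(x, y)\<close> for \<open>x + yt\<close>.
\<close>
definition quadratic_ring :: "('q, 'd) ring_scheme \<Rightarrow> 'q \<Rightarrow> 'q \<Rightarrow> ('q \<times> 'q) ring" where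
 "quadratic_ring Q a b = \<lparr>carrier = carrier Q \<times> carrier Q,
   monoid.mult = (\<lambda>(x, y) (x', y'). (x \<otimes>\<^bsub>Q\<^esub> x' \<ominus>\<^bsub>Q\<^esub> b \<otimes>\<^bsub>Q\<^esub> (y \<otimes>\<^bsub>Q\<^esub> y'),
    (x \<otimes>\<^bsub>Q\<^esub> y' \<oplus>\<^bsub>Q\<^esub> x' \<otimes>\<^bsub>Q\<^esub> y) \<ominus>\<^bsub>Q\<^esub> a \<otimes>\<^bsub>Q\<^esub> (y \<otimes>\<^bsub>Q\<^esub> y'))),
   one = (\<one>\<^bsub>Q\<^esub>, \<zero>\<^bsub>Q\<^esub>), ring.zero = (\<zero>\<^bsub>Q\<^esub>, \<zero>\<^bsub>Q\<^esub>),
   ring.add = (\<lambda>(x, y) (x', y'). (x \<oplus>\<^bsub>Q\<^esub> x', y \<oplus>\<^bsub>Q\<^esub> y'))\<rparr>"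

lemma quadratic_ring_simps [simp]:
 "carrier (quadratic_ring Q a b) = carrier Q \<times> carrier Q"
 "(x, y) \<otimes>\<^bsub>quadratic_ring Q a b\<^esub> (x', y') = (x \<otimes>\<^bsub>Q\<^esub> x' \<ominus>\<^bsub>Q\<^esub> b \<otimes>\<^bsub>Q\<^esub> (y \<otimes>\<^bsub>Q\<^esub> y'),
    (x \<otimes>\<^bsub>Q\<^esub> y' \<oplus>\<^bsub>Q\<^esub> x' \<otimes>\<^bsub>Q\<^esub> y) \<ominus>\<^bsub>Q\<^esub> a \<otimes>\<^bsub>Q\<^esub> (y \<otimes>\<^bsub>Q\<^esub> y'))"
 "\<one>\<^bsub>quadratic_ring Q a b\<^esub> = (\<one>\<^bsub>Q\<^esub>, \<zero>\<^bsub>Q\<^esub>)" "\<zero>\<^bsub>quadratic_ring Q a b\<^esub> = (\<zero>\<^bsub>Q\<^esub>, \<zero>\<^bsub>Q\<^esub>)"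
 "(x, y) \<oplus>\<^bsub>quadratic_ring Q a b\<^esub> (x', y') = (x \<oplus>\<^bsub>Q\<^esub> x', y \<oplus>\<^bsub>Q\<^esub> y')"
 by (simp_all add: quadratic_ring_def)

lemma (in cring) quadratic_ring_cring:
 assumes ab: "a \<in> carrier R" "b \<in> carrier R"
 shows "cring (quadratic_ring R a b)"
proof (rule cringI)
 show "abelian_group (quadratic_ring R a b)"
 proof (rule abelian_groupI)
  show "\<exists>z\<in>carrier (quadratic_ring R a b). z \<oplus>\<^bsub>quadratic_ring R a b\<^esub> w = \<zero>\<^bsub>quadratic_ring R a b\<^esub>"
   if "w \<in> carrier (quadratic_ring R a b)" for w
   using that by (intro bexI[of _ "(\<ominus> fst w, \<ominus> snd w)"]) (auto simp: l_neg)
 qed (auto simp: a_ac)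
 show "comm_monoid (quadratic_ring R a b)"
 proof (rule comm_monoidI)
  show "z \<otimes>\<^bsub>quadratic_ring R a b\<^esub> w = w \<otimes>\<^bsub>quadratic_ring R a b\<^esub> z"
   if asm: "z \<in> carrier (quadratic_ring R a b)" "w \<in> carrier (quadratic_ring R a b)" for z w
  proof -
   obtain x y x' y' where e: "z = (x, y)" "w = (x', y')" and c: "x \<in> carrier R" "y \<in> carrier R" "x' \<in> carrier R" "y' \<in> carrier R"
    using asm by auto
   have "x \<otimes> x' \<ominus> b \<otimes> (y \<otimes> y') = x' \<otimes> x \<ominus> b \<otimes> (y' \<otimes> y)"
    "(x \<otimes> y' \<oplus> x' \<otimes> y) \<ominus> a \<otimes> (y \<otimes> y') = (x' \<otimes> y \<oplus> x \<otimes> y') \<ominus> a \<otimes> (y' \<otimes> y)"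
    using c ab by algebra+
   then show ?thesis unfolding e by simp
  qed
  show "z \<otimes>\<^bsub>quadratic_ring R a b\<^esub> w \<otimes>\<^bsub>quadratic_ring R a b\<^esub> v = z \<otimes>\<^bsub>quadratic_ring R a b\<^esub> (w \<otimes>\<^bsub>quadratic_ring R a b\<^esub> v)"
   if asm: "z \<in> carrier (quadratic_ring R a b)" "w \<in> carrier (quadratic_ring R a b)" "v \<in> carrier (quadratic_ring R a b)" for z w v
  proof -
   obtain x y x' y' p q where e: "z = (x, y)" "w = (x', y')" "v = (p, q)"
    and c: "x \<in> carrier R" "y \<in> carrier R" "x' \<in> carrier R" "y' \<in> carrier R" "p \<in> carrier R" "q \<in> carrier R"
    using asm by auto
   have 1: "(x \<otimes> x' \<ominus> b \<otimes> (y \<otimes> y')) \<otimes> p \<ominus> b \<otimes> (((x \<otimes> y' \<oplus> x' \<otimes> y) \<ominus> a \<otimes> (y \<otimes> y')) \<otimes> q) =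
    x \<otimes> (x' \<otimes> p \<ominus> b \<otimes> (y' \<otimes> q)) \<ominus> b \<otimes> (y \<otimes> ((x' \<otimes> q \<oplus> p \<otimes> y') \<ominus> a \<otimes> (y' \<otimes> q)))"
    using c ab by algebra
   have 2: "((x \<otimes> x' \<ominus> b \<otimes> (y \<otimes> y')) \<otimes> q \<oplus> p \<otimes> ((x \<otimes> y' \<oplus> x' \<otimes> y) \<ominus> a \<otimes> (y \<otimes> y'))) \<ominus> a \<otimes> (((x \<otimes> y' \<oplus> x' \<otimes> y) \<ominus> a \<otimes> (y \<otimes> y')) \<otimes> q)
    = (x \<otimes> ((x' \<otimes> q \<oplus> p \<otimes> y') \<ominus> a \<otimes> (y' \<otimes> q)) \<oplus> (x' \<otimes> p \<ominus> b \<otimes> (y' \<otimes> q)) \<otimes> y) \<ominus> a \<otimes> (y \<otimes> ((x' \<otimes> q \<oplus> p \<otimes> y') \<ominus> a \<otimes> (y' \<otimes> q)))"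
    using c ab by algebra
   show ?thesis unfolding e by (simp add: 1 2)
  qed
 qed (use ab in \<open>auto simp: minus_eq\<close>)
 show "(z \<oplus>\<^bsub>quadratic_ring R a b\<^esub> w) \<otimes>\<^bsub>quadratic_ring R a b\<^esub> v =
   z \<otimes>\<^bsub>quadratic_ring R a b\<^esub> v \<oplus>\<^bsub>quadratic_ring R a b\<^esub> w \<otimes>\<^bsub>quadratic_ring R a b\<^esub> v"
  if asm: "z \<in> carrier (quadratic_ring R a b)" "w \<in> carrier (quadratic_ring R a b)" "v \<in> carrier (quadratic_ring R a b)" for z w v
 proof -
  obtain x y x' y' p q where e: "z = (x, y)" "w = (x', y')" "v = (p, q)"
   and c: "x \<in> carrier R" "y \<in> carrier R" "x' \<in> carrier R" "y' \<in> carrier R" "p \<in> carrier R" "q \<in> carrier R"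
   using asm by auto
  have 1: "(x \<oplus> x') \<otimes> p \<ominus> b \<otimes> ((y \<oplus> y') \<otimes> q) = (x \<otimes> p \<ominus> b \<otimes> (y \<otimes> q)) \<oplus> (x' \<otimes> p \<ominus> b \<otimes> (y' \<otimes> q))"
   using c ab by algebra
  have 2: "((x \<oplus> x') \<otimes> q \<oplus> p \<otimes> (y \<oplus> y')) \<ominus> a \<otimes> ((y \<oplus> y') \<otimes> q) =
   ((x \<otimes> q \<oplus> p \<otimes> y) \<ominus> a \<otimes> (y \<otimes> q)) \<oplus> ((x' \<otimes> q \<oplus> p \<otimes> y') \<ominus> a \<otimes> (y' \<otimes> q))"
   using c ab by algebra
  show ?thesis unfolding e by (simp add: 1 2)
 qed
qed

lemma (in cring) unit_of_left_inverse:
 assumes "x \<in> carrier R" "y \<in> carrier R" "x \<otimes> y = \<one>" shows "y \<in> Units R"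
 using assms m_comm[of x y] unfolding Units_def by auto

lemma stable_Inter:
 assumes "Fam \<noteq> {}" "\<And>N. N \<in> Fam \<Longrightarrow> stable_subgroup Q A N"
 shows "stable_subgroup Q A (\<Inter>Fam)"
proof (rule stableI)
 obtain N0 where "N0 \<in> Fam" using assms(1) by blast
 then show "\<Inter>Fam \<subseteq> carrier Q" using stableD(1)[OF assms(2)] by blast
qed (use stableD(2-4)[OF assms(2)] in auto)

text \<open>
 An order A \<times> I in the quadratic extension, and a canonical ideal C of A described by the two
 properties that matter: duality and type one.
\<close>
locale quadratic_lattices = Q: lattice_ring Q A m + B: lattice_ring "quadratic_ring Q a b" "A \<times> I" "m \<times> I"
 for Q :: "('q, 'd) ring_scheme" (structure) and A m I :: "'q set" and a b :: 'q +
 fixes C :: "'q set"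
 assumes ab: "a \<in> A" "b \<in> A"
  and I_stable: "Q.submod I" and I_m: "I \<subseteq> m" and I_regular: "\<exists>z\<in>I. z \<in> Units Q"
  and C_lattice: "Q.latt C" and C_reflexive: "reflexive_for Q A C"
  and C_type: "\<And>Y. Q.submod Y \<Longrightarrow> C \<subseteq> Y \<Longrightarrow> Y \<subseteq> colon Q C m \<Longrightarrow> Y = C \<or> Y = colon Q C m"
begin

abbreviation "B \<equiv> quadratic_ring Q a b"
abbreviation B_mult (infixl "\<bullet>" 70) where "x \<bullet> y \<equiv> x \<otimes>\<^bsub>B\<^esub> y"
abbreviation "AB \<equiv> A \<times> I"
abbreviation "n \<equiv> m \<times> I"

definition "D = colon Q C I"
definition "K0 = D \<times> C"

lemma abc: "a \<in> carrier Q" "b \<in> carrier Q" using ab Q.A_closed by auto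

lemma I_A: "i \<in> I \<Longrightarrow> i \<in> A" using I_m Q.m_sub by auto
lemma I_closed: "i \<in> I \<Longrightarrow> i \<in> carrier Q" using I_A Q.A_closed by auto

lemma I_lattice: "Q.latt I"
 unfolding is_lattice_def using I_stable I_regular I_A I_closed by (auto intro!: bexI[of _ \<one>])

lemma D_lattice: "Q.latt D" unfolding D_def by (rule Q.lattice_colon[OF C_lattice I_lattice])

lemmas C_stable = Q.lattice_stable[OF C_lattice] and D_stable = Q.lattice_stable[OF D_lattice]
lemmas C_closed = Q.lattice_closed[OF C_lattice] and D_closed = Q.lattice_closed[OF D_lattice]
lemmas CD = stableD[OF C_stable] and DD = stableD[OF D_stable]
 and ID = stableD[OF I_stable] and mD = stableD[OF Q.m_stable] and AD = stableD[OF Q.A_stable]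

lemma C_D: "C \<subseteq> D"
proof
 fix c assume c: "c \<in> C"
 have "c \<otimes> i \<in> C" if "i \<in> I" for i
  using CD(4)[OF I_A[OF that] c] Q.m_comm[OF C_closed[OF c] I_closed[OF that]] by simp
 then show "c \<in> D" unfolding D_def colon_def using C_closed[OF c] by simp
qed

lemma D_I: "x \<in> D \<Longrightarrow> i \<in> I \<Longrightarrow> x \<otimes> i \<in> C"
 unfolding D_def colon_def by simp

lemma unit_fst: assumes "u \<in> Units Q" shows "(u, \<zero>) \<in> Units B" "inv\<^bsub>B\<^esub> (u, \<zero>) = (inv u, \<zero>)"
proof -
 have 1: "(inv u, \<zero>) \<bullet> (u, \<zero>) = \<one>\<^bsub>B\<^esub>" "(u, \<zero>) \<bullet> (inv u, \<zero>) = \<one>\<^bsub>B\<^esub>"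
  using assms abc by (simp_all add: Q.minus_eq Q.Units_closed)
 have 2: "(u, \<zero>) \<in> carrier B" "(inv u, \<zero>) \<in> carrier B" using assms by (auto simp: Q.Units_closed)
 show "(u, \<zero>) \<in> Units B" unfolding Units_def using 1 2 by blast
 show "inv\<^bsub>B\<^esub> (u, \<zero>) = (inv u, \<zero>)" by (rule B.comm_inv_char[OF 2 1(2)])
qed

lemma fst_mult: "x \<in> carrier Q \<Longrightarrow> y \<in> carrier Q \<Longrightarrow> r \<in> carrier Q \<Longrightarrow> (r, \<zero>) \<bullet> (x, y) = (r \<otimes> x, r \<otimes> y)"
 using abc by (simp add: Q.minus_eq)

lemma AB_fst: "r \<in> A \<Longrightarrow> (r, \<zero>) \<in> AB" using ID(2) by simp

lemma B_stableI:
 assumes "F \<subseteq> carrier B" "(\<zero>, \<zero>) \<in> F" "\<And>x y. x \<in> F \<Longrightarrow> y \<in> F \<Longrightarrow> x \<oplus>\<^bsub>B\<^esub> y \<in> F"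
  "\<And>r x y. r \<in> A \<Longrightarrow> (x, y) \<in> F \<Longrightarrow> (r \<otimes> x, r \<otimes> y) \<in> F"
  "\<And>i x y. i \<in> I \<Longrightarrow> (x, y) \<in> F \<Longrightarrow> (\<zero>, i) \<bullet> (x, y) \<in> F"
 shows "B.submod F"
proof (rule stableI)
 fix p q assume p: "p \<in> AB" and q: "q \<in> F"
 obtain r i x y where e: "p = (r, i)" "q = (x, y)" "r \<in> A" "i \<in> I" using p by (cases p; cases q) auto
 have c: "r \<in> carrier Q" "i \<in> carrier Q" "x \<in> carrier Q" "y \<in> carrier Q"
  using e Q.A_closed I_closed q assms(1) by auto
 have "p = (r, \<zero>) \<oplus>\<^bsub>B\<^esub> (\<zero>, i)" using e c by simp
 moreover have "((r, \<zero>) \<oplus>\<^bsub>B\<^esub> (\<zero>, i)) \<bullet> q = (r, \<zero>) \<bullet> q \<oplus>\<^bsub>B\<^esub> (\<zero>, i) \<bullet> q"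
  by (rule B.l_distr) (use e c in auto)
 ultimately have "p \<bullet> q = (r, \<zero>) \<bullet> q \<oplus>\<^bsub>B\<^esub> (\<zero>, i) \<bullet> q" by simp
 also have "(r, \<zero>) \<bullet> q = (r \<otimes> x, r \<otimes> y)" unfolding e(2) using fst_mult c by simp
 finally show "p \<bullet> q \<in> F" using assms(3)[OF assms(4,5)] e q by simp
qed (use assms in auto)

lemma snd_mult: "x \<in> carrier Q \<Longrightarrow> y \<in> carrier Q \<Longrightarrow> i \<in> carrier Q \<Longrightarrow>
  (\<zero>, i) \<bullet> (x, y) = (\<ominus> (b \<otimes> (i \<otimes> y)), x \<otimes> i \<ominus> a \<otimes> (i \<otimes> y))"
 using abc by (simp add: Q.minus_eq)

lemma K0_stable: "B.submod K0"
proof (rule B_stableI)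
 show "K0 \<subseteq> carrier B" unfolding K0_def using C_closed D_closed by auto
 show "(\<zero>, \<zero>) \<in> K0" unfolding K0_def using CD(2) DD(2) by simp
 show "x \<oplus>\<^bsub>B\<^esub> y \<in> K0" if "x \<in> K0" "y \<in> K0" for x y using that CD(3) DD(3) unfolding K0_def by auto
 show "(r \<otimes> x, r \<otimes> y) \<in> K0" if "r \<in> A" "(x, y) \<in> K0" for r x y using that CD(4) DD(4) unfolding K0_def by auto
 show "(\<zero>, i) \<bullet> (x, y) \<in> K0" if i: "i \<in> I" and xy: "(x, y) \<in> K0" for i x y
 proof -
  have xy': "x \<in> D" "y \<in> C" using xy by (auto simp: K0_def)
  have iy: "i \<otimes> y \<in> C" by (rule CD(4)[OF I_A[OF i] xy'(2)])
  have "\<ominus> (b \<otimes> (i \<otimes> y)) \<in> D" by (rule Q.stable_neg'[OF D_stable DD(4)[OF ab(2)]]) (use iy C_D in blast)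
  moreover have "x \<otimes> i \<ominus> a \<otimes> (i \<otimes> y) \<in> C" by (rule Q.stable_diff'[OF C_stable D_I[OF xy'(1) i] CD(4)[OF ab(1) iy]])
  ultimately show ?thesis using snd_mult[OF D_closed[OF xy'(1)] C_closed[OF xy'(2)] I_closed[OF i]] by (simp add: K0_def)
 qed
qed

lemma K0_lattice: "B.latt K0"
proof -
 obtain u where u: "u \<in> C" "u \<in> Units Q" using C_lattice unfolding is_lattice_def by blast
 obtain s where s: "s \<in> Units Q" "\<And>f. f \<in> D \<Longrightarrow> s \<otimes> f \<in> A" using D_lattice unfolding is_lattice_def by blast
 obtain z where z: "z \<in> I" "z \<in> Units Q" using I_regular by blast
 have zs: "z \<otimes> s \<in> Units Q" using z s by simp
 have sI: "(z \<otimes> s) \<otimes> f \<in> I" if f: "f \<in> D" for f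
 proof -
  have "(s \<otimes> f) \<otimes> z \<in> I" by (rule ID(4)[OF s(2)[OF f] z(1)])
  then show ?thesis using s(1) z(2) D_closed[OF f] by (simp add: Q.m_ac Q.Units_closed)
 qed
 have "(u, \<zero>) \<in> K0" using u C_D CD(2) by (auto simp: K0_def)
 moreover have "\<forall>f\<in>K0. (z \<otimes> s, \<zero>) \<bullet> f \<in> AB"
 proof
  fix f assume "f \<in> K0"
  then obtain x y where f: "f = (x, y)" "x \<in> D" "y \<in> C" unfolding K0_def by blast
  have "(z \<otimes> s, \<zero>) \<bullet> f = ((z \<otimes> s) \<otimes> x, (z \<otimes> s) \<otimes> y)"
   unfolding f(1) by (rule fst_mult[OF D_closed[OF f(2)] C_closed[OF f(3)] Q.Units_closed[OF zs]])
  then show "(z \<otimes> s, \<zero>) \<bullet> f \<in> AB" using sI[OF f(2)] sI[OF subsetD[OF C_D f(3)]] I_A by simp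
 qed
 ultimately show ?thesis unfolding is_lattice_def
  using K0_stable unit_fst(1)[OF u(2)] unit_fst(1)[OF zs] by blast
qed

text \<open>
 The second case is \<open>K0 : n\<close>, so the socle of B/K0 is simple. Multiplying by
 \<open>(\<mu>, 0)\<close> and by \<open>(0, i)\<close> shows that Y lies in
 \<open>D \<times> (C : m)\<close>; as it contains D \<times> 0, it is a rectangle D \<times> Z, and C has
 type one.
\<close>
lemma K0_colon_between:
 assumes Y: "B.submod Y" "K0 \<subseteq> Y" "Y \<subseteq> colon B K0 n"
 shows "Y = K0 \<or> Y = D \<times> colon Q C m"
proof -
 have Yc: "x \<in> carrier Q" "y \<in> carrier Q" if "(x, y) \<in> Y" for x y
  using stableD(1)[OF Y(1) that] by auto
 have Ym: "x \<in> D" "y \<in> colon Q C m" if xy: "(x, y) \<in> Y" for x y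
 proof -
  note c = Yc[OF xy]
  have q: "(x, y) \<bullet> \<nu> \<in> K0" if "\<nu> \<in> n" for \<nu> using Y(3) xy that by (auto simp: colon_def)
  have ym: "y \<otimes> \<mu> \<in> C" if \<mu>: "\<mu> \<in> m" for \<mu>
  proof -
   have \<mu>c: "\<mu> \<in> carrier Q" by (rule Q.m_closed'[OF \<mu>])
   have "(x, y) \<bullet> (\<mu>, \<zero>) \<in> K0" by (rule q) (use \<mu> ID(2) in simp)
   then show ?thesis using c \<mu>c abc by (simp add: K0_def Q.minus_eq Q.m_comm)
  qed
  then show "y \<in> colon Q C m" using c by (simp add: colon_def)
  show "x \<in> D" unfolding D_def colon_def
  proof (intro CollectI conjI ballI)
   fix i assume i: "i \<in> I"
   have ic: "i \<in> carrier Q" by (rule I_closed[OF i])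
   have "(x, y) \<bullet> (\<zero>, i) \<in> K0" by (rule q) (use i mD(2) in simp)
   then have 1: "x \<otimes> i \<ominus> a \<otimes> (y \<otimes> i) \<in> C" using c ic abc by (simp add: K0_def)
   have 2: "a \<otimes> (y \<otimes> i) \<in> C" by (rule CD(4)[OF ab(1) ym]) (use i I_m in blast)
   have "(x \<otimes> i \<ominus> a \<otimes> (y \<otimes> i)) \<oplus> a \<otimes> (y \<otimes> i) = x \<otimes> i" using c ic abc by algebra
   then show "x \<otimes> i \<in> C" using CD(3)[OF 1 2] by simp
  qed (rule c)
 qed
 define Z where "Z = {y. \<exists>x. (x, y) \<in> Y}"
 have YZ: "Y = D \<times> Z"
 proof (intro equalityI subsetI)
  fix p assume "p \<in> Y" then show "p \<in> D \<times> Z" using Ym(1) unfolding Z_def by (cases p) auto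
 next
  fix p assume "p \<in> D \<times> Z"
  then obtain x y x' where p: "p = (x, y)" "x \<in> D" "(x', y) \<in> Y" unfolding Z_def by auto
  have x': "x' \<in> D" "x' \<in> carrier Q" "y \<in> carrier Q" using Ym(1)[OF p(3)] Yc[OF p(3)] by auto
  have "(x \<ominus> x', \<zero>) \<in> Y"
   using Y(2) Q.stable_diff'[OF D_stable p(2) x'(1)] CD(2) unfolding K0_def by blast
  then have "(x \<ominus> x', \<zero>) \<oplus>\<^bsub>B\<^esub> (x', y) \<in> Y" using stableD(3)[OF Y(1) _ p(3)] by blast
  moreover have "(x \<ominus> x') \<oplus> x' = x" using D_closed[OF p(2)] x'(2) by algebra
  ultimately show "p \<in> Y" using p(1) x'(3) by simp
 qed
 have "Q.submod Z"
 proof (rule stableI)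
  show "Z \<subseteq> carrier Q" using Yc unfolding Z_def by blast
  show "\<zero> \<in> Z" using stableD(2)[OF Y(1)] unfolding Z_def by auto
  show "y \<oplus> y' \<in> Z" if "y \<in> Z" "y' \<in> Z" for y y'
   using that stableD(3)[OF Y(1)] unfolding Z_def by fastforce
  show "r \<otimes> y \<in> Z" if r: "r \<in> A" and y: "y \<in> Z" for r y
  proof -
   obtain x where x: "(x, y) \<in> Y" using y unfolding Z_def by blast
   have "(r, \<zero>) \<bullet> (x, y) \<in> Y" by (rule stableD(4)[OF Y(1) AB_fst[OF r] x])
   then show ?thesis unfolding fst_mult[OF Yc[OF x] Q.A_closed[OF r]] Z_def by blast
  qed
 qed
 moreover have "C \<subseteq> Z" using Y(2) DD(2) unfolding K0_def Z_def by blast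
 moreover have "Z \<subseteq> colon Q C m" using Ym(2) unfolding Z_def by blast
 ultimately have "Z = C \<or> Z = colon Q C m" by (rule C_type)
 then show ?thesis using YZ K0_def by auto
qed

text \<open>
 Put \<open>L = K : K0\<close>, so \<open>K : L = K0\<close> by duality. The lattice \<open>K : nL\<close>
 lies in \<open>K0 : n\<close>, which leaves no room between it and K0; dually, there is no lattice strictly
 between nL and L. By Nakayama L is generated by one element u, and \<open>K0 = K : u\<close>.
\<close>
lemma canonical_is_scaled:
 assumes K: "B.latt K" "reflexive_for B AB K" and one: "\<one>\<^bsub>B\<^esub> \<in> K"
 obtains u where "u \<in> Units B" "K = (\<lambda>x. u \<bullet> x) ` K0" "inv\<^bsub>B\<^esub> u \<in> K0"
proof -
 have rf: "colon B K (colon B K F) = F" if "B.latt F" for F using K(2) that unfolding reflexive_for_def by blast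
 define L where "L = colon B K K0"
 have L: "B.latt L" unfolding L_def by (rule B.lattice_colon[OF K(1) K0_lattice])
 have KL: "colon B K L = K0" unfolding L_def by (rule rf[OF K0_lattice])
 \<comment> \<open>P is the product nL.\<close>
 define P where "P = \<Inter>{N. B.submod N \<and> (\<forall>\<nu>\<in>n. \<forall>l\<in>L. \<nu> \<bullet> l \<in> N)}"
 have nL: "\<nu> \<bullet> l \<in> L" if "\<nu> \<in> n" "l \<in> L" for \<nu> l
  by (rule stableD(4)[OF B.lattice_stable[OF L] _ that(2)]) (use that(1) Q.m_sub in auto)
 have PL: "P \<subseteq> L" unfolding P_def using nL B.lattice_stable[OF L] by blast
 have Pin: "\<nu> \<bullet> l \<in> P" if "\<nu> \<in> n" "l \<in> L" for \<nu> l using that unfolding P_def by blast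
 have Pmin: "P \<subseteq> N" if "B.submod N" "\<And>\<nu> l. \<nu> \<in> n \<Longrightarrow> l \<in> L \<Longrightarrow> \<nu> \<bullet> l \<in> N" for N
  using that unfolding P_def by blast
 have P: "B.submod P"
  unfolding P_def
 proof (rule stable_Inter)
  show "{N. B.submod N \<and> (\<forall>\<nu>\<in>n. \<forall>l\<in>L. \<nu> \<bullet> l \<in> N)} \<noteq> {}"
   using nL B.lattice_stable[OF L] by blast
 qed simp
 obtain l0 where l0: "l0 \<in> L" "l0 \<in> Units B" using L unfolding is_lattice_def by blast
 have P_lat: "B.latt P"
 proof -
  obtain x0 where x0: "x0 \<in> n" "x0 \<in> Units B" using B.m_regular by blast
  have "x0 \<bullet> l0 \<in> P" "x0 \<bullet> l0 \<in> Units B" using Pin[OF x0(1) l0(1)] x0 l0 by auto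
  then show ?thesis using L P PL unfolding is_lattice_def by blast
 qed
 have z: "B.submod {\<zero>\<^bsub>B\<^esub>}" by (rule stableI) (use abc I_closed Q.A_closed in \<open>auto simp: Q.minus_eq\<close>)
 have "P \<noteq> L"
 proof
  assume eq: "P = L"
  have "{\<zero>\<^bsub>B\<^esub>} = L"
   by (rule B.nakayama[OF L z]) (use stableD(2)[OF B.lattice_stable[OF L]] Pmin eq in auto)
  then have "l0 = \<zero>\<^bsub>B\<^esub>" using l0(1) by blast
  then have "\<one>\<^bsub>B\<^esub> = \<zero>\<^bsub>B\<^esub>" using l0(2) B.Units_l_inv[OF l0(2)] B.Units_inv_closed[OF l0(2)] by (metis B.r_null)
  then show False using B.one_not_m stableD(2)[OF B.m_stable] by simp
 qed
 then obtain u where u: "u \<in> L" "u \<notin> P" using PL by blast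
 note uc = B.lattice_closed[OF L u(1)]
 define L1 where "L1 = B.adjoin P u"
 note S = B.stable_adjoin[OF P uc, folded L1_def]
 have L1L: "L1 \<subseteq> L" by (rule S(4)[OF B.lattice_stable[OF L] PL u(1)])
 have L1: "B.latt L1" by (rule B.lattice_between[OF L P_lat S(1,2) L1L])
 have Pc: "P \<subseteq> carrier B" "L1 \<subseteq> carrier B" "L \<subseteq> carrier B"
  using B.lattice_closed[OF P_lat] B.lattice_closed[OF L1] B.lattice_closed[OF L] by auto
 have KP: "colon B K P \<subseteq> colon B K0 n"
 proof
  fix q assume q: "q \<in> colon B K P"
  have qc: "q \<in> carrier B" using q by (simp add: colon_def)
  have "q \<bullet> \<nu> \<in> colon B K L" if \<nu>: "\<nu> \<in> n" for \<nu>
   unfolding colon_def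
  proof (intro CollectI conjI ballI)
   have \<nu>c: "\<nu> \<in> carrier B" by (rule B.m_closed'[OF \<nu>])
   show "q \<bullet> \<nu> \<in> carrier B" by (rule B.m_closed[OF qc \<nu>c])
   fix l assume l: "l \<in> L"
   have "q \<bullet> (\<nu> \<bullet> l) \<in> K" using q Pin[OF \<nu> l] by (simp add: colon_def)
   then show "q \<bullet> \<nu> \<bullet> l \<in> K" using B.m_assoc[OF qc \<nu>c B.lattice_closed[OF L l]] by simp
  qed
  then show "q \<in> colon B K0 n" unfolding KL using qc by (simp add: colon_def)
 qed
 have KL1: "K0 \<subseteq> colon B K L1" "colon B K L1 \<subseteq> colon B K P" "K0 \<subseteq> colon B K P"
 proof -
  show a: "K0 \<subseteq> colon B K L1" using B.colon_antimono[OF L1L, of K] unfolding KL .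
  show b: "colon B K L1 \<subseteq> colon B K P" by (rule B.colon_antimono[OF S(2)])
  show "K0 \<subseteq> colon B K P" by (rule order_trans[OF a b])
 qed
 have ne: "colon B K L1 \<noteq> colon B K P" using rf[OF L1] rf[OF P_lat] S(3) u(2) by metis
 \<comment> \<open>Both colons lie between K0 and \<open>K0 : n\<close>, and they differ.\<close>
 have or1: "colon B K L1 = K0 \<or> colon B K L1 = D \<times> colon Q C m"
  by (rule K0_colon_between[OF B.stable_colon[OF B.lattice_stable[OF K(1)] Pc(2)] KL1(1) order_trans[OF KL1(2) KP]])
 have or2: "colon B K P = K0 \<or> colon B K P = D \<times> colon Q C m"
  by (rule K0_colon_between[OF B.stable_colon[OF B.lattice_stable[OF K(1)] Pc(1)] KL1(3) KP])
 have KL1_eq: "colon B K L1 = K0" using or1 or2 KL1(1,2) ne by (metis subset_antisym)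
 have "L1 = colon B K (colon B K L1)" by (rule rf[OF L1, symmetric])
 also have "\<dots> = L" unfolding KL1_eq KL[symmetric] by (rule rf[OF L])
 finally have "L1 = L" .
 note Z = B.stable_adjoin[OF z uc]
 have ZL: "B.adjoin {\<zero>\<^bsub>B\<^esub>} u = L"
 proof (rule B.nakayama[OF L Z(1)])
  show "B.adjoin {\<zero>\<^bsub>B\<^esub>} u \<subseteq> L"
   by (rule Z(4)[OF B.lattice_stable[OF L] _ u(1)]) (use stableD(2)[OF B.lattice_stable[OF L]] in auto)
  fix N assume N: "B.submod N" "B.adjoin {\<zero>\<^bsub>B\<^esub>} u \<subseteq> N" "\<And>\<nu> l. \<nu> \<in> n \<Longrightarrow> l \<in> L \<Longrightarrow> \<nu> \<bullet> l \<in> N"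
  have "L1 \<subseteq> N" by (rule S(4)[OF N(1) Pmin[OF N(1,3)]]) (use Z(3) N(2) in auto)
  then show "L \<subseteq> N" using \<open>L1 = L\<close> by simp
 qed
 have L_eq: "\<exists>r\<in>AB. l = r \<bullet> u" if "l \<in> L" for l
 proof -
  have "l \<in> B.adjoin {\<zero>\<^bsub>B\<^esub>} u" using that ZL by simp
  then obtain r where r: "r \<in> AB" "l = \<zero>\<^bsub>B\<^esub> \<oplus>\<^bsub>B\<^esub> r \<bullet> u" unfolding B.adjoin_def by auto
  have "r \<bullet> u \<in> carrier B" by (rule B.m_closed[OF B.A_closed[OF r(1)] uc])
  then show ?thesis using r B.l_zero by metis
 qed
 have uU: "u \<in> Units B"
 proof -
  obtain r where r: "r \<in> AB" "l0 = r \<bullet> u" using L_eq[OF l0(1)] by blast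
  have rc: "r \<in> carrier B" by (rule B.A_closed[OF r(1)])
  have lc: "inv\<^bsub>B\<^esub> l0 \<in> carrier B" using l0(2) by (rule B.Units_inv_closed)
  have "(inv\<^bsub>B\<^esub> l0 \<bullet> r) \<bullet> u = \<one>\<^bsub>B\<^esub>"
   using B.Units_l_inv[OF l0(2)] B.m_assoc[OF lc rc uc] r(2) by simp
  then show ?thesis by (rule B.unit_of_left_inverse[OF B.m_closed[OF lc rc] uc])
 qed
 have K0_iff: "x \<in> K0 \<longleftrightarrow> u \<bullet> x \<in> K" if x: "x \<in> carrier B" for x
 proof
  assume "x \<in> K0"
  then have "x \<bullet> u \<in> K" using u(1) unfolding KL[symmetric] by (simp add: colon_def)
  then show "u \<bullet> x \<in> K" using B.m_comm[OF x uc] by simp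
 next
  assume ux: "u \<bullet> x \<in> K"
  show "x \<in> K0" unfolding KL[symmetric] colon_def
  proof (intro CollectI conjI ballI x)
   fix l assume "l \<in> L"
   then obtain r where r: "r \<in> AB" "l = r \<bullet> u" using L_eq by blast
   have rc: "r \<in> carrier B" by (rule B.A_closed[OF r(1)])
   have "x \<bullet> l = r \<bullet> (u \<bullet> x)" unfolding r(2)
    using B.m_lcomm[OF x rc uc] B.m_comm[OF x uc] by simp
   then show "x \<bullet> l \<in> K" using stableD(4)[OF B.lattice_stable[OF K(1)] r(1) ux] by simp
  qed
 qed
 have K0c: "K0 \<subseteq> carrier B" using B.lattice_closed[OF K0_lattice] by auto
 show ?thesis
 proof (rule that[OF uU])
  show "K = (\<lambda>x. u \<bullet> x) ` K0"
  proof (intro equalityI subsetI)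
   fix k assume k: "k \<in> K"
   have kc: "k \<in> carrier B" by (rule B.lattice_closed[OF K(1) k])
   have ic: "inv\<^bsub>B\<^esub> u \<bullet> k \<in> carrier B" by (rule B.m_closed[OF B.Units_inv_closed[OF uU] kc])
   have "u \<bullet> (inv\<^bsub>B\<^esub> u \<bullet> k) = k"
    using B.m_assoc[OF uc B.Units_inv_closed[OF uU] kc] B.Units_r_inv[OF uU] B.l_one[OF kc] by simp
   then show "k \<in> (\<lambda>x. u \<bullet> x) ` K0" using K0_iff[OF ic] k by (intro image_eqI[of _ _ "inv\<^bsub>B\<^esub> u \<bullet> k"]) simp_all
  next
   fix k assume "k \<in> (\<lambda>x. u \<bullet> x) ` K0"
   then show "k \<in> K" using K0_iff K0c by auto
  qed
  show "inv\<^bsub>B\<^esub> u \<in> K0" using K0_iff[OF B.Units_inv_closed[OF uU]] B.Units_r_inv[OF uU] one by simp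
 qed
qed

end

section \<open>Maximal ideals of the endomorphism ring of the maximal ideal\<close>

context lattice_ring
begin

text \<open>
 Duality turns the ascending chain condition into the descending one.
\<close>
lemma dcc_lattice:
 assumes K: "latt K" "reflexive_for Q A K" and F: "latt F" and G: "latt G" and ne: "Fam \<noteq> {}"
  and Fam: "\<And>H. H \<in> Fam \<Longrightarrow> submod H \<and> G \<subseteq> H \<and> H \<subseteq> F"
 obtains H where "H \<in> Fam" "\<And>H'. H' \<in> Fam \<Longrightarrow> H' \<subseteq> H \<Longrightarrow> H' = H"
proof -
 have ne': "colon Q K ` Fam \<noteq> {}" using ne by simp
 have dd: "colon Q K (colon Q K H) = H" if "H \<in> Fam" for H
  using K(2) lattice_between[OF F G] Fam[OF that] unfolding reflexive_for_def by blast
 have Hc: "H \<subseteq> carrier Q" if "H \<in> Fam" for H using Fam[OF that] lattice_closed[OF F] by auto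
 obtain N where N: "N \<in> colon Q K ` Fam" "\<And>N'. N' \<in> colon Q K ` Fam \<Longrightarrow> N \<subseteq> N' \<Longrightarrow> N' = N"
 proof (rule acc_lattice[OF lattice_colon[OF K(1) G] ne'])
  fix N assume "N \<in> colon Q K ` Fam"
  then obtain H where "H \<in> Fam" "N = colon Q K H" by blast
  then show "submod N \<and> N \<subseteq> colon Q K G"
   using stable_colon[OF lattice_stable[OF K(1)] Hc] colon_antimono[of G H K] Fam by simp
 qed blast
 then obtain H where H: "H \<in> Fam" "N = colon Q K H" by blast
 have "H' = H" if H': "H' \<in> Fam" "H' \<subseteq> H" for H'
 proof -
  have "colon Q K H' = N" using N(2)[of "colon Q K H'"] H' colon_antimono[OF H'(2), of K] H(2) by simp
  then have "colon Q K (colon Q K H') = colon Q K (colon Q K H)" using H(2) by simp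
  then show ?thesis using dd[OF H'(1)] dd[OF H(1)] by simp
 qed
 then show ?thesis using that H(1) by blast
qed

end

text \<open>
 K supplies a duality; it enters only through the descending chain condition for lattices between m and T.
\<close>
locale overring = lattice_ring Q A m for Q :: "('q, 'd) ring_scheme" (structure) and A m +
 fixes K :: "'q set"
 assumes K_lattice: "latt K" and K_reflexive: "reflexive_for Q A K"
begin

definition "T = colon Q m m"

lemma T_lattice: "latt T" unfolding T_def by (rule lattice_colon[OF lattice_m lattice_m])
lemmas T_stable = lattice_stable[OF T_lattice]
lemmas T_closed = lattice_closed[OF T_lattice]
lemma T_m: "t \<in> T \<Longrightarrow> x \<in> m \<Longrightarrow> t \<otimes> x \<in> m" by (simp add: T_def colon_def)

lemma A_T: "A \<subseteq> T"
 unfolding T_def colon_def using A_closed stableD(4)[OF m_stable] by auto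

lemma T_mult: "s \<in> T \<Longrightarrow> t \<in> T \<Longrightarrow> s \<otimes> t \<in> T"
 unfolding T_def colon_def using m_closed' by (auto simp: m_assoc)

text \<open>
 Only ideals that contain m are considered: as T/m has finite length, they satisfy both chain conditions.
\<close>
definition T_ideal :: "'q set \<Rightarrow> bool" where
 "T_ideal N \<longleftrightarrow> submod N \<and> m \<subseteq> N \<and> N \<subseteq> T \<and> (\<forall>t\<in>T. \<forall>x\<in>N. t \<otimes> x \<in> N)"

definition T_maximal :: "'q set \<Rightarrow> bool" where
 "T_maximal N \<longleftrightarrow> T_ideal N \<and> \<one> \<notin> N \<and> (\<forall>N'. T_ideal N' \<longrightarrow> N \<subseteq> N' \<longrightarrow> \<one> \<notin> N' \<longrightarrow> N' = N)"

lemma T_idealD: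
 assumes "T_ideal N"
 shows "submod N" "m \<subseteq> N" "N \<subseteq> T" "t \<in> T \<Longrightarrow> x \<in> N \<Longrightarrow> t \<otimes> x \<in> N"
 using assms unfolding T_ideal_def by auto

lemma T_ideal_add:
 assumes N: "T_ideal N" and x: "x \<in> T"
 defines "N' \<equiv> {p \<oplus> t \<otimes> x | p t. p \<in> N \<and> t \<in> T}"
 shows "T_ideal N'" "N \<subseteq> N'" "x \<in> N'"
proof -
 note D = T_idealD[OF N]
 note S = stableD[OF D(1)] and TS = stableD[OF T_stable]
 have xc: "x \<in> carrier Q" by (rule T_closed[OF x])
 have one: "\<one> \<in> T" using A_T A_one by blast
 show NN: "N \<subseteq> N'"
 proof
  fix p assume p: "p \<in> N"
  then have "p = p \<oplus> \<zero> \<otimes> x" using S(1) xc by simp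
  then show "p \<in> N'" unfolding N'_def using p TS(2) by blast
 qed
 have "x = \<zero> \<oplus> \<one> \<otimes> x" using xc by simp
 then show "x \<in> N'" unfolding N'_def using S(2) one by blast
 have tmul: "s \<otimes> z \<in> N'" if s: "s \<in> T" and z: "z \<in> N'" for s z
 proof -
  obtain p t where p: "z = p \<oplus> t \<otimes> x" "p \<in> N" "t \<in> T" using z unfolding N'_def by blast
  have "s \<otimes> z = s \<otimes> p \<oplus> (s \<otimes> t) \<otimes> x"
   unfolding p(1) using S(1)[OF p(2)] T_closed[OF s] T_closed[OF p(3)] xc by (simp add: r_distr m_assoc)
  then show ?thesis unfolding N'_def using D(4)[OF s p(2)] T_mult[OF s p(3)] by blast
 qed
 show "T_ideal N'" unfolding T_ideal_def
 proof (intro conjI ballI)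
  show "m \<subseteq> N'" using D(2) NN by blast
  show N'T: "N' \<subseteq> T" unfolding N'_def using TS(3) D(3) T_mult[OF _ x] by blast
  show "submod N'"
  proof (rule stableI)
   show "N' \<subseteq> carrier Q" using N'T T_closed by blast
   show "\<zero> \<in> N'" using NN S(2) by blast
   show "z \<oplus> w \<in> N'" if z: "z \<in> N'" and w: "w \<in> N'" for z w
   proof -
    obtain p t where p: "z = p \<oplus> t \<otimes> x" "p \<in> N" "t \<in> T" using z unfolding N'_def by blast
    obtain q s where q: "w = q \<oplus> s \<otimes> x" "q \<in> N" "s \<in> T" using w unfolding N'_def by blast
    have "z \<oplus> w = (p \<oplus> q) \<oplus> (t \<oplus> s) \<otimes> x"
     unfolding p(1) q(1) using S(1)[OF p(2)] S(1)[OF q(2)] T_closed[OF p(3)] T_closed[OF q(3)] xc by (simp add: l_distr a_ac)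
    then show ?thesis unfolding N'_def using S(3)[OF p(2) q(2)] TS(3)[OF p(3) q(3)] by blast
   qed
   show "a \<otimes> z \<in> N'" if "a \<in> A" "z \<in> N'" for a z by (rule tmul[OF _ that(2)]) (use A_T that(1) in blast)
  qed
 qed (rule tmul)
qed

lemma T_maximal_prime:
 assumes N: "T_maximal N" and xy: "x \<in> T" "y \<in> T" "x \<otimes> y \<in> N" shows "x \<in> N \<or> y \<in> N"
proof (rule disjCI)
 assume "y \<notin> N"
 have I: "T_ideal N" using N by (simp add: T_maximal_def)
 note A = T_ideal_add[OF I xy(2)]
 have "\<one> \<in> {p \<oplus> t \<otimes> y | p t. p \<in> N \<and> t \<in> T}"
 proof (rule ccontr)
  assume "\<one> \<notin> {p \<oplus> t \<otimes> y | p t. p \<in> N \<and> t \<in> T}"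
  then have "{p \<oplus> t \<otimes> y | p t. p \<in> N \<and> t \<in> T} = N" using N A(1,2) unfolding T_maximal_def by simp
  then show False using A(3) \<open>y \<notin> N\<close> by simp
 qed
 then obtain p t where p: "\<one> = p \<oplus> t \<otimes> y" "p \<in> N" "t \<in> T" by blast
 have c: "p \<in> carrier Q" "t \<in> carrier Q" "x \<in> carrier Q" "y \<in> carrier Q"
  using stableD(1)[OF T_idealD(1)[OF I] p(2)] T_closed p(3) xy by auto
 have "x = x \<otimes> \<one>" using c by simp
 also have "\<dots> = x \<otimes> (p \<oplus> t \<otimes> y)" by (rule arg_cong[OF p(1)])
 also have "\<dots> = x \<otimes> p \<oplus> t \<otimes> (x \<otimes> y)" using c by algebra
 also have "\<dots> \<in> N" by (rule stableD(3)[OF T_idealD(1)[OF I] T_idealD(4)[OF I xy(1) p(2)] T_idealD(4)[OF I p(3) xy(3)]])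
 finally show "x \<in> N" .
qed

lemma T_maximal_exists:
 assumes N: "T_ideal N" "\<one> \<notin> N" obtains N' where "T_maximal N'" "N \<subseteq> N'"
proof -
 let ?Fam = "{N'. T_ideal N' \<and> N \<subseteq> N' \<and> \<one> \<notin> N'}"
 have ne: "?Fam \<noteq> {}" using N by blast
 obtain N' where N': "N' \<in> ?Fam" "\<And>N''. N'' \<in> ?Fam \<Longrightarrow> N' \<subseteq> N'' \<Longrightarrow> N'' = N'"
  by (rule acc_lattice[OF T_lattice ne]) (auto simp: T_ideal_def)
 have "T_maximal N'" unfolding T_maximal_def using N' by auto
 then show ?thesis using that N'(1) by simp
qed

lemma T_ideal_Inter: assumes "Fam \<noteq> {}" "\<And>N. N \<in> Fam \<Longrightarrow> T_ideal N" shows "T_ideal (\<Inter>Fam)"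
proof -
 have "submod (\<Inter>Fam)" by (rule stable_Inter[OF assms(1)]) (use assms(2) T_idealD in blast)
 moreover have "\<Inter>Fam \<subseteq> T" using assms T_idealD(3) by blast
 ultimately show ?thesis unfolding T_ideal_def using T_idealD(2)[OF assms(2)] T_idealD(4)[OF assms(2)] by auto
qed

text \<open>
 A prime that contains a finite intersection contains a member, and by maximality equals it.
\<close>
lemma T_maximal_Inter:
 assumes "finite Fam" "Fam \<noteq> {}" "\<And>N'. N' \<in> Fam \<Longrightarrow> T_maximal N'" "T_maximal N" "\<Inter>Fam \<subseteq> N"
 shows "N \<in> Fam"
proof -
 have "\<exists>N'\<in>Fam. N' \<subseteq> N" using assms(1,2,3,5)
 proof (induction Fam rule: finite_ne_induct)
  case (insert M Fam)
  show ?case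
  proof (cases "M \<subseteq> N")
   case False
   then obtain p where p: "p \<in> M" "p \<notin> N" by blast
   have MI: "T_ideal M" using insert.prems(1) by (simp add: T_maximal_def)
   have I: "T_ideal (\<Inter>Fam)" by (rule T_ideal_Inter) (use insert in \<open>auto simp: T_maximal_def\<close>)
   have "x \<in> N" if x: "x \<in> \<Inter>Fam" for x
   proof -
    have T: "p \<in> T" "x \<in> T" using T_idealD(3)[OF MI] T_idealD(3)[OF I] p x by auto
    have "x \<otimes> p \<in> M" by (rule T_idealD(4)[OF MI T(2) p(1)])
    moreover have "x \<otimes> p = p \<otimes> x" using T T_closed by (simp add: m_comm)
    moreover have "p \<otimes> x \<in> \<Inter>Fam" by (rule T_idealD(4)[OF I T(1) x])
    ultimately have "p \<otimes> x \<in> N" using insert.prems(2) by auto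
    then show ?thesis using T_maximal_prime[OF assms(4) T] p(2) by blast
   qed
   then have "\<Inter>Fam \<subseteq> N" by blast
   then show ?thesis using insert by blast
  qed blast
 qed simp
 then obtain N' where "N' \<in> Fam" "N' \<subseteq> N" by blast
 moreover have "N = N'" using assms(3)[OF \<open>N' \<in> Fam\<close>] assms(4) \<open>N' \<subseteq> N\<close> unfolding T_maximal_def by blast
 ultimately show ?thesis by simp
qed

text \<open>
 A minimal finite intersection of maximal ideals lies in every maximal ideal.
\<close>
lemma finite_T_maximal: "finite {N. T_maximal N}"
proof (cases "{N. T_maximal N} = {}")
 case False
 let ?Fam = "{\<Inter>F | F. finite F \<and> F \<noteq> {} \<and> F \<subseteq> {N. T_maximal N}}"
 obtain N0 where "T_maximal N0" using False by blast
 then have "\<Inter>{N0} \<in> ?Fam" by blast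
 then have ne: "?Fam \<noteq> {}" by blast
 obtain H where H: "H \<in> ?Fam" "\<And>H'. H' \<in> ?Fam \<Longrightarrow> H' \<subseteq> H \<Longrightarrow> H' = H"
 proof (rule dcc_lattice[OF K_lattice K_reflexive T_lattice lattice_m ne])
  fix H assume "H \<in> ?Fam"
  then obtain F where "H = \<Inter>F" "F \<noteq> {}" "F \<subseteq> {N. T_maximal N}" by blast
  then have "T_ideal H" using T_ideal_Inter[of F] by (auto simp: T_maximal_def)
  then show "submod H \<and> m \<subseteq> H \<and> H \<subseteq> T" using T_idealD by blast
 qed blast
 obtain F where F: "H = \<Inter>F" "finite F" "F \<noteq> {}" "F \<subseteq> {N. T_maximal N}" using H(1) by blast
 have "N \<in> F" if N: "T_maximal N" for N
 proof (rule T_maximal_Inter[OF F(2,3) _ N])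
  have "\<Inter>(insert N F) \<in> ?Fam" using F N by blast
  then have "\<Inter>(insert N F) = H" using H(2)[of "\<Inter>(insert N F)"] F(1) by auto
  then show "\<Inter>F \<subseteq> N" using F(1) by auto
 qed (use F(4) in auto)
 then have "{N. T_maximal N} \<subseteq> F" by blast
 then show ?thesis using F(2) finite_subset by blast
qed simp

text \<open>
 If t lies in no maximal ideal containing m, then \<open>1 = p + st\<close> with p \<in> m, and 1 - p is a
 unit of the local ring A.
\<close>
lemma T_unit:
 assumes t: "t \<in> T" "\<And>N. T_maximal N \<Longrightarrow> t \<notin> N"
 shows "\<exists>s\<in>T. s \<otimes> t = \<one>"
proof -
 have mI: "T_ideal m" unfolding T_ideal_def
 proof (intro conjI ballI)
  show "m \<subseteq> T" using m_sub A_T by blast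
  show "s \<otimes> x \<in> m" if "s \<in> T" "x \<in> m" for s x by (rule T_m[OF that])
 qed (auto intro: m_stable)
 note A = T_ideal_add[OF mI t(1)]
 have "\<one> \<in> {p \<oplus> s \<otimes> t | p s. p \<in> m \<and> s \<in> T}"
 proof (rule ccontr)
  assume "\<one> \<notin> {p \<oplus> s \<otimes> t | p s. p \<in> m \<and> s \<in> T}"
  then obtain N where "T_maximal N" "{p \<oplus> s \<otimes> t | p s. p \<in> m \<and> s \<in> T} \<subseteq> N"
   by (rule T_maximal_exists[OF A(1)])
  then show False using A(3) t(2) by blast
 qed
 then obtain p s where p: "\<one> = p \<oplus> s \<otimes> t" "p \<in> m" "s \<in> T" by blast
 have c: "p \<in> carrier Q" "s \<in> carrier Q" "t \<in> carrier Q" using m_closed'[OF p(2)] T_closed p(3) t(1) by auto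
 have st: "s \<otimes> t = \<one> \<ominus> p"
 proof -
  have "s \<otimes> t = (p \<oplus> s \<otimes> t) \<ominus> p" using c by algebra
  then show ?thesis using p(1) by simp
 qed
 have "\<one> \<ominus> p \<in> A" by (rule stable_diff'[OF A_stable A_one]) (use p(2) m_sub in blast)
 moreover have "\<one> \<ominus> p \<notin> m"
 proof
  assume "\<one> \<ominus> p \<in> m"
  then have "(\<one> \<ominus> p) \<oplus> p \<in> m" using p(2) stableD(3)[OF m_stable] by blast
  moreover have "(\<one> \<ominus> p) \<oplus> p = \<one>" using c by algebra
  ultimately show False using one_not_m by simp
 qed
 ultimately obtain e where e: "e \<in> A" "e \<otimes> (\<one> \<ominus> p) = \<one>" using not_m_inverse by blast
 have "(e \<otimes> s) \<otimes> t = \<one>" using A_closed[OF e(1)] c e(2) st by (simp add: m_assoc)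
 moreover have "e \<otimes> s \<in> T" by (rule T_mult) (use e A_T p(3) in auto)
 ultimately show ?thesis by blast
qed

text \<open>
 Prime avoidance for a set V that need not be an ideal of T, only closed under sums and under multiplication
 by infinitely many scalars that are incongruent modulo m. If v avoids the first ideals and v' the next one,
 each ideal contains at most one of the elements \<open>v + ev'\<close>, because differences of the scalars
 are units.
\<close>
lemma avoid_T_maximal:
 assumes E: "infinite E" "E \<subseteq> A" "\<And>e e'. e \<in> E \<Longrightarrow> e' \<in> E \<Longrightarrow> e \<noteq> e' \<Longrightarrow> e \<ominus> e' \<notin> m"
  and V: "V \<subseteq> T" "\<zero> \<in> V" "\<And>x y. x \<in> V \<Longrightarrow> y \<in> V \<Longrightarrow> x \<oplus> y \<in> V"
   "\<And>e x. e \<in> E \<Longrightarrow> x \<in> V \<Longrightarrow> e \<otimes> x \<in> V" and out: "\<And>N. T_maximal N \<Longrightarrow> \<not> V \<subseteq> N"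
 obtains v where "v \<in> V" "\<And>N. T_maximal N \<Longrightarrow> v \<notin> N"
proof -
 have "\<exists>v\<in>V. \<forall>N\<in>F. v \<notin> N" if "finite F" "F \<subseteq> {N. T_maximal N}" for F
  using that
 proof (induction F rule: finite_induct)
  case empty then show ?case using V(2) by blast
 next
  case (insert N F)
  then obtain v where v: "v \<in> V" "\<forall>N\<in>F. v \<notin> N" by blast
  have N: "T_maximal N" using insert.prems by simp
  then obtain v' where v': "v' \<in> V" "v' \<notin> N" using out by blast
  have vc: "v \<in> carrier Q" "v' \<in> carrier Q" using T_closed V(1) v v' by blast+
  have scale: "v' \<in> M" if M: "T_ideal M" and e: "e \<in> A" "e \<notin> m" "e \<otimes> v' \<in> M" for e M
  proof -
   obtain c where c: "c \<in> A" "c \<otimes> e = \<one>" using not_m_inverse e by blast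
   have "c \<otimes> (e \<otimes> v') \<in> M" by (rule stableD(4)[OF T_idealD(1)[OF M] c(1) e(3)])
   then show ?thesis using c vc A_closed e(1) by (simp flip: m_assoc)
  qed
  have sub: "v' \<in> M" if M: "T_ideal M" and e: "e \<in> E" "e' \<in> E" "e \<noteq> e'" "v \<oplus> e \<otimes> v' \<in> M" "v \<oplus> e' \<otimes> v' \<in> M" for e e' M
  proof (rule scale[OF M _ E(3)[OF e(1-3)]])
   have ec: "e \<in> A" "e' \<in> A" "e \<in> carrier Q" "e' \<in> carrier Q" using e E(2) A_closed by auto
   show "e \<ominus> e' \<in> A" by (rule stable_diff'[OF A_stable ec(1,2)])
   have "(v \<oplus> e \<otimes> v') \<ominus> (v \<oplus> e' \<otimes> v') = (e \<ominus> e') \<otimes> v'" using ec vc by algebra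
   then show "(e \<ominus> e') \<otimes> v' \<in> M" using stable_diff'[OF T_idealD(1)[OF M] e(4,5)] by simp
  qed
  have one: "finite {e \<in> E. v \<oplus> e \<otimes> v' \<in> M}" if M: "M \<in> insert N F" "v' \<notin> M \<or> v \<notin> M" for M
  proof -
   have MI: "T_ideal M" using M(1) insert.prems by (auto simp: T_maximal_def)
   have "e = e'" if e: "e \<in> E" "e' \<in> E" "v \<oplus> e \<otimes> v' \<in> M" "v \<oplus> e' \<otimes> v' \<in> M" for e e'
   proof (rule ccontr)
    assume "e \<noteq> e'"
    then have v'M: "v' \<in> M" using sub[OF MI e(1,2) _ e(3,4)] by blast
    have eA: "e \<in> A" "e \<in> carrier Q" using e(1) E(2) A_closed by auto
    have "(v \<oplus> e \<otimes> v') \<ominus> e \<otimes> v' \<in> M"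
     by (rule stable_diff'[OF T_idealD(1)[OF MI] e(3) stableD(4)[OF T_idealD(1)[OF MI] eA(1) v'M]])
    moreover have "(v \<oplus> e \<otimes> v') \<ominus> e \<otimes> v' = v" using vc eA by algebra
    ultimately show False using v'M M(2) by simp
   qed
   then have "{e \<in> E. v \<oplus> e \<otimes> v' \<in> M} \<subseteq> {SOME e. e \<in> E \<and> v \<oplus> e \<otimes> v' \<in> M}"
    by (auto intro: someI2)
   then show ?thesis using finite_subset by blast
  qed
  have "finite (\<Union>M\<in>insert N F. {e \<in> E. v \<oplus> e \<otimes> v' \<in> M})"
   using insert.hyps(1) one v'(2) v(2) by blast
  then obtain e where e: "e \<in> E" "e \<notin> (\<Union>M\<in>insert N F. {e \<in> E. v \<oplus> e \<otimes> v' \<in> M})"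
   using E(1) by (meson finite_subset subsetI)
  have "v \<oplus> e \<otimes> v' \<in> V" by (rule V(3)[OF v(1) V(4)[OF e(1) v'(1)]])
  moreover have "\<forall>M\<in>insert N F. v \<oplus> e \<otimes> v' \<notin> M" using e by blast
  ultimately show ?case by blast
 qed
 from this[OF finite_T_maximal] that show ?thesis by blast
qed

end

section \<open>The type of an almost Gorenstein quadratic extension\<close>

lemma colon_mult: "q \<in> colon Q F G \<Longrightarrow> g \<in> G \<Longrightarrow> q \<otimes>\<^bsub>Q\<^esub> g \<in> F"
 by (simp add: colon_def)

context lattice_ring
begin

lemma colon_self_one:
 assumes "submod K" shows "colon Q K A = K"
proof
 show "colon Q K A \<subseteq> K"
 proof
  fix q assume q: "q \<in> colon Q K A"
  then have "q \<otimes> \<one> \<in> K" "q \<in> carrier Q" using A_one by (auto simp: colon_def)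
  then show "q \<in> K" by simp
 qed
 show "K \<subseteq> colon Q K A"
 proof
  fix q assume q: "q \<in> K"
  have "q \<otimes> a \<in> K" if "a \<in> A" for a
   using stableD(4)[OF assms that q] m_comm[OF stableD(1)[OF assms q] A_closed[OF that]] by simp
  then show "q \<in> colon Q K A" using stableD(1)[OF assms q] by (simp add: colon_def)
 qed
qed

lemma colon_reflexive_self:
 assumes "latt K" "reflexive_for Q A K" shows "colon Q K K = A"
 using assms(2) lattice_A colon_self_one[OF lattice_stable[OF assms(1)]] unfolding reflexive_for_def by metis

text \<open>
 Rests on \<open>K : K = A\<close>, which is duality applied to A.
\<close>
lemma colon_via_endomorphisms:
 assumes K: "latt K" "reflexive_for Q A K" and V: "V \<subseteq> carrier Q" and p: "p \<in> carrier Q"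
  and pK: "\<And>v k. v \<in> V \<Longrightarrow> k \<in> K \<Longrightarrow> p \<otimes> (v \<otimes> k) \<in> K"
 shows "p \<in> colon Q A V"
proof -
 have "p \<otimes> v \<in> colon Q K K" if v: "v \<in> V" for v
  using pK[OF v] p subsetD[OF V v] lattice_closed[OF K(1)] by (simp add: colon_def m_assoc)
 then show ?thesis using p unfolding colon_reflexive_self[OF K] by (simp add: colon_def)
qed

lemma scale_length_one:
 assumes s: "s \<in> Units Q"
 shows "composition_series Q A ((\<lambda>h. s \<otimes> h) ` m) ((\<lambda>h. s \<otimes> h) ` A) 1"
proof -
 have sc: "s \<in> carrier Q" using s by (rule Units_closed)
 let ?H = "(\<lambda>h. s \<otimes> h) ` m"
 have H: "submod ?H" by (rule stable_scale[OF m_stable sc])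
 have "simple_over Q A (adjoin ?H s) ?H"
 proof (rule simple_adjoin[OF H sc])
  show "s \<notin> ?H"
  proof
   assume "s \<in> ?H"
   then obtain x where x: "x \<in> m" "s = s \<otimes> x" by blast
   then have "s \<otimes> x = s \<otimes> \<one>" using sc by simp
   then have "x = \<one>" using s m_closed'[OF x(1)] by (simp add: Units_l_cancel)
   then show False using one_not_m x(1) by simp
  qed
  show "a \<otimes> s \<in> ?H" if "a \<in> m" for a
   using that m_closed'[OF that] sc by (intro image_eqI[of _ _ a]) (auto simp: m_comm)
 qed
 moreover have "adjoin ?H s = (\<lambda>h. s \<otimes> h) ` A"
 proof
  show "adjoin ?H s \<subseteq> (\<lambda>h. s \<otimes> h) ` A"
   by (rule stable_adjoin(4)[OF H sc stable_scale[OF A_stable sc]])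
     (use m_sub A_one sc in \<open>auto intro: image_eqI[of _ _ \<one>]\<close>)
  show "(\<lambda>h. s \<otimes> h) ` A \<subseteq> adjoin ?H s"
   using stableD(4)[OF stable_adjoin(1)[OF H sc] _ stable_adjoin(3)[OF H sc]] A_closed sc
   by (auto simp: m_comm)
 qed
 ultimately have "simple_over Q A ((\<lambda>h. s \<otimes> h) ` A) ?H" by simp
 from composition_series.step[OF composition_series.trivial[OF H] this] show ?thesis by simp
qed

end

context quadratic_lattices
begin

lemma snd_zero_in_n: "i \<in> I \<Longrightarrow> (\<zero>, i) \<in> n" using mD(2) by simp
lemma fst_in_n: "\<mu> \<in> m \<Longrightarrow> (\<mu>, \<zero>) \<in> n" using ID(2) by simp

lemma B_neg: "x \<in> carrier Q \<Longrightarrow> y \<in> carrier Q \<Longrightarrow> \<ominus>\<^bsub>B\<^esub> (x, y) = (\<ominus> x, \<ominus> y)"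
 by (rule B.minus_equality) (simp_all add: Q.l_neg)

text \<open>
 Pulling back along a coordinate projection turns composition series over A into composition series over
 A \<times> I. As n maps K0 into the smallest fibre, A \<times> I acts on the layers through A alone.
\<close>
lemma composition_series_fibres:
 assumes cs: "composition_series Q A G F k" and F: "F \<subseteq> \<pi> ` (D \<times> J)" and J: "Q.submod J" "J \<subseteq> C"
  and \<pi>: "\<pi> = fst \<or> \<pi> = snd"
  and act: "\<And>\<nu> x. \<nu> \<in> n \<Longrightarrow> x \<in> K0 \<Longrightarrow> \<nu> \<bullet> x \<in> {p \<in> D \<times> J. \<pi> p \<in> G}"
 shows "composition_series B AB {p \<in> D \<times> J. \<pi> p \<in> G} {p \<in> D \<times> J. \<pi> p \<in> F} k"
proof -
 let ?X = "D \<times> J" and ?f = "\<lambda>H. {p \<in> D \<times> J. \<pi> p \<in> H}"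
 note JD = stableD[OF J(1)]
 have Xc: "p \<in> carrier B" "\<pi> p \<in> carrier Q" if "p \<in> ?X" for p
  using that \<pi> JD(1) D_closed by auto
 have add: "p \<oplus>\<^bsub>B\<^esub> q \<in> ?X" "\<pi> (p \<oplus>\<^bsub>B\<^esub> q) = \<pi> p \<oplus> \<pi> q" if "p \<in> ?X" "q \<in> ?X" for p q
  using that \<pi> JD(3) DD(3) by auto
 have neg: "\<ominus>\<^bsub>B\<^esub> p \<in> ?X" "\<pi> (\<ominus>\<^bsub>B\<^esub> p) = \<ominus> \<pi> p" if "p \<in> ?X" for p
  using that \<pi> B_neg Q.stable_neg'[OF J(1)] Q.stable_neg'[OF D_stable] JD(1) D_closed by auto
 have smult: "(r, \<zero>) \<bullet> p \<in> ?X" "\<pi> ((r, \<zero>) \<bullet> p) = r \<otimes> \<pi> p" if r: "r \<in> A" and p: "p \<in> ?X" for r p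
 proof -
  obtain x y where xy: "p = (x, y)" "x \<in> D" "y \<in> J" using p by blast
  note e = fst_mult[OF D_closed[OF xy(2)] JD(1)[OF xy(3)] Q.A_closed[OF r]]
  show "(r, \<zero>) \<bullet> p \<in> ?X" unfolding xy(1) e using DD(4)[OF r xy(2)] JD(4)[OF r xy(3)] by simp
  show "\<pi> ((r, \<zero>) \<bullet> p) = r \<otimes> \<pi> p" unfolding xy(1) e using \<pi> by auto
 qed
 have st: "B.submod (?f H)" if H: "Q.submod H" "G \<subseteq> H" for H
 proof (rule B_stableI)
  note HD = stableD[OF H(1)]
  show "?f H \<subseteq> carrier B" using Xc by blast
  show "(\<zero>, \<zero>) \<in> ?f H" using HD(2) DD(2) JD(2) \<pi> by auto
  show "x \<oplus>\<^bsub>B\<^esub> y \<in> ?f H" if "x \<in> ?f H" "y \<in> ?f H" for x y using that add HD(3) by simp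
  show "(r \<otimes> x, r \<otimes> y) \<in> ?f H" if "r \<in> A" "(x, y) \<in> ?f H" for r x y
   using that DD(4) JD(4) HD(4) \<pi> by auto
  show "(\<zero>, i) \<bullet> (x, y) \<in> ?f H" if "i \<in> I" "(x, y) \<in> ?f H" for i x y
  proof -
   have "(x, y) \<in> K0" using that(2) J(2) unfolding K0_def by auto
   from act[OF snd_zero_in_n[OF that(1)] this] H(2) show ?thesis by auto
  qed
 qed
 show ?thesis using cs F
 proof (induction rule: composition_series.induct)
  case trivial then show ?case by (intro composition_series.trivial st) auto
 next
  case (step F k F')
  have GF: "G \<subseteq> F" and Fs: "Q.submod F" using composition_series_stable[OF step(1)] by auto
  have F': "Q.submod F'" "F \<subset> F'" using step(2) by (auto simp: simple_over_def)
  have "simple_over B AB (?f F') (?f F)" unfolding simple_over_def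
  proof (intro conjI allI impI)
   show "B.submod (?f F')" by (rule st) (use F' GF in auto)
   show "?f F \<subset> ?f F'" using F'(2) step.prems by blast
   fix H assume H: "B.submod H" "?f F \<subseteq> H" "H \<subseteq> ?f F'"
   note HD = stableD[OF H(1)]
   have HX: "h \<in> ?X" "\<pi> h \<in> F'" if "h \<in> H" for h using subsetD[OF H(3) that] by auto
   have "Q.submod (\<pi> ` H)"
   proof (rule stableI)
    show "\<pi> ` H \<subseteq> carrier Q" using Xc(2) HX(1) by blast
    show "\<zero> \<in> \<pi> ` H" using HD(2) \<pi> by force
    fix x assume "x \<in> \<pi> ` H"
    then obtain p where p: "p \<in> H" "x = \<pi> p" by blast
    show "r \<otimes> x \<in> \<pi> ` H" if r: "r \<in> A" for r
     using imageI[OF HD(4)[OF AB_fst[OF r] p(1)], of \<pi>] smult(2)[OF r HX(1)[OF p(1)]] p(2) by simp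
    fix y assume "y \<in> \<pi> ` H"
    then obtain q where q: "q \<in> H" "y = \<pi> q" by blast
    show "x \<oplus> y \<in> \<pi> ` H"
     using imageI[OF HD(3)[OF p(1) q(1)], of \<pi>] add(2)[OF HX(1)[OF p(1)] HX(1)[OF q(1)]] p(2) q(2) by simp
   qed
   moreover have "F \<subseteq> \<pi> ` H"
   proof
    fix x assume x: "x \<in> F"
    then obtain p where "p \<in> ?X" "x = \<pi> p" using step.prems F'(2) by blast
    then show "x \<in> \<pi> ` H" using x H(2) by blast
   qed
   ultimately have "\<pi> ` H = F \<or> \<pi> ` H = F'" using step(2) HX(2) unfolding simple_over_def by blast
   moreover have "H = ?f (\<pi> ` H)"
   proof (intro equalityI subsetI)
    fix p assume p: "p \<in> ?f (\<pi> ` H)"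
    then obtain h where h: "h \<in> H" "\<pi> p = \<pi> h" by blast
    have "\<pi> (p \<oplus>\<^bsub>B\<^esub> \<ominus>\<^bsub>B\<^esub> h) = \<zero>"
     using add(2)[of p] neg HX(1)[OF h(1)] p h(2) Xc(2) by (simp add: Q.r_neg)
    moreover have "p \<oplus>\<^bsub>B\<^esub> \<ominus>\<^bsub>B\<^esub> h \<in> ?X" by (rule add(1)[OF _ neg(1)[OF HX(1)[OF h(1)]]]) (use p in blast)
    ultimately have "p \<oplus>\<^bsub>B\<^esub> \<ominus>\<^bsub>B\<^esub> h \<in> H"
     using stableD(2)[OF Fs] by (intro subsetD[OF H(2)]) (simp del: mem_Sigma_iff quadratic_ring_simps)
    then have "(p \<oplus>\<^bsub>B\<^esub> \<ominus>\<^bsub>B\<^esub> h) \<oplus>\<^bsub>B\<^esub> h \<in> H" by (rule HD(3)[OF _ h(1)])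
    moreover have "(p \<oplus>\<^bsub>B\<^esub> \<ominus>\<^bsub>B\<^esub> h) \<oplus>\<^bsub>B\<^esub> h = p" using Xc(1)[of p] Xc(1)[OF HX(1)[OF h(1)]] p
     by (simp add: B.a_assoc B.l_neg del: quadratic_ring_simps mem_Sigma_iff)
    ultimately show "p \<in> H" by simp
   qed (use HX in blast)
   ultimately show "H = ?f F \<or> H = ?f F'" by metis
  qed
  then show ?case using step.IH step.prems F'(2) by (intro composition_series.step) auto
 qed
qed

text \<open>
 The numerical heart. K is a canonical ideal with \<open>K n \<subseteq> n\<close>, and q below is the length
 of C/wI.
\<close>
theorem type_of_almost_gorenstein:
 assumes K: "B.latt K" "reflexive_for B AB K" "AB \<subseteq> K"
  and Kn: "\<And>k \<nu>. k \<in> K \<Longrightarrow> \<nu> \<in> n \<Longrightarrow> k \<bullet> \<nu> \<in> n"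
  and E: "infinite E" "E \<subseteq> A" "\<And>e e'. e \<in> E \<Longrightarrow> e' \<in> E \<Longrightarrow> e \<noteq> e' \<Longrightarrow> e \<ominus> e' \<notin> m"
 shows "\<exists>t r :: nat. quotient_length B AB (colon B AB n) AB = enat t \<and>
  quotient_length Q A (colon Q A m) A = enat r \<and> odd t \<and> 1 \<le> t \<and> t \<le> 2 * r + 1"
proof -
 interpret T: overring B AB n K
  by (intro overring.intro overring_axioms.intro B.lattice_ring_axioms K)
 have one: "\<one>\<^bsub>B\<^esub> \<in> K" by (rule subsetD[OF K(3) B.A_one])
 obtain u where u: "u \<in> Units B" "K = (\<lambda>x. u \<bullet> x) ` K0" "inv\<^bsub>B\<^esub> u \<in> K0"
  by (rule canonical_is_scaled[OF K(1,2) one])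
 have uc: "u \<in> carrier B" using u(1) by (rule B.Units_closed)
 have K0c: "x \<in> carrier B" if "x \<in> K0" for x using B.lattice_closed[OF K0_lattice that] .
 have uK: "u \<bullet> x \<in> K" if "x \<in> K0" for x using u(2) that by blast
 have KT: "K \<subseteq> T.T"
  unfolding T.T_def colon_def using B.lattice_closed[OF K(1)] Kn by blast
 have DK0: "(x, \<zero>) \<in> K0" if "x \<in> D" for x using that CD(2) by (simp add: K0_def)
 have CK0: "(\<zero>, y) \<in> K0" if "y \<in> C" for y using that DD(2) by (simp add: K0_def)
 \<comment> \<open>There is w \<in> D such that \<open>\<tau> = u(w, 0)\<close> is a unit of T.\<close>
 let ?E = "(\<lambda>e. (e, \<zero>)) ` E"
 let ?V = "(\<lambda>x. u \<bullet> (x, \<zero>)) ` D"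
 have Ec: "e \<in> carrier Q" if "e \<in> E" for e using that E(2) Q.A_closed by blast
 have Dc: "(x, \<zero>) \<in> carrier B" if "x \<in> D" for x using D_closed[OF that] by simp
 obtain \<tau> where \<tau>: "\<tau> \<in> ?V" "\<And>N. T.T_maximal N \<Longrightarrow> \<tau> \<notin> N"
 proof (rule T.avoid_T_maximal[of ?E ?V])
  show "infinite ?E" using E(1) by (simp add: finite_image_iff inj_on_def)
  show "?E \<subseteq> AB" using E(2) ID(2) by auto
  show "e \<ominus>\<^bsub>B\<^esub> e' \<notin> n" if ee: "e \<in> ?E" "e' \<in> ?E" "e \<noteq> e'" for e e'
  proof -
   obtain f f' where f: "e = (f, \<zero>)" "e' = (f', \<zero>)" "f \<in> E" "f' \<in> E" using ee by blast
   have "e \<ominus>\<^bsub>B\<^esub> e' = (f \<ominus> f', \<zero>)" unfolding B.minus_eq f(1,2)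
    using B_neg[OF Ec[OF f(4)] Q.zero_closed] Ec f(3,4) by (simp add: Q.minus_eq)
   then show ?thesis using E(3)[OF f(3,4)] ee(3) f(1,2) by auto
  qed
  show "?V \<subseteq> T.T" using KT uK DK0 by blast
  show "\<zero>\<^bsub>B\<^esub> \<in> ?V" using DD(2) B.r_null[OF uc] by (intro image_eqI[of _ _ \<zero>]) simp_all
  show "x \<oplus>\<^bsub>B\<^esub> y \<in> ?V" if xy: "x \<in> ?V" "y \<in> ?V" for x y
  proof -
   obtain p q where p: "x = u \<bullet> (p, \<zero>)" "y = u \<bullet> (q, \<zero>)" "p \<in> D" "q \<in> D" using xy by blast
   have "x \<oplus>\<^bsub>B\<^esub> y = u \<bullet> ((p, \<zero>) \<oplus>\<^bsub>B\<^esub> (q, \<zero>))" unfolding p by (rule B.r_distr[symmetric, OF Dc Dc uc]) (use p in auto)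
   also have "(p, \<zero>) \<oplus>\<^bsub>B\<^esub> (q, \<zero>) = (p \<oplus> q, \<zero>)" by simp
   finally show ?thesis using DD(3)[OF p(3,4)] by blast
  qed
  show "e \<bullet> x \<in> ?V" if ex: "e \<in> ?E" "x \<in> ?V" for e x
  proof -
   obtain f p where p: "e = (f, \<zero>)" "x = u \<bullet> (p, \<zero>)" "f \<in> E" "p \<in> D" using ex by blast
   have fc: "(f, \<zero>) \<in> carrier B" using Ec[OF p(3)] by simp
   have "e \<bullet> x = u \<bullet> ((f, \<zero>) \<bullet> (p, \<zero>))" unfolding p by (rule B.m_lcomm[OF fc uc Dc[OF p(4)]])
   also have "(f, \<zero>) \<bullet> (p, \<zero>) = (f \<otimes> p, \<zero>)"
    using fst_mult[OF D_closed[OF p(4)] Q.zero_closed Ec[OF p(3)]] Ec[OF p(3)] by simp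
   finally show ?thesis using DD(4)[OF _ p(4), of f] E(2) p(3) by blast
  qed
  show "\<not> ?V \<subseteq> N" if N: "T.T_maximal N" for N
  proof
   assume VN: "?V \<subseteq> N"
   have NI: "T.T_ideal N" and N1: "\<one>\<^bsub>B\<^esub> \<notin> N" using N by (auto simp: T.T_maximal_def)
   note ND = T.T_idealD[OF NI]
   have fstN: "u \<bullet> (x, \<zero>) \<in> N" if "x \<in> D" for x using VN that by blast
   have sndN: "u \<bullet> (\<zero>, y) \<in> N" if y: "y \<in> C" for y
   proof -
    have yc: "y \<in> carrier Q" by (rule C_closed[OF y])
    have y1: "(y, \<zero>) \<in> carrier B" "(\<zero>, y) \<in> carrier B" using yc by auto
    \<comment> \<open>The square of \<open>(0, y)\<close> is \<open>-by\<^sup>2 - ay\<^sup>2 t\<close>, a multiple of \<open>(y, 0)\<close>; so \<open>u(0, y)\<close> has its square in N.\<close>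
    let ?z = "(\<ominus> (b \<otimes> y), \<ominus> (a \<otimes> y))"
    have z: "?z \<in> K0" unfolding K0_def
     using Q.stable_neg'[OF C_stable CD(4)[OF ab(1) y]] Q.stable_neg'[OF C_stable CD(4)[OF ab(2) y]] C_D by auto
    have eq: "(\<zero>, y) \<bullet> (\<zero>, y) = (y, \<zero>) \<bullet> ?z"
     using yc abc by (simp add: Q.minus_eq Q.r_minus Q.m_lcomm)
    have "(u \<bullet> (\<zero>, y)) \<bullet> (u \<bullet> (\<zero>, y)) = u \<bullet> (u \<bullet> ((\<zero>, y) \<bullet> (\<zero>, y)))"
     using y1 uc by (simp only: B.m_ac B.m_closed)
    also have "\<dots> = (u \<bullet> ?z) \<bullet> (u \<bullet> (y, \<zero>))"
     unfolding eq using y1 K0c[OF z] uc by (simp only: B.m_ac B.m_closed)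
    also have "\<dots> \<in> N" by (rule ND(4)[OF subsetD[OF KT uK[OF z]] fstN[OF subsetD[OF C_D y]]])
    finally show ?thesis
     using T.T_maximal_prime[OF N subsetD[OF KT uK[OF CK0[OF y]]] subsetD[OF KT uK[OF CK0[OF y]]]] by blast
   qed
   \<comment> \<open>N now contains u K0, and 1 belongs to u K0.\<close>
   obtain x y where xy: "inv\<^bsub>B\<^esub> u = (x, y)" "x \<in> D" "y \<in> C" using u(3) unfolding K0_def by blast
   have "\<one>\<^bsub>B\<^esub> = u \<bullet> ((x, \<zero>) \<oplus>\<^bsub>B\<^esub> (\<zero>, y))"
    using B.Units_r_inv[OF u(1)] xy D_closed[OF xy(2)] C_closed[OF xy(3)] by simp
   also have "\<dots> = u \<bullet> (x, \<zero>) \<oplus>\<^bsub>B\<^esub> u \<bullet> (\<zero>, y)"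
    by (rule B.r_distr[OF _ _ uc]) (use D_closed[OF xy(2)] C_closed[OF xy(3)] in auto)
   also have "\<dots> \<in> N" by (rule stableD(3)[OF ND(1) fstN[OF xy(2)] sndN[OF xy(3)]])
   finally show False using N1 by simp
  qed
 qed blast
 obtain w where w: "w \<in> D" "\<tau> = u \<bullet> (w, \<zero>)" using \<tau>(1) by blast
 have wc: "w \<in> carrier Q" by (rule D_closed[OF w(1)])
 have wB: "(w, \<zero>) \<in> carrier B" using wc by simp
 have \<tau>T: "\<tau> \<in> T.T" unfolding w(2) using KT uK[OF DK0[OF w(1)]] by blast
 obtain \<rho> where \<rho>: "\<rho> \<in> T.T" "\<rho> \<bullet> \<tau> = \<one>\<^bsub>B\<^esub>" using T.T_unit[OF \<tau>T \<tau>(2)] by blast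
 have \<rho>c: "\<rho> \<in> carrier B" by (rule T.T_closed[OF \<rho>(1)])
 have \<rho>u: "(\<rho> \<bullet> u) \<bullet> (w, \<zero>) = \<one>\<^bsub>B\<^esub>" using \<rho>(2) B.m_assoc[OF \<rho>c uc wB] w(2) by simp
 have wU: "w \<in> Units Q"
 proof -
  obtain x y where xy: "\<rho> \<bullet> u = (x, y)" "x \<in> carrier Q" "y \<in> carrier Q"
   using B.m_closed[OF \<rho>c uc] by auto
  have "x \<otimes> w = \<one>" using \<rho>u xy wc abc by (simp add: Q.minus_eq)
  then show ?thesis by (rule Q.unit_of_left_inverse[OF xy(2) wc])
 qed
 let ?wm = "(\<lambda>x. w \<otimes> x) ` m" and ?wI = "(\<lambda>x. w \<otimes> x) ` I" and ?wA = "(\<lambda>x. w \<otimes> x) ` A"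
 have n_mul: "(w, \<zero>) \<bullet> \<nu> \<in> ?wm \<times> ?wI" if "\<nu> \<in> n" for \<nu>
 proof -
  obtain \<mu> i where \<nu>: "\<nu> = (\<mu>, i)" "\<mu> \<in> m" "i \<in> I" using \<open>\<nu> \<in> n\<close> by blast
  show ?thesis unfolding \<nu>(1) fst_mult[OF Q.m_closed'[OF \<nu>(2)] I_closed[OF \<nu>(3)] wc] using \<nu> by blast
 qed
 \<comment> \<open>n K0 is contained in \<open>(w, 0) n\<close>, as \<rho> is inverse to \<open>u(w, 0)\<close> and preserves n.\<close>
 have act: "\<nu> \<bullet> x \<in> ?wm \<times> ?wI" if \<nu>: "\<nu> \<in> n" and x: "x \<in> K0" for \<nu> x
 proof -
  have \<nu>c: "\<nu> \<in> carrier B" by (rule B.m_closed'[OF \<nu>])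
  have xc: "x \<in> carrier B" by (rule K0c[OF x])
  have "\<rho> \<bullet> ((u \<bullet> x) \<bullet> \<nu>) \<in> n" by (rule T.T_m[OF \<rho>(1) Kn[OF uK[OF x] \<nu>]])
  then have "(w, \<zero>) \<bullet> (\<rho> \<bullet> ((u \<bullet> x) \<bullet> \<nu>)) \<in> ?wm \<times> ?wI" by (rule n_mul)
  also have "(w, \<zero>) \<bullet> (\<rho> \<bullet> ((u \<bullet> x) \<bullet> \<nu>)) = ((\<rho> \<bullet> u) \<bullet> (w, \<zero>)) \<bullet> (\<nu> \<bullet> x)"
   using \<nu>c xc uc \<rho>c wB by (simp only: B.m_ac B.m_closed)
  also have "\<dots> = \<nu> \<bullet> x" unfolding \<rho>u by (rule B.l_one[OF B.m_closed[OF \<nu>c xc]])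
  finally show ?thesis .
 qed
 have wIC: "?wI \<subseteq> C" using D_I[OF w(1)] by blast
 have wAD: "?wA \<subseteq> D" using DD(4)[OF _ w(1)] Q.A_closed wc by (auto simp: Q.m_comm)
 have wmA: "?wm \<subseteq> ?wA" using Q.m_sub by blast
 note wI_s = Q.stable_scale[OF I_stable wc] and wA_s = Q.stable_scale[OF Q.A_stable wc]
  and wm_s = Q.stable_scale[OF Q.m_stable wc]
 note wI_l = Q.lattice_scale[OF I_lattice wU] and wA_l = Q.lattice_scale[OF Q.lattice_A wU]
 have mC: "\<mu> \<otimes> y \<in> ?wI" if "\<mu> \<in> m" "y \<in> C" for \<mu> y
  using act[OF fst_in_n[OF that(1)] CK0[OF that(2)]] fst_mult[OF Q.zero_closed C_closed[OF that(2)] Q.m_closed'[OF that(1)]] by simp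
 have mD: "\<mu> \<otimes> x \<in> ?wm" if "\<mu> \<in> m" "x \<in> D" for \<mu> x
  using act[OF fst_in_n[OF that(1)] DK0[OF that(2)]] fst_mult[OF D_closed[OF that(2)] Q.zero_closed Q.m_closed'[OF that(1)]] by simp
 obtain q where q: "composition_series Q A ?wI C q"
  using Q.composition_series_exists[OF C_lattice wI_s wIC mC] by blast
 obtain q' where q': "composition_series Q A ?wA D q'"
  using Q.composition_series_exists[OF D_lattice wA_s wAD] mD wmA by blast
 note len = Q.composition_series_length[OF _ Q.A_carrier Q.A_neg]
 have Cc: "C \<subseteq> carrier Q" and Ac: "A \<subseteq> carrier Q" using C_closed Q.A_closed by auto
 have dd: "colon Q C (colon Q C F) = F" if "Q.latt F" for F using C_reflexive that unfolding reflexive_for_def by blast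
 have wUi: "inv w \<in> Units Q" using wU by simp
 have colon_wA: "colon Q C ?wA = (\<lambda>x. inv w \<otimes> x) ` C"
 proof
  show "colon Q C ?wA \<subseteq> (\<lambda>x. inv w \<otimes> x) ` C"
  proof
   fix p assume "p \<in> colon Q C ?wA"
   then have p: "p \<in> carrier Q" "p \<otimes> (w \<otimes> \<one>) \<in> C" using Q.A_one by (auto simp: colon_def)
   have "p = inv w \<otimes> (p \<otimes> (w \<otimes> \<one>))"
    using p(1) wc wU by (simp add: Q.m_lcomm[of "inv w"])
   then show "p \<in> (\<lambda>x. inv w \<otimes> x) ` C" using p(2) by blast
  qed
  show "(\<lambda>x. inv w \<otimes> x) ` C \<subseteq> colon Q C ?wA"
  proof
   fix p assume "p \<in> (\<lambda>x. inv w \<otimes> x) ` C"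
   then obtain c where c: "c \<in> C" "p = inv w \<otimes> c" by blast
   have "p \<otimes> (w \<otimes> r) \<in> C" if r: "r \<in> A" for r
   proof -
    have "p \<otimes> (w \<otimes> r) = (inv w \<otimes> w) \<otimes> (r \<otimes> c)"
     unfolding c(2) using C_closed[OF c(1)] Q.A_closed[OF r] wc Q.Units_inv_closed[OF wU] by (simp only: Q.m_ac Q.m_closed)
    also have "\<dots> = r \<otimes> c" using wU Q.A_closed[OF r] C_closed[OF c(1)] by simp
    finally show ?thesis using CD(4)[OF r c(1)] by simp
   qed
   then show "p \<in> colon Q C ?wA" unfolding colon_def using c C_closed wU by auto
  qed
 qed
 \<comment> \<open>Duality turns D/wA into \<open>w\<^sup>-\<^sup>1C/I\<close>, which is C/wI up to scaling.\<close>
 have "q = q'"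
 proof -
  have "enat q' = quotient_length Q A D ?wA" using len[OF q'] by simp
  also have "\<dots> = quotient_length Q A (colon Q C ?wA) (colon Q C D)"
   by (rule Q.dual_length[OF C_lattice C_reflexive D_lattice wA_l])
  also have "colon Q C D = I" unfolding D_def by (rule dd[OF I_lattice])
  also have "I = (\<lambda>x. inv w \<otimes> x) ` ?wI"
   using Q.scale_inverse(1)[OF wU, of I] I_closed by auto
  also have "quotient_length Q A (colon Q C ?wA) \<dots> = quotient_length Q A C ?wI"
   unfolding colon_wA by (rule Q.scale_length[OF C_lattice wUi]) (use wIC Cc in auto)
  also have "\<dots> = enat q" using len[OF q] .
  finally show ?thesis by simp
 qed
 have cD: "composition_series Q A ?wm D (1 + q)"
  using composition_series_trans[OF q' Q.scale_length_one[OF wU]] \<open>q = q'\<close> by simp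
 have wmD: "?wm \<subseteq> D" using wmA wAD by blast
 have fib: "{p \<in> D \<times> C. snd p \<in> ?wI} = D \<times> ?wI" "{p \<in> D \<times> C. snd p \<in> C} = K0"
  "{p \<in> D \<times> ?wI. fst p \<in> ?wm} = ?wm \<times> ?wI" "{p \<in> D \<times> ?wI. fst p \<in> D} = D \<times> ?wI"
  using wIC wmD unfolding K0_def by auto
 \<comment> \<open>\<open>wm \<times> wI \<subseteq> D \<times> wI \<subseteq> K0\<close>\<close>
 have "composition_series B AB (D \<times> ?wI) K0 q"
  using composition_series_fibres[OF q _ C_stable _ disjI2[OF refl]] act wmD DD(2) unfolding fib by fastforce
 moreover have "composition_series B AB (?wm \<times> ?wI) (D \<times> ?wI) (1 + q)"
  using composition_series_fibres[OF cD _ wI_s wIC disjI1[OF refl]] act stableD(2)[OF wI_s] unfolding fib by fastforce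
 ultimately have "composition_series B AB (?wm \<times> ?wI) K0 (2 * q + 1)"
  using composition_series_trans by (fastforce simp: mult_2)
 then have lenK0: "quotient_length B AB K0 (?wm \<times> ?wI) = enat (2 * q + 1)"
  by (rule B.composition_series_length[OF _ B.A_carrier B.A_neg])
 have n_eq: "(\<lambda>x. u \<bullet> x) ` (?wm \<times> ?wI) = n"
 proof
  show "(\<lambda>x. u \<bullet> x) ` (?wm \<times> ?wI) \<subseteq> n"
  proof
   fix p assume "p \<in> (\<lambda>x. u \<bullet> x) ` (?wm \<times> ?wI)"
   then obtain \<mu> i where p: "p = u \<bullet> (w \<otimes> \<mu>, w \<otimes> i)" "\<mu> \<in> m" "i \<in> I" by blast
   have \<mu>i: "(\<mu>, i) \<in> n" using p by simp
   have "p = \<tau> \<bullet> (\<mu>, i)"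
    unfolding p(1) w(2) fst_mult[OF Q.m_closed'[OF p(2)] I_closed[OF p(3)] wc, symmetric]
    by (rule B.m_assoc[symmetric, OF uc wB B.m_closed'[OF \<mu>i]])
   then show "p \<in> n" using T.T_m[OF \<tau>T \<mu>i] by simp
  qed
  show "n \<subseteq> (\<lambda>x. u \<bullet> x) ` (?wm \<times> ?wI)"
  proof
   fix \<nu> assume \<nu>: "\<nu> \<in> n"
   have \<nu>c: "\<nu> \<in> carrier B" by (rule B.m_closed'[OF \<nu>])
   have \<rho>\<nu>: "\<rho> \<bullet> \<nu> \<in> n" by (rule T.T_m[OF \<rho>(1) \<nu>])
   have "u \<bullet> ((w, \<zero>) \<bullet> (\<rho> \<bullet> \<nu>)) = ((\<rho> \<bullet> u) \<bullet> (w, \<zero>)) \<bullet> \<nu>"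
    using uc wB \<rho>c \<nu>c by (simp only: B.m_ac B.m_closed)
   also have "\<dots> = \<nu>" unfolding \<rho>u by (rule B.l_one[OF \<nu>c])
   finally show "\<nu> \<in> (\<lambda>x. u \<bullet> x) ` (?wm \<times> ?wI)" using n_mul[OF \<rho>\<nu>] by (metis image_eqI)
  qed
 qed
 \<comment> \<open>\<open>S : n = K : n\<close>, since K maps n into itself\<close>
 have colon_n: "colon B AB n = colon B K n"
 proof
  show "colon B AB n \<subseteq> colon B K n" using K(3) unfolding colon_def by blast
  show "colon B K n \<subseteq> colon B AB n"
  proof
   fix p assume p: "p \<in> colon B K n"
   show "p \<in> colon B AB n"
   proof (rule B.colon_via_endomorphisms[OF K(1,2)])
    fix \<nu> k assume \<nu>: "\<nu> \<in> n" and k: "k \<in> K"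
    then show "p \<bullet> (\<nu> \<bullet> k) \<in> K"
     using colon_mult[OF p Kn[OF k \<nu>]] B.m_comm[OF B.m_closed'[OF \<nu>] B.lattice_closed[OF K(1) k]] by simp
   qed (use B.m_closed' p in \<open>auto simp: colon_def simp del: quadratic_ring_simps\<close>)
  qed
 qed
 have n_lat: "B.latt n" by (rule B.lattice_m)
 have "quotient_length B AB (colon B AB n) AB = quotient_length B AB (colon B K AB) (colon B K (colon B AB n))"
  by (rule B.dual_length[OF K(1,2) B.lattice_colon[OF B.lattice_A n_lat] B.lattice_A])
 also have "colon B K AB = K" by (rule B.colon_self_one[OF B.lattice_stable[OF K(1)]])
 also have "colon B K (colon B AB n) = n" unfolding colon_n using K(2) n_lat unfolding reflexive_for_def by blast
 also have "quotient_length B AB K n =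
   quotient_length B AB ((\<lambda>x. u \<bullet> x) ` K0) ((\<lambda>x. u \<bullet> x) ` (?wm \<times> ?wI))"
  unfolding n_eq u(2)[symmetric] ..
 also have "\<dots> = quotient_length B AB K0 (?wm \<times> ?wI)"
  by (rule B.scale_length[OF K0_lattice u(1)]) (use wc Q.m_closed' I_closed in auto)
 finally have type_B: "quotient_length B AB (colon B AB n) AB = enat (2 * q + 1)" using lenK0 by simp
 have Am: "Q.latt (colon Q A m)" by (rule Q.lattice_colon[OF Q.lattice_A Q.lattice_m])
 have A_sub: "A \<subseteq> colon Q A m"
  unfolding colon_def using Q.A_closed AD(4) Q.m_sub by auto
 have "a' \<otimes> f \<in> A" if "a' \<in> m" "f \<in> colon Q A m" for a' f
  using that Q.m_closed'[OF that(1)] by (auto simp: colon_def Q.m_comm)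
 then obtain r where r: "composition_series Q A A (colon Q A m) r"
  using Q.composition_series_exists[OF Am Q.A_stable A_sub] by blast
 have type_A: "quotient_length Q A (colon Q A m) A = enat r" by (rule len[OF r])
 \<comment> \<open>\<open>m C \<subseteq> wI\<close> bounds C/wI by the dual of \<open>(A : m)/A\<close>.\<close>
 let ?G = "colon Q C (colon Q A m)"
 have "?G \<subseteq> ?wI"
 proof -
  have "colon Q C ?wI \<subseteq> colon Q A m"
  proof
   fix p assume p: "p \<in> colon Q C ?wI"
   then show "p \<in> colon Q A m"
    by (intro Q.colon_via_endomorphisms[OF C_lattice C_reflexive] colon_mult[OF p mC])
     (auto simp: Q.m_closed' colon_def)
  qed
  then have "?G \<subseteq> colon Q C (colon Q C ?wI)" by (rule Q.colon_antimono)
  then show ?thesis unfolding dd[OF wI_l] .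
 qed
 then have "quotient_length Q A C ?wI \<le> quotient_length Q A C ?G"
  by (intro quotient_length_le[of Q A _ _ Q A "\<lambda>x. x"]) auto
 also have "quotient_length Q A C ?G = quotient_length Q A (colon Q C A) ?G"
  unfolding Q.colon_self_one[OF C_stable] ..
 also have "\<dots> = quotient_length Q A (colon Q A m) A"
  by (rule Q.dual_length[symmetric, OF C_lattice C_reflexive Am Q.lattice_A])
 finally have "q \<le> r" unfolding type_A len[OF q] by simp
 then show ?thesis using type_A type_B by (intro exI[of _ "2 * q + 1"] exI[of _ r]) simp
qed

end

section \<open>The total ring of fractions\<close>

text \<open>
 Sum and product of fractions are defined as unions over representatives; this is how well-definedness enters.
\<close>
lemma Union_const:
 assumes "\<And>a s b t. (a, s) \<in> U \<Longrightarrow> (b, t) \<in> V \<Longrightarrow> f a s b t = Z" "(a0, s0) \<in> U" "(b0, t0) \<in> V"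
 shows "(\<Union>(a, s)\<in>U. \<Union>(b, t)\<in>V. f a s b t) = Z"
proof -
 have 1: "(\<Union>(b, t)\<in>V. f (fst p) (snd p) b t) = Z" if "p \<in> U" for p
 proof -
  have "(\<Union>(b, t)\<in>V. f (fst p) (snd p) b t) = (\<Union>q\<in>V. Z)"
   by (rule SUP_cong[OF refl]) (use assms(1)[of "fst p" "snd p"] that in auto)
  then show ?thesis using assms(3) by auto
 qed
 have "(\<Union>(a, s)\<in>U. \<Union>(b, t)\<in>V. f a s b t) = (\<Union>p\<in>U. Z)"
  by (rule SUP_cong[OF refl]) (use 1 in \<open>simp add: case_prod_unfold\<close>)
 then show ?thesis using assms(2) by auto
qed

context cring
begin

lemma nzd_carrier: "s \<in> nonzerodivisors R \<Longrightarrow> s \<in> carrier R"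
 by (simp add: nonzerodivisors_def)

lemma nzd_cancel:
 assumes "s \<in> nonzerodivisors R" "x \<in> carrier R" "y \<in> carrier R" "s \<otimes> x = s \<otimes> y"
 shows "x = y"
proof -
 have sc: "s \<in> carrier R" by (rule nzd_carrier[OF assms(1)])
 have "s \<otimes> (x \<ominus> y) = s \<otimes> x \<ominus> s \<otimes> y" using sc assms(2,3) by algebra
 also have "\<dots> = \<zero>" using assms(4) sc assms(3) by (simp add: minus_eq r_neg)
 finally have "x \<ominus> y = \<zero>" using assms(1-3) unfolding nonzerodivisors_def by simp
 then show ?thesis by (rule minus_eq_zeroD[OF assms(2,3)])
qed

lemma nzd_one: "\<one> \<in> nonzerodivisors R"
 by (simp add: nonzerodivisors_def)

lemma nzd_mult:
 assumes s: "s \<in> nonzerodivisors R" and t: "t \<in> nonzerodivisors R"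
 shows "s \<otimes> t \<in> nonzerodivisors R"
proof -
 have c: "s \<in> carrier R" "t \<in> carrier R" by (rule nzd_carrier[OF s], rule nzd_carrier[OF t])
 have "r = \<zero>" if r: "r \<in> carrier R" "s \<otimes> t \<otimes> r = \<zero>" for r
 proof -
  have "s \<otimes> (t \<otimes> r) = s \<otimes> (t \<otimes> \<zero>)" using c r by (simp add: m_assoc)
  then have "t \<otimes> r = t \<otimes> \<zero>" by (rule nzd_cancel[OF s, rotated -1]) (use c r in auto)
  then show ?thesis by (rule nzd_cancel[OF t, rotated -1]) (use r in auto)
 qed
 then show ?thesis using c unfolding nonzerodivisors_def by simp
qed

lemma fraction_mem:
 "(b, t) \<in> fraction R a s \<longleftrightarrow> b \<in> carrier R \<and> t \<in> nonzerodivisors R \<and> a \<otimes> t = b \<otimes> s"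
 by (simp add: fraction_def)

lemma fraction_eq_iff:
 assumes a: "a \<in> carrier R" "s \<in> nonzerodivisors R" and b: "b \<in> carrier R" "t \<in> nonzerodivisors R"
 shows "fraction R a s = fraction R b t \<longleftrightarrow> a \<otimes> t = b \<otimes> s"
proof
 have c: "s \<in> carrier R" "t \<in> carrier R" using assms nzd_carrier by auto
 assume "fraction R a s = fraction R b t"
 moreover have "(b, t) \<in> fraction R b t" using b c by (simp add: fraction_mem)
 ultimately show "a \<otimes> t = b \<otimes> s" by (metis fraction_mem)
next
 have c: "s \<in> carrier R" "t \<in> carrier R" using assms nzd_carrier by auto
 assume eq: "a \<otimes> t = b \<otimes> s"
 have "a \<otimes> u = d \<otimes> s \<longleftrightarrow> b \<otimes> u = d \<otimes> t" if d: "d \<in> carrier R" "u \<in> nonzerodivisors R" for d u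
 proof -
  have u: "u \<in> carrier R" by (rule nzd_carrier[OF d(2)])
  have 1: "t \<otimes> (a \<otimes> u) = s \<otimes> (b \<otimes> u)"
  proof -
   have "t \<otimes> (a \<otimes> u) = (a \<otimes> t) \<otimes> u" using a b c u by (simp add: m_ac)
   also have "\<dots> = s \<otimes> (b \<otimes> u)" unfolding eq using a b c u by (simp add: m_ac)
   finally show ?thesis .
  qed
  have 2: "t \<otimes> (d \<otimes> s) = s \<otimes> (d \<otimes> t)" using c d by (simp add: m_ac)
  show ?thesis
  proof
   assume "a \<otimes> u = d \<otimes> s"
   then have "s \<otimes> (b \<otimes> u) = s \<otimes> (d \<otimes> t)" using 1 2 by simp
   then show "b \<otimes> u = d \<otimes> t" by (rule nzd_cancel[OF a(2), rotated -1]) (use b u d c in auto)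
  next
   assume "b \<otimes> u = d \<otimes> t"
   then have "t \<otimes> (a \<otimes> u) = t \<otimes> (d \<otimes> s)" using 1 2 by simp
   then show "a \<otimes> u = d \<otimes> s" by (rule nzd_cancel[OF b(2), rotated -1]) (use a u d c in auto)
  qed
 qed
 then show "fraction R a s = fraction R b t" unfolding fraction_def by auto
qed

abbreviation "\<Q> \<equiv> total_fractions R"

lemma total_fractions_carrier: "a \<in> carrier R \<Longrightarrow> s \<in> nonzerodivisors R \<Longrightarrow> fraction R a s \<in> carrier \<Q>"
 unfolding total_fractions_def by auto

lemma total_fractions_cases:
 assumes "q \<in> carrier \<Q>"
 obtains a s where "a \<in> carrier R" "s \<in> nonzerodivisors R" "q = fraction R a s"
 using assms unfolding total_fractions_def by auto

lemma total_fractions_one: "\<one>\<^bsub>\<Q>\<^esub> = fraction R \<one> \<one>" and total_fractions_zero: "\<zero>\<^bsub>\<Q>\<^esub> = fraction R \<zero> \<one>"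
 by (simp_all add: total_fractions_def)

lemma fraction_self: "a \<in> carrier R \<Longrightarrow> s \<in> nonzerodivisors R \<Longrightarrow> (a, s) \<in> fraction R a s"
 by (simp add: fraction_mem)

lemma fraction_memD:
 assumes "(a', s') \<in> fraction R a s" "a \<in> carrier R" "s \<in> nonzerodivisors R"
 shows "a' \<in> carrier R" "s' \<in> nonzerodivisors R" "a \<otimes> s' = a' \<otimes> s"
 using assms by (auto simp: fraction_mem)

lemma fraction_mult:
 assumes a: "a \<in> carrier R" "s \<in> nonzerodivisors R" and b: "b \<in> carrier R" "t \<in> nonzerodivisors R"
 shows "fraction R a s \<otimes>\<^bsub>\<Q>\<^esub> fraction R b t = fraction R (a \<otimes> b) (s \<otimes> t)"
proof -
 have c: "s \<in> carrier R" "t \<in> carrier R" using a b nzd_carrier by auto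
 have "fraction R (a' \<otimes> b') (s' \<otimes> t') = fraction R (a \<otimes> b) (s \<otimes> t)"
  if "(a', s') \<in> fraction R a s" "(b', t') \<in> fraction R b t" for a' s' b' t'
 proof -
  note A = fraction_memD[OF that(1) a] and B = fraction_memD[OF that(2) b]
  have c': "s' \<in> carrier R" "t' \<in> carrier R" using A B nzd_carrier by auto
  have "(a' \<otimes> b') \<otimes> (s \<otimes> t) = (a' \<otimes> s) \<otimes> (b' \<otimes> t)" using A(1) B(1) c by (simp add: m_ac)
  also have "\<dots> = (a \<otimes> s') \<otimes> (b \<otimes> t')" by (simp only: A(3) B(3))
  also have "\<dots> = (a \<otimes> b) \<otimes> (s' \<otimes> t')" using a b c' by (simp add: m_ac)
  finally show ?thesis using A B a b by (subst fraction_eq_iff) (auto intro: nzd_mult)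
 qed
 from Union_const[OF this fraction_self[OF a] fraction_self[OF b]]
 have "(\<Union>(a', s')\<in>fraction R a s. \<Union>(b', t')\<in>fraction R b t. fraction R (a' \<otimes> b') (s' \<otimes> t')) = fraction R (a \<otimes> b) (s \<otimes> t)"
  .
 then show ?thesis by (simp add: total_fractions_def)
qed

lemma fraction_add:
 assumes a: "a \<in> carrier R" "s \<in> nonzerodivisors R" and b: "b \<in> carrier R" "t \<in> nonzerodivisors R"
 shows "fraction R a s \<oplus>\<^bsub>\<Q>\<^esub> fraction R b t = fraction R (a \<otimes> t \<oplus> b \<otimes> s) (s \<otimes> t)"
proof -
 have c: "s \<in> carrier R" "t \<in> carrier R" using a b nzd_carrier by auto
 have "fraction R (a' \<otimes> t' \<oplus> b' \<otimes> s') (s' \<otimes> t') = fraction R (a \<otimes> t \<oplus> b \<otimes> s) (s \<otimes> t)"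
  if "(a', s') \<in> fraction R a s" "(b', t') \<in> fraction R b t" for a' s' b' t'
 proof -
  note A = fraction_memD[OF that(1) a] and B = fraction_memD[OF that(2) b]
  have c': "s' \<in> carrier R" "t' \<in> carrier R" using A B nzd_carrier by auto
  have "(a' \<otimes> t' \<oplus> b' \<otimes> s') \<otimes> (s \<otimes> t) = (a' \<otimes> s) \<otimes> (t \<otimes> t') \<oplus> (b' \<otimes> t) \<otimes> (s \<otimes> s')"
   using A(1) B(1) c c' by algebra
  also have "\<dots> = (a \<otimes> s') \<otimes> (t \<otimes> t') \<oplus> (b \<otimes> t') \<otimes> (s \<otimes> s')" by (simp only: A(3) B(3))
  also have "\<dots> = (a \<otimes> t \<oplus> b \<otimes> s) \<otimes> (s' \<otimes> t')" using a(1) b(1) c c' by algebra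
  finally show ?thesis using A B a b c c' by (subst fraction_eq_iff) (auto intro: nzd_mult)
 qed
 from Union_const[OF this fraction_self[OF a] fraction_self[OF b]]
 have "(\<Union>(a', s')\<in>fraction R a s. \<Union>(b', t')\<in>fraction R b t. fraction R (a' \<otimes> t' \<oplus> b' \<otimes> s') (s' \<otimes> t')) = fraction R (a \<otimes> t \<oplus> b \<otimes> s) (s \<otimes> t)"
  .
 then show ?thesis by (simp add: total_fractions_def)
qed

lemma fraction_expand:
 assumes "a \<in> carrier R" "s \<in> nonzerodivisors R" "t \<in> nonzerodivisors R"
 shows "fraction R a s = fraction R (a \<otimes> t) (s \<otimes> t)"
 using assms nzd_carrier by (simp add: fraction_eq_iff nzd_mult m_ac)

text \<open>
 Ring axioms are checked on fractions with a common denominator.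
\<close>
lemma total_fractions_common:
 assumes "x \<in> carrier \<Q>" "y \<in> carrier \<Q>" "z \<in> carrier \<Q>"
 obtains a b c s where "a \<in> carrier R" "b \<in> carrier R" "c \<in> carrier R" "s \<in> nonzerodivisors R"
  "x = fraction R a s" "y = fraction R b s" "z = fraction R c s"
proof -
 obtain a s where a: "a \<in> carrier R" "s \<in> nonzerodivisors R" "x = fraction R a s" using assms(1) by (rule total_fractions_cases)
 obtain b t where b: "b \<in> carrier R" "t \<in> nonzerodivisors R" "y = fraction R b t" using assms(2) by (rule total_fractions_cases)
 obtain c u where c: "c \<in> carrier R" "u \<in> nonzerodivisors R" "z = fraction R c u" using assms(3) by (rule total_fractions_cases)
 have e: "s \<in> carrier R" "t \<in> carrier R" "u \<in> carrier R" using a b c nzd_carrier by auto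
 have "x = fraction R (a \<otimes> (t \<otimes> u)) (s \<otimes> (t \<otimes> u))" "y = fraction R (b \<otimes> (s \<otimes> u)) (s \<otimes> (t \<otimes> u))"
  "z = fraction R (c \<otimes> (s \<otimes> t)) (s \<otimes> (t \<otimes> u))"
  using fraction_expand[OF a(1,2), of "t \<otimes> u"] fraction_expand[OF b(1,2), of "s \<otimes> u"]
   fraction_expand[OF c(1,2), of "s \<otimes> t"] a b c e by (simp_all add: nzd_mult m_ac)
 then show ?thesis using that[of "a \<otimes> (t \<otimes> u)" "b \<otimes> (s \<otimes> u)" "c \<otimes> (s \<otimes> t)" "s \<otimes> (t \<otimes> u)"] a(1,2) b(1,2) c(1,2) e
  by (simp add: nzd_mult)
qed

lemma fraction_add_same:
 assumes "a \<in> carrier R" "b \<in> carrier R" "s \<in> nonzerodivisors R"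
 shows "fraction R a s \<oplus>\<^bsub>\<Q>\<^esub> fraction R b s = fraction R (a \<oplus> b) s"
proof -
 have "s \<in> carrier R" by (rule nzd_carrier[OF assms(3)])
 then show ?thesis using assms fraction_expand[of "a \<oplus> b" s s] by (simp add: fraction_add l_distr)
qed

lemma total_fractions_cring: "cring \<Q>"
proof (rule cringI)
 note S = fraction_mult fraction_add_same nzd_mult nzd_one total_fractions_carrier
 have Z: "\<zero>\<^bsub>\<Q>\<^esub> = fraction R \<zero> s" if "s \<in> nonzerodivisors R" for s
  using that nzd_carrier by (simp add: total_fractions_zero fraction_eq_iff nzd_one)
 show "abelian_group \<Q>"
 proof (rule abelian_groupI)
  show "\<zero>\<^bsub>\<Q>\<^esub> \<in> carrier \<Q>" by (simp add: total_fractions_zero S)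
  fix x assume x: "x \<in> carrier \<Q>"
  then obtain a s where a: "a \<in> carrier R" "s \<in> nonzerodivisors R" "x = fraction R a s" by (rule total_fractions_cases)
  show "\<zero>\<^bsub>\<Q>\<^esub> \<oplus>\<^bsub>\<Q>\<^esub> x = x" using a by (simp add: S Z)
  show "\<exists>y\<in>carrier \<Q>. y \<oplus>\<^bsub>\<Q>\<^esub> x = \<zero>\<^bsub>\<Q>\<^esub>"
   by (rule bexI[of _ "fraction R (\<ominus> a) s"]) (use a in \<open>simp_all add: S Z l_neg\<close>)
  fix y assume y: "y \<in> carrier \<Q>"
  show "x \<oplus>\<^bsub>\<Q>\<^esub> y \<in> carrier \<Q>" "x \<oplus>\<^bsub>\<Q>\<^esub> y = y \<oplus>\<^bsub>\<Q>\<^esub> x"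
   by (rule total_fractions_common[OF x y y]; simp add: S a_comm)+
  fix z assume "z \<in> carrier \<Q>"
  then show "x \<oplus>\<^bsub>\<Q>\<^esub> y \<oplus>\<^bsub>\<Q>\<^esub> z = x \<oplus>\<^bsub>\<Q>\<^esub> (y \<oplus>\<^bsub>\<Q>\<^esub> z)"
   by (rule total_fractions_common[OF x y]) (simp add: S a_assoc)
 qed
 show "comm_monoid \<Q>"
 proof (rule comm_monoidI)
  show "\<one>\<^bsub>\<Q>\<^esub> \<in> carrier \<Q>" by (simp add: total_fractions_one S)
  fix x assume x: "x \<in> carrier \<Q>"
  then show "\<one>\<^bsub>\<Q>\<^esub> \<otimes>\<^bsub>\<Q>\<^esub> x = x"
   by (rule total_fractions_cases) (simp add: S total_fractions_one nzd_carrier)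
  fix y assume y: "y \<in> carrier \<Q>"
  show "x \<otimes>\<^bsub>\<Q>\<^esub> y \<in> carrier \<Q>" "x \<otimes>\<^bsub>\<Q>\<^esub> y = y \<otimes>\<^bsub>\<Q>\<^esub> x"
   by (rule total_fractions_common[OF x y y]; simp add: S m_comm)+
  fix z assume "z \<in> carrier \<Q>"
  then show "x \<otimes>\<^bsub>\<Q>\<^esub> y \<otimes>\<^bsub>\<Q>\<^esub> z = x \<otimes>\<^bsub>\<Q>\<^esub> (y \<otimes>\<^bsub>\<Q>\<^esub> z)"
   by (rule total_fractions_common[OF x y]) (simp add: S m_assoc nzd_carrier)
 qed
 fix x y z assume x: "x \<in> carrier \<Q>" and y: "y \<in> carrier \<Q>" and "z \<in> carrier \<Q>"
 then show "(x \<oplus>\<^bsub>\<Q>\<^esub> y) \<otimes>\<^bsub>\<Q>\<^esub> z = x \<otimes>\<^bsub>\<Q>\<^esub> z \<oplus>\<^bsub>\<Q>\<^esub> y \<otimes>\<^bsub>\<Q>\<^esub> z"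
  by (rule total_fractions_common) (simp add: S l_distr)
qed

lemma frac_embed_hom: "frac_embed R \<in> ring_hom R \<Q>"
 by (rule ring_hom_memI)
  (simp_all add: frac_embed_def total_fractions_carrier nzd_one fraction_mult fraction_add total_fractions_one)

lemma total_fractions_quotient: "total_quotient R \<Q> (frac_embed R)"
proof (intro total_quotient.intro total_quotient_axioms.intro is_cring total_fractions_cring frac_embed_hom)
 interpret Q: cring \<Q> by (rule total_fractions_cring)
 show "inj_on (frac_embed R) (carrier R)"
  by (rule inj_onI) (simp add: frac_embed_def fraction_eq_iff nzd_one)
 show "frac_embed R s \<in> Units \<Q>" if s: "s \<in> nonzerodivisors R" for s
 proof (rule Q.unit_of_left_inverse)
  show "fraction R \<one> s \<in> carrier \<Q>" using s by (simp add: total_fractions_carrier)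
  show "frac_embed R s \<in> carrier \<Q>" using nzd_carrier[OF s] by (simp add: frac_embed_def total_fractions_carrier nzd_one)
  show "fraction R \<one> s \<otimes>\<^bsub>\<Q>\<^esub> frac_embed R s = \<one>\<^bsub>\<Q>\<^esub>"
   using s nzd_carrier[OF s] by (simp add: frac_embed_def fraction_mult nzd_one total_fractions_one fraction_eq_iff)
 qed
 show "\<exists>r\<in>carrier R. \<exists>s\<in>nonzerodivisors R. frac_embed R s \<otimes>\<^bsub>\<Q>\<^esub> q = frac_embed R r" if q: "q \<in> carrier \<Q>" for q
 proof -
  obtain a s where a: "a \<in> carrier R" "s \<in> nonzerodivisors R" "q = fraction R a s" using q by (rule total_fractions_cases)
  have sc: "s \<in> carrier R" by (rule nzd_carrier[OF a(2)])
  have "frac_embed R s \<otimes>\<^bsub>\<Q>\<^esub> q = frac_embed R a"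
   using a sc by (simp add: frac_embed_def fraction_mult nzd_one nzd_mult fraction_eq_iff m_comm)
  then show ?thesis using a by blast
 qed
qed

end

text \<open>
 The universal property of the total ring of fractions, for two models over the same ring.
\<close>
lemma (in total_quotient) fractions_extend:
 assumes "total_quotient R T \<kappa>"
 obtains \<Phi> where "\<Phi> \<in> ring_hom T Q" "inj_on \<Phi> (carrier T)" "\<And>r. r \<in> carrier R \<Longrightarrow> \<Phi> (\<kappa> r) = \<iota> r"
proof -
 interpret T: total_quotient R T \<kappa> by fact
 obtain num den where nd: "\<And>q. q \<in> carrier T \<Longrightarrow> num q \<in> carrier R \<and> den q \<in> nonzerodivisors R \<and> \<kappa> (den q) \<otimes>\<^bsub>T\<^esub> q = \<kappa> (num q)"
  using T.fractions by metis
 define \<Phi> where "\<Phi> q = inv (\<iota> (den q)) \<otimes> \<iota> (num q)" for q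
 have n: "num q \<in> carrier R" "\<kappa> (den q) \<otimes>\<^bsub>T\<^esub> q = \<kappa> (num q)" and d: "den q \<in> carrier R" "\<iota> (den q) \<in> Units Q" "\<kappa> (den q) \<in> Units T"
  and \<Phi>c: "\<Phi> q \<in> carrier Q" and \<Phi>d: "\<iota> (den q) \<otimes> \<Phi> q = \<iota> (num q)" if "q \<in> carrier T" for q
 proof -
  show n: "num q \<in> carrier R" "\<kappa> (den q) \<otimes>\<^bsub>T\<^esub> q = \<kappa> (num q)" and d: "den q \<in> carrier R" "\<iota> (den q) \<in> Units Q" "\<kappa> (den q) \<in> Units T"
   using nd[OF that] iota_units T.iota_units nzd_closed by auto
  then show "\<Phi> q \<in> carrier Q" "\<iota> (den q) \<otimes> \<Phi> q = \<iota> (num q)" unfolding \<Phi>_def by (simp_all flip: Q.m_assoc)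
 qed
 \<comment> \<open>\<open>\<Phi> q\<close> does not depend on the chosen numerator and denominator.\<close>
 have eval: "\<iota> s \<otimes> \<Phi> q = \<iota> r"
  if q: "q \<in> carrier T" and r: "r \<in> carrier R" "s \<in> carrier R" "\<kappa> s \<otimes>\<^bsub>T\<^esub> q = \<kappa> r" for q r s
 proof -
  have "\<kappa> (s \<otimes>\<^bsub>R\<^esub> num q) = \<kappa> (den q) \<otimes>\<^bsub>T\<^esub> (\<kappa> s \<otimes>\<^bsub>T\<^esub> q)" using q r(2) n(1) d by (simp flip: n(2)[OF q] add: T.Q.m_lcomm)
  also have "\<dots> = \<kappa> (den q \<otimes>\<^bsub>R\<^esub> r)" using r d[OF q] by simp
  finally have "s \<otimes>\<^bsub>R\<^esub> num q = den q \<otimes>\<^bsub>R\<^esub> r" by (rule inj_onD[OF T.iota_inj]) (use q r n d in auto)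
  then have "\<iota> s \<otimes> \<iota> (num q) = \<iota> (den q) \<otimes> \<iota> r" using r n(1)[OF q] d(1)[OF q] iota_simps(3) by metis
  then have "\<iota> (den q) \<otimes> (\<iota> s \<otimes> \<Phi> q) = \<iota> (den q) \<otimes> \<iota> r"
   using q r d \<Phi>c by (simp flip: \<Phi>d[OF q] add: Q.m_lcomm)
  then show ?thesis using q r d \<Phi>c by (simp add: Q.Units_l_cancel)
 qed
 have unit: "\<iota> (den p \<otimes>\<^bsub>R\<^esub> den q) \<in> Units Q" if "p \<in> carrier T" "q \<in> carrier T" for p q using that d by simp
 have "\<Phi> \<in> ring_hom T Q"
 proof (rule ring_hom_memI \<Phi>c)+
  fix p q assume p: "p \<in> carrier T" and q: "q \<in> carrier T"
  note c = n(1)[OF p] n(1)[OF q] d(1)[OF p] d(1)[OF q]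
  have e: "(\<kappa> (den p) \<otimes>\<^bsub>T\<^esub> \<kappa> (den q)) \<otimes>\<^bsub>T\<^esub> (p \<otimes>\<^bsub>T\<^esub> q) = (\<kappa> (den p) \<otimes>\<^bsub>T\<^esub> p) \<otimes>\<^bsub>T\<^esub> (\<kappa> (den q) \<otimes>\<^bsub>T\<^esub> q)"
   "(\<kappa> (den p) \<otimes>\<^bsub>T\<^esub> \<kappa> (den q)) \<otimes>\<^bsub>T\<^esub> (p \<oplus>\<^bsub>T\<^esub> q) = (\<kappa> (den p) \<otimes>\<^bsub>T\<^esub> p) \<otimes>\<^bsub>T\<^esub> \<kappa> (den q) \<oplus>\<^bsub>T\<^esub> (\<kappa> (den q) \<otimes>\<^bsub>T\<^esub> q) \<otimes>\<^bsub>T\<^esub> \<kappa> (den p)"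
   using p q T.iota_simps(1)[OF c(3)] T.iota_simps(1)[OF c(4)] by algebra+
  have "\<iota> (den p \<otimes>\<^bsub>R\<^esub> den q) \<otimes> \<Phi> (p \<otimes>\<^bsub>T\<^esub> q) = \<iota> (num p \<otimes>\<^bsub>R\<^esub> num q)"
   by (rule eval) (use p q c e n in simp_all)
  also have "\<dots> = \<iota> (den p \<otimes>\<^bsub>R\<^esub> den q) \<otimes> (\<Phi> p \<otimes> \<Phi> q)"
   using c p q \<Phi>c by (simp flip: \<Phi>d[OF p] \<Phi>d[OF q] add: Q.m_ac)
  finally show "\<Phi> (p \<otimes>\<^bsub>T\<^esub> q) = \<Phi> p \<otimes> \<Phi> q" using unit p q \<Phi>c by (simp add: Q.Units_l_cancel del: iota_simps)
  have "\<iota> (den p \<otimes>\<^bsub>R\<^esub> den q) \<otimes> \<Phi> (p \<oplus>\<^bsub>T\<^esub> q) = \<iota> (num p \<otimes>\<^bsub>R\<^esub> den q \<oplus>\<^bsub>R\<^esub> num q \<otimes>\<^bsub>R\<^esub> den p)"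
   by (rule eval) (use p q c e n in simp_all)
  also have "\<dots> = \<iota> (den p \<otimes>\<^bsub>R\<^esub> den q) \<otimes> (\<Phi> p \<oplus> \<Phi> q)"
   using c p q \<Phi>c by (simp flip: \<Phi>d[OF p] \<Phi>d[OF q] add: Q.m_ac Q.r_distr)
  finally show "\<Phi> (p \<oplus>\<^bsub>T\<^esub> q) = \<Phi> p \<oplus> \<Phi> q" using unit p q \<Phi>c by (simp add: Q.Units_l_cancel del: iota_simps)
 next
  show "\<Phi> \<one>\<^bsub>T\<^esub> = \<one>" using eval[of "\<one>\<^bsub>T\<^esub>" "\<one>\<^bsub>R\<^esub>" "\<one>\<^bsub>R\<^esub>"] \<Phi>c by simp
 qed
 moreover have "inj_on \<Phi> (carrier T)"
 proof (rule inj_onI)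
  fix p q assume p: "p \<in> carrier T" and q: "q \<in> carrier T" and eq: "\<Phi> p = \<Phi> q"
  note c = n(1)[OF p] n(1)[OF q] d(1)[OF p] d(1)[OF q]
  have "\<iota> (den q \<otimes>\<^bsub>R\<^esub> num p) = \<iota> (den p \<otimes>\<^bsub>R\<^esub> num q)"
   using c p q \<Phi>c by (simp flip: \<Phi>d[OF p] \<Phi>d[OF q] add: eq Q.m_lcomm)
  then have "den q \<otimes>\<^bsub>R\<^esub> num p = den p \<otimes>\<^bsub>R\<^esub> num q" by (rule inj_onD[OF iota_inj]) (use c in auto)
  then have "\<kappa> (den q) \<otimes>\<^bsub>T\<^esub> \<kappa> (num p) = \<kappa> (den p) \<otimes>\<^bsub>T\<^esub> \<kappa> (num q)" using c T.iota_simps(3) by metis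
  then have "\<kappa> (den p) \<otimes>\<^bsub>T\<^esub> (\<kappa> (den q) \<otimes>\<^bsub>T\<^esub> p) = \<kappa> (den p) \<otimes>\<^bsub>T\<^esub> (\<kappa> (den q) \<otimes>\<^bsub>T\<^esub> q)"
   using c p q by (simp flip: n(2)[OF p] n(2)[OF q] add: T.Q.m_lcomm)
  then show "p = q" using c d p q by (simp add: T.Q.Units_l_cancel)
 qed
 moreover have "\<Phi> (\<kappa> r) = \<iota> r" if "r \<in> carrier R" for r
  using eval[of "\<kappa> r" r "\<one>\<^bsub>R\<^esub>"] that \<Phi>c by simp
 ultimately show ?thesis using that by blast
qed

section \<open>Passing from rings to lattices\<close>

locale one_dim_quotient = one_dim_cm R + total_quotient R Q \<iota>
 for R :: "('a, 'b) ring_scheme" (structure) and Q :: "('q, 'd) ring_scheme" and \<iota>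
begin

lemma ideal_image_stable:
 assumes "ideal J R" shows "stable_subgroup Q A (\<iota> ` J)"
proof -
 interpret J: ideal J R by fact
 show ?thesis
 proof (rule stableI)
  show "\<iota> ` J \<subseteq> carrier Q" using J.Icarr by auto
  show "\<zero>\<^bsub>Q\<^esub> \<in> \<iota> ` J" using J.zero_closed by (auto simp flip: hom.hom_zero)
  fix x y assume "x \<in> \<iota> ` J" "y \<in> \<iota> ` J"
  then obtain r s where "r \<in> J" "s \<in> J" "x = \<iota> r" "y = \<iota> s" by blast
  moreover from this have "x \<oplus>\<^bsub>Q\<^esub> y = \<iota> (r \<oplus> s)" using J.Icarr by simp
  ultimately show "x \<oplus>\<^bsub>Q\<^esub> y \<in> \<iota> ` J" using J.a_closed by blast
 next
  fix a x assume "a \<in> A" "x \<in> \<iota> ` J"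
  then obtain r s where "r \<in> carrier R" "s \<in> J" "a = \<iota> r" "x = \<iota> s" by blast
  moreover from this have "a \<otimes>\<^bsub>Q\<^esub> x = \<iota> (r \<otimes> s)" using J.Icarr by simp
  ultimately show "a \<otimes>\<^bsub>Q\<^esub> x \<in> \<iota> ` J" using J.I_l_closed by blast
 qed
qed

lemmas A_stable = ideal_image_stable[OF oneideal]

lemma iota_image_mem: "J \<subseteq> carrier R \<Longrightarrow> r \<in> carrier R \<Longrightarrow> \<iota> r \<in> \<iota> ` J \<longleftrightarrow> r \<in> J"
 using inj_on_image_mem_iff[OF iota_inj] by blast

lemma lattice_ring_image: "lattice_ring Q A (\<iota> ` M)"
proof (intro lattice_ring.intro lattice_ring_axioms.intro Q.is_cring A_stable ideal_image_stable[OF M_ideal])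
 show "\<one>\<^bsub>Q\<^esub> \<in> A" by (auto simp flip: iota_simps(4))
 have "\<ominus>\<^bsub>Q\<^esub> \<one>\<^bsub>Q\<^esub> = \<iota> (\<ominus> \<one>)" by simp
 then show "\<ominus>\<^bsub>Q\<^esub> \<one>\<^bsub>Q\<^esub> \<in> A" by blast
 show "\<iota> ` M \<subseteq> A" using M_sub by blast
 have "\<one> \<notin> M" using ideal.one_imp_carrier[OF M_ideal] M_proper by blast
 then show "\<one>\<^bsub>Q\<^esub> \<notin> \<iota> ` M" using iota_image_mem[OF M_sub, of \<one>] by simp
 show "\<exists>b\<in>A. b \<otimes>\<^bsub>Q\<^esub> a = \<one>\<^bsub>Q\<^esub>" if a: "a \<in> A" "a \<notin> \<iota> ` M" for a
 proof -
  obtain r where r: "r \<in> carrier R" "a = \<iota> r" "r \<notin> M" using a by blast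
  have u: "r \<in> Units R" by (rule not_M_unit[OF r(1,3)])
  have "\<iota> (inv r) \<otimes>\<^bsub>Q\<^esub> \<iota> r = \<iota> (inv r \<otimes> r)" using u r(1) by (simp only: iota_simps(3) Units_inv_closed)
  then have "\<iota> (inv r) \<otimes>\<^bsub>Q\<^esub> a = \<one>\<^bsub>Q\<^esub>" using u r(2) by simp
  then show ?thesis using u by blast
 qed
 obtain x where "x \<in> M" "x \<in> nonzerodivisors R" by (rule exists_regular)
 then show "\<exists>x\<in>\<iota> ` M. x \<in> Units Q" using iota_units by blast
 fix Fam :: "'q set set"
 assume ne: "Fam \<noteq> {}" and Fam: "\<And>H. H \<in> Fam \<Longrightarrow> stable_subgroup Q A H \<and> H \<subseteq> A"
 let ?pre = "\<lambda>H. {r \<in> carrier R. \<iota> r \<in> H}"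
 have im: "\<iota> ` ?pre H = H" if "H \<in> Fam" for H using Fam[OF that] by auto
 have "?pre ` Fam \<noteq> {}" using ne by simp
 moreover have "ideal J R" if "J \<in> ?pre ` Fam" for J
 proof -
  obtain H where H: "H \<in> Fam" "J = ?pre H" using \<open>J \<in> ?pre ` Fam\<close> by blast
  have "?pre H = {r \<in> carrier R. \<one>\<^bsub>Q\<^esub> \<otimes>\<^bsub>Q\<^esub> \<iota> r \<in> H}" by auto
  then show ?thesis using preimage_ideal[of H "\<one>\<^bsub>Q\<^esub>"] Fam[OF H(1)] H(2) by simp
 qed
 ultimately obtain J where J: "J \<in> ?pre ` Fam" "\<And>J'. J' \<in> ?pre ` Fam \<Longrightarrow> J \<subseteq> J' \<Longrightarrow> J' = J"
  by (rule exists_maximal_ideal_in) auto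
 then obtain H where H: "H \<in> Fam" "J = ?pre H" by blast
 have "H' = H" if "H' \<in> Fam" "H \<subseteq> H'" for H'
 proof -
  have "?pre H' = J" by (rule J(2)[OF imageI[OF that(1)]]) (use that(2) H(2) in auto)
  then have "\<iota> ` ?pre H' = \<iota> ` ?pre H" by (simp only: H(2))
  then show ?thesis unfolding im[OF that(1)] im[OF H(1)] .
 qed
 then show "\<exists>H\<in>Fam. \<forall>H'\<in>Fam. H \<subseteq> H' \<longrightarrow> H' = H" using H(1) by blast
qed

lemma cm_type_length: "cm_type R = quotient_length Q A (colon Q A (\<iota> ` M)) A"
proof -
 interpret E: embedded_module R Q \<iota> "ring_as_module R" \<iota>
  by (intro embedded_module.intro total_quotient_axioms ring_as_module_module is_cring embedded_module_axioms.intro)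
   (use iota_inj in auto)
 obtain x where "x \<in> M" "x \<in> nonzerodivisors R" by (rule exists_regular)
 from E.ext1_length[OF noetherian_ring_axioms M_ideal this] show ?thesis
  unfolding cm_type_def by simp
qed

text \<open>
 A canonical ideal inside the standard total ring of fractions is moved along \<Phi> into another model; it
 contains the unit 1, so it is a regular fractional ideal.
\<close>
lemma canonical_embeddingI:
 assumes frac: "fractional_ideal R \<omega>" and canonical: "canonical_module R (frac_module R \<omega>)"
  and one: "frac_embed R ` carrier R \<subseteq> \<omega>"
  and \<Phi>: "\<Phi> \<in> ring_hom (total_fractions R) Q" "inj_on \<Phi> (carrier (total_fractions R))"
   "\<And>r. r \<in> carrier R \<Longrightarrow> \<Phi> (frac_embed R r) = \<iota> r"
 shows "canonical_embedding R Q \<iota> (frac_module R \<omega>) \<Phi>"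
proof -
 interpret T: total_quotient R "total_fractions R" "frac_embed R" by (rule total_fractions_quotient)
 interpret \<Phi>: ring_hom_cring "total_fractions R" Q \<Phi>
  by (intro ring_hom_cring.intro T.Q.is_cring Q.is_cring ring_hom_cring_axioms.intro \<Phi>(1))
 have sub: "\<omega> \<subseteq> carrier (total_fractions R)"
  using frac subgroup.subset[OF submodule.axioms(1)] unfolding fractional_ideal_def by (fastforce simp: frac_module_def)
 interpret E: embedded_module R Q \<iota> "frac_module R \<omega>" \<Phi>
 proof (intro embedded_module.intro total_quotient_axioms embedded_module_axioms.intro)
  show "module R (frac_module R \<omega>)" using canonical unfolding canonical_module_def fin_gen_module_def by blast
  show "inj_on \<Phi> (carrier (frac_module R \<omega>))" using \<Phi>(2) sub by (auto simp: frac_module_def intro: inj_on_subset)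
 qed (use sub \<Phi>(3) in \<open>auto simp: frac_module_def subset_iff\<close>)
 have CC: "\<Phi> ` carrier (frac_module R \<omega>) = \<Phi> ` \<omega>" by (simp add: frac_module_def)
 show ?thesis
 proof (intro canonical_embedding.intro canonical_embedding_axioms.intro one_dim_cm_axioms E.embedded_module_axioms)
  show "finite_injective_dim R (frac_module R \<omega>)" using canonical by (simp add: canonical_module_def)
  obtain d where "krull_dim R = enat d" "module_length R (Ext_module R (cyclic_module R M) (frac_module R \<omega>) d) = 1"
   using canonical unfolding canonical_module_def by blast
  then show "module_length R (Ext_module R (cyclic_module R M) (frac_module R \<omega>) 1) = 1"
   using dim by (simp add: one_enat_def)
  have "\<one>\<^bsub>Q\<^esub> = \<Phi> (frac_embed R \<one>)" using \<Phi>(3) by simp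
  then have "\<one>\<^bsub>Q\<^esub> \<in> \<Phi> ` \<omega>" using one by blast
  moreover obtain s where s: "s \<in> nonzerodivisors R"
   "\<And>q. q \<in> \<omega> \<Longrightarrow> frac_embed R s \<otimes>\<^bsub>total_fractions R\<^esub> q \<in> frac_embed R ` carrier R"
   using frac unfolding fractional_ideal_def by blast
  have "\<iota> s \<otimes>\<^bsub>Q\<^esub> f \<in> A" if "f \<in> \<Phi> ` \<omega>" for f
  proof -
   obtain q where q: "q \<in> \<omega>" "f = \<Phi> q" using \<open>f \<in> \<Phi> ` \<omega>\<close> by blast
   obtain r where r: "r \<in> carrier R" "frac_embed R s \<otimes>\<^bsub>total_fractions R\<^esub> q = frac_embed R r" using s(2)[OF q(1)] by blast
   have sc: "s \<in> carrier R" by (rule nzd_closed[OF s(1)])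
   have "\<iota> s \<otimes>\<^bsub>Q\<^esub> f = \<Phi> (frac_embed R s \<otimes>\<^bsub>total_fractions R\<^esub> q)"
    using q sub sc \<Phi>(3) by (simp add: subset_iff)
   then show ?thesis using r \<Phi>(3) by simp
  qed
  ultimately have "\<exists>s\<in>Units Q. \<forall>f\<in>\<Phi> ` \<omega>. s \<otimes>\<^bsub>Q\<^esub> f \<in> A" "\<exists>u\<in>\<Phi> ` \<omega>. u \<in> Units Q"
   using iota_units[OF s(1)] Q.Units_one_closed by blast+
  then show "is_lattice Q A (\<Phi> ` carrier (frac_module R \<omega>))"
   unfolding is_lattice_def CC using E.CC_stable unfolding CC by blast
 qed
qed

lemma infinite_incongruent:
 assumes "infinite (carrier (R Quot M))"
 obtains E where "infinite E" "E \<subseteq> A" "\<And>e e'. e \<in> E \<Longrightarrow> e' \<in> E \<Longrightarrow> e \<noteq> e' \<Longrightarrow> e \<ominus>\<^bsub>Q\<^esub> e' \<notin> \<iota> ` M"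
proof -
 interpret M: ideal M R by (rule M_ideal)
 \<comment> \<open>one representative of each residue class\<close>
 define rep where "rep = (\<lambda>U. SOME r. r \<in> carrier R \<and> M +> r = U)"
 have rep: "rep U \<in> carrier R" "M +> rep U = U" if "U \<in> carrier (R Quot M)" for U
 proof -
  have "\<exists>r. r \<in> carrier R \<and> M +> r = U" using that unfolding FactRing_def A_RCOSETS_def' by auto
  from someI_ex[OF this] show "rep U \<in> carrier R" "M +> rep U = U" unfolding rep_def by auto
 qed
 let ?E = "(\<iota> \<circ> rep) ` carrier (R Quot M)"
 have "inj_on (\<iota> \<circ> rep) (carrier (R Quot M))"
  by (rule inj_onI) (metis comp_apply rep inj_onD[OF iota_inj])
 then have "infinite ?E" using assms by (metis finite_image_iff)
 moreover have "e \<ominus>\<^bsub>Q\<^esub> e' \<notin> \<iota> ` M" if asm: "e \<in> ?E" "e' \<in> ?E" "e \<noteq> e'" for e e'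
 proof
  assume m: "e \<ominus>\<^bsub>Q\<^esub> e' \<in> \<iota> ` M"
  obtain U V where U: "U \<in> carrier (R Quot M)" "e = \<iota> (rep U)" and V: "V \<in> carrier (R Quot M)" "e' = \<iota> (rep V)" using asm by auto
  have "\<iota> (rep U \<ominus> rep V) = e \<ominus>\<^bsub>Q\<^esub> e'" using U V rep by (simp add: minus_eq Q.minus_eq)
  then have "rep U \<ominus> rep V \<in> M" using m iota_image_mem[OF M_sub, of "rep U \<ominus> rep V"] rep U V by simp
  then have "M +> rep U = M +> rep V"
   using quotient_eq_iff_same_a_r_cos[OF M_ideal, of "rep U" "rep V"] rep U V by simp
  then show False using rep U V asm(3) by simp
 qed
 ultimately show ?thesis using rep by (intro that[of ?E]) auto
qed

end

section \<open>The Rees quotient as an order in a quadratic extension\<close>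

lemma (in abelian_monoid) finsum_mem:
 assumes "H \<subseteq> carrier G" "\<And>x y. x \<in> H \<Longrightarrow> y \<in> H \<Longrightarrow> x \<oplus> y \<in> H" "\<And>i. i \<le> n \<Longrightarrow> f i \<in> H"
 shows "(\<Oplus>i\<in>{..n::nat}. f i) \<in> H"
 using assms(3)
proof (induction n)
 case 0
 then show ?case using assms(1) by (auto simp: finsum_0)
next
 case (Suc n)
 have "f \<in> {..Suc n} \<rightarrow> carrier G" using Suc.prems assms(1) by blast
 then show ?case using Suc assms(2) by (simp add: finsum_Suc)
qed

context cring
begin

lemma ideal_power_ideal: "ideal I R \<Longrightarrow> ideal (ideal_power R I n) R"
 by (induction n) (auto intro: oneideal ideal_prod_is_ideal)

lemma ideal_power_mult:
 assumes I: "ideal I R" and "x \<in> ideal_power R I k" "y \<in> ideal_power R I l"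
 shows "x \<otimes> y \<in> ideal_power R I (k + l)"
 using assms(2)
proof (induction k arbitrary: x)
 case 0
 then show ?case using ideal.I_l_closed[OF ideal_power_ideal[OF I]] assms(3) by simp
next
 case (Suc k)
 have y: "y \<in> carrier R" by (rule ideal.Icarr[OF ideal_power_ideal[OF I] assms(3)])
 have "x \<in> I \<cdot>\<^bsub>R\<^esub> ideal_power R I k" using Suc.prems by simp
 then have "x \<in> carrier R \<and> x \<otimes> y \<in> I \<cdot>\<^bsub>R\<^esub> ideal_power R I (k + l)"
 proof (induction rule: ideal_prod.induct)
  case (prod i j)
  have ij: "i \<in> carrier R" "j \<in> carrier R"
   using prod ideal.Icarr[OF I] ideal.Icarr[OF ideal_power_ideal[OF I]] by auto
  then show ?case using ideal_prod.prod[OF prod(1) Suc.IH[OF prod(2)]] y by (simp add: m_assoc)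
 next
  case (sum s t)
  then show ?case using ideal_prod.sum[of "s \<otimes> y" R] y by (auto simp: l_distr)
 qed
 then show ?case by simp
qed

lemma ideal_power_sub: "ideal I R \<Longrightarrow> ideal_power R I (Suc n) \<subseteq> I"
 using ideal_prod_inter[OF _ ideal_power_ideal] by fastforce

lemma ideal_power_one: assumes "ideal I R" "i \<in> I" shows "i \<in> ideal_power R I (Suc 0)"
 using ideal_prod.prod[OF assms(2) one_closed, of R] ideal.Icarr[OF assms] by simp

lemma rees_algebra_subring:
 assumes I: "ideal I R" shows "subring (carrier (rees_algebra R I)) (UP R)"
proof -
 let ?c = "up_ring.coeff (UP R)"
 note J = ideal_power_ideal[OF I] and JM = ideal_power_mult[OF I] and JA = ideal_add_closed[OF J]
 have JS: "(\<Oplus>i\<in>{..n}. f i) \<in> ideal_power R I n" if "\<And>i. i \<le> n \<Longrightarrow> f i \<in> ideal_power R I n" for f and n :: nat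
  by (rule finsum_mem[OF _ ideal_add_closed[OF J] that]) (use ideal.Icarr[OF J] in auto)
 interpret UP_cring R "UP R" by unfold_locales
 interpret P: cring "UP R" by (rule UP_cring)
 show ?thesis
 proof (rule P.subringI)
  show "\<one>\<^bsub>UP R\<^esub> \<in> carrier (rees_algebra R I)"
   using additive_subgroup.zero_closed[OF ideal.axioms(1)[OF J]] by (auto simp: rees_algebra_def)
  show "\<ominus>\<^bsub>UP R\<^esub> p \<in> carrier (rees_algebra R I)" if "p \<in> carrier (rees_algebra R I)" for p
   using that additive_subgroup.a_inv_closed[OF ideal.axioms(1)[OF J]] by (auto simp: rees_algebra_def)
  show "p \<oplus>\<^bsub>UP R\<^esub> q \<in> carrier (rees_algebra R I)"
   if "p \<in> carrier (rees_algebra R I)" "q \<in> carrier (rees_algebra R I)" for p q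
   using that JA by (auto simp: rees_algebra_def)
  show "p \<otimes>\<^bsub>UP R\<^esub> q \<in> carrier (rees_algebra R I)"
   if asm: "p \<in> carrier (rees_algebra R I)" "q \<in> carrier (rees_algebra R I)" for p q
  proof -
   have "?c p i \<otimes> ?c q (n - i) \<in> ideal_power R I n" if "i \<le> n" for i n
    using JM[of _ i _ "n - i"] asm that by (simp add: rees_algebra_def)
   then show ?thesis using asm JS by (simp add: rees_algebra_def)
  qed
 qed (auto simp: rees_algebra_def)
qed

text \<open>
 The isomorphism is evaluation at \<open>t = (0, 1)\<close>. Division by the monic polynomial shows that its
 kernel on R[t] is generated by that polynomial. Coefficients of positive degree lie in I, so the Rees algebra
 has image R \<times> I, already attained by polynomials \<open>r + it\<close>.
\<close>
theorem rees_quotient_iso: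
 assumes I: "ideal I R" and ab: "a \<in> carrier R" "b \<in> carrier R" and nz: "\<one> \<noteq> \<zero>"
 obtains \<Theta> where "\<Theta> \<in> ring_iso (rees_quotient R I a b) ((quadratic_ring R a b)\<lparr>carrier := carrier R \<times> I\<rparr>)"
proof -
 let ?P = "UP R" and ?W = "rees_algebra R I" and ?B = "quadratic_ring R a b" and ?f = "rees_poly R a b"
 let ?c = "up_ring.coeff ?P" and ?m = "up_ring.monom ?P" and ?x = "(\<zero>, \<one>)"
 define h where "h = (\<lambda>r::'a. (r, \<zero>))"
 let ?ev = "UnivPoly.eval R ?B h ?x"
 note I_ideal_power = ideal_power_ideal[OF I] ideal_power_sub[OF I] ideal_power_one[OF I]
  and subring = rees_algebra_subring[OF I] and I_add = ideal_add_closed[OF I] and minus_R = minus_eq and l_neg_R = l_neg and is_cring_R = is_cring and one_R = one_closed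
 interpret B: cring ?B by (rule quadratic_ring_cring[OF ab])
 interpret UP_cring R "?P" by unfold_locales
 interpret P: cring "?P" by (rule UP_cring)
 have h: "h \<in> ring_hom R ?B"
  unfolding h_def by (rule ring_hom_memI) (use ab in \<open>auto simp: minus_R\<close>)
 interpret UP_pre_univ_prop R ?B h "?P"
  by (rule UP_pre_univ_propI[OF is_cring_R B.is_cring h])
 have x: "?x \<in> carrier ?B" by simp
 have ev: "?ev \<in> ring_hom ?P ?B" by (rule eval_ring_hom[OF x])
 interpret ev: ring_hom_cring "?P" ?B ?ev
  by (intro ring_hom_cring.intro P.is_cring B.is_cring ring_hom_cring_axioms.intro ev)
 have "?x [^]\<^bsub>?B\<^esub> Suc (Suc 0) = ?x \<otimes>\<^bsub>?B\<^esub> ?x"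
  using B.l_one[OF x] by (simp only: B.nat_pow_Suc B.nat_pow_0)
 also have "\<dots> = (\<ominus> b, \<ominus> a)" using ab by (simp add: minus_R)
 finally have x2: "?x [^]\<^bsub>?B\<^esub> (2::nat) = (\<ominus> b, \<ominus> a)" by (simp only: numeral_2_eq_2)
 have ev0: "?ev (?m r 0) = (r, \<zero>)" if "r \<in> carrier R" for r using eval_const[OF x that] by (simp add: h_def)
 have ev1: "?ev (?m r 1) = (\<zero>, r)" if "r \<in> carrier R" for r
  using eval_monom[OF that x, of 1] that ab by (simp add: minus_R h_def)
 have f: "?f \<in> carrier ?P" unfolding rees_poly_def using ab by simp
 have evf: "?ev ?f = \<zero>\<^bsub>?B\<^esub>"
 proof -
  have "?ev (?m \<one> 2) = (\<one>, \<zero>) \<otimes>\<^bsub>?B\<^esub> (\<ominus> b, \<ominus> a)"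
   using eval_monom[OF one_R x, of 2] by (simp only: x2 h_def)
  then have "?ev ?f = (\<one>, \<zero>) \<otimes>\<^bsub>?B\<^esub> (\<ominus> b, \<ominus> a) \<oplus>\<^bsub>?B\<^esub> (\<zero>, a) \<oplus>\<^bsub>?B\<^esub> (b, \<zero>)"
   unfolding rees_poly_def using ab by (simp add: ev0 ev1[simplified] del: quadratic_ring_simps)
  also have "\<dots> = \<zero>\<^bsub>?B\<^esub>" using ab by (simp add: minus_R l_neg_R)
  finally show ?thesis .
 qed
 have coeff_f: "?c ?f n = (if n = 2 then \<one> else if n = 1 then a else if n = 0 then b else \<zero>)" for n
  unfolding rees_poly_def using ab by auto
 have deg_f: "deg R ?f = 2"
  by (intro le_antisym deg_aboveI deg_belowI f) (use nz in \<open>simp_all add: coeff_f\<close>)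
 \<comment> \<open>Division by a monic polynomial leaves a remainder \<open>r0 + r1 t\<close>, whose value is \<open>(r0, r1)\<close>.\<close>
 have ker: "p \<in> PIdl\<^bsub>?P\<^esub> ?f" if p: "p \<in> carrier ?P" "?ev p = \<zero>\<^bsub>?B\<^esub>" for p
 proof -
  have "?f \<noteq> \<zero>\<^bsub>?P\<^esub>" using deg_f by auto
  then obtain q r and k :: nat where qr: "q \<in> carrier ?P" "r \<in> carrier ?P"
   "?c ?f (deg R ?f) [^] k \<odot>\<^bsub>?P\<^esub> p = ?f \<otimes>\<^bsub>?P\<^esub> q \<oplus>\<^bsub>?P\<^esub> r" "r = \<zero>\<^bsub>?P\<^esub> \<or> deg R r < deg R ?f"
   using long_div_theorem[OF f p(1)] by blast
  have pe: "p = ?f \<otimes>\<^bsub>?P\<^esub> q \<oplus>\<^bsub>?P\<^esub> r" using qr(3) p(1) by (simp add: coeff_f deg_f)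
  define r0 r1 where "r0 = ?c r 0" and "r1 = ?c r 1"
  have r01: "r0 \<in> carrier R" "r1 \<in> carrier R" unfolding r0_def r1_def using qr(2) by auto
  have re: "r = ?m r0 0 \<oplus>\<^bsub>?P\<^esub> ?m r1 1"
  proof (rule up_eqI)
   fix n
   have "?c r n = \<zero>" if "n \<ge> 2" using qr(2,4) that deg_f by (auto intro: deg_aboveD)
   then show "?c r n = ?c (?m r0 0 \<oplus>\<^bsub>?P\<^esub> ?m r1 1) n"
    using r01 by (cases "n = 0 \<or> n = 1") (auto simp: r0_def r1_def)
  qed (use qr(2) r01 in auto)
  have "?ev p = ?ev r" unfolding pe using f qr(1,2) by (simp add: evf del: quadratic_ring_simps)
  also have "?ev r = (r0, r1)" unfolding re using r01 by (simp add: ev0 ev1[simplified])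
  finally have "r0 = \<zero>" "r1 = \<zero>" using p(2) by auto
  then have "p = q \<otimes>\<^bsub>?P\<^esub> ?f" unfolding pe re using f qr(1) by (simp add: P.m_comm)
  then show ?thesis unfolding cgenideal_def using qr(1) by blast
 qed
 have W: "ring ?W" using P.subring_is_ring[OF subring] by (simp add: rees_algebra_def)
 have Wc: "p \<in> carrier ?P" if "p \<in> carrier ?W" for p using that by (simp add: rees_algebra_def)
 interpret evW: ring_hom_ring ?W ?B ?ev
 proof (intro ring_hom_ring.intro ring_hom_ring_axioms.intro W B.ring_axioms)
  show "?ev \<in> ring_hom ?W ?B"
  proof (rule ring_hom_memI)
   have s: "\<one>\<^bsub>?W\<^esub> = \<one>\<^bsub>?P\<^esub>" "p \<otimes>\<^bsub>?W\<^esub> q = p \<otimes>\<^bsub>?P\<^esub> q" "p \<oplus>\<^bsub>?W\<^esub> q = p \<oplus>\<^bsub>?P\<^esub> q" for p q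
    by (simp_all add: rees_algebra_def)
   show "?ev \<one>\<^bsub>?W\<^esub> = \<one>\<^bsub>?B\<^esub>" unfolding s by (rule ev.hom_one)
   fix p assume p: "p \<in> carrier ?W"
   show "?ev p \<in> carrier ?B" by (rule ev.hom_closed[OF Wc[OF p]])
   fix q assume q: "q \<in> carrier ?W"
   show "?ev (p \<otimes>\<^bsub>?W\<^esub> q) = ?ev p \<otimes>\<^bsub>?B\<^esub> ?ev q" unfolding s by (rule ev.hom_mult[OF Wc[OF p] Wc[OF q]])
   show "?ev (p \<oplus>\<^bsub>?W\<^esub> q) = ?ev p \<oplus>\<^bsub>?B\<^esub> ?ev q" unfolding s by (rule ev.hom_add[OF Wc[OF p] Wc[OF q]])
  qed
 qed
 have kernel: "a_kernel ?W ?B ?ev = PIdl\<^bsub>?P\<^esub> ?f \<inter> carrier ?W"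
 proof (rule Set.set_eqI)
  fix p
  have "?ev p = \<zero>\<^bsub>?B\<^esub>" if "p \<in> PIdl\<^bsub>?P\<^esub> ?f"
  proof -
   obtain q where q: "q \<in> carrier ?P" "p = q \<otimes>\<^bsub>?P\<^esub> ?f" using \<open>p \<in> PIdl\<^bsub>?P\<^esub> ?f\<close> unfolding cgenideal_def by blast
   show ?thesis unfolding q(2) ev.hom_mult[OF q(1) f] evf using q(1) by (simp del: quadratic_ring_simps)
  qed
  then show "p \<in> a_kernel ?W ?B ?ev \<longleftrightarrow> p \<in> PIdl\<^bsub>?P\<^esub> ?f \<inter> carrier ?W"
   unfolding a_kernel_def' using ker Wc by blast
 qed
 have image: "?ev ` carrier ?W = carrier R \<times> I"
 proof
  show "?ev ` carrier ?W \<subseteq> carrier R \<times> I"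
  proof
   fix w assume "w \<in> ?ev ` carrier ?W"
   then obtain p where p: "p \<in> carrier ?W" "w = ?ev p" by blast
   have pn: "?c p n \<in> ideal_power R I n" for n using p(1) by (simp add: rees_algebra_def)
   have RI: "carrier R \<times> I \<subseteq> carrier ?B" using ideal.Icarr[OF I] by auto
   have t: "h (?c p i) \<otimes>\<^bsub>?B\<^esub> ?x [^]\<^bsub>?B\<^esub> i \<in> carrier R \<times> I" for i
   proof (cases i)
    case 0
    then show ?thesis using coeff_closed[OF Wc[OF p(1)], of 0] ab
     additive_subgroup.zero_closed[OF ideal.axioms(1)[OF I]] by (simp add: minus_R h_def)
   next
    case (Suc j)
    have c: "?c p i \<in> I" using pn[of i] I_ideal_power(2) Suc by blast
    obtain u v where uv: "?x [^]\<^bsub>?B\<^esub> i = (u, v)" "u \<in> carrier R" "v \<in> carrier R"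
     using B.nat_pow_closed[OF x, of i] by auto
    show ?thesis unfolding uv(1) h_def using c uv(2,3) ideal.I_r_closed[OF I c] ideal.Icarr[OF I c] ab by (simp add: minus_R)
   qed
   have "(\<Oplus>\<^bsub>?B\<^esub>i\<in>{..n}. h (?c p i) \<otimes>\<^bsub>?B\<^esub> ?x [^]\<^bsub>?B\<^esub> i) \<in> carrier R \<times> I" for n :: nat
    by (rule B.finsum_mem[OF RI _ t]) (use I_add in auto)
   then show "w \<in> carrier R \<times> I" unfolding p(2) eval_on_carrier[OF Wc[OF p(1)]] .
  qed
  show "carrier R \<times> I \<subseteq> ?ev ` carrier ?W"
  proof
   fix w assume "w \<in> carrier R \<times> I"
   then obtain r i where w: "w = (r, i)" "r \<in> carrier R" "i \<in> I" by blast
   have i: "i \<in> carrier R" by (rule ideal.Icarr[OF I w(3)])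
   let ?p = "?m r 0 \<oplus>\<^bsub>?P\<^esub> ?m i 1"
   have "?c ?p n \<in> ideal_power R I n" for n
    using w i I_ideal_power(3)[OF w(3)] additive_subgroup.zero_closed[OF ideal.axioms(1)[OF I_ideal_power(1)]]
    by (cases n) (auto simp del: ideal_power.simps(2))
   then have "?p \<in> carrier ?W" using w(2) i by (simp add: rees_algebra_def)
   moreover have "?ev ?p = w" using w i by (simp add: ev0 ev1[simplified])
   ultimately show "w \<in> ?ev ` carrier ?W" by blast
  qed
 qed
 show ?thesis using that evW.FactRing_iso_set_aux unfolding kernel image rees_quotient_def by blast
qed

end

text \<open>
 An abstract ring S isomorphic to the order R \<times> I, such as the Rees quotient. I is regular, which makes
 the quadratic extension of Q the total ring of fractions of S.
\<close>
locale quadratic_order = one_dim_quotient R Q \<iota> + S: cring S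
 for R :: "('a, 'b) ring_scheme" (structure) and Q :: "('q, 'd) ring_scheme" and \<iota> and S :: "('s, 'e) ring_scheme" +
 fixes I a b \<Theta>
 assumes I_ideal: "ideal I R" and I_M: "I \<subseteq> M" and I_regular: "\<exists>z\<in>I. z \<in> nonzerodivisors R"
  and ab: "a \<in> carrier R" "b \<in> carrier R"
  and \<Theta>: "\<Theta> \<in> ring_iso S ((quadratic_ring R a b)\<lparr>carrier := carrier R \<times> I\<rparr>)"
begin

abbreviation "B \<equiv> quadratic_ring Q (\<iota> a) (\<iota> b)"
abbreviation B_mult (infixl "\<bullet>" 70) where "x \<bullet> y \<equiv> x \<otimes>\<^bsub>B\<^esub> y"

definition \<Psi> :: "'s \<Rightarrow> 'q \<times> 'q" where "\<Psi> s = map_prod \<iota> \<iota> (\<Theta> s)"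

sublocale B: cring B by (rule Q.quadratic_ring_cring) (use ab in auto)

lemma I_closed: "i \<in> I \<Longrightarrow> i \<in> carrier R" by (rule ideal.Icarr[OF I_ideal])

lemma I_zero: "\<zero> \<in> I" by (rule additive_subgroup.zero_closed[OF ideal.axioms(1)[OF I_ideal]])

lemma \<Psi>_cases:
 assumes "s \<in> carrier S"
 obtains x y where "x \<in> carrier R" "y \<in> I" "\<Theta> s = (x, y)" "\<Psi> s = (\<iota> x, \<iota> y)"
proof -
 have "\<Theta> s \<in> carrier R \<times> I" using \<Theta> assms unfolding ring_iso_def ring_hom_def by auto
 then show ?thesis using that unfolding \<Psi>_def by (cases "\<Theta> s") auto
qed

lemma \<Psi>_onto:
 assumes "x \<in> carrier R" "y \<in> I"
 obtains s where "s \<in> carrier S" "\<Psi> s = (\<iota> x, \<iota> y)"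
proof -
 have "bij_betw \<Theta> (carrier S) (carrier R \<times> I)" using \<Theta> unfolding ring_iso_def by simp
 then have "(x, y) \<in> \<Theta> ` carrier S" using assms by (auto simp: bij_betw_def)
 then obtain s where "s \<in> carrier S" "\<Theta> s = (x, y)" by (metis imageE)
 then show ?thesis using that[of s] by (simp add: \<Psi>_def)
qed

lemma \<Psi>_image: "\<Psi> ` carrier S = A \<times> \<iota> ` I"
proof
 show "\<Psi> ` carrier S \<subseteq> A \<times> \<iota> ` I" by (auto elim!: \<Psi>_cases)
 show "A \<times> \<iota> ` I \<subseteq> \<Psi> ` carrier S"
 proof
  fix w assume "w \<in> A \<times> \<iota> ` I"
  then obtain x y where w: "x \<in> carrier R" "y \<in> I" "w = (\<iota> x, \<iota> y)" by auto
  obtain s where "s \<in> carrier S" "\<Psi> s = (\<iota> x, \<iota> y)" by (rule \<Psi>_onto[OF w(1,2)])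
  then show "w \<in> \<Psi> ` carrier S" using w(3) by force
 qed
qed

lemma \<Psi>_inj: "inj_on \<Psi> (carrier S)"
proof (rule inj_onI)
 fix s t assume s: "s \<in> carrier S" and t: "t \<in> carrier S" and eq: "\<Psi> s = \<Psi> t"
 obtain x y where x: "x \<in> carrier R" "y \<in> I" "\<Theta> s = (x, y)" "\<Psi> s = (\<iota> x, \<iota> y)" by (rule \<Psi>_cases[OF s])
 obtain x' y' where x': "x' \<in> carrier R" "y' \<in> I" "\<Theta> t = (x', y')" "\<Psi> t = (\<iota> x', \<iota> y')" by (rule \<Psi>_cases[OF t])
 have "x = x'" "y = y'" using eq x x' I_closed inj_onD[OF iota_inj] by auto
 moreover have "inj_on \<Theta> (carrier S)" using \<Theta> unfolding ring_iso_def bij_betw_def by simp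
 ultimately show "s = t" using inj_onD[of \<Theta> "carrier S" s t] x(3) x'(3) s t by simp
qed

lemma \<Psi>_hom: "\<Psi> \<in> ring_hom S B"
proof (rule ring_hom_memI)
 have \<Theta>h: "\<Theta> \<in> ring_hom S ((quadratic_ring R a b)\<lparr>carrier := carrier R \<times> I\<rparr>)" using \<Theta> by (simp add: ring_iso_def)
 show "\<Psi> s \<in> carrier B" if s: "s \<in> carrier S" for s
  by (rule \<Psi>_cases[OF s]) (use I_closed in auto)
 fix s t assume s: "s \<in> carrier S" and t: "t \<in> carrier S"
 obtain x y where x: "x \<in> carrier R" "y \<in> I" "\<Theta> s = (x, y)" "\<Psi> s = (\<iota> x, \<iota> y)" by (rule \<Psi>_cases[OF s])
 obtain x' y' where x': "x' \<in> carrier R" "y' \<in> I" "\<Theta> t = (x', y')" "\<Psi> t = (\<iota> x', \<iota> y')" by (rule \<Psi>_cases[OF t])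
 have c: "y \<in> carrier R" "y' \<in> carrier R" using x x' I_closed by auto
 have "\<Theta> (s \<otimes>\<^bsub>S\<^esub> t) = (x, y) \<otimes>\<^bsub>quadratic_ring R a b\<^esub> (x', y')" "\<Theta> (s \<oplus>\<^bsub>S\<^esub> t) = (x, y) \<oplus>\<^bsub>quadratic_ring R a b\<^esub> (x', y')"
  using ring_hom_mult[OF \<Theta>h s t] ring_hom_add[OF \<Theta>h s t] x x' by auto
 then show "\<Psi> (s \<otimes>\<^bsub>S\<^esub> t) = \<Psi> s \<bullet> \<Psi> t" "\<Psi> (s \<oplus>\<^bsub>S\<^esub> t) = \<Psi> s \<oplus>\<^bsub>B\<^esub> \<Psi> t"
  using x(1,4) x'(1,4) c ab by (simp_all add: \<Psi>_def minus_eq Q.minus_eq)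
next
 have "\<Theta> \<one>\<^bsub>S\<^esub> = (\<one>, \<zero>)" using \<Theta> unfolding ring_iso_def ring_hom_def by simp
 then show "\<Psi> \<one>\<^bsub>S\<^esub> = \<one>\<^bsub>B\<^esub>" by (simp add: \<Psi>_def)
qed

interpretation \<Psi>: ring_hom_cring S B \<Psi>
 by (intro ring_hom_cring.intro S.is_cring B.is_cring ring_hom_cring_axioms.intro \<Psi>_hom)

text \<open>
 The norm \<open>x\<^sup>2 - axy + by\<^sup>2\<close> as the product with the conjugate, where t is replaced
 by the other root \<open>-a - t\<close>.
\<close>
lemma conjugate_mult:
 assumes "x \<in> carrier Q" "y \<in> carrier Q"
 shows "(x \<ominus>\<^bsub>Q\<^esub> \<iota> a \<otimes>\<^bsub>Q\<^esub> y, \<ominus>\<^bsub>Q\<^esub> y) \<bullet> (x, y) = (x \<otimes>\<^bsub>Q\<^esub> x \<ominus>\<^bsub>Q\<^esub> \<iota> a \<otimes>\<^bsub>Q\<^esub> (x \<otimes>\<^bsub>Q\<^esub> y) \<oplus>\<^bsub>Q\<^esub> \<iota> b \<otimes>\<^bsub>Q\<^esub> (y \<otimes>\<^bsub>Q\<^esub> y), \<zero>\<^bsub>Q\<^esub>)"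
proof -
 have ab': "\<iota> a \<in> carrier Q" "\<iota> b \<in> carrier Q" using ab by auto
 have "(x \<ominus>\<^bsub>Q\<^esub> \<iota> a \<otimes>\<^bsub>Q\<^esub> y) \<otimes>\<^bsub>Q\<^esub> x \<ominus>\<^bsub>Q\<^esub> \<iota> b \<otimes>\<^bsub>Q\<^esub> ((\<ominus>\<^bsub>Q\<^esub> y) \<otimes>\<^bsub>Q\<^esub> y) = x \<otimes>\<^bsub>Q\<^esub> x \<ominus>\<^bsub>Q\<^esub> \<iota> a \<otimes>\<^bsub>Q\<^esub> (x \<otimes>\<^bsub>Q\<^esub> y) \<oplus>\<^bsub>Q\<^esub> \<iota> b \<otimes>\<^bsub>Q\<^esub> (y \<otimes>\<^bsub>Q\<^esub> y)"
  "(x \<ominus>\<^bsub>Q\<^esub> \<iota> a \<otimes>\<^bsub>Q\<^esub> y) \<otimes>\<^bsub>Q\<^esub> y \<oplus>\<^bsub>Q\<^esub> x \<otimes>\<^bsub>Q\<^esub> (\<ominus>\<^bsub>Q\<^esub> y) \<ominus>\<^bsub>Q\<^esub> \<iota> a \<otimes>\<^bsub>Q\<^esub> ((\<ominus>\<^bsub>Q\<^esub> y) \<otimes>\<^bsub>Q\<^esub> y) = \<zero>\<^bsub>Q\<^esub>"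
  using assms ab' by algebra+
 then show ?thesis by simp
qed

lemma scalar_mult: "r \<in> carrier Q \<Longrightarrow> x \<in> carrier Q \<Longrightarrow> y \<in> carrier Q \<Longrightarrow> (r, \<zero>\<^bsub>Q\<^esub>) \<bullet> (x, y) = (r \<otimes>\<^bsub>Q\<^esub> x, r \<otimes>\<^bsub>Q\<^esub> y)"
 using ab by (simp add: Q.minus_eq)

text \<open>
 The norm of a nonzerodivisor s is a nonzerodivisor of R: if it kills r, then r times the conjugate of s,
 which lies in the order, kills s and vanishes; so r kills both coordinates of s, and \<open>rs = 0\<close>
 gives r = 0.
\<close>
lemma \<Psi>_units: assumes s: "s \<in> nonzerodivisors S" shows "\<Psi> s \<in> Units B"
proof -
 have sc: "s \<in> carrier S" using s by (simp add: nonzerodivisors_def)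
 obtain x y where xy: "x \<in> carrier R" "y \<in> I" "\<Psi> s = (\<iota> x, \<iota> y)" by (rule \<Psi>_cases[OF sc])
 have y: "y \<in> carrier R" by (rule I_closed[OF xy(2)])
 have kill: "u = \<zero> \<and> v = \<zero>" if uv: "u \<in> carrier R" "v \<in> I" "(\<iota> u, \<iota> v) \<bullet> \<Psi> s = \<zero>\<^bsub>B\<^esub>" for u v
 proof -
  obtain t where t: "t \<in> carrier S" "\<Psi> t = (\<iota> u, \<iota> v)" by (rule \<Psi>_onto[OF uv(1,2)])
  have "\<Psi> (t \<otimes>\<^bsub>S\<^esub> s) = \<Psi> \<zero>\<^bsub>S\<^esub>" using t sc uv(3) by (simp del: quadratic_ring_simps)
  then have "s \<otimes>\<^bsub>S\<^esub> t = \<zero>\<^bsub>S\<^esub>" using inj_onD[OF \<Psi>_inj, of "t \<otimes>\<^bsub>S\<^esub> s"] S.m_comm sc t(1) by simp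
  then have "t = \<zero>\<^bsub>S\<^esub>" using s t(1) by (simp add: nonzerodivisors_def)
  then have "(\<iota> u, \<iota> v) = (\<iota> \<zero>, \<iota> \<zero>)" unfolding t(2)[symmetric] hom.hom_zero by simp
  then have "\<iota> u = \<iota> \<zero>" "\<iota> v = \<iota> \<zero>" by (simp_all only: prod.inject)
  then show ?thesis using inj_onD[OF iota_inj] uv(1) I_closed[OF uv(2)] by blast
 qed
 define N where "N = x \<otimes> x \<ominus> a \<otimes> (x \<otimes> y) \<oplus> b \<otimes> (y \<otimes> y)"
 have N: "N \<in> carrier R" unfolding N_def using xy(1) y ab by simp
 define c where "c = (\<iota> x \<ominus>\<^bsub>Q\<^esub> \<iota> a \<otimes>\<^bsub>Q\<^esub> \<iota> y, \<ominus>\<^bsub>Q\<^esub> \<iota> y)"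
 have cB: "c \<in> carrier B" unfolding c_def using xy(1) y ab by simp
 have cs: "c \<bullet> \<Psi> s = (\<iota> N, \<zero>\<^bsub>Q\<^esub>)"
  unfolding c_def xy(3) N_def using xy(1) y ab by (subst conjugate_mult) (simp_all add: minus_eq Q.minus_eq)
 have "N \<in> nonzerodivisors R"
  unfolding nonzerodivisors_def
 proof (intro CollectI conjI ballI impI N)
  fix r assume r: "r \<in> carrier R" "N \<otimes> r = \<zero>"
  have sB: "\<Psi> s \<in> carrier B" using sc by (rule \<Psi>.hom_closed)
  have r0: "(\<iota> r, \<zero>\<^bsub>Q\<^esub>) \<in> carrier B" using r by simp
  have "((\<iota> r, \<zero>\<^bsub>Q\<^esub>) \<bullet> c) \<bullet> \<Psi> s = (\<iota> r, \<zero>\<^bsub>Q\<^esub>) \<bullet> (\<iota> N, \<zero>\<^bsub>Q\<^esub>)"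
   unfolding cs[symmetric] by (rule B.m_assoc[OF r0 cB sB])
  also have "\<dots> = (\<iota> (N \<otimes> r), \<zero>\<^bsub>Q\<^esub>)" using r(1) N by (subst scalar_mult) (simp_all add: Q.m_comm)
  finally have 1: "((\<iota> r, \<zero>\<^bsub>Q\<^esub>) \<bullet> c) \<bullet> \<Psi> s = \<zero>\<^bsub>B\<^esub>" unfolding r(2) by simp
  have "(\<iota> r, \<zero>\<^bsub>Q\<^esub>) \<bullet> c = (\<iota> (r \<otimes> (x \<ominus> a \<otimes> y)), \<iota> (r \<otimes> \<ominus> y))"
   unfolding c_def using r(1) xy(1) y ab by (subst scalar_mult) (simp_all add: minus_eq Q.minus_eq)
  moreover have "r \<otimes> \<ominus> y \<in> I"
   by (intro ideal.I_l_closed[OF I_ideal] additive_subgroup.a_inv_closed[OF ideal.axioms(1)[OF I_ideal]] xy(2) r(1))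
  ultimately have 2: "r \<otimes> (x \<ominus> a \<otimes> y) = \<zero>" "r \<otimes> \<ominus> y = \<zero>"
   using kill[of "r \<otimes> (x \<ominus> a \<otimes> y)" "r \<otimes> \<ominus> y"] 1 r(1) xy(1) y ab by auto
  have "r \<otimes> y = \<ominus> (r \<otimes> \<ominus> y)" "r \<otimes> x = r \<otimes> (x \<ominus> a \<otimes> y) \<ominus> a \<otimes> (r \<otimes> \<ominus> y)"
   using r(1) xy(1) y ab by algebra+
  then have "r \<otimes> y = \<zero>" "r \<otimes> x = \<zero>" unfolding 2 using ab by simp_all
  then have "(\<iota> r, \<iota> \<zero>) \<bullet> \<Psi> s = \<zero>\<^bsub>B\<^esub>" unfolding xy(3) using r(1) xy(1) y scalar_mult[of "\<iota> r" "\<iota> x" "\<iota> y"] 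
   by (simp flip: iota_simps(3))
  then show "r = \<zero>" using kill[OF r(1) I_zero] by simp
 qed
 then have U: "\<iota> N \<in> Units Q" by (rule iota_units)
 define d where "d = (inv\<^bsub>Q\<^esub> (\<iota> N), \<zero>\<^bsub>Q\<^esub>)"
 have dB: "d \<in> carrier B" unfolding d_def using U by simp
 have "(d \<bullet> c) \<bullet> \<Psi> s = d \<bullet> (\<iota> N, \<zero>\<^bsub>Q\<^esub>)"
  unfolding cs[symmetric] by (rule B.m_assoc[OF dB cB \<Psi>.hom_closed[OF sc]])
 also have "\<dots> = \<one>\<^bsub>B\<^esub>" unfolding d_def using U N by (subst scalar_mult) simp_all
 finally show ?thesis
  by (intro B.unit_of_left_inverse[OF B.m_closed[OF dB cB]] \<Psi>.hom_closed[OF sc])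
qed

text \<open>
 A common denominator of both coordinates, times a regular element of I, moves any pair into R \<times> I.
\<close>
lemma total_quotient_\<Psi>: "total_quotient S B \<Psi>"
proof (intro total_quotient.intro total_quotient_axioms.intro S.is_cring B.is_cring \<Psi>_hom \<Psi>_inj \<Psi>_units)
 fix q assume "q \<in> carrier B"
 then obtain p1 p2 where q: "q = (p1, p2)" "p1 \<in> carrier Q" "p2 \<in> carrier Q" by auto
 obtain r1 s1 where 1: "r1 \<in> carrier R" "s1 \<in> nonzerodivisors R" "\<iota> s1 \<otimes>\<^bsub>Q\<^esub> p1 = \<iota> r1" using fractions[OF q(2)] by blast
 obtain r2 s2 where 2: "r2 \<in> carrier R" "s2 \<in> nonzerodivisors R" "\<iota> s2 \<otimes>\<^bsub>Q\<^esub> p2 = \<iota> r2" using fractions[OF q(3)] by blast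
 obtain z where z: "z \<in> I" "z \<in> nonzerodivisors R" using I_regular by blast
 have c: "s1 \<in> carrier R" "s2 \<in> carrier R" "z \<in> carrier R" using 1 2 z nzd_carrier by auto
 define \<sigma> where "\<sigma> = s1 \<otimes> s2 \<otimes> z"
 have \<sigma>: "\<sigma> \<in> nonzerodivisors R" "\<sigma> \<in> carrier R" unfolding \<sigma>_def using 1 2 z c by (auto intro: nzd_mult)
 obtain s where s: "s \<in> carrier S" "\<Psi> s = (\<iota> \<sigma>, \<iota> \<zero>)" by (rule \<Psi>_onto[OF \<sigma>(2) I_zero])
 have "z \<otimes> (s1 \<otimes> r2) \<in> I" using ideal.I_r_closed[OF I_ideal z(1)] c 2 by simp
 then obtain r where r: "r \<in> carrier S" "\<Psi> r = (\<iota> (s2 \<otimes> z \<otimes> r1), \<iota> (z \<otimes> (s1 \<otimes> r2)))"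
  using \<Psi>_onto[of "s2 \<otimes> z \<otimes> r1"] c 1(1) by (metis m_closed)
 have e: "\<iota> \<sigma> \<otimes>\<^bsub>Q\<^esub> p1 = \<iota> s2 \<otimes>\<^bsub>Q\<^esub> \<iota> z \<otimes>\<^bsub>Q\<^esub> (\<iota> s1 \<otimes>\<^bsub>Q\<^esub> p1)" "\<iota> \<sigma> \<otimes>\<^bsub>Q\<^esub> p2 = \<iota> z \<otimes>\<^bsub>Q\<^esub> (\<iota> s1 \<otimes>\<^bsub>Q\<^esub> (\<iota> s2 \<otimes>\<^bsub>Q\<^esub> p2))"
  unfolding \<sigma>_def using c q(2,3) by (simp_all add: Q.m_ac)
 have "\<Psi> s \<bullet> q = \<Psi> r"
  unfolding s(2) q(1) r(2) using scalar_mult[of "\<iota> \<sigma>" p1 p2] q(2,3) \<sigma>(2) e 1(1,3) 2(1,3) c by simp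
 moreover have "s \<in> nonzerodivisors S"
  unfolding nonzerodivisors_def
 proof (intro CollectI conjI ballI impI s(1))
  fix t assume t: "t \<in> carrier S" "s \<otimes>\<^bsub>S\<^esub> t = \<zero>\<^bsub>S\<^esub>"
  obtain u v where uv: "u \<in> carrier R" "v \<in> I" "\<Psi> t = (\<iota> u, \<iota> v)" by (rule \<Psi>_cases[OF t(1)])
  have v: "v \<in> carrier R" by (rule I_closed[OF uv(2)])
  have "\<Psi> s \<bullet> \<Psi> t = \<zero>\<^bsub>B\<^esub>" using \<Psi>.hom_mult[OF s(1) t(1)] t(2) by (simp del: quadratic_ring_simps)
  moreover have "\<Psi> s \<bullet> \<Psi> t = (\<iota> (\<sigma> \<otimes> u), \<iota> (\<sigma> \<otimes> v))"
   unfolding s(2) uv(3) hom.hom_zero using uv(1) v \<sigma>(2) by (subst scalar_mult) simp_all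
  ultimately have "\<iota> (\<sigma> \<otimes> u) = \<iota> \<zero>" "\<iota> (\<sigma> \<otimes> v) = \<iota> \<zero>" by (auto simp del: iota_simps)
  then have "\<sigma> \<otimes> u = \<zero>" "\<sigma> \<otimes> v = \<zero>" using inj_onD[OF iota_inj] uv(1) v \<sigma>(2) by blast+
  then have "u = \<zero>" "v = \<zero>" using \<sigma>(1) uv(1) v unfolding nonzerodivisors_def by auto
  then have "\<Psi> t = \<Psi> \<zero>\<^bsub>S\<^esub>" using uv(3) \<Psi>.hom_zero by simp
  then show "t = \<zero>\<^bsub>S\<^esub>" using inj_onD[OF \<Psi>_inj] t(1) by blast
 qed
 ultimately show "\<exists>r\<in>carrier S. \<exists>s\<in>nonzerodivisors S. \<Psi> s \<bullet> q = \<Psi> r" using r(1) by blast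
qed

text \<open>
 M \<times> I is an ideal, and it is maximal: if x is a unit of R, subtracting an element of 0 \<times> I from
 \<open>(x, y)\<close> leaves the unit \<open>(x, 0)\<close>.
\<close>
lemma max_ideal_image:
 assumes local: "one_dim_cm S"
 shows "\<Psi> ` max_ideal S = \<iota> ` M \<times> \<iota> ` I"
proof -
 interpret T: one_dim_quotient S B \<Psi> by (intro one_dim_quotient.intro local total_quotient_\<Psi>)
 let ?N = "{s \<in> carrier S. \<Psi> s \<in> \<iota> ` M \<times> \<iota> ` I}"
 note Mst = ideal_image_stable[OF M_ideal] and Ist = ideal_image_stable[OF I_ideal]
 have st: "stable_subgroup B (\<Psi> ` carrier S) (\<iota> ` M \<times> \<iota> ` I)"
  unfolding \<Psi>_image
 proof (rule stableI)
  show "\<iota> ` M \<times> \<iota> ` I \<subseteq> carrier B" using stableD(1)[OF Mst] stableD(1)[OF Ist] by auto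
  show "\<zero>\<^bsub>B\<^esub> \<in> \<iota> ` M \<times> \<iota> ` I" using stableD(2)[OF Mst] stableD(2)[OF Ist] by simp
  show "p \<oplus>\<^bsub>B\<^esub> q \<in> \<iota> ` M \<times> \<iota> ` I" if "p \<in> \<iota> ` M \<times> \<iota> ` I" "q \<in> \<iota> ` M \<times> \<iota> ` I" for p q
   using that stableD(3)[OF Mst] stableD(3)[OF Ist] by auto
  fix p q assume "p \<in> A \<times> \<iota> ` I" "q \<in> \<iota> ` M \<times> \<iota> ` I"
  then obtain r i x y where pq: "p = (\<iota> r, \<iota> i)" "q = (\<iota> x, \<iota> y)" and m: "r \<in> carrier R" "i \<in> I" "x \<in> M" "y \<in> I" by blast
  have c: "i \<in> carrier R" "x \<in> carrier R" "y \<in> carrier R" using m I_closed M_sub by auto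
  note Mi = ideal.I_l_closed[OF M_ideal] and Ii = ideal.I_l_closed[OF I_ideal]
   and Mm = ideal_minus_closed[OF M_ideal] and Im = ideal_minus_closed[OF I_ideal]
  have "p \<bullet> q = (\<iota> (r \<otimes> x \<ominus> b \<otimes> (i \<otimes> y)), \<iota> (r \<otimes> y \<oplus> x \<otimes> i \<ominus> a \<otimes> (i \<otimes> y)))"
   unfolding pq using m(1) c ab by (simp add: minus_eq Q.minus_eq)
  moreover have "r \<otimes> x \<ominus> b \<otimes> (i \<otimes> y) \<in> M"
   by (rule Mm[OF Mi[OF m(3,1)] Mi[OF Mi[OF subsetD[OF I_M m(4)] c(1)] ab(2)]])
  moreover have "r \<otimes> y \<oplus> x \<otimes> i \<ominus> a \<otimes> (i \<otimes> y) \<in> I"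
   by (rule Im[OF ideal_add_closed[OF I_ideal Ii[OF m(4,1)] Ii[OF m(2) c(2)]] Ii[OF Ii[OF m(4) c(1)] ab(1)]])
  ultimately show "p \<bullet> q \<in> \<iota> ` M \<times> \<iota> ` I" by simp
 qed
 have "?N = {s \<in> carrier S. \<one>\<^bsub>B\<^esub> \<bullet> \<Psi> s \<in> \<iota> ` M \<times> \<iota> ` I}"
  by (rule Collect_cong) (metis B.l_one \<Psi>.hom_closed)
 then have N: "ideal ?N S" using T.preimage_ideal[OF st B.one_closed] by simp
 have one: "\<one> \<notin> M" using ideal.one_imp_carrier[OF M_ideal] M_proper by blast
 have "maximalideal ?N S"
 proof (rule maximalidealI[OF N])
  show "carrier S \<noteq> ?N"
  proof
   assume "carrier S = ?N"
   then have "\<Psi> \<one>\<^bsub>S\<^esub> \<in> \<iota> ` M \<times> \<iota> ` I" using S.one_closed by blast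
   then have "\<iota> \<one> \<in> \<iota> ` M" by simp
   then show False using one iota_image_mem[OF M_sub one_closed] by simp
  qed
  fix J assume J: "ideal J S" "?N \<subseteq> J" "J \<subseteq> carrier S"
  have "J = carrier S" if "J \<noteq> ?N"
  proof -
   from that obtain s where s: "s \<in> J" "\<Psi> s \<notin> \<iota> ` M \<times> \<iota> ` I" using J by blast
   obtain x y where xy: "x \<in> carrier R" "y \<in> I" "\<Psi> s = (\<iota> x, \<iota> y)" by (rule \<Psi>_cases[OF subsetD[OF J(3) s(1)]])
   have y: "y \<in> carrier R" by (rule I_closed[OF xy(2)])
   have x: "x \<in> Units R" by (rule not_M_unit[OF xy(1)]) (use s(2) xy in auto)
   have my: "\<ominus> y \<in> I" by (rule additive_subgroup.a_inv_closed[OF ideal.axioms(1)[OF I_ideal] xy(2)])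
   obtain t where t: "t \<in> carrier S" "\<Psi> t = (\<iota> \<zero>, \<iota> (\<ominus> y))" by (rule \<Psi>_onto[OF zero_closed my])
   have "\<zero> \<in> M" by (rule additive_subgroup.zero_closed[OF ideal.axioms(1)[OF M_ideal]])
   then have "\<Psi> t \<in> \<iota> ` M \<times> \<iota> ` I" unfolding t(2) using my by blast
   then have "t \<in> J" by (intro subsetD[OF J(2)] CollectI conjI t(1))
   then have stJ: "s \<oplus>\<^bsub>S\<^esub> t \<in> J" by (rule ideal_add_closed[OF J(1) s(1)])
   obtain w where w: "w \<in> carrier S" "\<Psi> w = (\<iota> (inv x), \<iota> \<zero>)" by (rule \<Psi>_onto[OF Units_inv_closed[OF x] I_zero])
   have sc: "s \<in> carrier S" using s(1) J(3) by blast
   have "\<Psi> (s \<oplus>\<^bsub>S\<^esub> t) = (\<iota> x, \<zero>\<^bsub>Q\<^esub>)"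
    using \<Psi>.hom_add[OF sc t(1)] xy y t(2) by (simp add: Q.r_neg)
   then have "\<Psi> (w \<otimes>\<^bsub>S\<^esub> (s \<oplus>\<^bsub>S\<^esub> t)) = (\<iota> (inv x), \<zero>\<^bsub>Q\<^esub>) \<bullet> (\<iota> x, \<zero>\<^bsub>Q\<^esub>)"
    using \<Psi>.hom_mult[OF w(1) S.a_closed[OF sc t(1)]] w(2) by (simp del: quadratic_ring_simps)
   also have "\<dots> = (\<iota> (inv x \<otimes> x), \<zero>\<^bsub>Q\<^esub>)" using scalar_mult[of "\<iota> (inv x)" "\<iota> x" "\<zero>\<^bsub>Q\<^esub>"] xy(1) x
    by (simp only: iota_simps(1,3) Units_inv_closed Q.zero_closed Q.r_null)
   also have "\<dots> = \<Psi> \<one>\<^bsub>S\<^esub>" using x by simp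
   finally have "w \<otimes>\<^bsub>S\<^esub> (s \<oplus>\<^bsub>S\<^esub> t) = \<one>\<^bsub>S\<^esub>" using inj_onD[OF \<Psi>_inj] w(1) sc t(1) by auto
   then have "\<one>\<^bsub>S\<^esub> \<in> J" using ideal.I_l_closed[OF J(1) stJ w(1)] by simp
   then show "J = carrier S" by (rule ideal.one_imp_carrier[OF J(1)])
  qed
  then show "J = ?N \<or> J = carrier S" by (cases "J = ?N") auto
 qed
 then have "max_ideal S = ?N" using T.M_unique by simp
 moreover have "\<iota> ` M \<times> \<iota> ` I \<subseteq> \<Psi> ` carrier S" unfolding \<Psi>_image using M_sub by auto
 moreover have "\<Psi> ` {s \<in> carrier S. \<Psi> s \<in> V} = \<Psi> ` carrier S \<inter> V" for V by blast
 ultimately show ?thesis by (simp only: Int_absorb1)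
qed

end

section \<open>The type of almost Gorenstein Rees quotients\<close>

theorem corollary2p7:
 fixes R :: "('a, 'b) ring_scheme"
  and \<omega> :: "('a \<times> 'a) set set"
  and I :: "'a set"
  and a b :: 'a
 assumes "cohen_macaulay_local R"
  and "krull_dim R = 1"
  and "infinite (carrier (R Quot max_ideal R))"
  and "fractional_ideal R \<omega>"
  and "canonical_module R (frac_module R \<omega>)"
  and "frac_embed R ` carrier R \<subseteq> \<omega>"
  and "\<omega> \<subseteq> integral_closure R"
  and "primary_to R (max_ideal R) I"
  and "a \<in> carrier R"
  and "b \<in> carrier R"
  and "almost_gorenstein (rees_quotient R I a b)"
 shows "\<exists>t r :: nat. cm_type (rees_quotient R I a b) = enat t \<and> cm_type R = enat r \<and>
      odd t \<and> 1 \<le> t \<and> t \<le> 2 * r + 1"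
proof -
 let ?Q = "total_fractions R" and ?\<iota> = "frac_embed R" and ?S = "rees_quotient R I a b"
 interpret one_dim_cm R by (rule one_dim_cmI) fact+
 interpret one_dim_quotient R ?Q ?\<iota>
  by (intro one_dim_quotient.intro one_dim_cm_axioms total_fractions_quotient)
 have I: "ideal I R" "I \<noteq> carrier R" "radical R I = M"
  using assms(8) by (auto simp: primary_to_def primary_ideal_def)
 have IM: "I \<subseteq> M" by (rule proper_ideal_sub_M[OF I(1,2)])
 have I_regular: "\<exists>z\<in>I. z \<in> nonzerodivisors R"
 proof -
  obtain x where x: "x \<in> M" "x \<in> nonzerodivisors R" by (rule exists_regular)
  then obtain n :: nat where "x [^]\<^bsub>R\<^esub> n \<in> I" using I(3) unfolding radical_def by blast
  moreover have "x [^]\<^bsub>R\<^esub> n \<in> nonzerodivisors R" by (induction n) (auto simp: nzd_one nzd_mult x(2))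
  ultimately show ?thesis by blast
 qed
 have "\<one>\<^bsub>R\<^esub> \<noteq> \<zero>\<^bsub>R\<^esub>"
  using ideal.one_imp_carrier[OF M_ideal] additive_subgroup.zero_closed[OF ideal.axioms(1)[OF M_ideal]] M_proper by auto
 then obtain \<Theta> where \<Theta>: "\<Theta> \<in> ring_iso ?S ((quadratic_ring R a b)\<lparr>carrier := carrier R \<times> I\<rparr>)"
  by (rule rees_quotient_iso[OF I(1) assms(9,10)])
 obtain \<omega>' where S: "cohen_macaulay_local ?S" "krull_dim ?S = 1"
  and \<omega>': "fractional_ideal ?S \<omega>'" "canonical_module ?S (frac_module ?S \<omega>')"
   "frac_embed ?S ` carrier ?S \<subseteq> \<omega>'" "\<omega>' \<subseteq> endo_colon ?S (max_ideal ?S)"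
  using assms(11) unfolding almost_gorenstein_def by blast
 interpret S: one_dim_cm ?S by (rule one_dim_cmI[OF S])
 interpret O: quadratic_order R ?Q ?\<iota> ?S I a b \<Theta>
  by (intro quadratic_order.intro quadratic_order_axioms.intro one_dim_quotient_axioms S.is_cring I(1) IM I_regular assms(9,10) \<Theta>)
 interpret S: one_dim_quotient ?S O.B O.\<Psi>
  by (intro one_dim_quotient.intro S.one_dim_cm_axioms O.total_quotient_\<Psi>)
 let ?n = "?\<iota> ` M \<times> ?\<iota> ` I"
 note n = O.max_ideal_image[OF S.one_dim_cm_axioms]
 have id: "(\<lambda>x. x) ` carrier (frac_module R \<omega>) = \<omega>" by (simp add: frac_module_def)
 interpret C: canonical_embedding R ?Q ?\<iota> "frac_module R \<omega>" "\<lambda>x. x"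
  by (rule canonical_embeddingI[OF assms(4-6)]) (auto simp: ring_hom_def)
 obtain \<Phi> where \<Phi>: "\<Phi> \<in> ring_hom (total_fractions ?S) O.B" "inj_on \<Phi> (carrier (total_fractions ?S))"
  "\<And>s. s \<in> carrier ?S \<Longrightarrow> \<Phi> (frac_embed ?S s) = O.\<Psi> s" by (rule S.fractions_extend[OF S.total_fractions_quotient]) blast
 interpret K: canonical_embedding ?S O.B O.\<Psi> "frac_module ?S \<omega>'" \<Phi>
  by (rule S.canonical_embeddingI[OF \<omega>'(1-3) \<Phi>])
 have K: "\<Phi> ` carrier (frac_module ?S \<omega>') = \<Phi> ` \<omega>'" by (simp add: frac_module_def)
 interpret quadratic_lattices ?Q A "?\<iota> ` M" "?\<iota> ` I" "?\<iota> a" "?\<iota> b" \<omega>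
 proof (intro quadratic_lattices.intro quadratic_lattices_axioms.intro lattice_ring_image ideal_image_stable[OF I(1)])
  show "lattice_ring O.B (A \<times> ?\<iota> ` I) ?n" using S.lattice_ring_image unfolding O.\<Psi>_image n .
  show "\<exists>z\<in>?\<iota> ` I. z \<in> Units ?Q" using I_regular iota_units by blast
  show "is_lattice ?Q A \<omega>" "reflexive_for ?Q A \<omega>" using C.lattice_CC C.CC_reflexive unfolding id .
  fix Y assume "stable_subgroup ?Q A Y" "\<omega> \<subseteq> Y" "Y \<subseteq> colon ?Q \<omega> (?\<iota> ` M)"
  then show "Y = \<omega> \<or> Y = colon ?Q \<omega> (?\<iota> ` M)"
   using quotient_length_one(2)[OF C.colon_M_length C.colon_stable[OF C.CC_stable C.iota_M_sub] C.CC_stable C.CC_sub_colon_M]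
   unfolding id by blast
 qed (use assms(9,10) IM in auto)
 obtain E where E: "infinite E" "E \<subseteq> A" "\<And>e e'. e \<in> E \<Longrightarrow> e' \<in> E \<Longrightarrow> e \<noteq> e' \<Longrightarrow> e \<ominus>\<^bsub>?Q\<^esub> e' \<notin> ?\<iota> ` M"
  by (rule infinite_incongruent[OF assms(3)]) blast
 have "\<exists>t r :: nat. quotient_length O.B (A \<times> ?\<iota> ` I) (colon O.B (A \<times> ?\<iota> ` I) ?n) (A \<times> ?\<iota> ` I) = enat t \<and>
  quotient_length ?Q A (colon ?Q A (?\<iota> ` M)) A = enat r \<and> odd t \<and> 1 \<le> t \<and> t \<le> 2 * r + 1"
 proof (rule type_of_almost_gorenstein[OF _ _ _ _ E])
  show "is_lattice O.B (A \<times> ?\<iota> ` I) (\<Phi> ` \<omega>')" "reflexive_for O.B (A \<times> ?\<iota> ` I) (\<Phi> ` \<omega>')"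
   using K.lattice_CC K.CC_reflexive unfolding K O.\<Psi>_image .
  show "A \<times> ?\<iota> ` I \<subseteq> \<Phi> ` \<omega>'"
   unfolding O.\<Psi>_image[symmetric]
  proof
   fix w assume "w \<in> O.\<Psi> ` carrier ?S"
   then obtain s where "s \<in> carrier ?S" "w = \<Phi> (frac_embed ?S s)" using \<Phi>(3) by force
   then show "w \<in> \<Phi> ` \<omega>'" using \<omega>'(3) by blast
  qed
  fix k \<nu> assume "k \<in> \<Phi> ` \<omega>'" "\<nu> \<in> ?n"
  then obtain q x where q: "q \<in> \<omega>'" "k = \<Phi> q" and x: "x \<in> max_ideal ?S" "\<nu> = O.\<Psi> x"
   unfolding n[symmetric] by blast
  have qe: "q \<in> endo_colon ?S (max_ideal ?S)" using q(1) \<omega>'(4) by blast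
  then obtain y where y: "y \<in> max_ideal ?S" "q \<otimes>\<^bsub>total_fractions ?S\<^esub> frac_embed ?S x = frac_embed ?S y"
   using x(1) unfolding endo_colon_def by blast
  have c: "q \<in> carrier (total_fractions ?S)" "x \<in> carrier ?S" "y \<in> carrier ?S"
   using qe x(1) y(1) S.M_sub unfolding endo_colon_def by auto
  interpret T: total_quotient ?S "total_fractions ?S" "frac_embed ?S" by (rule S.total_fractions_quotient)
  have "k \<otimes>\<^bsub>O.B\<^esub> \<nu> = \<Phi> q \<otimes>\<^bsub>O.B\<^esub> \<Phi> (frac_embed ?S x)" using q(2) x(2) \<Phi>(3)[OF c(2)] by simp
  also have "\<dots> = \<Phi> (frac_embed ?S y)" using ring_hom_mult[OF \<Phi>(1) c(1) T.iota_simps(1)[OF c(2)]] y(2) by simp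
  also have "\<dots> = O.\<Psi> y" by (rule \<Phi>(3)[OF c(3)])
  finally show "k \<otimes>\<^bsub>O.B\<^esub> \<nu> \<in> ?n" using y(1) unfolding n[symmetric] by blast
 qed
 then show ?thesis unfolding cm_type_length S.cm_type_length O.\<Psi>_image n .
qed

end
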